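(* Let $0<q\le r<\infty$, $s\in\mathbb R$ and $\varphi\in\mathcal G_q$. Let $\mathcal A\in\{\mathcal N,\mathcal E\}$. In the case $\mathcal A=\mathcal E$ assume in addition that there exist constants $\varepsilon>0$ and $C>0$ such that $$\frac{t^{\varepsilon}}{\varphi(t)}\le C\,\frac{\rho^{\varepsilon}}{\varphi(\rho)}\qquad\text{for all } t\ge\rho>0 .$$ Then different choices of admissible pairs $(\theta,\tau)$ yield equivalent quasi-norms: for any two admissible pairs $(\theta,\tau)$ and $(\tilde\theta,\tilde\tau)$ there is a constant $C'\ge1$ such that for all $f\in\mathcal S'(\mathbb R^n)$ $$C'^{-1}\|f\|_{\mathcal A^s_{\mathcal M^\varphi_q,r}(\tilde\theta,\tilde\tau)}\le\|f\|_{\mathcal A^s_{\mathcal M^\varphi_q,r}(\theta,\tau)}\le C'\|f\|_{\mathcal A^s_{\mathcal M^\varphi_q,r}(\tilde\theta,\tilde\tau)} .$$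
   Context: Notation. $Q(r)=[-r,r]^n$. Dyadic cubes: $Q_{jm}=\prod_{k=1}^n[2^{-j}m_k,2^{-j}(m_k+1))$, $j\in\mathbb Z$, $m\in\mathbb Z^n$; $\mathcal D$ is the set of all of them, $\ell(Q)=|Q|^{1/n}$. $\mathcal F f(\xi)=(2\pi)^{-n/2}\int f(x)e^{-ix\cdot\xi}dx$, and $\zeta(D)f=\mathcal F^{-1}[\zeta\,\mathcal F f]$ for $\zeta\in\mathcal S(\mathbb R^n)$, $f\in\mathcal S'(\mathbb R^n)$. $\mathcal G_q$ ($0<q<\infty$) is the set of nondecreasing $\varphi:(0,\infty)\to(0,\infty)$ with $\varphi(t_1)t_1^{-n/q}\ge\varphi(t_2)t_2^{-n/q}$ for $0<t_1\le t_2<\infty$. The generalized Morrey quasi-norm of a measurable $f$ is $\|f\|_{\mathcal M^\varphi_q}=\sup_{Q\in\mathcal D}\varphi(\ell(Q))\big(\frac1{|Q|}\int_Q|f(y)|^q\,dy\big)^{1/q}$. A pair $(\theta,\tau)$ is admissible if $\theta,\tau\in C^\infty_{\rm c}(\mathbb R^n)$, $0\notin\operatorname{supp}\tau$, $\theta>0$ on $Q(2)$ and $\tau>0$ on $Q(2)\setminus Q(1)$. Put $\tau_j(\xi)=\tau(2^{-j}\xi)$ for $j\in\mathbb N=\{1,2,\dots\}$. For $f\in\mathcal S'(\mathbb R^n)$ and $r<\infty$, $\|f\|_{\mathcal N^s_{\mathcal M^\varphi_q,r}(\theta,\tau)}=\|\theta(D)f\|_{\mathcal M^\varphi_q}+\big(\sum_{j=1}^\infty2^{jsr}\|\tau_j(D)f\|_{\mathcal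 M^\varphi_q}^r\big)^{1/r}$ (generalized Besov–Morrey) and $\|f\|_{\mathcal E^s_{\mathcal M^\varphi_q,r}(\theta,\tau)}=\|\theta(D)f\|_{\mathcal M^\varphi_q}+\big\|\big(\sum_{j=1}^\infty2^{jsr}|\tau_j(D)f|^r\big)^{1/r}\big\|_{\mathcal M^\varphi_q}$ (generalized Triebel–Lizorkin–Morrey). *)

theory Defs
  imports "HOL-Analysis.Analysis"
begin

subsection \<open>Smooth functions, Schwartz functions, tempered distributions\<close>

definition partial_deriv :: "'n \<Rightarrow> (real^'n \<Rightarrow> complex) \<Rightarrow> real^'n \<Rightarrow> complex" where
  "partial_deriv k f x = frechet_derivative f (at x) (axis k 1)"

text \<open>A multi-index is represented by the list of coordinates in which one differentiates.\<close>

fun iter_partial :: "'n list \<Rightarrow> (real^'n \<Rightarrow> complex) \<Rightarrow> real^'n \<Rightarrow> complex" where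
  "iter_partial [] f = f"
| "iter_partial (k # ks) f = partial_deriv k (iter_partial ks f)"

definition smooth :: "(real^'n \<Rightarrow> complex) \<Rightarrow> bool" where
  "smooth f \<longleftrightarrow> (\<forall>ks x. iter_partial ks f differentiable (at x))"

definition supp :: "(real^'n \<Rightarrow> complex) \<Rightarrow> (real^'n) set" where
  "supp f = closure {x. f x \<noteq> 0}"

definition test_functions :: "(real^'n \<Rightarrow> complex) set" where
  "test_functions = {f. smooth f \<and> compact (supp f)}"

definition schwartz :: "(real^'n \<Rightarrow> complex) set" where
  "schwartz = {f. smooth f \<and>
     (\<forall>N ks. bdd_above (range (\<lambda>x. (1 + norm x) ^ N * norm (iter_partial ks f x))))}"

definition schwartz_seminorm :: "nat \<Rightarrow> 'n list \<Rightarrow> (real^'n \<Rightarrow> complex) \<Rightarrow> real" where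
  "schwartz_seminorm N ks f = (SUP x. (1 + norm x) ^ N * norm (iter_partial ks f x))"

definition schwartz_topology :: "(real^'n \<Rightarrow> complex) topology" where
  "schwartz_topology = topology_generated_by
     {{g \<in> schwartz. schwartz_seminorm N ks (\<lambda>x. g x - f x) < e} | f N ks e.
        f \<in> schwartz \<and> 0 < e}"

text \<open>Only the values of a functional on Schwartz functions matter below.\<close>

definition tempered_distribution :: "((real^'n \<Rightarrow> complex) \<Rightarrow> complex) \<Rightarrow> bool" where
  "tempered_distribution u \<longleftrightarrow>
     (\<forall>f\<in>schwartz. \<forall>g\<in>schwartz. u (\<lambda>x. f x + g x) = u f + u g) \<and>
     (\<forall>c. \<forall>f\<in>schwartz. u (\<lambda>x. c * f x) = c * u f) \<and>
     continuous_map schwartz_topology euclidean u"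

subsection \<open>Fourier transform and Fourier multipliers\<close>

definition fourier :: "(real^'n \<Rightarrow> complex) \<Rightarrow> real^'n \<Rightarrow> complex" where
  "fourier f \<xi> = of_real ((2 * pi) powr (- real CARD('n) / 2)) *
     (\<integral>x. f x * exp (- (\<i> * of_real (x \<bullet> \<xi>))) \<partial>lborel)"

definition inv_fourier :: "(real^'n \<Rightarrow> complex) \<Rightarrow> real^'n \<Rightarrow> complex" where
  "inv_fourier f x = of_real ((2 * pi) powr (- real CARD('n) / 2)) *
     (\<integral>\<xi>. f \<xi> * exp (\<i> * of_real (x \<bullet> \<xi>)) \<partial>lborel)"

definition fourier_dist ::
    "((real^'n \<Rightarrow> complex) \<Rightarrow> complex) \<Rightarrow> (real^'n \<Rightarrow> complex) \<Rightarrow> complex" where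
  "fourier_dist u g = u (fourier g)"

definition inv_fourier_dist ::
    "((real^'n \<Rightarrow> complex) \<Rightarrow> complex) \<Rightarrow> (real^'n \<Rightarrow> complex) \<Rightarrow> complex" where
  "inv_fourier_dist u g = u (inv_fourier g)"

definition mult_dist ::
    "(real^'n \<Rightarrow> complex) \<Rightarrow> ((real^'n \<Rightarrow> complex) \<Rightarrow> complex) \<Rightarrow> (real^'n \<Rightarrow> complex) \<Rightarrow> complex" where
  "mult_dist \<zeta> u g = u (\<lambda>x. \<zeta> x * g x)"

definition represents :: "(real^'n \<Rightarrow> complex) \<Rightarrow> ((real^'n \<Rightarrow> complex) \<Rightarrow> complex) \<Rightarrow> bool" where
  "represents h u \<longleftrightarrow>
     (\<forall>g\<in>schwartz. integrable lborel (\<lambda>x. h x * g x) \<and> u g = (\<integral>x. h x * g x \<partial>lborel))"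

text \<open>For \<open>\<zeta>\<close> in the Schwartz class and \<open>u\<close> tempered, the distribution
  \<open>inv_fourier_dist (mult_dist \<zeta> (fourier_dist u))\<close> is given by a unique continuous function
  (smooth, of polynomial growth); \<open>multiplier \<zeta> u\<close>, i.e. \<open>\<zeta>(D)u\<close>, is this function.\<close>

definition multiplier ::
    "(real^'n \<Rightarrow> complex) \<Rightarrow> ((real^'n \<Rightarrow> complex) \<Rightarrow> complex) \<Rightarrow> real^'n \<Rightarrow> complex" where
  "multiplier \<zeta> u = (THE h. continuous_on UNIV h \<and>
     represents h (inv_fourier_dist (mult_dist \<zeta> (fourier_dist u))))"

subsection \<open>Generalized Morrey spaces\<close>

definition dyadic_cube :: "int \<Rightarrow> int^'n \<Rightarrow> (real^'n) set" where
  "dyadic_cube j m = {x. \<forall>k. 2 powi (- j) * of_int (m $ k) \<le> x $ k \<and>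
                            x $ k < 2 powi (- j) * (of_int (m $ k) + 1)}"

definition dyadic_cubes :: "(real^'n) set set" where
  "dyadic_cubes = {dyadic_cube j m | j m. True}"

definition side_length :: "(real^'n) set \<Rightarrow> real" where
  "side_length Q = measure lebesgue Q powr (1 / real CARD('n))"

text \<open>The class of Morrey weights in dimension \<open>n\<close>; only values on \<open>{0<..}\<close> matter.\<close>

definition morrey_weights :: "nat \<Rightarrow> real \<Rightarrow> (real \<Rightarrow> real) set" where
  "morrey_weights n q = {\<phi>. (\<forall>t>0. 0 < \<phi> t) \<and> mono_on {0<..} \<phi> \<and>
     (\<forall>t1 t2. 0 < t1 \<and> t1 \<le> t2 \<longrightarrow>
        \<phi> t2 * t2 powr (- real n / q) \<le> \<phi> t1 * t1 powr (- real n / q))}"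

text \<open>Powers of extended nonnegative reals; only used for positive exponents.\<close>

definition ennreal_powr :: "ennreal \<Rightarrow> real \<Rightarrow> ennreal" where
  "ennreal_powr x a = (if x = \<infinity> then \<infinity> else ennreal (enn2real x powr a))"

text \<open>The Morrey quasi-norm of \<open>f\<close>, as a function of \<open>\<bar>f\<bar>\<close>. Extended real values are allowed
  because the square-function-type sums in the Triebel-Lizorkin quasi-norm may diverge.\<close>

definition morrey_norm :: "(real \<Rightarrow> real) \<Rightarrow> real \<Rightarrow> (real^'n \<Rightarrow> ennreal) \<Rightarrow> ennreal" where
  "morrey_norm \<phi> q F = (SUP Q\<in>dyadic_cubes. ennreal (\<phi> (side_length Q)) *
     ennreal_powr ((\<integral>\<^sup>+y\<in>Q. ennreal_powr (F y) q \<partial>lebesgue) / emeasure lebesgue Q) (1 / q))"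

subsection \<open>Generalized Besov-Morrey and Triebel-Lizorkin-Morrey quasi-norms\<close>

definition centered_cube :: "real \<Rightarrow> (real^'n) set" where
  "centered_cube r = {x. \<forall>k. - r \<le> x $ k \<and> x $ k \<le> r}"

definition admissible :: "(real^'n \<Rightarrow> complex) \<Rightarrow> (real^'n \<Rightarrow> complex) \<Rightarrow> bool" where
  "admissible \<theta> \<tau> \<longleftrightarrow>
     \<theta> \<in> test_functions \<and> \<tau> \<in> test_functions \<and> 0 \<notin> supp \<tau> \<and>
     (\<forall>x\<in>centered_cube 2. \<theta> x \<in> \<real> \<and> 0 < Re (\<theta> x)) \<and>
     (\<forall>x\<in>centered_cube 2 - centered_cube 1. \<tau> x \<in> \<real> \<and> 0 < Re (\<tau> x))"

definition dilate :: "nat \<Rightarrow> (real^'n \<Rightarrow> complex) \<Rightarrow> real^'n \<Rightarrow> complex" where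
  "dilate j \<tau> \<xi> = \<tau> ((1 / 2 ^ j) *\<^sub>R \<xi>)"

text \<open>In both series below the summation index \<open>i\<close> corresponds to \<open>j = Suc i\<close>, so that
  \<open>j\<close> runs through the positive integers.\<close>

definition besov_morrey_norm ::
    "(real \<Rightarrow> real) \<Rightarrow> real \<Rightarrow> real \<Rightarrow> real \<Rightarrow> (real^'n \<Rightarrow> complex) \<Rightarrow> (real^'n \<Rightarrow> complex) \<Rightarrow>
     ((real^'n \<Rightarrow> complex) \<Rightarrow> complex) \<Rightarrow> ennreal" where
  "besov_morrey_norm \<phi> q r s \<theta> \<tau> f =
     morrey_norm \<phi> q (\<lambda>x. ennreal (norm (multiplier \<theta> f x))) +
     ennreal_powr (\<Sum>i. ennreal (2 powr (real (Suc i) * s * r)) *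
       ennreal_powr (morrey_norm \<phi> q
         (\<lambda>x. ennreal (norm (multiplier (dilate (Suc i) \<tau>) f x)))) r) (1 / r)"

definition triebel_lizorkin_morrey_norm ::
    "(real \<Rightarrow> real) \<Rightarrow> real \<Rightarrow> real \<Rightarrow> real \<Rightarrow> (real^'n \<Rightarrow> complex) \<Rightarrow> (real^'n \<Rightarrow> complex) \<Rightarrow>
     ((real^'n \<Rightarrow> complex) \<Rightarrow> complex) \<Rightarrow> ennreal" where
  "triebel_lizorkin_morrey_norm \<phi> q r s \<theta> \<tau> f =
     morrey_norm \<phi> q (\<lambda>x. ennreal (norm (multiplier \<theta> f x))) +
     morrey_norm \<phi> q (\<lambda>x. ennreal_powr (\<Sum>i. ennreal (2 powr (real (Suc i) * s * r)) *
       ennreal_powr (ennreal (norm (multiplier (dilate (Suc i) \<tau>) f x))) r) (1 / r))"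

datatype scale = Besov | Triebel_Lizorkin

fun scale_norm ::
    "scale \<Rightarrow> (real \<Rightarrow> real) \<Rightarrow> real \<Rightarrow> real \<Rightarrow> real \<Rightarrow> (real^'n \<Rightarrow> complex) \<Rightarrow> (real^'n \<Rightarrow> complex) \<Rightarrow>
     ((real^'n \<Rightarrow> complex) \<Rightarrow> complex) \<Rightarrow> ennreal" where
  "scale_norm Besov = besov_morrey_norm"
| "scale_norm Triebel_Lizorkin = triebel_lizorkin_morrey_norm"

end

theory Submission
  imports Defs "HOL-Probability.Probability"
begin

text \<open>
  Write \<open>g\<^sub>k\<close> for the pieces of \<open>f\<close> belonging to one admissible pair and \<open>h\<^sub>j\<close> for those of the other.
  Dividing symbols gives \<open>h\<^sub>j\<close> as a finite sum, over \<open>k\<close> with \<open>\<bar>k - j\<bar> \<le> b\<close>, of convolutions of \<open>g\<^sub>k\<close> with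
  Schwartz kernels at scale \<open>2\<^sup>-\<^sup>k\<close>. Since \<open>g\<^sub>k\<close> is band-limited, its Peetre maximal function is bounded by
  the supremum over \<open>y\<close> of \<open>c\<^sub>k(y)\<close> times a power of \<open>1 + 2\<^sup>k\<bar>x - y\<bar>\<close> with a large negative exponent, where
  \<open>c\<^sub>k(y)\<close> is the infimum of \<open>\<bar>g\<^sub>k\<bar>\<close> over a slightly smaller dyadic cube containing \<open>y\<close>.

  The functions \<open>c\<^sub>k\<close> are constant on dyadic cubes of their own level, so no maximal inequality is
  needed: with \<open>p = q / r \<le> 1\<close>, telescoping the \<open>p\<close>-th powers of the partial sums of \<open>c\<^sub>k\<^sup>r\<close> bounds the
  \<open>p\<close>-th power of the sum of the weighted suprema by a series of single-scale integrals. On a fixed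
  dyadic cube the finer levels are estimated in this way, while each coarser level contributes at most a multiple of
  \<open>\<phi>(2\<^sup>-\<^sup>k)\<^bsup>-r\<^esup>\<close>. The growth condition on \<open>\<phi>\<close> makes these contributions a geometric series; in the Besov
  case only boundedly many levels occur at a time and monotonicity of \<open>\<phi>\<close> is enough.
\<close>

subsection \<open>Smooth functions\<close>

text \<open>A maximal-function proof would bound each piece by a Hardy-Littlewood maximal function
  and then need a vector-valued maximal inequality on the Morrey space. Infima over small cells
  avoid both: they lie below \<open>\<bar>g\<^sub>k\<bar>\<close>, so the estimate returns to the
  given quasi-norm, and they are constant on cells, so each value is its own mean. The hypothesis
  \<open>q \<le> r\<close> enters as \<open>p \<le> 1\<close>, which makes
  \<open>V \<mapsto> V powr (1 / p)\<close> convex. The Peetre weights have exponent 4n / q, which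
  the powers r and then p turn into 4n: one half makes the weight integrable over the space, the
  other half localizes to the test cube. Absorbing half of a Peetre maximal function needs its
  finiteness in advance. An infinite right-hand quasi-norm leaves nothing to show; a finite one
  bounds the infima on every level, and together with the polynomial growth of a band-limited piece
  this shows the piece to be bounded.\<close>

lemma partial_derivI:
  assumes "(f has_derivative D) (at x)"
  shows "partial_deriv k f x = D (axis k 1)"
  using frechet_derivative_at[OF assms] by (simp add: partial_deriv_def)

lemma has_derivative_partial:
  fixes f :: "real^'n \<Rightarrow> complex"
  assumes "f differentiable (at x)"
  shows "(f has_derivative (\<lambda>v. \<Sum>k\<in>UNIV. of_real (v $ k) * partial_deriv k f x)) (at x)"
proof -
  let ?D = "frechet_derivative f (at x)"
  have D: "(f has_derivative ?D) (at x)"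
    using assms by (simp add: frechet_derivative_works)
  then have lin: "linear ?D" by (rule has_derivative_linear)
  have "?D v = (\<Sum>k\<in>UNIV. of_real (v $ k) * partial_deriv k f x)" for v
  proof -
    have "?D v = ?D (\<Sum>k\<in>UNIV. v $ k *\<^sub>R axis k 1)"
      using basis_expansion[of v] by (simp add: scalar_mult_eq_scaleR)
    also have "\<dots> = (\<Sum>k\<in>UNIV. v $ k *\<^sub>R ?D (axis k 1))"
      by (simp add: linear_sum[OF lin] linear_scale[OF lin])
    finally show ?thesis by (simp add: partial_deriv_def scaleR_conv_of_real)
  qed
  then have "?D = (\<lambda>v. \<Sum>k\<in>UNIV. of_real (v $ k) * partial_deriv k f x)" by auto
  with D show ?thesis by simp
qed

text \<open>\<open>smooth\<close> adds derivatives on the outside and refers to the whole space.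
  Here derivatives are peeled off from the inside and a set \<open>U\<close> is a parameter: the
  calculus rules become inductions over the order, and a quotient can be treated on the open set
  where its denominator does not vanish.\<close>

fun differentiable_upto :: "nat \<Rightarrow> (real^'n) set \<Rightarrow> (real^'n \<Rightarrow> complex) \<Rightarrow> bool" where
  "differentiable_upto 0 U f \<longleftrightarrow> True"
| "differentiable_upto (Suc m) U f \<longleftrightarrow>
     (\<forall>x\<in>U. f differentiable (at x)) \<and> (\<forall>k. differentiable_upto m U (partial_deriv k f))"

text \<open>Since \<open>U\<close> is open, a derivative at a point of \<open>U\<close> depends on
  values in \<open>U\<close> only; hence the partial derivatives agree on \<open>U\<close> as well
  and the induction applies to them.\<close>

lemma differentiable_upto_cong:
  assumes "open U" "\<And>x. x \<in> U \<Longrightarrow> f x = g x" "differentiable_upto m U f"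
  shows "differentiable_upto m U g"
  using assms(2,3)
proof (induction m arbitrary: f g)
  case (Suc m)
  have D: "(g has_derivative D) (at x)" if "x \<in> U" "(f has_derivative D) (at x)" for x D
    using has_derivative_transform_within_open[OF that(2) assms(1) that(1)] Suc.prems(1) by auto
  have "g differentiable (at x)" if "x \<in> U" for x
    using Suc.prems(2) D that by (fastforce simp: differentiable_def)
  moreover have "differentiable_upto m U (partial_deriv k g)" for k
  proof (rule Suc.IH[of "partial_deriv k f"])
    show "partial_deriv k f x = partial_deriv k g x" if "x \<in> U" for x
    proof -
      have f: "(f has_derivative frechet_derivative f (at x)) (at x)"
        using Suc.prems(2) that by (simp add: frechet_derivative_works)
      show ?thesis using partial_derivI[OF f] partial_derivI[OF D[OF that f]] by simp
    qed
    show "differentiable_upto m U (partial_deriv k f)" using Suc.prems(2) by simp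
  qed
  ultimately show ?case by simp
qed simp

lemma differentiable_upto_Suc_imp: "differentiable_upto (Suc m) U f \<Longrightarrow> differentiable_upto m U f"
proof (induction m arbitrary: f)
  case (Suc m)
  then have "\<forall>k. differentiable_upto m U (partial_deriv k f)" by (metis differentiable_upto.simps(2))
  then show ?case using Suc.prems by simp
qed simp

lemma differentiable_upto_const: "differentiable_upto m U (\<lambda>_. c :: complex)"
proof (induction m arbitrary: c)
  case (Suc m)
  have "partial_deriv k (\<lambda>_::real^'a. c) = (\<lambda>_. 0)" for k
    by (rule ext) (rule partial_derivI, simp)
  then show ?case using Suc by auto
qed simp

lemma differentiable_upto_add:
  assumes "open U" "differentiable_upto m U f" "differentiable_upto m U g"
  shows "differentiable_upto m U (\<lambda>x. f x + g x)"
  using assms(2,3)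
proof (induction m arbitrary: f g)
  case (Suc m)
  have "differentiable_upto m U (partial_deriv k (\<lambda>x. f x + g x))" for k
  proof (rule differentiable_upto_cong[OF assms(1)])
    show "differentiable_upto m U (\<lambda>x. partial_deriv k f x + partial_deriv k g x)"
      using Suc by simp
    show "partial_deriv k f x + partial_deriv k g x = partial_deriv k (\<lambda>x. f x + g x) x"
      if "x \<in> U" for x
      using Suc.prems that
      by (subst partial_derivI[OF has_derivative_add[of f "frechet_derivative f (at x)" _ g "frechet_derivative g (at x)"]])
         (auto simp: frechet_derivative_works[symmetric] partial_deriv_def)
  qed
  then show ?case using Suc.prems by auto
qed simp

lemma differentiable_upto_mult:
  assumes "open U" "differentiable_upto m U f" "differentiable_upto m U g"
  shows "differentiable_upto m U (\<lambda>x. f x * g x)"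
  using assms(2,3)
proof (induction m arbitrary: f g)
  case (Suc m)
  have "differentiable_upto m U (partial_deriv k (\<lambda>x. f x * g x))" for k
  proof (rule differentiable_upto_cong[OF assms(1)])
    show "differentiable_upto m U (\<lambda>x. f x * partial_deriv k g x + partial_deriv k f x * g x)"
      using Suc.prems[THEN differentiable_upto_Suc_imp] Suc.prems
      by (intro differentiable_upto_add[OF assms(1)] Suc.IH) simp_all
    show "f x * partial_deriv k g x + partial_deriv k f x * g x = partial_deriv k (\<lambda>x. f x * g x) x"
      if "x \<in> U" for x
      using Suc.prems that
      by (subst partial_derivI[OF has_derivative_mult[of f "frechet_derivative f (at x)" _ _ g "frechet_derivative g (at x)"]])
         (auto simp: frechet_derivative_works[symmetric] partial_deriv_def)
  qed
  then show ?case using Suc.prems by auto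
qed simp

text \<open>The derivative of the reciprocal contains the reciprocal itself, so order
  \<open>m\<close> for it yields order \<open>Suc m\<close> through the product rule, with
  \<open>f\<close> fixed in the induction.\<close>

lemma differentiable_upto_inverse:
  assumes "open U" "differentiable_upto m U f" "\<And>x. x \<in> U \<Longrightarrow> f x \<noteq> 0"
  shows "differentiable_upto m U (\<lambda>x. inverse (f x))"
  using assms(2)
proof (induction m)
  case (Suc m)
  have "differentiable_upto m U (partial_deriv k (\<lambda>x. inverse (f x)))" for k
  proof (rule differentiable_upto_cong[OF assms(1)])
    show "differentiable_upto m U (\<lambda>x. (-1) * (inverse (f x) * partial_deriv k f x * inverse (f x)))"
      using Suc.prems Suc.IH[OF differentiable_upto_Suc_imp[OF Suc.prems]]
      by (intro differentiable_upto_mult[OF assms(1)] differentiable_upto_const) simp_all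
    show "(-1) * (inverse (f x) * partial_deriv k f x * inverse (f x)) = partial_deriv k (\<lambda>x. inverse (f x)) x"
      if "x \<in> U" for x
    proof -
      have "(f has_derivative frechet_derivative f (at x)) (at x)"
        using Suc.prems that by (simp add: frechet_derivative_works)
      from partial_derivI[OF Deriv.has_derivative_inverse[OF assms(3)[OF that] this]]
      show ?thesis by (simp add: partial_deriv_def)
    qed
  qed
  then show ?case using Suc.prems assms(3) by auto
qed simp

lemma differentiable_upto_cnj:
  assumes "open U" "differentiable_upto m U f"
  shows "differentiable_upto m U (\<lambda>x. cnj (f x))"
  using assms(2)
proof (induction m arbitrary: f)
  case (Suc m)
  have D: "((\<lambda>x. cnj (f x)) has_derivative (\<lambda>v. cnj (D v))) (at x)"
    if "(f has_derivative D) (at x)" for x D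
    by (rule bounded_linear.has_derivative[OF bounded_linear_cnj that])
  have F: "(f has_derivative frechet_derivative f (at x)) (at x)" if "x \<in> U" for x
    using Suc.prems that by (simp add: frechet_derivative_works)
  have "differentiable_upto m U (partial_deriv k (\<lambda>x. cnj (f x)))" for k
  proof (rule differentiable_upto_cong[OF assms(1)])
    show "differentiable_upto m U (\<lambda>x. cnj (partial_deriv k f x))"
      using Suc by simp
    show "cnj (partial_deriv k f x) = partial_deriv k (\<lambda>x. cnj (f x)) x" if "x \<in> U" for x
      using partial_derivI[OF D[OF F[OF that]]] by (simp add: partial_deriv_def)
  qed
  moreover have "(\<lambda>x. cnj (f x)) differentiable (at x)" if "x \<in> U" for x
    using D[OF F[OF that]] by (auto simp: differentiable_def)
  ultimately show ?case by simp
qed simp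

lemma differentiable_upto_Un:
  "differentiable_upto m U f \<Longrightarrow> differentiable_upto m V f \<Longrightarrow> differentiable_upto m (U \<union> V) f"
  by (induction m arbitrary: f) auto

lemma has_derivative_affine_comp:
  fixes f :: "real^'n \<Rightarrow> complex"
  assumes "(f has_derivative D) (at (a + c *\<^sub>R x))"
  shows "((\<lambda>x. f (a + c *\<^sub>R x)) has_derivative (\<lambda>v. D (c *\<^sub>R v))) (at x)"
proof -
  have "((\<lambda>x. a + c *\<^sub>R x) has_derivative (\<lambda>v. c *\<^sub>R v)) (at x)"
    by (auto intro!: derivative_eq_intros)
  from diff_chain_at[OF this assms] show ?thesis by (simp add: o_def)
qed

lemma differentiable_affine_comp:
  fixes f :: "real^'n \<Rightarrow> complex"
  shows "f differentiable (at (a + c *\<^sub>R x)) \<Longrightarrow> (\<lambda>x. f (a + c *\<^sub>R x)) differentiable (at x)"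
  using has_derivative_affine_comp unfolding differentiable_def by blast

lemma partial_deriv_affine_comp:
  fixes f :: "real^'n \<Rightarrow> complex"
  assumes "f differentiable (at (a + c *\<^sub>R x))"
  shows "partial_deriv k (\<lambda>x. f (a + c *\<^sub>R x)) x = of_real c * partial_deriv k f (a + c *\<^sub>R x)"
proof -
  have D: "(f has_derivative frechet_derivative f (at (a + c *\<^sub>R x))) (at (a + c *\<^sub>R x))"
    using assms by (simp add: frechet_derivative_works)
  show ?thesis using partial_derivI[OF has_derivative_affine_comp[OF D], of k]
    linear_scale[OF has_derivative_linear[OF D]]
    by (simp add: partial_deriv_def scaleR_conv_of_real)
qed

lemma differentiable_upto_affine_comp:
  "differentiable_upto m UNIV f \<Longrightarrow> differentiable_upto m UNIV (\<lambda>x. f (a + c *\<^sub>R x))"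
proof (induction m arbitrary: f)
  case (Suc m)
  have "partial_deriv k (\<lambda>x. f (a + c *\<^sub>R x)) = (\<lambda>x. of_real c * partial_deriv k f (a + c *\<^sub>R x))" for k
    using Suc.prems by (intro ext partial_deriv_affine_comp) auto
  moreover have "differentiable_upto m UNIV (\<lambda>x. of_real c * partial_deriv k f (a + c *\<^sub>R x))" for k
    using Suc by (intro differentiable_upto_mult differentiable_upto_const) auto
  moreover have "(\<lambda>x. f (a + c *\<^sub>R x)) differentiable (at x)" for x
    using Suc.prems by (intro differentiable_affine_comp) auto
  ultimately show ?case by simp
qed simp

section \<open>From differentiability of finite order to smooth functions\<close>

lemma iter_partial_snoc: "iter_partial (ks @ [k]) f = iter_partial ks (partial_deriv k f)"
  by (induction ks) auto

lemma iter_partial_append: "iter_partial (ks @ ls) f = iter_partial ks (iter_partial ls f)"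
  by (induction ks) auto

text \<open>The bridge between two orders of recursion: the last entry of the list in
  \<open>iter_partial\<close> is the derivative taken first, which is the one that
  \<open>differentiable_upto\<close> removes. Hence the case split at the right end of the
  list.\<close>

lemma differentiable_upto_UNIV_iff:
  fixes f :: "real^'n \<Rightarrow> complex"
  shows "differentiable_upto m UNIV f \<longleftrightarrow> (\<forall>(ks::'n list) x. length ks < m \<longrightarrow> iter_partial ks f differentiable (at x))"
proof (induction m arbitrary: f)
  case (Suc m)
  show ?case
  proof (intro iffI allI impI)
    fix ks :: "'n list" and x assume d: "differentiable_upto (Suc m) UNIV f" and l: "length ks < Suc m"
    show "iter_partial ks f differentiable (at x)"
    proof (cases ks rule: rev_cases)
      case Nil then show ?thesis using d by simp
    next
      case (snoc ls k) then show ?thesis using d l Suc.IH[of "partial_deriv k f"]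
        by (simp add: iter_partial_snoc)
    qed
  next
    assume a: "\<forall>ks x. length ks < Suc m \<longrightarrow> iter_partial ks f differentiable (at x)"
    have "f differentiable (at x)" for x using a[rule_format, of "[]"] by simp
    moreover have "differentiable_upto m UNIV (partial_deriv k f)" for k
      unfolding Suc.IH using a[rule_format, of "_ @ [k]"] by (simp add: iter_partial_snoc)
    ultimately show "differentiable_upto (Suc m) UNIV f" by simp
  qed
qed simp

lemma smooth_iff: "smooth f \<longleftrightarrow> (\<forall>m. differentiable_upto m UNIV f)"
  unfolding smooth_def differentiable_upto_UNIV_iff by blast

lemma smooth_const [intro]: "smooth (\<lambda>_. b :: complex)"
  and smooth_add [intro]: "smooth f \<Longrightarrow> smooth g \<Longrightarrow> smooth (\<lambda>x. f x + g x)"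
  and smooth_mult [intro]: "smooth f \<Longrightarrow> smooth g \<Longrightarrow> smooth (\<lambda>x. f x * g x)"
  and smooth_cnj [intro]: "smooth f \<Longrightarrow> smooth (\<lambda>x. cnj (f x))"
  and smooth_affine_comp: "smooth f \<Longrightarrow> smooth (\<lambda>x. f (a + c *\<^sub>R x))"
  unfolding smooth_iff
  by (auto intro: differentiable_upto_const differentiable_upto_add differentiable_upto_mult
      differentiable_upto_cnj differentiable_upto_affine_comp)

lemma smooth_sum [intro]: "(\<And>i. i \<in> I \<Longrightarrow> smooth (f i)) \<Longrightarrow> smooth (\<lambda>x. \<Sum>i\<in>I. f i x)"
proof (induction I rule: infinite_finite_induct)
  case (insert i I)
  then show ?case using smooth_add[of "f i" "\<lambda>x. \<Sum>i\<in>I. f i x"] by simp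
qed (use smooth_const[of 0] in auto)

lemma smooth_iter_partial [intro]: "smooth f \<Longrightarrow> smooth (iter_partial ks f)"
  unfolding smooth_def by (metis iter_partial_append)

lemma smooth_partial_deriv [intro]: "smooth f \<Longrightarrow> smooth (partial_deriv k f)"
  using smooth_iter_partial[of f "[k]"] by simp

lemma smooth_imp_differentiable: "smooth f \<Longrightarrow> f differentiable (at x)"
  unfolding smooth_def by (metis iter_partial.simps(1))

lemma smooth_imp_continuous: "smooth f \<Longrightarrow> continuous_on S f"
  by (meson continuous_at_imp_continuous_on differentiable_imp_continuous_within smooth_imp_differentiable)

lemma smooth_coordinate [intro]: "smooth (\<lambda>x::real^'n. of_real (x $ k))"
proof -
  have D: "((\<lambda>x::real^'n. of_real (x $ k) :: complex) has_derivative (\<lambda>v. of_real (v $ k))) (at x)" for x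
    by (rule has_derivative_of_real, rule bounded_linear_imp_has_derivative) (rule bounded_linear_vec_nth)
  have "partial_deriv l (\<lambda>x::real^'n. of_real (x $ k)) = (\<lambda>_. of_real (axis l 1 $ k))" for l
    by (rule ext) (rule partial_derivI[OF D])
  then have "differentiable_upto m UNIV (\<lambda>x::real^'n. of_real (x $ k))" for m
    using D by (cases m) (auto intro: differentiable_upto_const simp: differentiable_def)
  then show ?thesis by (simp add: smooth_iff)
qed

text \<open>The set where \<open>g\<close> is nonzero and the complement of \<open>supp f\<close>
  are open and cover the space; on the second one the quotient is zero because its numerator
  vanishes.\<close>

lemma smooth_divide:
  fixes f g :: "real^'n \<Rightarrow> complex"
  assumes "smooth f" "smooth g" "\<And>x. x \<in> supp f \<Longrightarrow> g x \<noteq> 0"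
  shows "smooth (\<lambda>x. f x / g x)"
  unfolding smooth_iff
proof
  fix m
  let ?U = "{x. g x \<noteq> 0}" and ?V = "- supp f"
  have U: "open ?U"
    using open_Collect_neq[of g "\<lambda>_. 0"] smooth_imp_continuous[OF assms(2)] by simp
  have V: "open ?V" by (simp add: supp_def open_Compl)
  have mono: "differentiable_upto m W h" if "smooth h" for h :: "real^'n \<Rightarrow> complex" and W
  proof -
    have "differentiable_upto m (UNIV \<union> W) h \<Longrightarrow> differentiable_upto m W h" for m and h :: "real^'n \<Rightarrow> complex"
      by (induction m arbitrary: h) auto
    then show ?thesis using that by (simp add: smooth_iff)
  qed
  have "differentiable_upto m ?U (\<lambda>x. f x * inverse (g x))"
    by (intro differentiable_upto_mult[OF U] differentiable_upto_inverse[OF U] mono assms(1,2)) auto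
  moreover have "differentiable_upto m ?V (\<lambda>x. f x * inverse (g x))"
    by (rule differentiable_upto_cong[OF V _ differentiable_upto_const[of m ?V 0]])
       (use closure_subset[of "{x. f x \<noteq> 0}"] in \<open>auto simp: supp_def\<close>)
  ultimately have "differentiable_upto m (?U \<union> ?V) (\<lambda>x. f x * inverse (g x))"
    by (rule differentiable_upto_Un)
  moreover have "?U \<union> ?V = UNIV" using assms(3) by auto
  ultimately show "differentiable_upto m UNIV (\<lambda>x. f x / g x)" by (simp add: divide_inverse)
qed

lemma iter_partial_add:
  assumes "smooth f" "smooth g"
  shows "iter_partial ks (\<lambda>x. f x + g x) = (\<lambda>x. iter_partial ks f x + iter_partial ks g x)"
proof (induction ks)
  case (Cons k ks)
  have "partial_deriv k (\<lambda>x. iter_partial ks f x + iter_partial ks g x) x =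
      partial_deriv k (iter_partial ks f) x + partial_deriv k (iter_partial ks g) x" for x
    using assms
    by (subst partial_derivI[OF has_derivative_add[of "iter_partial ks f" "frechet_derivative (iter_partial ks f) (at x)" _ "iter_partial ks g" "frechet_derivative (iter_partial ks g) (at x)"]])
       (auto simp: frechet_derivative_works[symmetric] partial_deriv_def smooth_def)
  then show ?case using Cons by auto
qed simp

lemma iter_partial_cmult:
  assumes "smooth f"
  shows "iter_partial ks (\<lambda>x. c * f x) = (\<lambda>x. c * iter_partial ks f x)"
proof (induction ks)
  case (Cons k ks)
  have "partial_deriv k (\<lambda>x. c * iter_partial ks f x) x = c * partial_deriv k (iter_partial ks f) x" for x
    using assms
    by (subst partial_derivI[OF has_derivative_mult[of "\<lambda>_. c" "\<lambda>_. 0" _ _ "iter_partial ks f" "frechet_derivative (iter_partial ks f) (at x)"]])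
       (auto simp: frechet_derivative_works[symmetric] partial_deriv_def smooth_def)
  then show ?case using Cons by auto
qed simp

lemma iter_partial_diff:
  assumes "smooth f" "smooth g"
  shows "iter_partial ks (\<lambda>x. f x - g x) = (\<lambda>x. iter_partial ks f x - iter_partial ks g x)"
  using iter_partial_add[OF assms(1) smooth_mult[OF smooth_const assms(2)], of ks "-1"]
    iter_partial_cmult[OF assms(2), of ks "-1"] by simp

lemma smooth_diff [intro]: "smooth f \<Longrightarrow> smooth g \<Longrightarrow> smooth (\<lambda>x. f x - g x)"
  using smooth_add[OF _ smooth_mult[OF smooth_const[of "-1"]], of f g] by simp

lemma iter_partial_translation:
  assumes "smooth f"
  shows "iter_partial ks (\<lambda>x. f (x - y)) = (\<lambda>x. iter_partial ks f (x - y))"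
proof (induction ks)
  case (Cons k ks)
  have "partial_deriv k (\<lambda>x. iter_partial ks f (x - y)) x = partial_deriv k (iter_partial ks f) (x - y)" for x
    using partial_deriv_affine_comp[of "iter_partial ks f" "-y" 1 x k] assms
    by (simp add: smooth_def)
  then show ?case using Cons by auto
qed simp

lemma smooth_translation: "smooth f \<Longrightarrow> smooth (\<lambda>x. f (x - y))"
  using smooth_affine_comp[of f "-y" 1] by simp

section \<open>Mean value and Taylor estimates\<close>

lemma smooth_has_derivative:
  fixes f :: "real^'n \<Rightarrow> complex"
  assumes "smooth f"
  shows "(f has_derivative (\<lambda>v. \<Sum>k\<in>UNIV. of_real (v $ k) * partial_deriv k f x)) (at x)"
  by (rule has_derivative_partial[OF smooth_imp_differentiable[OF assms]])

lemma onorm_partial_le: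
  fixes a :: "'n::finite \<Rightarrow> complex"
  assumes "\<And>k. norm (a k) \<le> B"
  shows "onorm (\<lambda>v::real^'n. \<Sum>k\<in>UNIV. of_real (v $ k) * a k) \<le> real CARD('n) * B"
proof (rule onorm_le)
  fix v :: "real^'n"
  have "norm (\<Sum>k\<in>UNIV. of_real (v $ k) * a k) \<le> (\<Sum>k\<in>(UNIV::'n set). norm v * B)"
    by (rule sum_norm_le) (auto simp: norm_mult intro!: mult_mono component_le_norm_cart assms)
  then show "norm (\<Sum>k\<in>UNIV. of_real (v $ k) * a k) \<le> real CARD('n) * B * norm v"
    by (simp add: mult_ac)
qed

lemma smooth_lipschitz_convex:
  fixes f :: "real^'n \<Rightarrow> complex"
  assumes "smooth f" "convex S" "\<And>k x. x \<in> S \<Longrightarrow> norm (partial_deriv k f x) \<le> B" "x \<in> S" "y \<in> S"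
  shows "norm (f x - f y) \<le> real CARD('n) * B * norm (x - y)"
  using smooth_has_derivative[OF assms(1)] assms
  by (intro differentiable_bound[of S f "\<lambda>x v. \<Sum>k\<in>UNIV. of_real (v $ k) * partial_deriv k f x"])
     (auto intro: has_derivative_at_withinI onorm_partial_le)

text \<open>The mean value inequality is used twice, for the first derivatives and for the deviation
  from the linear part. The remainder is uniform in \<open>x\<close>; integrated against a kernel it
  permits differentiation under the integral sign.\<close>

lemma smooth_taylor:
  fixes f :: "real^'n \<Rightarrow> complex"
  assumes "smooth f" "\<And>k l x. norm (partial_deriv k (partial_deriv l f) x) \<le> B"
  shows "norm (f (x + v) - f x - (\<Sum>k\<in>UNIV. of_real (v $ k) * partial_deriv k f x))
    \<le> real CARD('n) ^ 2 * B * norm v ^ 2"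
proof -
  have B: "0 \<le> B" using assms(2)[of undefined undefined undefined] norm_ge_zero order_trans by blast
  let ?D = "\<lambda>x v. \<Sum>k\<in>UNIV. of_real (v $ k) * partial_deriv k f x"
  have "norm (f (x + v) - f x - ?D x ((x + v) - x)) \<le> norm ((x + v) - x) * (real CARD('n) * (real CARD('n) * B * norm v))"
  proof (rule differentiable_bound_linearization[where S = "cball x (norm v)"])
    show "x + t *\<^sub>R (x + v - x) \<in> cball x (norm v)" if "t \<in> {0..1}" for t
      using that by (simp add: dist_norm mult_left_le_one_le)
    show "(f has_derivative ?D y) (at y within cball x (norm v))" for y
      by (rule has_derivative_at_withinI[OF smooth_has_derivative[OF assms(1)]])
    show "onorm (?D y - ?D x) \<le> real CARD('n) * (real CARD('n) * B * norm v)"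
      if y: "y \<in> cball x (norm v)" for y
    proof -
      have "?D y - ?D x = (\<lambda>v. \<Sum>k\<in>UNIV. of_real (v $ k) * (partial_deriv k f y - partial_deriv k f x))"
        by (auto simp: fun_eq_iff sum_subtractf algebra_simps)
      moreover have "norm (partial_deriv k f y - partial_deriv k f x) \<le> real CARD('n) * B * norm v" for k
      proof -
        have "norm (partial_deriv k f y - partial_deriv k f x) \<le> real CARD('n) * B * norm (y - x)"
          by (rule smooth_lipschitz_convex[where S = UNIV]) (use assms in auto)
        also have "\<dots> \<le> real CARD('n) * B * norm v"
          using y B by (intro mult_left_mono) (auto simp: dist_norm norm_minus_commute)
        finally show ?thesis .
      qed
      ultimately show ?thesis
        using onorm_partial_le[of "\<lambda>k. partial_deriv k f y - partial_deriv k f x"] by simp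
    qed
  qed auto
  then show ?thesis by (simp add: power2_eq_square mult_ac)
qed

subsection \<open>Test functions and Schwartz functions\<close>

lemma test_functionsD:
  assumes "f \<in> test_functions"
  shows "smooth f" "compact (supp f)" "continuous_on S f" "f \<in> borel_measurable borel"
    "\<And>x. x \<notin> supp f \<Longrightarrow> f x = 0"
proof -
  show "smooth f" "compact (supp f)" using assms by (auto simp: test_functions_def)
  then show "continuous_on S f" by (auto intro: smooth_imp_continuous)
  show "f \<in> borel_measurable borel"
    using \<open>smooth f\<close> by (intro borel_measurable_continuous_onI smooth_imp_continuous)
  show "f x = 0" if "x \<notin> supp f" for x
    using that closure_subset[of "{x. f x \<noteq> 0}"] by (auto simp: supp_def)
qed

lemma test_functionsI_support:
  assumes "smooth f" "compact K" "\<And>x. x \<notin> K \<Longrightarrow> f x = 0"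
  shows "f \<in> test_functions"
proof -
  have "supp f \<subseteq> K" unfolding supp_def
    using assms(3) compact_imp_closed[OF assms(2)] by (intro closure_minimal) auto
  then show ?thesis using assms(1,2) unfolding test_functions_def
    by (metis (mono_tags, lifting) closed_closure compact_Int_closed inf.absorb2 mem_Collect_eq supp_def)
qed

lemma test_mult [intro]:
  assumes "f \<in> test_functions" "smooth g"
  shows "(\<lambda>x. f x * g x) \<in> test_functions" "(\<lambda>x. g x * f x) \<in> test_functions"
  using assms test_functionsD[OF assms(1)]
  by (auto intro!: test_functionsI_support[of _ "supp f"] smooth_mult)

lemma test_add [intro]:
  assumes "f \<in> test_functions" "g \<in> test_functions"
  shows "(\<lambda>x. f x + g x) \<in> test_functions"
  using test_functionsD[OF assms(1)] test_functionsD[OF assms(2)]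
  by (intro test_functionsI_support[of _ "supp f \<union> supp g"] smooth_add) auto

lemma test_zero: "(\<lambda>_. 0) \<in> test_functions"
  by (rule test_functionsI_support[of _ "{}"]) (use smooth_const[of 0] in auto)

lemma test_sum [intro]:
  "(\<And>i. i \<in> I \<Longrightarrow> f i \<in> test_functions) \<Longrightarrow> (\<lambda>x. \<Sum>i\<in>I. f i x) \<in> test_functions"
proof (induction I rule: infinite_finite_induct)
  case (insert i I)
  then show ?case using test_add[of "f i" "\<lambda>x. \<Sum>i\<in>I. f i x"] by simp
qed (use test_zero in auto)

lemma test_divide:
  fixes f g :: "real^'n \<Rightarrow> complex"
  assumes "f \<in> test_functions" "smooth g" "\<And>x. x \<in> supp f \<Longrightarrow> g x \<noteq> 0"
  shows "(\<lambda>x. f x / g x) \<in> test_functions"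
  using test_functionsD[OF assms(1)]
  by (intro test_functionsI_support[of _ "supp f"] smooth_divide assms) auto

lemma test_partial [intro]:
  assumes "f \<in> test_functions"
  shows "partial_deriv k f \<in> test_functions"
proof (rule test_functionsI_support)
  show "smooth (partial_deriv k f)" "compact (supp f)" using test_functionsD[OF assms] by auto
  show "partial_deriv k f x = 0" if "x \<notin> supp f" for x
  proof -
    have "open (- supp f)" by (simp add: supp_def open_Compl)
    then have "(f has_derivative (\<lambda>_. 0)) (at x)"
      using that test_functionsD(5)[OF assms]
      by (intro has_derivative_transform_within_open[OF has_derivative_const[of 0]]) auto
    from partial_derivI[OF this] show ?thesis .
  qed
qed

lemma test_iter_partial: "f \<in> test_functions \<Longrightarrow> iter_partial ks f \<in> test_functions"
  by (induction ks) auto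

lemma test_affine_comp:
  assumes "f \<in> test_functions" "c \<noteq> 0"
  shows "(\<lambda>x. f (a + c *\<^sub>R x)) \<in> test_functions"
proof (rule test_functionsI_support)
  show "smooth (\<lambda>x. f (a + c *\<^sub>R x))" using assms by (intro smooth_affine_comp test_functionsD)
  show "compact ((\<lambda>y. (1/c) *\<^sub>R (y - a)) ` supp f)"
    using test_functionsD(2)[OF assms(1)] by (intro compact_continuous_image continuous_intros)
  show "f (a + c *\<^sub>R x) = 0" if "x \<notin> (\<lambda>y. (1/c) *\<^sub>R (y - a)) ` supp f" for x
  proof (rule test_functionsD(5)[OF assms(1)], rule notI)
    assume "a + c *\<^sub>R x \<in> supp f"
    then have "(1/c) *\<^sub>R ((a + c *\<^sub>R x) - a) \<in> (\<lambda>y. (1/c) *\<^sub>R (y - a)) ` supp f" by blast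
    with that assms(2) show False by simp
  qed
qed

lemma test_bounded:
  assumes "f \<in> test_functions"
  obtains B where "0 \<le> B" "\<And>x. norm (f x) \<le> B"
proof -
  have "bounded (f ` supp f)"
    using test_functionsD[OF assms] by (intro compact_imp_bounded compact_continuous_image) auto
  then obtain B where "\<forall>x\<in>supp f. norm (f x) \<le> B" by (auto simp: bounded_iff)
  then have "norm (f x) \<le> max 0 B" for x
    using test_functionsD(5)[OF assms, of x] by (cases "x \<in> supp f") force+
  then show ?thesis using that[of "max 0 B"] by simp
qed

lemma test_integrable_mult:
  fixes f g :: "real^'n \<Rightarrow> complex"
  assumes "f \<in> test_functions" "continuous_on UNIV g"
  shows "integrable lborel (\<lambda>x. f x * g x)"
proof -
  note D = test_functionsD[OF assms(1)]
  have c: "continuous_on S (\<lambda>x. f x * g x)" for S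
    by (intro continuous_on_mult D) (rule continuous_on_subset[OF assms(2)], simp)
  have "bounded ((\<lambda>x. f x * g x) ` supp f)"
    by (intro compact_imp_bounded compact_continuous_image c D)
  then obtain B where B: "\<And>x. x \<in> supp f \<Longrightarrow> norm (f x * g x) \<le> B" by (auto simp: bounded_iff)
  show ?thesis
  proof (rule integrableI_bounded_set[where A = "supp f" and B = B])
    show "supp f \<in> sets lborel" by (simp add: supp_def)
    show "(\<lambda>x. f x * g x) \<in> borel_measurable lborel"
      using borel_measurable_continuous_onI[OF c] by simp
    show "emeasure lborel (supp f) < \<infinity>"
      using emeasure_bounded_finite[OF compact_imp_bounded[OF D(2)]] by simp
  qed (use B D(5) in auto)
qed

lemma test_integrable: "f \<in> test_functions \<Longrightarrow> integrable lborel f"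
  using test_integrable_mult[of f "\<lambda>_. 1"] by simp

section \<open>Decay and integrability of Schwartz functions\<close>

lemma schwartz_bound:
  assumes "f \<in> schwartz"
  obtains B where "0 \<le> B" "\<And>x. (1 + norm x) ^ N * norm (iter_partial ks f x) \<le> B"
proof -
  obtain B where B: "\<And>x. (1 + norm x) ^ N * norm (iter_partial ks f x) \<le> B"
    using assms unfolding schwartz_def bdd_above_def by blast
  show ?thesis using B that[of B] order_trans[OF _ B[of 0]] by simp
qed

lemma schwartz_smooth: "f \<in> schwartz \<Longrightarrow> smooth f"
  by (simp add: schwartz_def)

lemma schwartzI:
  assumes "smooth f" "\<And>N ks. \<exists>B. \<forall>x. (1 + norm x) ^ N * norm (iter_partial ks f x) \<le> B"
  shows "f \<in> schwartz"
  using assms unfolding schwartz_def bdd_above_def by blast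

lemma test_imp_schwartz:
  assumes "f \<in> test_functions"
  shows "f \<in> schwartz"
proof (rule schwartzI)
  show "smooth f" by (rule test_functionsD[OF assms])
  show "\<exists>B. \<forall>x. (1 + norm x) ^ N * norm (iter_partial ks f x) \<le> B" for N ks
  proof -
    note D = test_functionsD[OF test_iter_partial[OF assms, of ks]]
    let ?g = "\<lambda>x. (1 + norm x) ^ N * norm (iter_partial ks f x)"
    have "bounded (?g ` supp (iter_partial ks f))"
      by (intro compact_imp_bounded compact_continuous_image continuous_intros D)
    then obtain B where "\<And>x. x \<in> supp (iter_partial ks f) \<Longrightarrow> norm (?g x) \<le> B"
      unfolding bounded_iff by blast
    then have "?g x \<le> max B 0" for x
      using D(5)[of x] by (cases "x \<in> supp (iter_partial ks f)") force+
    then show ?thesis by blast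
  qed
qed

text \<open>\<open>lborel\<close> is the image of a product of one-dimensional Lebesgue measures
  indexed by \<open>Basis\<close>, which reduces products of one-variable functions to the product
  measure. Gaussians and the majorants of the weights are of this form.\<close>

lemma lborel_integral_prod:
  fixes f :: "'a::euclidean_space \<Rightarrow> real \<Rightarrow> 'b::{real_normed_field,banach,second_countable_topology}"
  assumes int: "\<And>b. b \<in> Basis \<Longrightarrow> integrable lborel (f b)"
  shows "integrable lborel (\<lambda>x::'a. \<Prod>b\<in>Basis. f b (x \<bullet> b))"
    and "(\<integral>x. (\<Prod>b\<in>Basis. f b (x \<bullet> b)) \<partial>(lborel :: 'a measure)) = (\<Prod>b\<in>Basis. \<integral>t. f b t \<partial>lborel)"
proof -
  interpret product_sigma_finite "\<lambda>_::'a. lborel :: real measure" by standard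
  have [measurable]: "f b \<in> borel_measurable borel" if "b \<in> Basis" for b
    using borel_measurable_integrable[OF int[OF that]] by simp
  have m: "(\<lambda>x::'a. \<Prod>b\<in>Basis. f b (x \<bullet> b)) \<in> borel_measurable borel"
    by (intro borel_measurable_prod) measurable
  have T: "(\<lambda>f. \<Sum>b\<in>Basis. f b *\<^sub>R b) \<in> (\<Pi>\<^sub>M b\<in>(Basis::'a set). lborel) \<rightarrow>\<^sub>M borel"
    by measurable
  have eq: "(\<Prod>b\<in>Basis. f b ((\<Sum>c\<in>Basis. y c *\<^sub>R c) \<bullet> b)) = (\<Prod>b\<in>(Basis::'a set). f b (y b))" for y
    by (intro prod.cong) (auto simp: inner_sum_left inner_Basis if_distrib cong: if_cong)
  have "integrable (\<Pi>\<^sub>M b\<in>(Basis::'a set). lborel) (\<lambda>y. \<Prod>b\<in>Basis. f b (y b))"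
    by (intro product_integrable_prod int) auto
  then show "integrable lborel (\<lambda>x::'a. \<Prod>b\<in>Basis. f b (x \<bullet> b))"
    by (subst lborel_eq, subst integrable_distr_eq[OF T m]) (simp add: eq)
  show "(\<integral>x. (\<Prod>b\<in>Basis. f b (x \<bullet> b)) \<partial>(lborel :: 'a measure)) = (\<Prod>b\<in>Basis. \<integral>t. f b t \<partial>lborel)"
    by (subst lborel_eq, subst integral_distr[OF T m])
       (simp add: eq product_integral_prod[OF finite_Basis int])
qed

text \<open>The exponent \<open>2 * CARD('n)\<close> that recurs in all weight estimates originates
  here: each factor \<open>1 + (x \<bullet> b)^2\<close> is at most \<open>(1 + norm x)^2\<close>,
  and its reciprocal is integrable on the line.\<close>

lemma integrable_inverse_power_norm:
  assumes "2 * CARD('n) \<le> N"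
  shows "integrable lborel (\<lambda>x::real^'n. 1 / (1 + norm x) ^ N)"
proof (rule Bochner_Integration.integrable_bound)
  have "integrable lborel (\<lambda>x. inverse (1 + x^2) :: real)"
    using integrable_inverse_1_plus_square by (simp add: set_integrable_def)
  then show "integrable lborel (\<lambda>x::real^'n. \<Prod>b\<in>Basis. inverse (1 + (x \<bullet> b)^2))"
    by (rule lborel_integral_prod(1))
  show "AE x::real^'n in lborel. norm (1 / (1 + norm x) ^ N) \<le> norm (\<Prod>b\<in>Basis. inverse (1 + (x \<bullet> b)^2))"
  proof (rule AE_I2)
    fix x :: "real^'n"
    have "(\<Prod>b\<in>(Basis::(real^'n) set). 1 + (x \<bullet> b)^2) \<le> (\<Prod>b\<in>(Basis::(real^'n) set). (1 + norm x)^2)"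
    proof (rule prod_mono, intro conjI)
      fix b :: "real^'n" assume b: "b \<in> Basis"
      have "(x \<bullet> b)^2 \<le> (norm x)^2"
        using Basis_le_norm[OF b, of x] by (metis abs_ge_zero power2_abs power_mono)
      then have "1 + (x \<bullet> b)^2 \<le> 1 + (norm x)^2 + 2 * norm x" using norm_ge_zero[of x] by linarith
      then show "1 + (x \<bullet> b)^2 \<le> (1 + norm x)^2" by (simp add: power2_sum)
    qed simp
    also have "\<dots> = (1 + norm x) ^ (2 * CARD('n))" by (simp add: power_mult)
    also have "\<dots> \<le> (1 + norm x) ^ N" by (rule power_increasing[OF assms]) simp
    finally have "inverse ((1 + norm x) ^ N) \<le> inverse (\<Prod>b\<in>(Basis::(real^'n) set). 1 + (x \<bullet> b)^2)"
      by (intro le_imp_inverse_le prod_pos) (auto intro: add_pos_nonneg)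
    then show "norm (1 / (1 + norm x) ^ N) \<le> norm (\<Prod>b\<in>Basis. inverse (1 + (x \<bullet> b)^2))"
      by (simp add: prod_inversef[symmetric] o_def divide_inverse prod_nonneg)
  qed
qed measurable

lemma weight_peetre:
  fixes x y :: "'a::real_normed_vector"
  shows "(1 + norm x) ^ N \<le> (1 + norm y) ^ N * (1 + norm (x - y)) ^ N"
proof -
  have "norm x \<le> norm y + norm (x - y)" by (rule norm_triangle_sub)
  also have "\<dots> \<le> norm y + norm (x - y) + norm y * norm (x - y)" by simp
  finally have "1 + norm x \<le> (1 + norm y) * (1 + norm (x - y))" by (simp add: algebra_simps)
  then show ?thesis unfolding power_mult_distrib[symmetric] by (intro power_mono) auto
qed

lemma schwartz_decay:
  assumes "f \<in> schwartz"
  obtains B where "0 \<le> B" "\<And>x. norm (iter_partial ks f x) \<le> B / (1 + norm x) ^ N"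
proof -
  obtain B where B: "0 \<le> B" "\<And>x. (1 + norm x) ^ N * norm (iter_partial ks f x) \<le> B"
    using schwartz_bound[OF assms] by blast
  have "norm (iter_partial ks f x) \<le> B / (1 + norm x) ^ N" for x
    using B(2)[of x] by (subst pos_le_divide_eq) (auto simp: mult.commute intro!: zero_less_power add_pos_nonneg)
  then show ?thesis using B(1) that by blast
qed

lemma schwartz_weight_integrable:
  fixes f :: "real^'n \<Rightarrow> complex"
  assumes "f \<in> schwartz"
  shows "integrable lborel (\<lambda>x. (1 + norm x) ^ N * norm (f x))"
proof -
  obtain B where B: "0 \<le> B" "\<And>x. (1 + norm x) ^ (N + 2 * CARD('n)) * norm (f x) \<le> B"
    using schwartz_bound[OF assms, of _ "[]"] by (metis iter_partial.simps(1))
  have [measurable]: "f \<in> borel_measurable borel"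
    by (intro borel_measurable_continuous_onI smooth_imp_continuous schwartz_smooth assms)
  have pos: "0 < (1 + norm x) ^ k" for x :: "real^'n" and k
    by (intro zero_less_power add_pos_nonneg) auto
  show ?thesis
  proof (rule Bochner_Integration.integrable_bound)
    show "integrable lborel (\<lambda>x::real^'n. B * (1 / (1 + norm x) ^ (2 * CARD('n))))"
      by (intro integrable_mult_right integrable_inverse_power_norm) simp
    show "AE x in lborel. norm ((1 + norm x) ^ N * norm (f x)) \<le> norm (B * (1 / (1 + norm x) ^ (2 * CARD('n))))"
      using B pos by (intro AE_I2) (auto simp: abs_mult power_add field_simps)
  qed measurable
qed

lemma schwartz_integrable:
  fixes f :: "real^'n \<Rightarrow> complex"
  assumes "f \<in> schwartz"
  shows "integrable lborel f"
proof -
  have [measurable]: "f \<in> borel_measurable borel"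
    by (intro borel_measurable_continuous_onI smooth_imp_continuous schwartz_smooth assms)
  show ?thesis
    by (rule Bochner_Integration.integrable_bound[OF schwartz_weight_integrable[OF assms, of 0]]) auto
qed

text \<open>Integrals depending on a parameter are differentiated through this criterion: the
  pointwise second-order remainder is integrated, and division by \<open>norm h\<close> leaves a
  factor \<open>norm h\<close>.\<close>

lemma has_derivativeI_quadratic:
  fixes f :: "real^'n \<Rightarrow> complex"
  assumes "linear D" "\<And>v. norm (f (x + v) - f x - D v) \<le> C * norm v ^ 2"
  shows "(f has_derivative D) (at x)"
  unfolding has_derivative_at
proof
  show "bounded_linear D" using assms(1) by (simp add: linear_conv_bounded_linear)
  show "(\<lambda>h. norm (f (x + h) - f x - D h) / norm h) \<midarrow>0\<rightarrow> 0"
  proof (rule tendsto_sandwich[where f = "\<lambda>_. 0" and h = "\<lambda>h. C * norm h"])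
    have "norm (f (x + h) - f x - D h) / norm h \<le> C * norm h" if "h \<noteq> 0" for h
      using assms(2)[of h] that by (simp add: field_simps power2_eq_square)
    then show "\<forall>\<^sub>F h in at 0. norm (f (x + h) - f x - D h) / norm h \<le> C * norm h"
      by (auto simp: eventually_at intro!: exI[of _ 1])
    show "((\<lambda>h::real^'n. C * norm h) \<longlongrightarrow> 0) (at 0)"
      by (auto intro!: tendsto_eq_intros)
  qed auto
qed

section \<open>Translations and affine changes of variables\<close>

lemma lborel_integral_translation:
  fixes f :: "'a::euclidean_space \<Rightarrow> 'b::{banach,second_countable_topology}"
  assumes "f \<in> borel_measurable borel"
  shows "(\<integral>x. f (c + x) \<partial>lborel) = (\<integral>x. f x \<partial>lborel)"
    and "integrable lborel (\<lambda>x. f (c + x)) \<longleftrightarrow> integrable lborel f"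
proof -
  have m: "(\<lambda>x. c + x) \<in> lborel \<rightarrow>\<^sub>M (borel :: 'a measure)" by measurable
  show "(\<integral>x. f (c + x) \<partial>lborel) = (\<integral>x. f x \<partial>lborel)"
    using integral_distr[OF m assms] lborel_distr_plus[of c] by simp
  show "integrable lborel (\<lambda>x. f (c + x)) \<longleftrightarrow> integrable lborel f"
    using integrable_distr_eq[OF m assms] lborel_distr_plus[of c] by simp
qed

lemma lborel_integral_affine:
  fixes f :: "'a::euclidean_space \<Rightarrow> 'b::{banach,second_countable_topology}"
  assumes "f \<in> borel_measurable borel" "c \<noteq> 0"
  shows "(\<integral>x. f x \<partial>lborel) = \<bar>c\<bar> ^ DIM('a) *\<^sub>R (\<integral>x. f (t + c *\<^sub>R x) \<partial>lborel)"
    and "integrable lborel f \<longleftrightarrow> integrable lborel (\<lambda>x. f (t + c *\<^sub>R x))"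
proof -
  have m: "(\<lambda>x. t + c *\<^sub>R x) \<in> lborel \<rightarrow>\<^sub>M (borel :: 'a measure)" by measurable
  have f: "f \<in> borel_measurable (distr lborel borel (\<lambda>x. t + c *\<^sub>R x))" using assms(1) by simp
  have "(\<integral>x. f x \<partial>lborel) = (\<integral>x. f x \<partial>density (distr lborel borel (\<lambda>x. t + c *\<^sub>R x)) (\<lambda>_. ennreal (\<bar>c\<bar>^DIM('a))))"
    using lborel_affine[OF assms(2), of t] by simp
  also have "\<dots> = (\<integral>x. \<bar>c\<bar>^DIM('a) *\<^sub>R f x \<partial>distr lborel borel (\<lambda>x. t + c *\<^sub>R x))"
    by (rule integral_density[OF f]) auto
  also have "\<dots> = \<bar>c\<bar>^DIM('a) *\<^sub>R (\<integral>x. f (t + c *\<^sub>R x) \<partial>lborel)"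
    using integral_distr[OF m assms(1)] by simp
  finally show "(\<integral>x. f x \<partial>lborel) = \<bar>c\<bar> ^ DIM('a) *\<^sub>R (\<integral>x. f (t + c *\<^sub>R x) \<partial>lborel)" .
  have "integrable lborel f \<longleftrightarrow> integrable (density (distr lborel borel (\<lambda>x. t + c *\<^sub>R x)) (\<lambda>_. ennreal (\<bar>c\<bar>^DIM('a)))) f"
    using lborel_affine[OF assms(2), of t] by simp
  also have "\<dots> \<longleftrightarrow> integrable (distr lborel borel (\<lambda>x. t + c *\<^sub>R x)) (\<lambda>x. \<bar>c\<bar>^DIM('a) *\<^sub>R f x)"
    by (rule integrable_density[OF f]) auto
  also have "\<dots> \<longleftrightarrow> integrable lborel (\<lambda>x. f (t + c *\<^sub>R x))"
  proof -
    have "integrable M (\<lambda>x. \<bar>c\<bar>^DIM('a) *\<^sub>R f x) \<longleftrightarrow> integrable M f" for M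
      using integrable_scaleR_right[of "inverse (\<bar>c\<bar>^DIM('a))" M "\<lambda>x. \<bar>c\<bar>^DIM('a) *\<^sub>R f x"]
        integrable_scaleR_right[of "\<bar>c\<bar>^DIM('a)" M f] assms(2) by auto
    then show ?thesis using integrable_distr_eq[OF m assms(1)] by simp
  qed
  finally show "integrable lborel f \<longleftrightarrow> integrable lborel (\<lambda>x. f (t + c *\<^sub>R x))" .
qed

subsection \<open>Fourier kernels of test functions\<close>

text \<open>The reflected convolution kernel of a multiplier: with this sign,
  \<open>\<zeta>(D)u\<close> at \<open>y\<close> is \<open>u\<close> applied to
  \<open>\<lambda>x. fker \<zeta> (x - y)\<close>. The constant collects those of both Fourier
  transforms, so products of symbols correspond to convolutions of kernels without further
  factors.\<close>

definition fker :: "(real^'n \<Rightarrow> complex) \<Rightarrow> real^'n \<Rightarrow> complex" where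
  "fker \<zeta> x = of_real ((2 * pi) powr (- real CARD('n))) *
     (\<integral>\<xi>. \<zeta> \<xi> * exp (- (\<i> * of_real (x \<bullet> \<xi>))) \<partial>lborel)"

lemma fker_integrable:
  "\<zeta> \<in> test_functions \<Longrightarrow> integrable lborel (\<lambda>\<xi>. \<zeta> \<xi> * exp (- (\<i> * of_real (x \<bullet> \<xi>))))"
  by (intro test_integrable_mult continuous_intros)

lemma fker_add:
  "f \<in> test_functions \<Longrightarrow> g \<in> test_functions \<Longrightarrow> fker (\<lambda>x. f x + g x) x = fker f x + fker g x"
  by (simp add: fker_def distrib_right fker_integrable ring_distribs)

lemma fker_zero: "fker (\<lambda>_. 0) x = 0"
  by (simp add: fker_def)

lemma fker_sum:
  "(\<And>i. i \<in> I \<Longrightarrow> f i \<in> test_functions) \<Longrightarrow> fker (\<lambda>x. \<Sum>i\<in>I. f i x) x = (\<Sum>i\<in>I. fker (f i) x)"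
proof (induction I rule: infinite_finite_induct)
  case (insert i I)
  then show ?case using fker_add[of "f i" "\<lambda>x. \<Sum>i\<in>I. f i x" x] by (simp add: test_sum)
qed (auto simp: fker_zero)

lemma test_coordinate:
  "\<zeta> \<in> test_functions \<Longrightarrow> (\<lambda>\<xi>. - \<i> * of_real (\<xi> $ k) * \<zeta> \<xi>) \<in> test_functions"
  by (intro test_mult(2) smooth_mult smooth_const smooth_coordinate)

lemma exp_taylor_1: "norm (exp (- (\<i> * of_real t)) - 1 + \<i> * of_real t) \<le> t^2 / 2"
  using iexp_approx1[of "-t" 1] by (simp add: algebra_simps power2_eq_square)

text \<open>Expanding the exponential to second order leaves a remainder bounded by
  \<open>norm v ^ 2\<close> times the second moment of the symbol, which is finite because the
  support is compact.\<close>

lemma fker_has_derivative: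
  fixes \<zeta> :: "real^'n \<Rightarrow> complex"
  assumes z: "\<zeta> \<in> test_functions"
  shows "(fker \<zeta> has_derivative
    (\<lambda>v. \<Sum>k\<in>UNIV. of_real (v $ k) * fker (\<lambda>\<xi>. - \<i> * of_real (\<xi> $ k) * \<zeta> \<xi>) x)) (at x)"
proof -
  let ?c = "of_real ((2 * pi) powr (- real CARD('n))) :: complex"
  let ?e = "\<lambda>x \<xi>. exp (- (\<i> * of_real (x \<bullet> \<xi>))) :: complex"
  let ?D = "\<lambda>v. \<Sum>k\<in>UNIV. of_real (v $ k) * fker (\<lambda>\<xi>. - \<i> * of_real (\<xi> $ k) * \<zeta> \<xi>) x"
  let ?K = "norm ?c * (\<integral>\<xi>. norm (\<zeta> \<xi>) * norm \<xi> ^ 2 \<partial>lborel)"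
  have int2: "integrable lborel (\<lambda>\<xi>. norm (\<zeta> \<xi>) * norm \<xi> ^ 2)"
  proof -
    have "integrable lborel (\<lambda>\<xi>. \<zeta> \<xi> * of_real (norm \<xi> ^ 2))"
      by (intro test_integrable_mult z continuous_intros)
    from integrable_norm[OF this] show ?thesis by (simp add: norm_mult norm_power)
  qed
  show ?thesis
  proof (rule has_derivativeI_quadratic)
    show "linear ?D"
      by (intro linearI)
         (simp_all add: sum.distrib distrib_right scaleR_sum_right scaleR_conv_of_real[where 'a=complex] sum_distrib_left mult.assoc)
    fix v :: "real^'n"
    have D: "?D v = ?c * (\<integral>\<xi>. \<zeta> \<xi> * ?e x \<xi> * (- \<i> * of_real (v \<bullet> \<xi>)) \<partial>lborel)"
    proof -
      have i: "integrable lborel (\<lambda>\<xi>. - \<i> * of_real (\<xi> $ k) * \<zeta> \<xi> * ?e x \<xi>)" for k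
        using fker_integrable[OF test_coordinate[OF z]] .
      have "?D v = ?c * (\<Sum>k\<in>UNIV. \<integral>\<xi>. of_real (v $ k) * (- \<i> * of_real (\<xi> $ k) * \<zeta> \<xi> * ?e x \<xi>) \<partial>lborel)"
        by (simp add: fker_def sum_distrib_left mult.left_commute)
      also have "(\<Sum>k\<in>UNIV. \<integral>\<xi>. of_real (v $ k) * (- \<i> * of_real (\<xi> $ k) * \<zeta> \<xi> * ?e x \<xi>) \<partial>lborel)
          = (\<integral>\<xi>. (\<Sum>k\<in>UNIV. of_real (v $ k) * (- \<i> * of_real (\<xi> $ k) * \<zeta> \<xi> * ?e x \<xi>)) \<partial>lborel)"
        by (rule Bochner_Integration.integral_sum[symmetric]) (intro integrable_mult_right i)
      also have "\<dots> = (\<integral>\<xi>. \<zeta> \<xi> * ?e x \<xi> * (- \<i> * of_real (v \<bullet> \<xi>)) \<partial>lborel)"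
        by (intro Bochner_Integration.integral_cong refl)
           (simp add: inner_vec_def sum_distrib_left sum_distrib_right mult_ac)
      finally show ?thesis .
    qed
    have iD: "integrable lborel (\<lambda>\<xi>. \<zeta> \<xi> * ?e x \<xi> * (- \<i> * of_real (v \<bullet> \<xi>)))"
      unfolding mult.assoc by (intro test_integrable_mult z continuous_intros)
    have "fker \<zeta> (x + v) - fker \<zeta> x - ?D v =
        ?c * (\<integral>\<xi>. \<zeta> \<xi> * ?e (x + v) \<xi> - \<zeta> \<xi> * ?e x \<xi> - \<zeta> \<xi> * ?e x \<xi> * (- \<i> * of_real (v \<bullet> \<xi>)) \<partial>lborel)"
      unfolding D unfolding fker_def using fker_integrable[OF z, of "x + v"] fker_integrable[OF z, of x] iD
      by (simp, simp add: algebra_simps)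
    also have "norm \<dots> \<le> norm ?c * (\<integral>\<xi>. norm v ^ 2 * (norm (\<zeta> \<xi>) * norm \<xi> ^ 2) \<partial>lborel)"
    proof (subst norm_mult, rule mult_left_mono, rule Bochner_Integration.integral_norm_bound_integral)
      show "integrable lborel (\<lambda>\<xi>. \<zeta> \<xi> * ?e (x + v) \<xi> - \<zeta> \<xi> * ?e x \<xi> - \<zeta> \<xi> * ?e x \<xi> * (- \<i> * of_real (v \<bullet> \<xi>)))"
        by (intro Bochner_Integration.integrable_diff fker_integrable z iD)
      show "integrable lborel (\<lambda>\<xi>. norm v ^ 2 * (norm (\<zeta> \<xi>) * norm \<xi> ^ 2))"
        by (intro integrable_mult_right int2)
      fix \<xi>
      have e: "?e (x + v) \<xi> = ?e x \<xi> * ?e v \<xi>"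
        by (simp add: inner_add_left exp_add[symmetric] algebra_simps)
      have "\<zeta> \<xi> * ?e (x + v) \<xi> - \<zeta> \<xi> * ?e x \<xi> - \<zeta> \<xi> * ?e x \<xi> * (- \<i> * of_real (v \<bullet> \<xi>))
          = \<zeta> \<xi> * ?e x \<xi> * (?e v \<xi> - 1 + \<i> * of_real (v \<bullet> \<xi>))"
        unfolding e by (simp add: algebra_simps)
      also have "norm \<dots> \<le> norm (\<zeta> \<xi>) * ((v \<bullet> \<xi>)^2 / 2)"
        using mult_left_mono[OF exp_taylor_1[of "v \<bullet> \<xi>"], of "norm (\<zeta> \<xi>)"] by (simp add: norm_mult)
      also have "\<dots> \<le> norm (\<zeta> \<xi>) * (norm v * norm \<xi>)^2"
      proof (rule mult_left_mono)
        have "(v \<bullet> \<xi>)^2 \<le> (norm v * norm \<xi>)^2"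
          using Cauchy_Schwarz_ineq2[of v \<xi>] by (metis abs_ge_zero power2_abs power_mono)
        then show "(v \<bullet> \<xi>)^2 / 2 \<le> (norm v * norm \<xi>)^2" using zero_le_power2[of "v \<bullet> \<xi>"] by linarith
      qed simp
      finally show "norm (\<zeta> \<xi> * ?e (x + v) \<xi> - \<zeta> \<xi> * ?e x \<xi> - \<zeta> \<xi> * ?e x \<xi> * (- \<i> * of_real (v \<bullet> \<xi>)))
          \<le> norm v ^ 2 * (norm (\<zeta> \<xi>) * norm \<xi> ^ 2)"
        by (simp add: power_mult_distrib mult_ac)
    qed simp
    also have "\<dots> = ?K * norm v ^ 2" by simp
    finally show "norm (fker \<zeta> (x + v) - fker \<zeta> x - ?D v) \<le> ?K * norm v ^ 2" .
  qed
qed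

lemma partial_deriv_fker:
  assumes "\<zeta> \<in> test_functions"
  shows "partial_deriv k (fker \<zeta>) = fker (\<lambda>\<xi>. - \<i> * of_real (\<xi> $ k) * \<zeta> \<xi>)"
proof
  fix x
  show "partial_deriv k (fker \<zeta>) x = fker (\<lambda>\<xi>. - \<i> * of_real (\<xi> $ k) * \<zeta> \<xi>) x"
    unfolding partial_derivI[OF fker_has_derivative[OF assms]]
    by (simp add: axis_def if_distrib[of complex_of_real] if_distrib[of "\<lambda>a. a * _"] cong: if_cong)
qed

text \<open>A derivative of a kernel is the kernel of the symbol times monomials, again a test
  function; decay therefore has to be proved for undifferentiated kernels only.\<close>

lemma iter_partial_fker:
  assumes "\<zeta> \<in> test_functions"
  shows "\<exists>\<zeta>'\<in>test_functions. iter_partial ks (fker \<zeta>) = fker \<zeta>'"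
proof (induction ks)
  case (Cons k ks)
  then obtain \<zeta>' where "\<zeta>' \<in> test_functions" "iter_partial ks (fker \<zeta>) = fker \<zeta>'" by blast
  then show ?case using partial_deriv_fker[of \<zeta>' k] test_coordinate[of \<zeta>' k] by auto
qed (use assms in auto)

lemma smooth_fker: "\<zeta> \<in> test_functions \<Longrightarrow> smooth (fker \<zeta>)"
  unfolding smooth_def
proof (intro allI)
  fix ks :: "'a list" and x
  assume "\<zeta> \<in> test_functions"
  then obtain \<zeta>' where "\<zeta>' \<in> test_functions" "iter_partial ks (fker \<zeta>) = fker \<zeta>'"
    using iter_partial_fker by blast
  then show "iter_partial ks (fker \<zeta>) differentiable (at x)"
    using fker_has_derivative[of \<zeta>' x] by (auto simp: differentiable_def)
qed

lemma fker_bounded: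
  assumes "\<zeta> \<in> test_functions"
  shows "\<exists>B. \<forall>x. norm (fker \<zeta> x) \<le> B"
proof (intro exI allI)
  fix x
  have "norm (\<integral>\<xi>. \<zeta> \<xi> * exp (- (\<i> * of_real (x \<bullet> \<xi>))) \<partial>lborel) \<le> (\<integral>\<xi>. norm (\<zeta> \<xi>) \<partial>lborel)"
    using integral_norm_bound[of lborel "\<lambda>\<xi>. \<zeta> \<xi> * exp (- (\<i> * of_real (x \<bullet> \<xi>)))"]
    by (simp add: norm_mult)
  then show "norm (fker \<zeta> x) \<le> (2 * pi) powr (- real CARD('a)) * (\<integral>\<xi>. norm (\<zeta> \<xi>) \<partial>lborel)"
    by (auto simp: fker_def norm_mult intro!: mult_left_mono)
qed

text \<open>Integration by parts through difference quotients: shifting the symbol by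
  \<open>t\<close> along axis \<open>k\<close> multiplies its kernel by
  \<open>exp (\<i> t x\<^sub>k)\<close> exactly, and the first-order coefficients in
  \<open>t\<close> are compared.\<close>

lemma fker_partial_deriv:
  fixes \<zeta> :: "real^'n \<Rightarrow> complex"
  assumes z: "\<zeta> \<in> test_functions"
  shows "fker (partial_deriv k \<zeta>) x = \<i> * of_real (x $ k) * fker \<zeta> x"
proof -
  let ?c = "of_real ((2 * pi) powr (- real CARD('n))) :: complex"
  let ?e = "\<lambda>\<xi>. exp (- (\<i> * of_real (x \<bullet> \<xi>))) :: complex"
  let ?A = "fker \<zeta> x" and ?B = "fker (partial_deriv k \<zeta>) x"
  let ?r = "\<lambda>t \<xi>. \<zeta> (t *\<^sub>R axis k 1 + \<xi>) - \<zeta> \<xi> - of_real t * partial_deriv k \<zeta> \<xi>"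
  have "bounded (supp \<zeta>)" by (intro compact_imp_bounded test_functionsD z)
  then obtain R where R: "\<And>\<xi>. \<xi> \<in> supp \<zeta> \<Longrightarrow> norm \<xi> \<le> R" by (auto simp: bounded_iff)
  have "\<exists>B. \<forall>k l x. norm (partial_deriv k (partial_deriv l \<zeta>) x) \<le> B"
  proof -
    have "\<forall>k l. \<exists>B. \<forall>x. norm (partial_deriv k (partial_deriv l \<zeta>) x) \<le> B"
      by (metis test_bounded test_partial z)
    then obtain B where B: "\<And>k l x. norm (partial_deriv k (partial_deriv l \<zeta>) x) \<le> B k l" by metis
    have "norm (partial_deriv k (partial_deriv l \<zeta>) x) \<le> (\<Sum>k\<in>UNIV. \<Sum>l\<in>UNIV. \<bar>B k l\<bar>)" for k l x
    proof -
      have "norm (partial_deriv k (partial_deriv l \<zeta>) x) \<le> \<bar>B k l\<bar>" using B[of k l x] by linarith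
      also have "\<dots> \<le> (\<Sum>l\<in>UNIV. \<bar>B k l\<bar>)" by (rule member_le_sum) auto
      also have "\<dots> \<le> (\<Sum>k\<in>UNIV. \<Sum>l\<in>UNIV. \<bar>B k l\<bar>)"
        by (rule member_le_sum) (auto intro: sum_nonneg)
      finally show ?thesis .
    qed
    then show ?thesis by blast
  qed
  then obtain B where B: "\<And>k l x. norm (partial_deriv k (partial_deriv l \<zeta>) x) \<le> B" by blast
  have B0: "0 \<le> B" using B[of undefined undefined undefined] norm_ge_zero order_trans by blast
  have tay: "norm (?r t \<xi>) \<le> real CARD('n)^2 * B * t^2" for t \<xi>
    using smooth_taylor[OF test_functionsD(1)[OF z] B, of \<xi> "t *\<^sub>R axis k 1"]
    by (simp add: axis_def if_distrib[of complex_of_real] if_distrib[of "\<lambda>a. _ * a"]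
        if_distrib[of "\<lambda>a. a * _"] add.commute norm_axis_1[unfolded axis_def] power_mult_distrib cong: if_cong)
  \<comment> \<open>Shifts of size at most one keep the support of the remainder in this ball, so
    its pointwise bound of order \<open>t^2\<close> carries over to its integral.\<close>
  let ?b = "cball (0::real^'n) (R + 1)"
  have zero: "?r t \<xi> = 0" if "\<bar>t\<bar> \<le> 1" "\<xi> \<notin> ?b" for t \<xi>
  proof -
    have "norm (t *\<^sub>R axis k 1 :: real^'n) \<le> 1" using that(1) by (simp add: norm_axis_1)
    then have "norm \<xi> \<le> norm (t *\<^sub>R axis k 1 + \<xi>) + 1"
      using norm_triangle_ineq4[of "t *\<^sub>R axis k 1 + \<xi>" "t *\<^sub>R axis k 1"] by simp
    then have "t *\<^sub>R axis k 1 + \<xi> \<notin> supp \<zeta>" "\<xi> \<notin> supp \<zeta>" using R that(2) by force+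
    moreover from this(2) have "partial_deriv k \<zeta> \<xi> = 0"
    proof -
      assume n: "\<xi> \<notin> supp \<zeta>"
      have "open (- supp \<zeta>)" by (simp add: supp_def open_Compl)
      then have "(\<zeta> has_derivative (\<lambda>_. 0)) (at \<xi>)"
        using n test_functionsD(5)[OF z]
        by (intro has_derivative_transform_within_open[OF has_derivative_const[of 0]]) auto
      from partial_derivI[OF this] show ?thesis .
    qed
    ultimately show ?thesis using test_functionsD(5)[OF z] by simp
  qed
  let ?K = "norm ?c * (real CARD('n)^2 * B * measure lborel ?b)"
  have main: "norm ((exp (\<i> * of_real (t * x $ k)) - 1) * ?A - of_real t * ?B) \<le> ?K * t^2"
    if t: "\<bar>t\<bar> \<le> 1" for t
  proof -
    have tr: "integrable lborel (\<lambda>\<xi>. \<zeta> (t *\<^sub>R axis k 1 + \<xi>) * ?e \<xi>)"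
      "(\<integral>\<xi>. \<zeta> (t *\<^sub>R axis k 1 + \<xi>) * ?e \<xi> \<partial>lborel) = exp (\<i> * of_real (t * x $ k)) * (\<integral>\<xi>. \<zeta> \<xi> * ?e \<xi> \<partial>lborel)"
    proof -
      let ?f = "\<lambda>\<xi>. \<zeta> \<xi> * ?e (\<xi> - t *\<^sub>R axis k 1)"
      have [measurable]: "\<zeta> \<in> borel_measurable borel" by (rule test_functionsD[OF z])
      have f: "?f \<in> borel_measurable borel" by measurable
      have fe: "?f = (\<lambda>\<xi>. exp (\<i> * of_real (t * x $ k)) * (\<zeta> \<xi> * ?e \<xi>))"
        by (auto simp: fun_eq_iff inner_diff_right inner_axis algebra_simps exp_add[symmetric] exp_diff)
      have "integrable lborel ?f" unfolding fe by (intro integrable_mult_right fker_integrable z)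
      then show "integrable lborel (\<lambda>\<xi>. \<zeta> (t *\<^sub>R axis k 1 + \<xi>) * ?e \<xi>)"
        using lborel_integral_translation(2)[OF f, of "t *\<^sub>R axis k 1"] by simp
      show "(\<integral>\<xi>. \<zeta> (t *\<^sub>R axis k 1 + \<xi>) * ?e \<xi> \<partial>lborel) = exp (\<i> * of_real (t * x $ k)) * (\<integral>\<xi>. \<zeta> \<xi> * ?e \<xi> \<partial>lborel)"
        using lborel_integral_translation(1)[OF f, of "t *\<^sub>R axis k 1"] by (simp add: fe)
    qed
    have i: "integrable lborel (\<lambda>\<xi>. partial_deriv k \<zeta> \<xi> * ?e \<xi>)" by (intro fker_integrable test_partial z)
    have ir: "integrable lborel (\<lambda>\<xi>. ?r t \<xi> * ?e \<xi>)"
      unfolding left_diff_distrib mult.assoc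
      by (intro Bochner_Integration.integrable_diff tr integrable_mult_right i fker_integrable z)
    have "(exp (\<i> * of_real (t * x $ k)) - 1) * ?A - of_real t * ?B = ?c * (\<integral>\<xi>. ?r t \<xi> * ?e \<xi> \<partial>lborel)"
      using tr i fker_integrable[OF z, of x]
      by (simp add: fker_def left_diff_distrib mult.assoc right_diff_distrib mult.left_commute)
    also have "norm \<dots> \<le> norm ?c * (\<integral>\<xi>. (real CARD('n)^2 * B * t^2) * indicator ?b \<xi> \<partial>lborel)"
    proof (subst norm_mult, rule mult_left_mono, rule Bochner_Integration.integral_norm_bound_integral)
      show "integrable lborel (\<lambda>\<xi>. (real CARD('n)^2 * B * t^2) * indicator ?b \<xi>)"
        by (intro integrable_mult_right integrable_real_indicator) (use emeasure_bounded_finite[of ?b] in simp_all)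
      show "norm (?r t \<xi> * ?e \<xi>) \<le> (real CARD('n)^2 * B * t^2) * indicator ?b \<xi>" for \<xi>
        using tay[of t \<xi>] zero[OF t, of \<xi>] B0 by (auto simp: norm_mult indicator_def)
    qed (use ir in auto)
    also have "\<dots> = ?K * t^2"
      by (simp add: mult_ac)
    finally show ?thesis .
  qed
  let ?M = "?K + (x $ k)^2 * norm ?A"
  have M0: "0 \<le> ?M" using B0 by simp
  have "norm (\<i> * of_real (x $ k) * ?A - ?B) \<le> ?M * t" if "0 < t" "t \<le> 1" for t
  proof -
    have "of_real t * (\<i> * of_real (x $ k) * ?A - ?B) =
        ((exp (\<i> * of_real (t * x $ k)) - 1) * ?A - of_real t * ?B)
        - (exp (\<i> * of_real (t * x $ k)) - 1 - \<i> * of_real (t * x $ k)) * ?A"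
      by (simp add: algebra_simps)
    also have "norm \<dots> \<le> ?K * t^2 + (t * x $ k)^2 / 2 * norm ?A"
    proof (rule order_trans[OF norm_triangle_ineq4], rule add_mono)
      show "norm ((exp (\<i> * of_real (t * x $ k)) - 1) * ?A - of_real t * ?B) \<le> ?K * t^2"
        using main[of t] that by simp
      have "norm (exp (\<i> * of_real (t * x $ k)) - 1 - \<i> * of_real (t * x $ k)) \<le> (t * x $ k)^2 / 2"
        using exp_taylor_1[of "- (t * x $ k)"] by simp
      from mult_right_mono[OF this, of "norm ?A"]
      show "norm ((exp (\<i> * of_real (t * x $ k)) - 1 - \<i> * of_real (t * x $ k)) * ?A) \<le> (t * x $ k)^2 / 2 * norm ?A"
        unfolding norm_mult by simp
    qed
    also have "\<dots> \<le> ?K * t^2 + (t * x $ k)^2 * norm ?A"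
      by (intro add_left_mono mult_right_mono) auto
    also have "\<dots> = t * (?M * t)" by (simp add: power2_eq_square algebra_simps)
    finally show ?thesis using that by (simp add: norm_mult)
  qed
  then have "norm (\<i> * of_real (x $ k) * ?A - ?B) \<le> 0 + e" if "0 < e" for e
  proof -
    \<comment> \<open>Small enough for \<open>?M * ?t \<le> e\<close>; the added one keeps the
      denominator positive when \<open>?M\<close> is zero.\<close>
    let ?t = "min 1 (e / (?M + 1))"
    have "0 < ?t" "?t \<le> 1" using that M0 by (auto intro: divide_pos_pos)
    then have "norm (\<i> * of_real (x $ k) * ?A - ?B) \<le> ?M * ?t"
      using \<open>\<And>t. \<lbrakk>0 < t; t \<le> 1\<rbrakk> \<Longrightarrow> _ \<le> ?M * t\<close> by blast
    also have "\<dots> \<le> ?M * (e / (?M + 1))" using M0 by (intro mult_left_mono) auto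
    also have "\<dots> \<le> e" using that M0 by (simp add: field_simps)
    finally show ?thesis by simp
  qed
  then have "norm (\<i> * of_real (x $ k) * ?A - ?B) \<le> 0" by (rule field_le_epsilon)
  then show ?thesis by simp
qed

text \<open>Each factor \<open>norm x\<close> is traded for partial derivatives of the symbol,
  through the sum of the \<open>\<bar>x $ k\<bar>\<close> and \<open>fker_partial_deriv\<close>; the
  symbol changes in this process and is generalized in the induction.\<close>

lemma fker_decay:
  assumes "\<zeta> \<in> test_functions"
  shows "\<exists>B. \<forall>x. (1 + norm x) ^ N * norm (fker \<zeta> x) \<le> B"
  using assms
proof (induction N arbitrary: \<zeta>)
  case 0
  then show ?case using fker_bounded by simp
next
  case (Suc N)
  obtain B where B: "\<And>x. (1 + norm x) ^ N * norm (fker \<zeta> x) \<le> B" using Suc by blast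
  have "\<forall>k. \<exists>B. \<forall>x. (1 + norm x) ^ N * norm (fker (partial_deriv k \<zeta>) x) \<le> B"
    using Suc by blast
  then obtain C where C: "\<And>k x. (1 + norm x) ^ N * norm (fker (partial_deriv k \<zeta>) x) \<le> C k" by metis
  have "(1 + norm x) ^ Suc N * norm (fker \<zeta> x) \<le> B + (\<Sum>k\<in>UNIV. C k)" for x
  proof -
    have "(1 + norm x) * norm (fker \<zeta> x) \<le> (1 + (\<Sum>k\<in>UNIV. \<bar>x $ k\<bar>)) * norm (fker \<zeta> x)"
      by (intro mult_right_mono add_left_mono norm_le_l1_cart) simp
    also have "\<dots> = norm (fker \<zeta> x) + (\<Sum>k\<in>UNIV. norm (fker (partial_deriv k \<zeta>) x))"
      by (simp add: fker_partial_deriv[OF Suc.prems] norm_mult distrib_right sum_distrib_right)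
    finally have "(1 + norm x) ^ N * ((1 + norm x) * norm (fker \<zeta> x)) \<le>
        (1 + norm x) ^ N * (norm (fker \<zeta> x) + (\<Sum>k\<in>UNIV. norm (fker (partial_deriv k \<zeta>) x)))"
      by (rule mult_left_mono) simp
    also have "\<dots> \<le> B + (\<Sum>k\<in>UNIV. C k)"
      unfolding distrib_left sum_distrib_left by (intro add_mono B sum_mono C)
    finally show ?thesis by (simp add: mult_ac)
  qed
  then show ?case by blast
qed

lemma fker_schwartz: "\<zeta> \<in> test_functions \<Longrightarrow> fker \<zeta> \<in> schwartz"
  by (rule schwartzI[OF smooth_fker]) (metis iter_partial_fker fker_decay)+

lemma fker_affine:
  fixes \<zeta> :: "real^'n \<Rightarrow> complex"
  assumes "\<zeta> \<in> test_functions" "0 < c"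
  shows "of_real (c ^ CARD('n)) * fker (\<lambda>v. \<zeta> (a + c *\<^sub>R v)) (c *\<^sub>R x) = exp (\<i> * of_real (x \<bullet> a)) * fker \<zeta> x"
proof -
  have [measurable]: "\<zeta> \<in> borel_measurable borel" by (rule test_functionsD[OF assms(1)])
  have "(\<integral>\<xi>. \<zeta> \<xi> * exp (- (\<i> * of_real (x \<bullet> \<xi>))) \<partial>lborel) =
     c ^ CARD('n) *\<^sub>R (\<integral>\<xi>. \<zeta> (a + c *\<^sub>R \<xi>) * exp (- (\<i> * of_real (x \<bullet> (a + c *\<^sub>R \<xi>)))) \<partial>lborel)"
    using assms(2) by (subst lborel_integral_affine(1)[of _ c a]) auto
  also have "(\<integral>\<xi>. \<zeta> (a + c *\<^sub>R \<xi>) * exp (- (\<i> * of_real (x \<bullet> (a + c *\<^sub>R \<xi>)))) \<partial>lborel) =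
     (\<integral>\<xi>. exp (- (\<i> * of_real (x \<bullet> a))) * (\<zeta> (a + c *\<^sub>R \<xi>) * exp (- (\<i> * of_real ((c *\<^sub>R x) \<bullet> \<xi>)))) \<partial>lborel)"
    by (intro Bochner_Integration.integral_cong refl)
       (simp add: inner_add_right exp_add[symmetric] algebra_simps exp_diff exp_minus divide_inverse)
  also have "\<dots> = exp (- (\<i> * of_real (x \<bullet> a))) * (\<integral>\<xi>. \<zeta> (a + c *\<^sub>R \<xi>) * exp (- (\<i> * of_real ((c *\<^sub>R x) \<bullet> \<xi>))) \<partial>lborel)"
    by (rule integral_mult_right_zero)
  finally show ?thesis
    by (simp add: fker_def scaleR_conv_of_real exp_minus field_simps)
qed

lemma fker_dilate:
  fixes \<zeta> :: "real^'n \<Rightarrow> complex"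
  assumes "\<zeta> \<in> test_functions"
  shows "fker (dilate j \<zeta>) x = 2 ^ (j * CARD('n)) * fker \<zeta> (2 ^ j *\<^sub>R x)"
  using fker_affine[OF assms, of "1 / 2 ^ j" 0 "2 ^ j *\<^sub>R x"]
  by (simp add: dilate_def[abs_def] power_mult field_simps)

subsection \<open>Fourier inversion\<close>

text \<open>The characteristic function of the standard normal law supplies the value.\<close>

lemma gaussian_1d:
  "integrable lborel (\<lambda>x. of_real (exp (- (x^2) / 2)) * exp (\<i> * of_real (t * x)) :: complex)"
  "(\<integral>x. of_real (exp (- (x^2) / 2)) * exp (\<i> * of_real (t * x)) \<partial>lborel) = of_real (sqrt (2 * pi) * exp (- (t^2) / 2))"
proof -
  let ?f = "\<lambda>x. std_normal_density x *\<^sub>R iexp (t * x)"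
  have eq: "of_real (exp (- (x^2) / 2)) * exp (\<i> * of_real (t * x)) = of_real (sqrt (2 * pi)) * ?f x" for x
    by (simp add: std_normal_density_def scaleR_conv_of_real)
  have "integrable lborel (\<lambda>x. std_normal_density x)" by simp
  then have i: "integrable lborel ?f"
    by (rule Bochner_Integration.integrable_bound) (auto simp: std_normal_density_def)
  then show "integrable lborel (\<lambda>x. of_real (exp (- (x^2) / 2)) * exp (\<i> * of_real (t * x)) :: complex)"
    unfolding eq by (rule integrable_mult_right)
  have "(\<integral>x. ?f x \<partial>lborel) = char std_normal_distribution t"
    unfolding char_def by (subst integral_density) auto
  also have "\<dots> = of_real (exp (- (t^2) / 2))" by (simp add: char_std_normal_distribution)
  finally show "(\<integral>x. of_real (exp (- (x^2) / 2)) * exp (\<i> * of_real (t * x)) \<partial>lborel) = of_real (sqrt (2 * pi) * exp (- (t^2) / 2))"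
    unfolding eq by (subst integral_mult_right_zero) simp
qed

lemma gaussian_fourier:
  fixes y :: "real^'n"
  shows "integrable lborel (\<lambda>w::real^'n. of_real (exp (- ((norm w)^2) / 2)) * exp (\<i> * of_real (y \<bullet> w)) :: complex)"
    and "(\<integral>w. of_real (exp (- ((norm w)^2) / 2)) * exp (\<i> * of_real (y \<bullet> w)) \<partial>lborel) =
      (of_real (sqrt (2 * pi) ^ CARD('n) * exp (- ((norm y)^2) / 2)) :: complex)"
proof -
  let ?f = "\<lambda>b x. of_real (exp (- (x^2) / 2)) * exp (\<i> * of_real ((y \<bullet> b) * x)) :: complex"
  have eq: "(\<Prod>b\<in>Basis. ?f b (w \<bullet> b)) = of_real (exp (- ((norm w)^2) / 2)) * exp (\<i> * of_real (y \<bullet> w))" for w :: "real^'n"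
  proof -
    have "(\<Prod>b\<in>Basis. ?f b (w \<bullet> b)) =
      of_real (exp (\<Sum>b\<in>Basis. - ((w \<bullet> b)^2) / 2)) * exp (\<Sum>b\<in>Basis. \<i> * of_real ((y \<bullet> b) * (w \<bullet> b)))"
      by (simp add: prod.distrib exp_sum)
    also have "(\<Sum>b\<in>Basis. - ((w \<bullet> b)^2) / 2) = - ((norm w)^2) / 2"
      unfolding power2_norm_eq_inner euclidean_inner[of w w]
      by (simp add: sum_negf sum_divide_distrib power2_eq_square)
    also have "(\<Sum>b\<in>Basis. \<i> * of_real ((y \<bullet> b) * (w \<bullet> b))) = \<i> * of_real (y \<bullet> w)"
      unfolding euclidean_inner[of y w] by (simp add: sum_distrib_left)
    finally show ?thesis .
  qed
  show "integrable lborel (\<lambda>w::real^'n. of_real (exp (- ((norm w)^2) / 2)) * exp (\<i> * of_real (y \<bullet> w)) :: complex)"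
    using lborel_integral_prod(1)[of ?f, OF gaussian_1d(1)] unfolding eq .
  have "(\<integral>w. of_real (exp (- ((norm w)^2) / 2)) * exp (\<i> * of_real (y \<bullet> w)) \<partial>lborel) =
      (\<Prod>b\<in>(Basis::(real^'n) set). of_real (sqrt (2 * pi) * exp (- ((y \<bullet> b)^2) / 2)) :: complex)"
    using lborel_integral_prod(2)[of ?f, OF gaussian_1d(1)] unfolding eq gaussian_1d(2) .
  also have "\<dots> = of_real (sqrt (2 * pi) ^ CARD('n) * exp (\<Sum>b\<in>(Basis::(real^'n) set). - ((y \<bullet> b)^2) / 2))"
    by (simp add: prod.distrib exp_sum)
  also have "(\<Sum>b\<in>Basis. - ((y \<bullet> b)^2) / 2) = - ((norm y)^2) / 2"
    unfolding power2_norm_eq_inner euclidean_inner[of y y]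
    by (simp add: sum_negf sum_divide_distrib power2_eq_square)
  finally show "(\<integral>w. of_real (exp (- ((norm w)^2) / 2)) * exp (\<i> * of_real (y \<bullet> w)) \<partial>lborel) =
      (of_real (sqrt (2 * pi) ^ CARD('n) * exp (- ((norm y)^2) / 2)) :: complex)" .
qed

lemma integrable_kernel_prod:
  fixes a :: "'a::euclidean_space \<Rightarrow> complex" and b :: "'b::euclidean_space \<Rightarrow> complex"
  assumes a: "integrable lborel a" and b: "integrable lborel b"
    and k: "(\<lambda>(x,y). k x y) \<in> borel_measurable (borel \<Otimes>\<^sub>M borel)" "\<And>x y. norm (k x y) \<le> 1"
  shows "integrable (lborel \<Otimes>\<^sub>M lborel) (\<lambda>(x, y). a x * b y * k x y)"
proof -
  have [measurable]: "a \<in> borel_measurable borel" "b \<in> borel_measurable borel"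
    using borel_measurable_integrable[OF a] borel_measurable_integrable[OF b] by simp_all
  have [measurable]: "(\<lambda>(x,y). k x y) \<in> borel_measurable (lborel \<Otimes>\<^sub>M lborel)"
    using k(1) by (simp cong: measurable_cong_sets)
  have "integrable (lborel \<Otimes>\<^sub>M lborel) (\<lambda>(x, y). a x * b y)"
  proof (rule lborel_pair.Fubini_integrable)
    show "(\<lambda>(x, y). a x * b y) \<in> borel_measurable (lborel \<Otimes>\<^sub>M lborel)" by measurable
    show "integrable lborel (\<lambda>x. \<integral>y. norm (case (x, y) of (x, y) \<Rightarrow> a x * b y) \<partial>lborel)"
      using a by (simp add: norm_mult)
    show "AE x in lborel. integrable lborel (\<lambda>y. case (x, y) of (x, y) \<Rightarrow> a x * b y)"
      using b by simp
  qed
  then show ?thesis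
  proof (rule Bochner_Integration.integrable_bound)
    show "(\<lambda>(x, y). a x * b y * k x y) \<in> borel_measurable (lborel \<Otimes>\<^sub>M lborel)"
      unfolding split_beta
      by (intro borel_measurable_times measurable_compose[OF measurable_fst] measurable_compose[OF measurable_snd])
         (use k(1) in \<open>simp_all add: split_beta cong: measurable_cong_sets\<close>)
    show "AE x in lborel \<Otimes>\<^sub>M lborel. norm (case x of (x, y) \<Rightarrow> a x * b y * k x y) \<le> norm (case x of (x, y) \<Rightarrow> a x * b y)"
      using k(2) by (intro AE_I2) (auto simp: norm_mult mult_left_le)
  qed
qed

text \<open>A Gaussian factor at scale \<open>\<epsilon> m\<close> makes the double integral
  absolutely convergent. Exchanging the integrals, and using that the Gaussian reproduces itself
  under the Fourier transform, gives Gaussian averages of \<open>\<zeta>\<close> around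
  \<open>\<xi>\<close>, which concentrate as \<open>\<epsilon> m\<close> tends to zero.\<close>

lemma fourier_inversion_fker:
  fixes \<zeta> :: "real^'n \<Rightarrow> complex"
  assumes z: "\<zeta> \<in> test_functions"
  shows "(\<integral>w. fker \<zeta> w * exp (\<i> * of_real (w \<bullet> \<xi>)) \<partial>lborel) = \<zeta> \<xi>"
proof -
  let ?c = "of_real ((2 * pi) powr (- real CARD('n))) :: complex"
  let ?G = "\<lambda>w::real^'n. of_real (exp (- ((norm w)^2) / 2)) :: complex"
  define \<epsilon> where "\<epsilon> m = 1 / real (Suc m)" for m
  have \<epsilon>: "0 < \<epsilon> m" for m by (simp add: \<epsilon>_def)
  have \<epsilon>0: "\<epsilon> \<longlonglongrightarrow> 0" unfolding \<epsilon>_def using LIMSEQ_inverse_real_of_nat by (simp add: divide_inverse)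
  have G: "integrable lborel ?G" using gaussian_fourier(1)[of 0] by simp
  have G1: "(\<integral>w. ?G w \<partial>lborel) = of_real (sqrt (2 * pi) ^ CARD('n))" using gaussian_fourier(2)[of 0] by simp
  have [measurable]: "\<zeta> \<in> borel_measurable borel" by (rule test_functionsD[OF z])
  have [measurable]: "fker \<zeta> \<in> borel_measurable borel"
    by (intro borel_measurable_continuous_onI smooth_imp_continuous smooth_fker z)
  obtain B where B: "0 \<le> B" "\<And>x. norm (\<zeta> x) \<le> B" using test_bounded[OF z] by blast
  let ?I = "\<lambda>m. \<integral>w. fker \<zeta> w * exp (\<i> * of_real (w \<bullet> \<xi>)) * ?G (\<epsilon> m *\<^sub>R w) \<partial>lborel"
  have lim1: "?I \<longlonglongrightarrow> (\<integral>w. fker \<zeta> w * exp (\<i> * of_real (w \<bullet> \<xi>)) * 1 \<partial>lborel)"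
  proof (rule integral_dominated_convergence[where w = "\<lambda>w. norm (fker \<zeta> w)"])
    show "AE w in lborel. (\<lambda>m. fker \<zeta> w * exp (\<i> * of_real (w \<bullet> \<xi>)) * ?G (\<epsilon> m *\<^sub>R w)) \<longlonglongrightarrow> fker \<zeta> w * exp (\<i> * of_real (w \<bullet> \<xi>)) * 1"
    proof (intro AE_I2 tendsto_mult tendsto_const)
      fix w :: "real^'n"
      have "(\<lambda>m. ?G (\<epsilon> m *\<^sub>R w)) \<longlonglongrightarrow> of_real (exp (- ((norm (0 *\<^sub>R w))^2) / 2))"
        by (intro tendsto_intros \<epsilon>0; simp)
      then show "(\<lambda>m. ?G (\<epsilon> m *\<^sub>R w)) \<longlonglongrightarrow> 1" by simp
    qed
    show "integrable lborel (\<lambda>w. norm (fker \<zeta> w))"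
      by (intro integrable_norm schwartz_integrable fker_schwartz z)
    show "AE x in lborel. norm (fker \<zeta> x * exp (\<i> * of_real (x \<bullet> \<xi>)) * ?G (\<epsilon> m *\<^sub>R x)) \<le> norm (fker \<zeta> x)" for m
      by (intro AE_I2) (auto simp: norm_mult intro!: mult_left_le)
  qed measurable
  \<comment> \<open>After rescaling \<open>w\<close> by \<open>1 / \<epsilon> m\<close>, modulation
    and dilation of the kernel become translation and dilation of the symbol, by
    \<open>fker_affine\<close>.\<close>
  have I: "?I m = ?c * of_real (sqrt (2 * pi) ^ CARD('n)) * (\<integral>v. \<zeta> (\<xi> + \<epsilon> m *\<^sub>R v) * ?G v \<partial>lborel)" for m
  proof -
    let ?z = "\<lambda>v. \<zeta> (\<xi> + \<epsilon> m *\<^sub>R v)"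
    have zt: "?z \<in> test_functions" using \<epsilon>[of m] by (intro test_affine_comp z) simp
    have "?I m = \<bar>1 / \<epsilon> m\<bar> ^ CARD('n) *\<^sub>R
        (\<integral>w. fker \<zeta> ((1 / \<epsilon> m) *\<^sub>R w) * exp (\<i> * of_real (((1 / \<epsilon> m) *\<^sub>R w) \<bullet> \<xi>)) * ?G (\<epsilon> m *\<^sub>R ((1 / \<epsilon> m) *\<^sub>R w)) \<partial>lborel)"
      using \<epsilon>[of m] by (subst lborel_integral_affine(1)[of _ "1 / \<epsilon> m" 0]) auto
    also have "\<dots> = (\<integral>w. \<bar>1 / \<epsilon> m\<bar> ^ CARD('n) *\<^sub>R (fker \<zeta> ((1 / \<epsilon> m) *\<^sub>R w) * exp (\<i> * of_real (((1 / \<epsilon> m) *\<^sub>R w) \<bullet> \<xi>)) * ?G (\<epsilon> m *\<^sub>R ((1 / \<epsilon> m) *\<^sub>R w))) \<partial>lborel)"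
      by (rule integral_scaleR_right[symmetric])
    also have "\<dots> = (\<integral>w. fker ?z w * ?G w \<partial>lborel)"
    proof (intro Bochner_Integration.integral_cong refl)
      fix w
      have "of_real (\<epsilon> m ^ CARD('n)) * fker ?z w = exp (\<i> * of_real (((1 / \<epsilon> m) *\<^sub>R w) \<bullet> \<xi>)) * fker \<zeta> ((1 / \<epsilon> m) *\<^sub>R w)"
        using fker_affine[OF z \<epsilon>[of m], of \<xi> "(1 / \<epsilon> m) *\<^sub>R w"] \<epsilon>[of m] by simp
      then have "fker ?z w = of_real (\<bar>1 / \<epsilon> m\<bar> ^ CARD('n)) * (fker \<zeta> ((1 / \<epsilon> m) *\<^sub>R w) * exp (\<i> * of_real (((1 / \<epsilon> m) *\<^sub>R w) \<bullet> \<xi>)))"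
        using \<epsilon>[of m] by (simp add: field_simps)
      then show "\<bar>1 / \<epsilon> m\<bar> ^ CARD('n) *\<^sub>R (fker \<zeta> ((1 / \<epsilon> m) *\<^sub>R w) * exp (\<i> * of_real (((1 / \<epsilon> m) *\<^sub>R w) \<bullet> \<xi>)) * ?G (\<epsilon> m *\<^sub>R ((1 / \<epsilon> m) *\<^sub>R w))) = fker ?z w * ?G w"
        using \<epsilon>[of m] by (simp add: scaleR_conv_of_real[where 'a = complex] mult.assoc)
    qed
    also have "\<dots> = ?c * (\<integral>w. (\<integral>v. ?z v * ?G w * exp (- (\<i> * of_real (w \<bullet> v))) \<partial>lborel) \<partial>lborel)"
      unfolding fker_def integral_mult_right_zero[symmetric] integral_mult_left_zero[symmetric]
      by (intro Bochner_Integration.integral_cong refl) (simp add: mult_ac)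
    also have "(\<integral>w. (\<integral>v. ?z v * ?G w * exp (- (\<i> * of_real (w \<bullet> v))) \<partial>lborel) \<partial>lborel) =
        (\<integral>v. (\<integral>w. ?z v * ?G w * exp (- (\<i> * of_real (w \<bullet> v))) \<partial>lborel) \<partial>lborel)"
      by (rule lborel_pair.Fubini_integral, rule integrable_kernel_prod[OF test_integrable[OF zt] G]) auto
    also have "\<dots> = (\<integral>v. of_real (sqrt (2 * pi) ^ CARD('n)) * (?z v * ?G v) \<partial>lborel)"
    proof (intro Bochner_Integration.integral_cong refl)
      fix v
      have "(\<integral>w. ?z v * ?G w * exp (- (\<i> * of_real (w \<bullet> v))) \<partial>lborel) = (\<integral>w. ?z v * (?G w * exp (\<i> * of_real ((-v) \<bullet> w))) \<partial>lborel)"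
        by (intro Bochner_Integration.integral_cong refl) (simp add: inner_commute mult.assoc)
      also have "\<dots> = ?z v * of_real (sqrt (2 * pi) ^ CARD('n) * exp (- ((norm v)^2) / 2))"
        unfolding integral_mult_right_zero gaussian_fourier(2) by simp
      finally show "(\<integral>w. ?z v * ?G w * exp (- (\<i> * of_real (w \<bullet> v))) \<partial>lborel) = of_real (sqrt (2 * pi) ^ CARD('n)) * (?z v * ?G v)"
        by simp
    qed
    finally show ?thesis by (simp only: integral_mult_right_zero mult.assoc)
  qed
  have "(\<lambda>m. \<integral>v. \<zeta> (\<xi> + \<epsilon> m *\<^sub>R v) * ?G v \<partial>lborel) \<longlonglongrightarrow> (\<integral>v. \<zeta> \<xi> * ?G v \<partial>lborel)"
  proof (rule integral_dominated_convergence[where w = "\<lambda>v. B * norm (?G v)"])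
    show "AE v in lborel. (\<lambda>m. \<zeta> (\<xi> + \<epsilon> m *\<^sub>R v) * ?G v) \<longlonglongrightarrow> \<zeta> \<xi> * ?G v"
    proof (intro AE_I2 tendsto_mult tendsto_const)
      fix v :: "real^'n"
      have "(\<lambda>m. \<xi> + \<epsilon> m *\<^sub>R v) \<longlonglongrightarrow> \<xi> + 0 *\<^sub>R v" by (intro tendsto_intros \<epsilon>0)
      then have "(\<lambda>m. \<xi> + \<epsilon> m *\<^sub>R v) \<longlonglongrightarrow> \<xi>" by simp
      then show "(\<lambda>m. \<zeta> (\<xi> + \<epsilon> m *\<^sub>R v)) \<longlonglongrightarrow> \<zeta> \<xi>"
        using continuous_on_tendsto_compose[OF test_functionsD(3)[OF z, of UNIV]] by simp
    qed
    show "AE v in lborel. norm (\<zeta> (\<xi> + \<epsilon> m *\<^sub>R v) * ?G v) \<le> B * norm (?G v)" for m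
      using B by (intro AE_I2) (auto simp: norm_mult intro!: mult_right_mono)
    show "integrable lborel (\<lambda>v. B * norm (?G v))" by (intro integrable_mult_right integrable_norm G)
  qed measurable
  then have "?I \<longlonglongrightarrow> ?c * of_real (sqrt (2 * pi) ^ CARD('n)) * (\<integral>v. \<zeta> \<xi> * ?G v \<partial>lborel)"
    unfolding I by (rule tendsto_mult_left)
  \<comment> \<open>One factor \<open>sqrt (2 * pi) ^ CARD('n)\<close> comes from the transform of
    the Gaussian, the other from its mass; together they cancel \<open>?c\<close>.\<close>
  also have "?c * of_real (sqrt (2 * pi) ^ CARD('n)) * (\<integral>v. \<zeta> \<xi> * ?G v \<partial>lborel) = \<zeta> \<xi>"
  proof -
    have "sqrt (2 * pi) ^ CARD('n) * sqrt (2 * pi) ^ CARD('n) = (2 * pi) ^ CARD('n)"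
      unfolding power_mult_distrib[symmetric] by simp
    moreover have "(2 * pi) powr (- real CARD('n)) = inverse ((2 * pi) ^ CARD('n))"
      using pi_gt_zero by (simp only: powr_minus powr_realpow mult_pos_pos zero_less_numeral)
    ultimately have "(2 * pi) powr (- real CARD('n)) * sqrt (2 * pi) ^ CARD('n) * sqrt (2 * pi) ^ CARD('n) = 1"
      by (simp only: mult.assoc) (rule left_inverse, simp)
    then have "?c * of_real (sqrt (2 * pi) ^ CARD('n)) * of_real (sqrt (2 * pi) ^ CARD('n)) = 1"
      unfolding of_real_mult[symmetric] by (simp only: of_real_1)
    then show ?thesis unfolding integral_mult_right_zero G1 by (simp add: mult_ac)
  qed
  finally show ?thesis using LIMSEQ_unique lim1 by simp blast
qed

text \<open>Writing out the kernel of \<open>\<mu>\<close> and exchanging the integrals leaves the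
  inverse transform of \<open>fker \<tau>\<close>, which the inversion formula evaluates.\<close>

lemma fker_mult:
  fixes \<mu> \<tau> :: "real^'n \<Rightarrow> complex"
  assumes m: "\<mu> \<in> test_functions" and t: "\<tau> \<in> test_functions"
  shows "fker (\<lambda>\<xi>. \<mu> \<xi> * \<tau> \<xi>) z = (\<integral>w. fker \<mu> (z - w) * fker \<tau> w \<partial>lborel)"
proof -
  let ?c = "of_real ((2 * pi) powr (- real CARD('n))) :: complex"
  have "(\<integral>w. fker \<mu> (z - w) * fker \<tau> w \<partial>lborel) =
      ?c * (\<integral>w. (\<integral>\<eta>. \<mu> \<eta> * fker \<tau> w * exp (- (\<i> * of_real ((z - w) \<bullet> \<eta>))) \<partial>lborel) \<partial>lborel)"
    unfolding fker_def[of \<mu>] integral_mult_right_zero[symmetric] integral_mult_left_zero[symmetric]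
    by (intro Bochner_Integration.integral_cong refl) (simp add: mult_ac)
  also have "(\<integral>w. (\<integral>\<eta>. \<mu> \<eta> * fker \<tau> w * exp (- (\<i> * of_real ((z - w) \<bullet> \<eta>))) \<partial>lborel) \<partial>lborel) =
      (\<integral>\<eta>. (\<integral>w. \<mu> \<eta> * fker \<tau> w * exp (- (\<i> * of_real ((z - w) \<bullet> \<eta>))) \<partial>lborel) \<partial>lborel)"
    by (rule lborel_pair.Fubini_integral,
        rule integrable_kernel_prod[OF test_integrable[OF m] schwartz_integrable[OF fker_schwartz[OF t]]]) auto
  also have "\<dots> = (\<integral>\<eta>. \<mu> \<eta> * \<tau> \<eta> * exp (- (\<i> * of_real (z \<bullet> \<eta>))) \<partial>lborel)"
  proof (intro Bochner_Integration.integral_cong refl)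
    fix \<eta>
    have "(\<integral>w. \<mu> \<eta> * fker \<tau> w * exp (- (\<i> * of_real ((z - w) \<bullet> \<eta>))) \<partial>lborel) =
      (\<integral>w. \<mu> \<eta> * exp (- (\<i> * of_real (z \<bullet> \<eta>))) * (fker \<tau> w * exp (\<i> * of_real (w \<bullet> \<eta>))) \<partial>lborel)"
      by (intro Bochner_Integration.integral_cong refl)
         (simp add: inner_diff_left exp_diff exp_minus field_simps)
    also have "\<dots> = \<mu> \<eta> * exp (- (\<i> * of_real (z \<bullet> \<eta>))) * \<tau> \<eta>"
      unfolding integral_mult_right_zero fourier_inversion_fker[OF t] ..
    finally show "(\<integral>w. \<mu> \<eta> * fker \<tau> w * exp (- (\<i> * of_real ((z - w) \<bullet> \<eta>))) \<partial>lborel) = \<mu> \<eta> * \<tau> \<eta> * exp (- (\<i> * of_real (z \<bullet> \<eta>)))"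
      by simp
  qed
  finally show ?thesis by (simp add: fker_def)
qed

subsection \<open>Tempered distributions\<close>

lemma schwartz_diff:
  assumes f: "f \<in> schwartz" and g: "g \<in> schwartz"
  shows "(\<lambda>x. f x - g x) \<in> schwartz"
proof (rule schwartzI)
  show "smooth (\<lambda>x. f x - g x)" using schwartz_smooth[OF f] schwartz_smooth[OF g] by auto
  fix N ks
  obtain A B where A: "\<And>x. (1 + norm x) ^ N * norm (iter_partial ks f x) \<le> A"
    and B: "\<And>x. (1 + norm x) ^ N * norm (iter_partial ks g x) \<le> B"
    using schwartz_bound[OF f] schwartz_bound[OF g] by metis
  have "(1 + norm x) ^ N * norm (iter_partial ks (\<lambda>x. f x - g x) x) \<le> A + B" for x
  proof -
    have "(1 + norm x) ^ N * norm (iter_partial ks (\<lambda>x. f x - g x) x) \<le>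
      (1 + norm x) ^ N * (norm (iter_partial ks f x) + norm (iter_partial ks g x))"
      unfolding iter_partial_diff[OF schwartz_smooth[OF f] schwartz_smooth[OF g]]
      by (intro mult_left_mono norm_triangle_ineq4) simp
    also have "\<dots> \<le> A + B" unfolding distrib_left by (intro add_mono A B)
    finally show ?thesis .
  qed
  then show "\<exists>B. \<forall>x. (1 + norm x) ^ N * norm (iter_partial ks (\<lambda>x. f x - g x) x) \<le> B" by blast
qed

lemma schwartz_cmult:
  assumes f: "f \<in> schwartz"
  shows "(\<lambda>x. c * f x) \<in> schwartz"
proof (rule schwartzI)
  show "smooth (\<lambda>x. c * f x)" using schwartz_smooth[OF f] by (intro smooth_mult smooth_const)
  fix N ks
  obtain A where A: "\<And>x. (1 + norm x) ^ N * norm (iter_partial ks f x) \<le> A"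
    using schwartz_bound[OF f] by metis
  have "(1 + norm x) ^ N * norm (iter_partial ks (\<lambda>x. c * f x) x) \<le> norm c * A" for x
    using mult_left_mono[OF A[of x], of "norm c"]
    by (simp add: iter_partial_cmult[OF schwartz_smooth[OF f]] norm_mult mult_ac)
  then show "\<exists>B. \<forall>x. (1 + norm x) ^ N * norm (iter_partial ks (\<lambda>x. c * f x) x) \<le> B" by blast
qed

lemma schwartz_add:
  "f \<in> schwartz \<Longrightarrow> g \<in> schwartz \<Longrightarrow> (\<lambda>x. f x + g x) \<in> schwartz"
  using schwartz_diff[of f "\<lambda>x. (-1) * g x"] schwartz_cmult[of g "-1"] by simp

lemma schwartz_zero: "(\<lambda>_. 0) \<in> schwartz"
  by (rule test_imp_schwartz[OF test_zero])

lemma schwartz_sum: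
  "(\<And>i. i \<in> I \<Longrightarrow> f i \<in> schwartz) \<Longrightarrow> (\<lambda>x. \<Sum>i\<in>I. f i x) \<in> schwartz"
proof (induction I rule: infinite_finite_induct)
  case (insert i I)
  then show ?case using schwartz_add[of "f i" "\<lambda>x. \<Sum>i\<in>I. f i x"] by simp
qed (auto simp: schwartz_zero)

lemma schwartz_iter_partial: "f \<in> schwartz \<Longrightarrow> iter_partial ks f \<in> schwartz"
  using schwartz_smooth[of f] schwartz_bound[of f]
  by (intro schwartzI) (auto simp: iter_partial_append[symmetric], metis)

lemma schwartz_translation:
  assumes f: "f \<in> schwartz"
  shows "(\<lambda>x. f (x - y)) \<in> schwartz"
proof (rule schwartzI)
  show "smooth (\<lambda>x. f (x - y))" using schwartz_smooth[OF f] by (rule smooth_translation)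
  fix N ks
  obtain A where A: "\<And>x. (1 + norm x) ^ N * norm (iter_partial ks f x) \<le> A"
    using schwartz_bound[OF f] by metis
  have "(1 + norm x) ^ N * norm (iter_partial ks (\<lambda>x. f (x - y)) x) \<le> (1 + norm y) ^ N * A" for x
  proof -
    have "(1 + norm x) ^ N * norm (iter_partial ks (\<lambda>x. f (x - y)) x)
        \<le> ((1 + norm y) ^ N * (1 + norm (x - y)) ^ N) * norm (iter_partial ks f (x - y))"
      unfolding iter_partial_translation[OF schwartz_smooth[OF f]]
      by (intro mult_right_mono weight_peetre) simp
    also have "\<dots> \<le> (1 + norm y) ^ N * A"
      unfolding mult.assoc by (intro mult_left_mono A) simp
    finally show ?thesis .
  qed
  then show "\<exists>B. \<forall>x. (1 + norm x) ^ N * norm (iter_partial ks (\<lambda>x. f (x - y)) x) \<le> B" by blast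
qed

lemma schwartz_seminorm_upper:
  "f \<in> schwartz \<Longrightarrow> (1 + norm x) ^ N * norm (iter_partial ks f x) \<le> schwartz_seminorm N ks f"
  unfolding schwartz_seminorm_def by (rule cSUP_upper) (auto simp: schwartz_def)

lemma schwartz_seminorm_least:
  "(\<And>x. (1 + norm x) ^ N * norm (iter_partial ks f x) \<le> B) \<Longrightarrow> schwartz_seminorm N ks f \<le> B"
  unfolding schwartz_seminorm_def by (rule cSUP_least) auto

text \<open>The generating sets are balls of single seminorms around arbitrary centres. The triangle
  inequality recentres such a ball at \<open>f\<close>, and finite intersections accumulate the
  index set \<open>F\<close>.\<close>

lemma openin_schwartz_ball:
  assumes "openin schwartz_topology U" "f \<in> U"
  shows "\<exists>F e. finite F \<and> 0 < e \<and>
    (\<forall>g\<in>schwartz. (\<forall>(N, ks)\<in>F. schwartz_seminorm N ks (\<lambda>x. g x - f x) < e) \<longrightarrow> g \<in> U)"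
  using assms unfolding schwartz_topology_def openin_topology_generated_by_iff
proof (induction U arbitrary: f rule: generate_topology_on.induct)
  case (Int a b)
  obtain F e where F: "finite F" "0 < e"
    "\<And>g. g \<in> schwartz \<Longrightarrow> (\<forall>(N, ks)\<in>F. schwartz_seminorm N ks (\<lambda>x. g x - f x) < e) \<Longrightarrow> g \<in> a"
    using Int.IH(1)[of f] Int.prems by blast
  obtain G d where G: "finite G" "0 < d"
    "\<And>g. g \<in> schwartz \<Longrightarrow> (\<forall>(N, ks)\<in>G. schwartz_seminorm N ks (\<lambda>x. g x - f x) < d) \<Longrightarrow> g \<in> b"
    using Int.IH(2)[of f] Int.prems by blast
  show ?case
  proof (intro exI[of _ "F \<union> G"] exI[of _ "min e d"] conjI ballI impI)
    fix g assume g: "g \<in> schwartz"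
      and b: "\<forall>(N, ks)\<in>F \<union> G. schwartz_seminorm N ks (\<lambda>x. g x - f x) < min e d"
    have "g \<in> a" by (rule F(3)[OF g]) (use b in fastforce)
    moreover have "g \<in> b" by (rule G(3)[OF g]) (use b in fastforce)
    ultimately show "g \<in> a \<inter> b" by simp
  qed (use F G in auto)
next
  case (UN K)
  then obtain k where k: "k \<in> K" "f \<in> k" by blast
  from UN.IH[OF k] obtain F e where "finite F" "0 < e"
    "\<forall>g\<in>schwartz. (\<forall>(N, ks)\<in>F. schwartz_seminorm N ks (\<lambda>x. g x - f x) < e) \<longrightarrow> g \<in> k" by blast
  with k(1) show ?case by (intro exI[of _ F] exI[of _ e]) auto
next
  case (Basis s)
  then obtain f0 N ks e where s: "s = {g \<in> schwartz. schwartz_seminorm N ks (\<lambda>x. g x - f0 x) < e}"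
    and f0: "f0 \<in> schwartz" by blast
  have f: "f \<in> schwartz" "schwartz_seminorm N ks (\<lambda>x. f x - f0 x) < e" using Basis.prems s by auto
  let ?d = "e - schwartz_seminorm N ks (\<lambda>x. f x - f0 x)"
  have "g \<in> s" if g: "g \<in> schwartz" and b: "schwartz_seminorm N ks (\<lambda>x. g x - f x) < ?d" for g
  proof -
    have "schwartz_seminorm N ks (\<lambda>x. g x - f0 x) \<le>
        schwartz_seminorm N ks (\<lambda>x. g x - f x) + schwartz_seminorm N ks (\<lambda>x. f x - f0 x)"
    proof (rule schwartz_seminorm_least)
      fix x
      have "iter_partial ks (\<lambda>x. g x - f0 x) x =
          iter_partial ks (\<lambda>x. g x - f x) x + iter_partial ks (\<lambda>x. f x - f0 x) x"
        using f g f0 by (simp add: iter_partial_diff schwartz_smooth)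
      then have "(1 + norm x) ^ N * norm (iter_partial ks (\<lambda>x. g x - f0 x) x) \<le>
          (1 + norm x) ^ N * (norm (iter_partial ks (\<lambda>x. g x - f x) x) + norm (iter_partial ks (\<lambda>x. f x - f0 x) x))"
        by (simp add: mult_left_mono norm_triangle_ineq)
      also have "\<dots> \<le> schwartz_seminorm N ks (\<lambda>x. g x - f x) + schwartz_seminorm N ks (\<lambda>x. f x - f0 x)"
        unfolding distrib_left
        by (intro add_mono schwartz_seminorm_upper schwartz_diff f g f0)
      finally show "(1 + norm x) ^ N * norm (iter_partial ks (\<lambda>x. g x - f0 x) x) \<le>
        schwartz_seminorm N ks (\<lambda>x. g x - f x) + schwartz_seminorm N ks (\<lambda>x. f x - f0 x)" .
    qed
    then show ?thesis using b g s by auto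
  qed
  then show ?case using f(2) by (intro exI[of _ "{(N, ks)}"] exI[of _ ?d]) auto
qed simp

lemma topspace_schwartz: "topspace schwartz_topology = schwartz"
proof -
  have "f \<in> topspace schwartz_topology" if f: "f \<in> schwartz" for f :: "real^'n \<Rightarrow> complex"
  proof -
    have "schwartz_seminorm 0 [] (\<lambda>x. f x - f x) \<le> 0"
      by (rule schwartz_seminorm_least) simp
    then have "f \<in> {g \<in> schwartz. schwartz_seminorm 0 [] (\<lambda>x. g x - f x) < 1}" using f by auto
    then show ?thesis unfolding schwartz_topology_def topology_generated_by_topspace using f
      by (blast intro: zero_less_one)
  qed
  then show ?thesis unfolding schwartz_topology_def topology_generated_by_topspace by blast
qed

section \<open>Linearity and finite order of tempered distributions\<close>

lemma tempered_cmult: "tempered_distribution u \<Longrightarrow> f \<in> schwartz \<Longrightarrow> u (\<lambda>x. c * f x) = c * u f"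
  by (simp add: tempered_distribution_def)

lemma tempered_add:
  "tempered_distribution u \<Longrightarrow> f \<in> schwartz \<Longrightarrow> g \<in> schwartz \<Longrightarrow> u (\<lambda>x. f x + g x) = u f + u g"
  by (simp add: tempered_distribution_def)

lemma tempered_zero: "tempered_distribution u \<Longrightarrow> u (\<lambda>_. 0) = 0"
  using tempered_cmult[OF _ schwartz_zero, of u 0] by simp

lemma tempered_diff:
  "tempered_distribution u \<Longrightarrow> f \<in> schwartz \<Longrightarrow> g \<in> schwartz \<Longrightarrow> u (\<lambda>x. f x - g x) = u f - u g"
  using tempered_add[of u f "\<lambda>x. (-1) * g x"] tempered_cmult[of u g "-1"] schwartz_cmult[of g "-1"] by simp

lemma tempered_sum:
  "tempered_distribution u \<Longrightarrow> (\<And>i. i \<in> I \<Longrightarrow> f i \<in> schwartz) \<Longrightarrow>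
    u (\<lambda>x. \<Sum>i\<in>I. f i x) = (\<Sum>i\<in>I. u (f i))"
proof (induction I rule: infinite_finite_induct)
  case (insert i I)
  then show ?case using tempered_add[of u "f i" "\<lambda>x. \<Sum>i\<in>I. f i x"] by (simp add: schwartz_sum)
qed (auto simp: tempered_zero)

text \<open>Continuity at zero and homogeneity give finite order. A common upper bound
  \<open>B\<close> takes the place of the seminorms, so that later uses need pointwise estimates
  only.\<close>

lemma tempered_bound:
  fixes u :: "(real^'n \<Rightarrow> complex) \<Rightarrow> complex"
  assumes u: "tempered_distribution u"
  shows "\<exists>C N K. 0 \<le> C \<and> finite K \<and> (\<forall>f B. f \<in> schwartz \<longrightarrow> 0 \<le> B \<longrightarrow>
    (\<forall>ks\<in>K. \<forall>x. (1 + norm x) ^ N * norm (iter_partial ks f x) \<le> B) \<longrightarrow> norm (u f) \<le> C * B)"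
proof -
  have "openin schwartz_topology {f \<in> topspace schwartz_topology. u f \<in> ball 0 1}"
    using u by (intro openin_continuous_map_preimage[of _ euclidean]) (auto simp: tempered_distribution_def)
  then have op: "openin schwartz_topology {f \<in> schwartz. norm (u f) < 1}"
    by (simp add: topspace_schwartz)
  have z: "(\<lambda>_. 0) \<in> {f \<in> schwartz. norm (u f) < 1}"
    using schwartz_zero tempered_zero[OF u] by simp
  obtain F e where F: "finite F" "0 < e"
    "\<And>g. g \<in> schwartz \<Longrightarrow> (\<forall>(N, ks)\<in>F. schwartz_seminorm N ks g < e) \<Longrightarrow> norm (u g) < 1"
    using openin_schwartz_ball[OF op z] by auto
  \<comment> \<open>The largest weight exponent serves for all seminorms in \<open>F\<close>, since
    \<open>1 + norm x\<close> is at least one.\<close>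
  define N where "N = Max (insert 0 (fst ` F))"
  have N: "M \<le> N" if "(M, ks) \<in> F" for M ks
    unfolding N_def using F(1) that by (intro Max_ge) force+
  have main: "norm (u f) \<le> 2 / e * B"
    if f: "f \<in> schwartz" and B: "0 < B"
      and b: "\<And>ks x. ks \<in> snd ` F \<Longrightarrow> (1 + norm x) ^ N * norm (iter_partial ks f x) \<le> B" for f B
  proof -
    let ?c = "of_real (e / (2 * B)) :: complex"
    have "norm (u (\<lambda>x. ?c * f x)) < 1"
    proof (rule F(3)[OF schwartz_cmult[OF f]], safe)
      fix M ks assume i: "(M, ks) \<in> F"
      have "schwartz_seminorm M ks (\<lambda>x. ?c * f x) \<le> e / 2"
      proof (rule schwartz_seminorm_least)
        fix x
        have "(1 + norm x) ^ M * norm (iter_partial ks f x) \<le> (1 + norm x) ^ N * norm (iter_partial ks f x)"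
          by (intro mult_right_mono power_increasing N[OF i]) auto
        also have "\<dots> \<le> B" by (rule b) (use i in force)
        finally have "e / (2 * B) * ((1 + norm x) ^ M * norm (iter_partial ks f x)) \<le> e / (2 * B) * B"
          using F(2) B by (intro mult_left_mono) auto
        then show "(1 + norm x) ^ M * norm (iter_partial ks (\<lambda>x. ?c * f x) x) \<le> e / 2"
          unfolding iter_partial_cmult[OF schwartz_smooth[OF f]] norm_mult norm_of_real
          using F(2) B by (simp add: mult_ac)
      qed
      then show "schwartz_seminorm M ks (\<lambda>x. ?c * f x) < e" using F(2) by simp
    qed
    then have "e / (2 * B) * norm (u f) < 1"
      using F(2) B unfolding tempered_cmult[OF u f] by (simp add: norm_mult norm_divide)
    then show ?thesis using F(2) B by (simp add: field_simps)
  qed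
  show ?thesis
  proof (intro exI[of _ "2 / e"] exI[of _ N] exI[of _ "snd ` F"] conjI allI impI)
    fix f B assume f: "f \<in> schwartz" and B: "0 \<le> B"
      and b: "\<forall>ks\<in>snd ` F. \<forall>x. (1 + norm x) ^ N * norm (iter_partial ks f x) \<le> B"
    show "norm (u f) \<le> 2 / e * B"
    proof (rule field_le_epsilon)
      fix d :: real assume d: "0 < d"
      \<comment> \<open>The scaling in \<open>main\<close> divides by the bound, so a possibly
        vanishing \<open>B\<close> is enlarged first; the excess amounts to
        \<open>d\<close>.\<close>
      have "norm (u f) \<le> 2 / e * (B + d * e / 2)"
        using B d F(2) by (intro main[OF f]) (auto intro: add_nonneg_pos order_trans[OF b[rule_format]])
      also have "\<dots> = 2 / e * B + d" using F(2) by (simp add: field_simps)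
      finally show "norm (u f) \<le> 2 / e * B + d" .
    qed
  qed (use F in auto)
qed

subsection \<open>Convolutions of Schwartz functions\<close>

text \<open>Isolates what is required of the function integrated against translates: its polynomial
  moments absorb the growth of a tempered distribution along them.\<close>

definition rapid :: "(real^'n \<Rightarrow> complex) \<Rightarrow> bool" where
  "rapid g \<longleftrightarrow> g \<in> borel_measurable borel \<and> (\<forall>N. integrable lborel (\<lambda>y. (1 + norm y) ^ N * norm (g y)))"

lemma rapidD:
  assumes "rapid g"
  shows "g \<in> borel_measurable borel" "integrable lborel (\<lambda>y. (1 + norm y) ^ N * norm (g y))" "integrable lborel g"
proof -
  show m: "g \<in> borel_measurable borel" and i: "integrable lborel (\<lambda>y. (1 + norm y) ^ N * norm (g y))" for N
    using assms by (auto simp: rapid_def)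
  show "integrable lborel g"
    by (rule Bochner_Integration.integrable_bound[OF i[of 0]]) (use m in auto)
qed

lemma schwartz_rapid: "g \<in> schwartz \<Longrightarrow> rapid g"
  unfolding rapid_def
  by (auto intro: schwartz_weight_integrable borel_measurable_continuous_onI smooth_imp_continuous schwartz_smooth)

lemma schwartz_bounded: "f \<in> schwartz \<Longrightarrow> \<exists>B. \<forall>x. norm (f x) \<le> B"
  using schwartz_bound[of f 0 "[]"] by auto

lemma rapid_mult_bounded:
  assumes "rapid g" "q \<in> borel_measurable borel" "\<And>y. norm (q y) \<le> B * (1 + norm y) ^ N"
  shows "integrable lborel (\<lambda>y. g y * q y)"
proof (rule Bochner_Integration.integrable_bound)
  show "integrable lborel (\<lambda>y. B * ((1 + norm y) ^ N * norm (g y)))"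
    by (intro integrable_mult_right rapidD assms)
  show "(\<lambda>y. g y * q y) \<in> borel_measurable lborel" using rapidD(1)[OF assms(1)] assms(2) by simp
  show "AE y in lborel. norm (g y * q y) \<le> norm (B * ((1 + norm y) ^ N * norm (g y)))"
  proof (rule AE_I2)
    fix y
    have "norm (g y * q y) \<le> (B * (1 + norm y) ^ N) * norm (g y)"
      using mult_right_mono[OF assms(3)[of y], of "norm (g y)"] by (simp add: norm_mult mult.commute)
    also have "\<dots> \<le> norm (B * ((1 + norm y) ^ N * norm (g y)))" by (simp add: mult.assoc)
    finally show "norm (g y * q y) \<le> norm (B * ((1 + norm y) ^ N * norm (g y)))" .
  qed
qed

lemma conv_integrable:
  assumes g: "rapid g" and k: "k \<in> schwartz"
  shows "integrable lborel (\<lambda>y. g y * k (x - y))"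
proof -
  obtain B where "\<And>x. norm (k x) \<le> B" using schwartz_bounded[OF k] by blast
  moreover have [measurable]: "k \<in> borel_measurable borel" using schwartz_rapid[OF k] rapidD by blast
  ultimately show ?thesis by (intro rapid_mult_bounded[OF g, of _ B 0]) auto
qed

lemma schwartz_partial: "f \<in> schwartz \<Longrightarrow> partial_deriv k f \<in> schwartz"
  using schwartz_iter_partial[of f "[k]"] by simp

lemma finite_bound:
  fixes B :: "'i::finite \<Rightarrow> real"
  assumes "\<And>i x. a i x \<le> B i"
  shows "a i x \<le> (\<Sum>i\<in>UNIV. \<bar>B i\<bar>)"
proof -
  have "a i x \<le> \<bar>B i\<bar>" using assms[of i x] by linarith
  also have "\<dots> \<le> (\<Sum>i\<in>UNIV. \<bar>B i\<bar>)" by (rule member_le_sum) auto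
  finally show ?thesis .
qed

text \<open>The derivatives fall on \<open>k\<close>, whose second derivatives are bounded; the
  quadratic remainder is then integrated against \<open>norm (g y)\<close>.\<close>

lemma conv_has_derivative:
  fixes g k :: "real^'n \<Rightarrow> complex"
  assumes g: "rapid g" and k: "k \<in> schwartz"
  shows "((\<lambda>x. \<integral>y. g y * k (x - y) \<partial>lborel) has_derivative
    (\<lambda>v. \<Sum>j\<in>UNIV. of_real (v $ j) * (\<integral>y. g y * partial_deriv j k (x - y) \<partial>lborel))) (at x)"
proof -
  have "\<forall>p::'n \<times> 'n. \<exists>B. \<forall>x. norm (partial_deriv (fst p) (partial_deriv (snd p) k) x) \<le> B"
    using k schwartz_partial schwartz_bounded by blast
  then obtain B where "\<And>p x. norm (partial_deriv (fst p) (partial_deriv (snd p) k) x) \<le> B p" by metis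
  from finite_bound[of "\<lambda>p x. norm (partial_deriv (fst p) (partial_deriv (snd p) k) x)", OF this]
  obtain B where B: "\<And>i j x. norm (partial_deriv i (partial_deriv j k) x) \<le> B" by (metis fst_conv snd_conv)
  let ?D = "\<lambda>v. \<Sum>j\<in>UNIV. of_real (v $ j) * (\<integral>y. g y * partial_deriv j k (x - y) \<partial>lborel)"
  show ?thesis
  proof (rule has_derivativeI_quadratic)
    show "linear ?D"
      by (intro linearI)
         (simp_all add: sum.distrib distrib_right scaleR_sum_right scaleR_conv_of_real[where 'a=complex] sum_distrib_left mult.assoc)
    fix v :: "real^'n"
    have i: "integrable lborel (\<lambda>y. of_real (v $ j) * (g y * partial_deriv j k (x - y)))" for j
      by (intro integrable_mult_right conv_integrable g schwartz_partial k)
    have D: "?D v = (\<integral>y. (\<Sum>j\<in>UNIV. of_real (v $ j) * (g y * partial_deriv j k (x - y))) \<partial>lborel)"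
      unfolding Bochner_Integration.integral_sum[OF i] by simp
    have "(\<integral>y. g y * k (x + v - y) \<partial>lborel) - (\<integral>y. g y * k (x - y) \<partial>lborel) - ?D v =
      (\<integral>y. g y * k (x + v - y) - g y * k (x - y) - (\<Sum>j\<in>UNIV. of_real (v $ j) * (g y * partial_deriv j k (x - y))) \<partial>lborel)"
      unfolding D using conv_integrable[OF g k] i
      by (simp add: Bochner_Integration.integral_diff Bochner_Integration.integrable_sum)
    also have "norm \<dots> \<le> (\<integral>y. norm (g y) * (real CARD('n) ^ 2 * B * norm v ^ 2) \<partial>lborel)"
    proof (rule Bochner_Integration.integral_norm_bound_integral)
      show "integrable lborel (\<lambda>y. norm (g y) * (real CARD('n) ^ 2 * B * norm v ^ 2))"
        by (intro integrable_mult_left integrable_norm rapidD g)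
      show "norm (g y * k (x + v - y) - g y * k (x - y) - (\<Sum>j\<in>UNIV. of_real (v $ j) * (g y * partial_deriv j k (x - y))))
         \<le> norm (g y) * (real CARD('n) ^ 2 * B * norm v ^ 2)" for y
      proof -
        have "g y * k (x + v - y) - g y * k (x - y) - (\<Sum>j\<in>UNIV. of_real (v $ j) * (g y * partial_deriv j k (x - y)))
          = g y * (k ((x - y) + v) - k (x - y) - (\<Sum>j\<in>UNIV. of_real (v $ j) * partial_deriv j k (x - y)))"
          by (simp add: right_diff_distrib sum_distrib_left algebra_simps)
        then show ?thesis
          using mult_left_mono[OF smooth_taylor[OF schwartz_smooth[OF k] B, of "x - y" v], of "norm (g y)"]
          by (simp add: norm_mult)
      qed
    qed (intro Bochner_Integration.integrable_diff Bochner_Integration.integrable_sum conv_integrable g k i)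
    finally show "norm ((\<integral>y. g y * k (x + v - y) \<partial>lborel) - (\<integral>y. g y * k (x - y) \<partial>lborel) - ?D v)
        \<le> (real CARD('n) ^ 2 * B * (\<integral>y. norm (g y) \<partial>lborel)) * norm v ^ 2"
      by (simp add: mult_ac)
  qed
qed

lemma iter_partial_conv:
  assumes g: "rapid g" and k: "k \<in> schwartz"
  shows "iter_partial ks (\<lambda>x. \<integral>y. g y * k (x - y) \<partial>lborel) = (\<lambda>x. \<integral>y. g y * iter_partial ks k (x - y) \<partial>lborel)"
proof (induction ks)
  case (Cons j ks)
  show ?case
  proof
    fix x
    show "iter_partial (j # ks) (\<lambda>x. \<integral>y. g y * k (x - y) \<partial>lborel) x = (\<integral>y. g y * iter_partial (j # ks) k (x - y) \<partial>lborel)"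
      unfolding iter_partial.simps Cons
        partial_derivI[OF conv_has_derivative[OF g schwartz_iter_partial[OF k]]]
      by (simp add: axis_def if_distrib[of complex_of_real] if_distrib[of "\<lambda>a. a * _"] cong: if_cong)
  qed
qed simp

text \<open>Peetre's inequality splits the weight at \<open>x\<close> into one at \<open>y\<close>,
  absorbed by the moments of \<open>g\<close>, and one at \<open>x - y\<close>, absorbed by the
  decay of \<open>k\<close>.\<close>

lemma conv_schwartz:
  assumes g: "rapid g" and k: "k \<in> schwartz"
  shows "(\<lambda>x. \<integral>y. g y * k (x - y) \<partial>lborel) \<in> schwartz"
proof (rule schwartzI)
  show "smooth (\<lambda>x. \<integral>y. g y * k (x - y) \<partial>lborel)"
    unfolding smooth_def iter_partial_conv[OF g k] differentiable_def
    using conv_has_derivative[OF g schwartz_iter_partial[OF k]] by blast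
  fix N ks
  obtain B where B: "0 \<le> B" "\<And>x. (1 + norm x) ^ N * norm (iter_partial ks k x) \<le> B"
    using schwartz_bound[OF k] by blast
  have "(1 + norm x) ^ N * norm (iter_partial ks (\<lambda>x. \<integral>y. g y * k (x - y) \<partial>lborel) x)
      \<le> (\<integral>y. (1 + norm y) ^ N * norm (g y) * B \<partial>lborel)" for x
  proof -
    have "(1 + norm x) ^ N * norm (iter_partial ks (\<lambda>x. \<integral>y. g y * k (x - y) \<partial>lborel) x) =
      norm (\<integral>y. of_real ((1 + norm x) ^ N) * (g y * iter_partial ks k (x - y)) \<partial>lborel)"
      unfolding iter_partial_conv[OF g k] integral_mult_right_zero norm_mult norm_of_real by simp
    also have "\<dots> \<le> (\<integral>y. (1 + norm y) ^ N * norm (g y) * B \<partial>lborel)"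
    proof (rule Bochner_Integration.integral_norm_bound_integral)
      show "integrable lborel (\<lambda>y. of_real ((1 + norm x) ^ N) * (g y * iter_partial ks k (x - y)))"
        by (intro integrable_mult_right conv_integrable g schwartz_iter_partial k)
      show "integrable lborel (\<lambda>y. (1 + norm y) ^ N * norm (g y) * B)"
        by (intro integrable_mult_left rapidD g)
      show "norm (of_real ((1 + norm x) ^ N) * (g y * iter_partial ks k (x - y))) \<le> (1 + norm y) ^ N * norm (g y) * B" for y
      proof -
        have "norm (of_real ((1 + norm x) ^ N) * (g y * iter_partial ks k (x - y))) =
          (1 + norm x) ^ N * (norm (g y) * norm (iter_partial ks k (x - y)))"
          unfolding norm_mult norm_of_real by simp
        also have "\<dots> \<le> ((1 + norm y) ^ N * (1 + norm (x - y)) ^ N) * (norm (g y) * norm (iter_partial ks k (x - y)))"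
          by (intro mult_right_mono weight_peetre) simp
        also have "\<dots> = (1 + norm y) ^ N * norm (g y) * ((1 + norm (x - y)) ^ N * norm (iter_partial ks k (x - y)))"
          by (simp add: mult_ac)
        also have "\<dots> \<le> (1 + norm y) ^ N * norm (g y) * B"
          by (intro mult_left_mono B) simp
        finally show ?thesis .
      qed
    qed
    finally show ?thesis .
  qed
  then show "\<exists>B. \<forall>x. (1 + norm x) ^ N * norm (iter_partial ks (\<lambda>x. \<integral>y. g y * k (x - y) \<partial>lborel) x) \<le> B" by blast
qed

subsection \<open>Tempered distributions and convolutions\<close>

lemma max_weight_nonneg: "0 \<le> (1 + max (norm y) (norm v)) ^ N"
  by (intro zero_le_power add_nonneg_nonneg max.coboundedI1) auto

text \<open>Both points lie in the ball around \<open>x\<close> with radius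
  \<open>max (norm y) (norm v)\<close>, where the weight differs from that at \<open>x\<close> by a
  power of one plus the radius. This gives continuity and polynomial growth of a tempered
  distribution along translates of \<open>k\<close>.\<close>

lemma kernel_lipschitz:
  fixes k :: "real^'n \<Rightarrow> complex"
  assumes k: "k \<in> schwartz"
  shows "\<exists>C. 0 \<le> C \<and> (\<forall>x y v. (1 + norm x) ^ N * norm (iter_partial ks k (x - y) - iter_partial ks k (x - v))
    \<le> C * norm (y - v) * (1 + max (norm y) (norm v)) ^ N)"
proof -
  have "\<forall>j. \<exists>B. \<forall>x. (1 + norm x) ^ N * norm (partial_deriv j (iter_partial ks k) x) \<le> B"
    using schwartz_bound[OF k, of N] by (metis iter_partial.simps(2))
  then obtain B where "\<And>j x. (1 + norm x) ^ N * norm (partial_deriv j (iter_partial ks k) x) \<le> B j" by metis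
  from finite_bound[of "\<lambda>j x. (1 + norm x) ^ N * norm (partial_deriv j (iter_partial ks k) x)", OF this]
  obtain B where B: "\<And>j x. (1 + norm x) ^ N * norm (partial_deriv j (iter_partial ks k) x) \<le> B" by blast
  have B0: "0 \<le> B" using order_trans[OF _ B[of 0 undefined]] by simp
  have pos: "0 < (1 + norm x) ^ N" for x :: "real^'n" by (intro zero_less_power add_pos_nonneg) auto
  have "(1 + norm x) ^ N * norm (iter_partial ks k (x - y) - iter_partial ks k (x - v))
    \<le> (real CARD('n) * B) * norm (y - v) * (1 + max (norm y) (norm v)) ^ N" for x y v
  proof -
    let ?m = "max (norm y) (norm v)"
    let ?B = "B * (1 + ?m) ^ N / (1 + norm x) ^ N"
    have "norm (iter_partial ks k (x - y) - iter_partial ks k (x - v)) \<le> real CARD('n) * ?B * norm ((x - y) - (x - v))"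
    proof (rule smooth_lipschitz_convex[where S = "cball x ?m"])
      show "smooth (iter_partial ks k)" using schwartz_smooth[OF k] by (rule smooth_iter_partial)
      show "norm (partial_deriv j (iter_partial ks k) \<xi>) \<le> ?B" if \<xi>: "\<xi> \<in> cball x ?m" for j \<xi>
      proof -
        have "(1 + norm x) ^ N \<le> (1 + norm (x - \<xi>)) ^ N * (1 + norm (x - (x - \<xi>))) ^ N"
          by (rule weight_peetre)
        also have "\<dots> \<le> (1 + ?m) ^ N * (1 + norm \<xi>) ^ N"
          using \<xi> by (intro mult_mono power_mono max_weight_nonneg) (simp_all add: dist_norm)
        finally have "(1 + norm x) ^ N * norm (partial_deriv j (iter_partial ks k) \<xi>)
            \<le> ((1 + ?m) ^ N * (1 + norm \<xi>) ^ N) * norm (partial_deriv j (iter_partial ks k) \<xi>)"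
          by (rule mult_right_mono) simp
        also have "\<dots> = (1 + ?m) ^ N * ((1 + norm \<xi>) ^ N * norm (partial_deriv j (iter_partial ks k) \<xi>))"
          by (simp add: mult.assoc)
        also have "\<dots> \<le> (1 + ?m) ^ N * B" by (intro mult_left_mono B max_weight_nonneg)
        finally show ?thesis using pos[of x] by (simp add: field_simps)
      qed
    qed (auto simp: dist_norm)
    from mult_left_mono[OF this, of "(1 + norm x) ^ N"] pos[of x]
    have "(1 + norm x) ^ N * norm (iter_partial ks k (x - y) - iter_partial ks k (x - v))
      \<le> (1 + norm x) ^ N * (real CARD('n) * ?B * norm ((x - y) - (x - v)))" by simp
    moreover have "1 + norm x \<noteq> 0" using norm_ge_zero[of x] by linarith
    ultimately show ?thesis by (simp add: norm_minus_commute field_simps)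
  qed
  then show ?thesis using B0 by (intro exI[of _ "real CARD('n) * B"]) auto
qed

lemma kernel_lipschitz_choice:
  fixes k :: "real^'n \<Rightarrow> complex"
  assumes k: "k \<in> schwartz"
  shows "\<exists>C. (\<forall>ks. 0 \<le> C ks) \<and> (\<forall>ks x y v.
    (1 + norm x) ^ N * norm (iter_partial ks k (x - y) - iter_partial ks k (x - v))
      \<le> C ks * norm (y - v) * (1 + max (norm y) (norm v)) ^ N)"
proof -
  let ?P = "\<lambda>ks C. 0 \<le> C \<and> (\<forall>x y v. (1 + norm x) ^ N * norm (iter_partial ks k (x - y) - iter_partial ks k (x - v))
    \<le> C * norm (y - v) * (1 + max (norm y) (norm v)) ^ N)"
  have "\<forall>ks. \<exists>C. ?P ks C" by (rule allI, rule kernel_lipschitz[OF k])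
  from choice[OF this] show ?thesis by (simp only: all_conj_distrib)
qed

text \<open>For \<open>s\<close> close to the identity map this is a Riemann sum, on which a linear
  functional can be evaluated term by term.\<close>

lemma integral_simple_comp:
  fixes g :: "real^'n \<Rightarrow> complex" and s :: "real^'n \<Rightarrow> real^'n" and q :: "real^'n \<Rightarrow> complex"
  assumes g: "integrable lborel g" and s: "simple_function lborel s"
  shows "(\<integral>y. g y * q (s y) \<partial>lborel) = (\<Sum>v\<in>range s. (\<integral>y. g y * indicator (s -` {v}) y \<partial>lborel) * q v)"
    and "integrable lborel (\<lambda>y. g y * q (s y))"
proof -
  have fin: "finite (range s)" using simple_functionD(1)[OF s] by simp
  have m: "s -` {v} \<in> sets borel" for v using simple_functionD(2)[OF s, of "{v}"] by simp
  have eq: "g y * q (s y) = (\<Sum>v\<in>range s. (g y * indicator (s -` {v}) y) * q v)" for y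
  proof -
    have "(\<Sum>v\<in>range s. (g y * indicator (s -` {v}) y) * q v) = (\<Sum>v\<in>range s. if v = s y then g y * q v else 0)"
      by (intro sum.cong) (auto simp: indicator_def)
    then show ?thesis using fin by simp
  qed
  have i: "integrable lborel (\<lambda>y. g y * indicator (s -` {v}) y)" for v
  proof (rule Bochner_Integration.integrable_bound[OF g])
    have "indicator (s -` {v}) \<in> borel_measurable lborel" using m by simp
    then show "(\<lambda>y. g y * indicator (s -` {v}) y) \<in> borel_measurable lborel"
      using borel_measurable_integrable[OF g] by (intro borel_measurable_times)
  qed (auto simp: indicator_def)
  show "integrable lborel (\<lambda>y. g y * q (s y))"
    unfolding eq by (intro Bochner_Integration.integrable_sum integrable_mult_left i)
  show "(\<integral>y. g y * q (s y) \<partial>lborel) = (\<Sum>v\<in>range s. (\<integral>y. g y * indicator (s -` {v}) y \<partial>lborel) * q v)"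
    unfolding eq by (subst Bochner_Integration.integral_sum) (auto intro!: integrable_mult_left i)
qed

lemma tempered_translation_lipschitz:
  fixes u :: "(real^'n \<Rightarrow> complex) \<Rightarrow> complex"
  assumes u: "tempered_distribution u" and k: "k \<in> schwartz"
  shows "\<exists>C N. \<forall>y v. norm (u (\<lambda>x. k (x - y)) - u (\<lambda>x. k (x - v)))
    \<le> C * norm (y - v) * (1 + max (norm y) (norm v)) ^ N"
proof -
  obtain C0 N K where C0: "0 \<le> C0" "finite K" "\<forall>f B. f \<in> schwartz \<longrightarrow> 0 \<le> B \<longrightarrow>
      (\<forall>ks\<in>K. \<forall>x. (1 + norm x) ^ N * norm (iter_partial ks f x) \<le> B) \<longrightarrow> norm (u f) \<le> C0 * B"
    using tempered_bound[OF u] by (elim exE conjE)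
  obtain C where C': "\<forall>ks. 0 \<le> C ks" "\<forall>ks x y v. (1 + norm x) ^ N * norm (iter_partial ks k (x - y) - iter_partial ks k (x - v))
    \<le> C ks * norm (y - v) * (1 + max (norm y) (norm v)) ^ N" 
    using kernel_lipschitz_choice[OF k, of N] by (elim exE conjE)
  note C = C'[rule_format]
  have "norm (u (\<lambda>x. k (x - y)) - u (\<lambda>x. k (x - v)))
     \<le> (C0 * sum C K) * norm (y - v) * (1 + max (norm y) (norm v)) ^ N" for y v
  proof -
    have "norm (u (\<lambda>x. k (x - y) - k (x - v))) \<le> C0 * (sum C K * norm (y - v) * (1 + max (norm y) (norm v)) ^ N)"
    proof (rule C0(3)[rule_format])
      show "(\<lambda>x. k (x - y) - k (x - v)) \<in> schwartz" by (intro schwartz_diff schwartz_translation k)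
      show "0 \<le> sum C K * norm (y - v) * (1 + max (norm y) (norm v)) ^ N"
        by (intro mult_nonneg_nonneg sum_nonneg C max_weight_nonneg) auto
      fix ks x assume ks: "ks \<in> K"
      have "iter_partial ks (\<lambda>x. k (x - y) - k (x - v)) x = iter_partial ks k (x - y) - iter_partial ks k (x - v)"
        using schwartz_smooth[OF k] by (simp add: iter_partial_diff iter_partial_translation smooth_translation)
      then have "(1 + norm x) ^ N * norm (iter_partial ks (\<lambda>x. k (x - y) - k (x - v)) x)
          \<le> C ks * norm (y - v) * (1 + max (norm y) (norm v)) ^ N" using C(2) by simp
      also have "\<dots> \<le> sum C K * norm (y - v) * (1 + max (norm y) (norm v)) ^ N"
        using ks C0(2) C(1) by (intro mult_right_mono member_le_sum max_weight_nonneg) auto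
      finally show "(1 + norm x) ^ N * norm (iter_partial ks (\<lambda>x. k (x - y) - k (x - v)) x)
          \<le> sum C K * norm (y - v) * (1 + max (norm y) (norm v)) ^ N" .
    qed
    then show ?thesis by (simp add: tempered_diff[OF u] schwartz_translation k mult.assoc)
  qed
  then show ?thesis by blast
qed

lemma tempered_translation_continuous:
  fixes u :: "(real^'n \<Rightarrow> complex) \<Rightarrow> complex"
  assumes u: "tempered_distribution u" and k: "k \<in> schwartz"
  shows "continuous_on S (\<lambda>y. u (\<lambda>x. k (x - y)))"
proof -
  let ?h = "\<lambda>y. u (\<lambda>x. k (x - y))"
  obtain C N where C: "\<And>y v. norm (?h y - ?h v) \<le> C * norm (y - v) * (1 + max (norm y) (norm v)) ^ N"
    using tempered_translation_lipschitz[OF u k] by blast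
  have "isCont ?h v" for v
  proof -
    have "((\<lambda>y. ?h y - ?h v) \<longlongrightarrow> 0) (at v)"
    proof (rule tendsto_0_le[where K = 1])
      have "((\<lambda>y. C * norm (y - v) * (1 + max (norm y) (norm v)) ^ N) \<longlongrightarrow> C * norm (v - v) * (1 + max (norm v) (norm v)) ^ N) (at v)"
        by (intro tendsto_intros)
      then show "((\<lambda>y. C * norm (y - v) * (1 + max (norm y) (norm v)) ^ N) \<longlongrightarrow> 0) (at v)" by simp
      show "\<forall>\<^sub>F y in at v. norm (?h y - ?h v) \<le> norm (C * norm (y - v) * (1 + max (norm y) (norm v)) ^ N) * 1"
        unfolding mult_1_right real_norm_def by (intro always_eventually allI order_trans[OF C abs_ge_self])
    qed
    then show ?thesis unfolding isCont_def by (rule LIM_zero_cancel)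
  qed
  then show ?thesis by (simp add: continuous_at_imp_continuous_on)
qed

lemma tempered_translation_growth:
  fixes u :: "(real^'n \<Rightarrow> complex) \<Rightarrow> complex"
  assumes u: "tempered_distribution u" and k: "k \<in> schwartz"
  shows "\<exists>B N. 0 \<le> B \<and> (\<forall>y. norm (u (\<lambda>x. k (x - y))) \<le> B * (1 + norm y) ^ N)"
proof -
  let ?h = "\<lambda>y. u (\<lambda>x. k (x - y))"
  obtain C N where C: "\<And>y v. norm (?h y - ?h v) \<le> C * norm (y - v) * (1 + max (norm y) (norm v)) ^ N"
    using tempered_translation_lipschitz[OF u k] by blast
  have "norm (?h y) \<le> (norm (?h 0) + \<bar>C\<bar>) * (1 + norm y) ^ Suc N" for y
  proof -
    have "norm (?h y - ?h 0) \<le> C * norm y * (1 + norm y) ^ N" using C[of y 0] by simp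
    also have "\<dots> \<le> \<bar>C\<bar> * (1 + norm y) * (1 + norm y) ^ N" by (intro mult_mono) auto
    finally have "norm (?h y) \<le> norm (?h 0) * 1 + \<bar>C\<bar> * (1 + norm y) ^ Suc N"
      using norm_triangle_sub[of "?h y" "?h 0"] by (simp add: mult.assoc)
    also have "\<dots> \<le> norm (?h 0) * (1 + norm y) ^ Suc N + \<bar>C\<bar> * (1 + norm y) ^ Suc N"
      by (intro add_right_mono mult_left_mono one_le_power) auto
    finally show ?thesis by (simp add: distrib_right)
  qed
  then show ?thesis by (intro exI[of _ "norm (?h 0) + \<bar>C\<bar>"] exI[of _ "Suc N"]) auto
qed

lemma weight_double: "norm y \<le> 2 * norm x \<Longrightarrow> (1 + norm y) ^ N \<le> 2 ^ N * (1 + norm x) ^ N"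
  unfolding power_mult_distrib[symmetric] by (intro power_mono) auto

text \<open>Linearity lets \<open>u\<close> pass through finite sums. Riemann sums built from simple
  approximations of the identity map converge to the convolution in the seminorms that control
  \<open>u\<close>, while the values of \<open>u\<close> on them converge by dominated
  convergence.\<close>

lemma tempered_conv:
  fixes u :: "(real^'n \<Rightarrow> complex) \<Rightarrow> complex"
  assumes u: "tempered_distribution u" and k: "k \<in> schwartz" and g: "rapid g"
  shows "integrable lborel (\<lambda>y. g y * u (\<lambda>x. k (x - y)))"
    and "u (\<lambda>x. \<integral>y. g y * k (x - y) \<partial>lborel) = (\<integral>y. g y * u (\<lambda>x. k (x - y)) \<partial>lborel)"
proof -
  let ?h = "\<lambda>y. u (\<lambda>x. k (x - y))"
  let ?F = "\<lambda>x. \<integral>y. g y * k (x - y) \<partial>lborel"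
  have cont: "continuous_on S ?h" for S by (rule tempered_translation_continuous[OF u k])
  have [measurable]: "?h \<in> borel_measurable borel" by (intro borel_measurable_continuous_onI cont)
  have [measurable]: "g \<in> borel_measurable borel" by (rule rapidD[OF g])
  obtain B M where B: "0 \<le> B" "\<And>y. norm (?h y) \<le> B * (1 + norm y) ^ M"
    using tempered_translation_growth[OF u k] by blast
  show "integrable lborel (\<lambda>y. g y * ?h y)" by (rule rapid_mult_bounded[OF g _ B(2)]) simp
  \<comment> \<open>Simple approximations of the identity map; the bound by
    \<open>2 * norm x\<close> keeps the polynomial weights under control.\<close>
  obtain s :: "nat \<Rightarrow> real^'n \<Rightarrow> real^'n" where s: "\<And>i. simple_function lborel (s i)"
    "\<And>x. (\<lambda>i. s i x) \<longlonglongrightarrow> x" "\<And>i x. norm (s i x) \<le> 2 * norm x"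
    using borel_measurable_implies_sequence_metric[of "\<lambda>x. x" lborel "0::real^'n"] by auto
  have [measurable]: "s i \<in> borel_measurable borel" for i
    using borel_measurable_simple_function[OF s(1)] by simp
  define a where "a i v = (\<integral>y. g y * indicator (s i -` {v}) y \<partial>lborel)" for i v
  define T where "T i x = (\<Sum>v\<in>range (s i). a i v * k (x - v))" for i x
  have kt: "(\<lambda>x. k (x - v)) \<in> schwartz" for v by (rule schwartz_translation[OF k])
  have T: "T i \<in> schwartz" for i
    unfolding T_def[abs_def] by (intro schwartz_sum schwartz_cmult kt)
  have uT: "u (T i) = (\<integral>y. g y * ?h (s i y) \<partial>lborel)" for i
  proof -
    have "u (T i) = (\<Sum>v\<in>range (s i). a i v * ?h v)"
      unfolding T_def[abs_def] by (simp add: tempered_sum[OF u] tempered_cmult[OF u] schwartz_cmult kt)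
    then show ?thesis using integral_simple_comp(1)[OF rapidD(3)[OF g] s(1)[of i], of ?h] by (simp add: a_def)
  qed
  have pT: "iter_partial ks (T i) x = (\<integral>y. g y * iter_partial ks k (x - s i y) \<partial>lborel)" for i ks x
  proof -
    have "iter_partial ks (\<lambda>x. \<Sum>v\<in>I. a i v * k (x - v)) = (\<lambda>x. \<Sum>v\<in>I. a i v * iter_partial ks k (x - v))" if "finite I" for I
      using that
    proof induction
      case empty
      show ?case using iter_partial_cmult[OF smooth_const[of 0], of ks 0] by simp
    next
      case (insert v I)
      have "smooth (\<lambda>x. \<Sum>v\<in>I. a i v * k (x - v))" "smooth (\<lambda>x. k (x - v))" "smooth (\<lambda>x. a i v * k (x - v))"
        by (intro schwartz_smooth schwartz_sum schwartz_cmult kt)+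
      then show ?case using insert
        by (simp add: iter_partial_add iter_partial_cmult iter_partial_translation schwartz_smooth k)
    qed
    from this[of "range (s i)"] simple_functionD(1)[OF s(1)[of i]]
    show ?thesis unfolding T_def[abs_def] integral_simple_comp(1)[OF rapidD(3)[OF g] s(1)[of i], of "\<lambda>v. iter_partial ks k (x - v)"]
      by (simp add: a_def)
  qed
  obtain C0 N K where C0: "0 \<le> C0" "finite K" "\<forall>f B. f \<in> schwartz \<longrightarrow> 0 \<le> B \<longrightarrow>
      (\<forall>ks\<in>K. \<forall>x. (1 + norm x) ^ N * norm (iter_partial ks f x) \<le> B) \<longrightarrow> norm (u f) \<le> C0 * B"
    using tempered_bound[OF u] by (elim exE conjE)
  obtain C where C': "\<forall>ks. 0 \<le> C ks" "\<forall>ks x y v. (1 + norm x) ^ N * norm (iter_partial ks k (x - y) - iter_partial ks k (x - v))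
    \<le> C ks * norm (y - v) * (1 + max (norm y) (norm v)) ^ N" 
    using kernel_lipschitz_choice[OF k, of N] by (elim exE conjE)
  note C = C'[rule_format]
  define C1 where "C1 = sum C K"
  have C1: "C ks \<le> C1" if "ks \<in> K" for ks
    unfolding C1_def using that C0(2) C(1) by (intro member_le_sum) auto
  have C10: "0 \<le> C1" unfolding C1_def using C(1) by (simp add: sum_nonneg)
  \<comment> \<open>Majorant for the weighted difference between the integrands of the convolution
    and of its Riemann sum, uniform in \<open>x\<close> and in the multi-indices of
    \<open>K\<close>.\<close>
  let ?d = "\<lambda>i y. norm (g y) * (C1 * norm (y - s i y) * (2 ^ N * (1 + norm y) ^ N))"
  have dbound: "?d i y \<le> 3 * C1 * 2 ^ N * ((1 + norm y) ^ Suc N * norm (g y))" for i y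
  proof -
    have "norm (y - s i y) \<le> norm y + norm (s i y)" by (rule norm_triangle_ineq4)
    also have "\<dots> \<le> norm y + 2 * norm y" by (intro add_left_mono s)
    also have "\<dots> \<le> 3 * (1 + norm y)" by simp
    finally have "norm (y - s i y) \<le> 3 * (1 + norm y)" .
    then have "?d i y \<le> norm (g y) * (C1 * (3 * (1 + norm y)) * (2 ^ N * (1 + norm y) ^ N))"
      using C10 by (intro mult_left_mono mult_right_mono) auto
    then show ?thesis by (simp add: algebra_simps)
  qed
  have dint: "integrable lborel (?d i)" for i
  proof (rule Bochner_Integration.integrable_bound)
    show "integrable lborel (\<lambda>y. 3 * C1 * 2 ^ N * ((1 + norm y) ^ Suc N * norm (g y)))"
      by (intro integrable_mult_right rapidD g)
    show "AE y in lborel. norm (?d i y) \<le> norm (3 * C1 * 2 ^ N * ((1 + norm y) ^ Suc N * norm (g y)))"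
      using dbound[where i = i] C10 by (intro AE_I2) (simp add: abs_mult)
  qed measurable
  have diff: "norm (u ?F - u (T i)) \<le> C0 * (\<integral>y. ?d i y \<partial>lborel)" for i
  proof -
    have "norm (u (\<lambda>x. ?F x - T i x)) \<le> C0 * (\<integral>y. ?d i y \<partial>lborel)"
    proof (rule C0(3)[rule_format])
      show "(\<lambda>x. ?F x - T i x) \<in> schwartz" by (intro schwartz_diff conv_schwartz g k T)
      show "0 \<le> (\<integral>y. ?d i y \<partial>lborel)" using C10 by (intro integral_nonneg_AE AE_I2) auto
      fix ks x assume ks: "ks \<in> K"
      let ?k = "iter_partial ks k"
      have i1: "integrable lborel (\<lambda>y. g y * ?k (x - y))" by (intro conv_integrable g schwartz_iter_partial k)
      have i2: "integrable lborel (\<lambda>y. g y * ?k (x - s i y))"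
        by (rule integral_simple_comp(2)[OF rapidD(3)[OF g] s(1)])
      have "iter_partial ks (\<lambda>x. ?F x - T i x) x = (\<integral>y. g y * ?k (x - y) - g y * ?k (x - s i y) \<partial>lborel)"
        using i1 i2 by (simp add: iter_partial_diff schwartz_smooth conv_schwartz g k T iter_partial_conv pT)
      then have "(1 + norm x) ^ N * norm (iter_partial ks (\<lambda>x. ?F x - T i x) x) =
         norm (\<integral>y. of_real ((1 + norm x) ^ N) * (g y * ?k (x - y) - g y * ?k (x - s i y)) \<partial>lborel)"
        unfolding integral_mult_right_zero norm_mult norm_of_real by simp
      also have "\<dots> \<le> (\<integral>y. ?d i y \<partial>lborel)"
      proof (rule Bochner_Integration.integral_norm_bound_integral)
        show "integrable lborel (\<lambda>y. of_real ((1 + norm x) ^ N) * (g y * ?k (x - y) - g y * ?k (x - s i y)))"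
          by (intro integrable_mult_right Bochner_Integration.integrable_diff i1 i2)
        show "integrable lborel (?d i)" by (rule dint)
        fix y
        have "norm (of_real ((1 + norm x) ^ N) * (g y * ?k (x - y) - g y * ?k (x - s i y)))
            = norm (g y) * ((1 + norm x) ^ N * norm (?k (x - y) - ?k (x - s i y)))"
          unfolding right_diff_distrib[symmetric] norm_mult norm_of_real by simp
        also have "\<dots> \<le> norm (g y) * (C ks * norm (y - s i y) * (1 + max (norm y) (norm (s i y))) ^ N)"
          by (intro mult_left_mono C) simp
        also have "\<dots> \<le> ?d i y"
        proof -
          have "(1 + max (norm y) (norm (s i y))) ^ N \<le> 2 ^ N * (1 + norm y) ^ N"
            unfolding power_mult_distrib[symmetric]
            using s(3)[of i y] max_weight_nonneg[of y "s i y" 1] by (intro power_mono) auto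
          then show ?thesis
            using C1[OF ks] C(1)[of ks] C10 by (intro mult_left_mono mult_mono max_weight_nonneg) auto
        qed
        finally show "norm (of_real ((1 + norm x) ^ N) * (g y * ?k (x - y) - g y * ?k (x - s i y))) \<le> ?d i y" .
      qed
      finally show "(1 + norm x) ^ N * norm (iter_partial ks (\<lambda>x. ?F x - T i x) x) \<le> (\<integral>y. ?d i y \<partial>lborel)" .
    qed
    then show ?thesis by (simp add: tempered_diff[OF u] conv_schwartz g k T)
  qed
  \<comment> \<open>As \<open>s i y\<close> tends to \<open>y\<close>, the majorants integrate to a
    null sequence, so \<open>u (T i)\<close> tends to the left-hand side.\<close>
  have "(\<lambda>i. \<integral>y. ?d i y \<partial>lborel) \<longlonglongrightarrow> (\<integral>y. 0 \<partial>(lborel :: (real^'n) measure))"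
  proof (rule integral_dominated_convergence)
    show "integrable lborel (\<lambda>y. 3 * C1 * 2 ^ N * ((1 + norm y) ^ Suc N * norm (g y)))"
      by (intro integrable_mult_right rapidD g)
    show "AE y in lborel. norm (?d i y) \<le> 3 * C1 * 2 ^ N * ((1 + norm y) ^ Suc N * norm (g y))" for i
      using dbound[where i = i] C10 by (intro AE_I2) (simp add: abs_mult)
    show "AE y in lborel. (\<lambda>i. ?d i y) \<longlonglongrightarrow> 0"
    proof (rule AE_I2)
      fix y
      have "(\<lambda>i. ?d i y) \<longlonglongrightarrow> norm (g y) * (C1 * norm (y - y) * (2 ^ N * (1 + norm y) ^ N))"
        by (intro tendsto_intros s(2))
      then show "(\<lambda>i. ?d i y) \<longlonglongrightarrow> 0" by simp
    qed
  qed measurable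
  then have "(\<lambda>i. C0 * (\<integral>y. ?d i y \<partial>lborel)) \<longlonglongrightarrow> 0"
    by (intro tendsto_mult_right_zero) simp
  then have "(\<lambda>i. u ?F - u (T i)) \<longlonglongrightarrow> 0"
    by (rule tendsto_0_le[where K = 1])
       (intro always_eventually allI, use diff in \<open>auto intro: order_trans[OF _ abs_ge_self]\<close>)
  then have "(\<lambda>i. u ?F - (u ?F - u (T i))) \<longlonglongrightarrow> u ?F - 0" by (intro tendsto_diff tendsto_const)
  then have l1: "(\<lambda>i. u (T i)) \<longlonglongrightarrow> u ?F" by simp
  \<comment> \<open>The same sequence tends to the right-hand side, by continuity of
    \<open>u\<close> along translates.\<close>
  have "(\<lambda>i. u (T i)) \<longlonglongrightarrow> (\<integral>y. g y * ?h y \<partial>lborel)"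
    unfolding uT
  proof (rule integral_dominated_convergence)
    show "integrable lborel (\<lambda>y. B * 2 ^ M * ((1 + norm y) ^ M * norm (g y)))"
      by (intro integrable_mult_right rapidD g)
    show "AE y in lborel. norm (g y * ?h (s i y)) \<le> B * 2 ^ M * ((1 + norm y) ^ M * norm (g y))" for i
    proof (rule AE_I2)
      fix y
      have "norm (?h (s i y)) \<le> B * (1 + norm (s i y)) ^ M" by (rule B)
      also have "\<dots> \<le> B * (2 ^ M * (1 + norm y) ^ M)"
        by (intro mult_left_mono weight_double s B)
      finally have "norm (g y) * norm (?h (s i y)) \<le> norm (g y) * (B * (2 ^ M * (1 + norm y) ^ M))"
        by (rule mult_left_mono) simp
      then show "norm (g y * ?h (s i y)) \<le> B * 2 ^ M * ((1 + norm y) ^ M * norm (g y))"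
        by (simp add: norm_mult mult_ac)
    qed
    show "AE y in lborel. (\<lambda>i. g y * ?h (s i y)) \<longlonglongrightarrow> g y * ?h y"
      using continuous_on_tendsto_compose[OF cont[of UNIV] s(2)] by (intro AE_I2 tendsto_mult tendsto_const) auto
  qed measurable
  with l1 show "u ?F = (\<integral>y. g y * ?h y \<partial>lborel)" by (rule LIMSEQ_unique)
qed

subsection \<open>Fourier multipliers\<close>

text \<open>Testing the multiplier distribution against \<open>g\<close> comes down to this
  function: after exchanging the integrals, the two normalizing factors combine to the constant of
  \<open>fker\<close>.\<close>

lemma fourier_mult_inv_fourier:
  fixes z g :: "real^'n \<Rightarrow> complex"
  assumes z: "z \<in> test_functions" and g: "integrable lborel g"
  shows "fourier (\<lambda>\<xi>. z \<xi> * inv_fourier g \<xi>) = (\<lambda>x. \<integral>y. g y * fker z (x - y) \<partial>lborel)"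
proof
  fix x
  let ?c = "of_real ((2 * pi) powr (- real CARD('n) / 2)) :: complex"
  have cc: "?c * ?c = of_real ((2 * pi) powr (- real CARD('n)))"
    unfolding of_real_mult[symmetric] powr_add[symmetric] by simp
  have "fourier (\<lambda>\<xi>. z \<xi> * inv_fourier g \<xi>) x =
    ?c * (\<integral>\<xi>. ?c * (\<integral>y. z \<xi> * g y * exp (- (\<i> * of_real ((x - y) \<bullet> \<xi>))) \<partial>lborel) \<partial>lborel)"
  proof -
    have "z \<xi> * inv_fourier g \<xi> * exp (- (\<i> * of_real (\<xi> \<bullet> x))) =
        ?c * (\<integral>y. z \<xi> * g y * exp (- (\<i> * of_real ((x - y) \<bullet> \<xi>))) \<partial>lborel)" for \<xi>
    proof -
      have "(\<integral>y. z \<xi> * g y * exp (- (\<i> * of_real ((x - y) \<bullet> \<xi>))) \<partial>lborel) =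
        (\<integral>y. z \<xi> * exp (- (\<i> * of_real (\<xi> \<bullet> x))) * (g y * exp (\<i> * of_real (\<xi> \<bullet> y))) \<partial>lborel)"
      proof (intro Bochner_Integration.integral_cong refl)
        fix y
        have "exp (- (\<i> * of_real ((x - y) \<bullet> \<xi>))) = exp (- (\<i> * of_real (\<xi> \<bullet> x))) * exp (\<i> * of_real (\<xi> \<bullet> y))"
          unfolding exp_add[symmetric] by (simp add: inner_diff_left inner_commute[of \<xi>] algebra_simps)
        then show "z \<xi> * g y * exp (- (\<i> * of_real ((x - y) \<bullet> \<xi>))) =
            z \<xi> * exp (- (\<i> * of_real (\<xi> \<bullet> x))) * (g y * exp (\<i> * of_real (\<xi> \<bullet> y)))"
          by simp
      qed
      then show ?thesis unfolding inv_fourier_def integral_mult_right_zero by (simp add: mult_ac)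
    qed
    then show ?thesis unfolding fourier_def by simp
  qed
  also have "\<dots> = (?c * ?c) * (\<integral>\<xi>. (\<integral>y. z \<xi> * g y * exp (- (\<i> * of_real ((x - y) \<bullet> \<xi>))) \<partial>lborel) \<partial>lborel)"
    by (simp only: integral_mult_right_zero mult.assoc)
  also have "(\<integral>\<xi>. (\<integral>y. z \<xi> * g y * exp (- (\<i> * of_real ((x - y) \<bullet> \<xi>))) \<partial>lborel) \<partial>lborel) =
     (\<integral>y. (\<integral>\<xi>. z \<xi> * g y * exp (- (\<i> * of_real ((x - y) \<bullet> \<xi>))) \<partial>lborel) \<partial>lborel)"
    by (rule lborel_pair.Fubini_integral[symmetric], rule integrable_kernel_prod[OF test_integrable[OF z] g]) auto
  also have "(?c * ?c) * \<dots> = (\<integral>y. g y * fker z (x - y) \<partial>lborel)"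
    unfolding cc fker_def integral_mult_right_zero[symmetric]
    by (intro Bochner_Integration.integral_cong refl) (simp add: mult_ac)
  finally show "fourier (\<lambda>\<xi>. z \<xi> * inv_fourier g \<xi>) x = (\<integral>y. g y * fker z (x - y) \<partial>lborel)" .
qed

text \<open>Otherwise the set where \<open>f\<close> is nonzero would be a nonempty open null
  set.\<close>

lemma continuous_integral_zero:
  fixes f :: "real^'n \<Rightarrow> real"
  assumes "continuous_on UNIV f" "\<And>x. 0 \<le> f x" "integrable lborel f" "(\<integral>x. f x \<partial>lborel) = 0"
  shows "f x = 0"
proof (rule ccontr)
  assume "f x \<noteq> 0"
  let ?U = "{x. f x \<noteq> 0}"
  have "AE x in lborel. f x = 0"
    using integral_nonneg_eq_0_iff_AE[OF assms(3)] assms(2,4) by auto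
  moreover have op: "open ?U" by (intro open_Collect_neq assms continuous_on_const)
  ultimately have "?U \<in> null_sets lborel" using AE_iff_null_sets[of ?U lborel] by simp
  then have "negligible ?U"
    unfolding negligible_iff_null_sets by (rule null_sets_completionI)
  then show False using op open_not_negligible[of ?U] \<open>f x \<noteq> 0\<close> by auto
qed

text \<open>The bump functions needed to identify a continuous density are rescaled copies of
  \<open>\<bar>\<beta>\<bar>\<^sup>2\<close>, so that a single test function with \<open>\<beta> 0 \<noteq> 0\<close> suffices.\<close>

lemma represents_unique:
  fixes h1 h2 \<beta> :: "real^'n \<Rightarrow> complex"
  assumes c: "continuous_on UNIV h1" "continuous_on UNIV h2"
    and r: "represents h1 U" "represents h2 U" and \<beta>: "\<beta> \<in> test_functions" "\<beta> 0 \<noteq> 0"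
  shows "h1 = h2"
proof (rule ccontr)
  assume "h1 \<noteq> h2"
  then obtain x0 where x0: "h1 x0 - h2 x0 \<noteq> 0" by (auto simp: fun_eq_iff)
  define d where "d x = h1 x - h2 x" for x
  let ?p = "\<lambda>x. Re (d x * cnj (d x0))"
  have dc: "continuous_on S d" for S
    unfolding d_def[abs_def] by (intro continuous_on_diff continuous_on_subset[OF c(1)] continuous_on_subset[OF c(2)]) auto
  have "?p x0 = (norm (d x0))^2" by (metis complex_norm_square Re_complex_of_real)
  then have "0 < ?p x0" using x0 by (simp add: d_def)
  moreover have "isCont ?p x0"
  proof -
    have "continuous_on UNIV ?p" by (intro continuous_intros dc)
    then show ?thesis by (simp add: continuous_on_eq_continuous_at)
  qed
  then have "(?p \<longlongrightarrow> ?p x0) (nhds x0)" by (simp add: isCont_def tendsto_nhds_iff)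
  ultimately have "\<forall>\<^sub>F x in nhds x0. 0 < ?p x" by (intro order_tendstoD(1))
  then obtain \<rho> where \<rho>: "0 < \<rho>" "\<And>x. dist x x0 < \<rho> \<Longrightarrow> 0 < ?p x"
    by (auto simp: eventually_nhds_metric)
  have "bounded (supp \<beta>)" by (intro compact_imp_bounded test_functionsD \<beta>)
  then obtain R where R: "0 < R" "\<And>x. x \<in> supp \<beta> \<Longrightarrow> norm x \<le> R" by (auto simp: bounded_pos)
  \<comment> \<open>With this dilation factor the support of the rescaled \<open>\<beta>\<close>
    fits into the ball of radius \<open>\<rho>\<close> around \<open>x0\<close>.\<close>
  define l where "l = (R + 1) / \<rho>"
  have l: "0 < l" using R \<rho> by (simp add: l_def)
  define b where "b x = \<beta> (- (l *\<^sub>R x0) + l *\<^sub>R x)" for x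
  have b: "b \<in> test_functions" unfolding b_def[abs_def] using l by (intro test_affine_comp \<beta>) simp
  have b0: "b x = 0" if "\<not> dist x x0 < \<rho>" for x
  proof -
    have "norm (- (l *\<^sub>R x0) + l *\<^sub>R x) = l * dist x x0"
    proof -
      have "- (l *\<^sub>R x0) + l *\<^sub>R x = l *\<^sub>R (x - x0)" by (simp add: scaleR_diff_right)
      then show ?thesis using l by (simp add: dist_norm)
    qed
    also have "\<dots> \<ge> R + 1"
      using mult_left_mono[of \<rho> "dist x x0" l] that l \<rho>(1) by (simp add: l_def)
    finally have "- (l *\<^sub>R x0) + l *\<^sub>R x \<notin> supp \<beta>" using R(2) by fastforce
    then show ?thesis unfolding b_def by (rule test_functionsD(5)[OF \<beta>(1)])
  qed
  define g where "g x = b x * (cnj (b x) * cnj (d x0))" for x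
  have g: "g \<in> test_functions"
    unfolding g_def[abs_def] using test_functionsD(1)[OF b] by (intro test_mult(1)[OF b]) auto
  have i: "integrable lborel (\<lambda>x. h1 x * g x)" "integrable lborel (\<lambda>x. h2 x * g x)"
    "(\<integral>x. h1 x * g x \<partial>lborel) = (\<integral>x. h2 x * g x \<partial>lborel)"
    using r test_imp_schwartz[OF g] by (auto simp: represents_def)
  have di: "integrable lborel (\<lambda>x. d x * g x)" "(\<integral>x. d x * g x \<partial>lborel) = 0"
    using i by (simp_all add: d_def left_diff_distrib)
  let ?f = "\<lambda>x. Re (d x * g x)"
  have fe: "?f x = ?p x * (norm (b x))^2" for x
  proof -
    have "d x * g x = (d x * cnj (d x0)) * of_real ((norm (b x))^2)"
      using complex_norm_square[of "b x"] by (simp add: g_def mult_ac)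
    then show ?thesis by (simp only: Re_complex_of_real times_complex.sel Im_complex_of_real mult_zero_right diff_zero)
  qed
  have "?f x0 = 0"
  proof (rule continuous_integral_zero)
    show "continuous_on UNIV ?f" by (intro continuous_intros dc test_functionsD g)
    show "0 \<le> ?f x" for x
      unfolding fe using \<rho>(2)[of x] b0[of x] by (cases "dist x x0 < \<rho>") auto
    show "integrable lborel ?f" using di(1) by (rule integrable_Re)
    show "(\<integral>x. ?f x \<partial>lborel) = 0" using integral_Re[OF di(1)] di(2) by simp
  qed
  then show False using \<open>0 < ?p x0\<close> \<beta>(2) unfolding fe by (simp add: b_def)
qed

text \<open>Turns the definite description into a formula: the right-hand function is continuous and
  represents the distribution by \<open>tempered_conv\<close>. The bump \<open>\<beta>\<close>
  enters through uniqueness; an admissible pair supplies it as \<open>\<theta>\<close>.\<close>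

lemma multiplier_eq:
  fixes u :: "(real^'n \<Rightarrow> complex) \<Rightarrow> complex"
  assumes u: "tempered_distribution u" and z: "z \<in> test_functions"
    and \<beta>: "\<beta> \<in> test_functions" "\<beta> (0::real^'n) \<noteq> 0"
  shows "multiplier z u = (\<lambda>y. u (\<lambda>x. fker z (x - y)))"
  unfolding multiplier_def
proof (rule the_equality)
  let ?h = "\<lambda>y. u (\<lambda>x. fker z (x - y))"
  have c: "continuous_on UNIV ?h"
    by (intro tempered_translation_continuous u fker_schwartz z)
  have r: "represents ?h (inv_fourier_dist (mult_dist z (fourier_dist u)))"
    unfolding represents_def
  proof (intro ballI conjI)
    fix g :: "real^'n \<Rightarrow> complex" assume g: "g \<in> schwartz"
    note t = tempered_conv[OF u fker_schwartz[OF z] schwartz_rapid[OF g]]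
    show "integrable lborel (\<lambda>x. ?h x * g x)" using t(1) by (simp add: mult.commute)
    show "inv_fourier_dist (mult_dist z (fourier_dist u)) g = (\<integral>x. ?h x * g x \<partial>lborel)"
      unfolding inv_fourier_dist_def mult_dist_def fourier_dist_def
        fourier_mult_inv_fourier[OF z schwartz_integrable[OF g]] t(2) by (simp add: mult.commute)
  qed
  show "continuous_on UNIV ?h \<and> represents ?h (inv_fourier_dist (mult_dist z (fourier_dist u)))"
    using c r by blast
  show "h = ?h" if "continuous_on UNIV h \<and> represents h (inv_fourier_dist (mult_dist z (fourier_dist u)))" for h
    using represents_unique[OF _ c _ r \<beta>] that by blast
qed

context
  fixes \<beta> :: "real^'n \<Rightarrow> complex" and u :: "(real^'n \<Rightarrow> complex) \<Rightarrow> complex"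
  assumes \<beta>: "\<beta> \<in> test_functions" "\<beta> 0 \<noteq> 0" and u: "tempered_distribution u"
begin

lemma multiplier_continuous: "z \<in> test_functions \<Longrightarrow> continuous_on S (multiplier z u)"
  unfolding multiplier_eq[OF u _ \<beta>] by (intro tempered_translation_continuous u fker_schwartz)

lemma multiplier_growth:
  "z \<in> test_functions \<Longrightarrow> \<exists>B N. 0 \<le> B \<and> (\<forall>y. norm (multiplier z u y) \<le> B * (1 + norm y) ^ N)"
  unfolding multiplier_eq[OF u _ \<beta>] by (intro tempered_translation_growth u fker_schwartz)

lemma multiplier_sum:
  assumes "\<And>i. i \<in> I \<Longrightarrow> z i \<in> test_functions"
  shows "multiplier (\<lambda>\<xi>. \<Sum>i\<in>I. z i \<xi>) u y = (\<Sum>i\<in>I. multiplier (z i) u y)"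
proof -
  have "multiplier (\<lambda>\<xi>. \<Sum>i\<in>I. z i \<xi>) u y = u (\<lambda>x. \<Sum>i\<in>I. fker (z i) (x - y))"
    by (simp add: multiplier_eq[OF u _ \<beta>] assms test_sum fker_sum)
  also have "\<dots> = (\<Sum>i\<in>I. multiplier (z i) u y)"
    by (simp add: tempered_sum[OF u] schwartz_translation fker_schwartz assms multiplier_eq[OF u _ \<beta>])
  finally show ?thesis .
qed

text \<open>\<open>fker_mult\<close> writes the kernel of the product as a superposition of
  translates of \<open>fker \<tau>\<close>, through which \<open>u\<close> passes by
  \<open>tempered_conv\<close>. The outer multiplier thus acts as a convolution on the function
  \<open>multiplier \<tau> u\<close>.\<close>

lemma multiplier_mult:
  assumes m: "\<mu> \<in> test_functions" and t: "\<tau> \<in> test_functions"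
  shows "integrable lborel (\<lambda>w. fker \<mu> (w - y) * multiplier \<tau> u w)"
    and "multiplier (\<lambda>\<xi>. \<mu> \<xi> * \<tau> \<xi>) u y = (\<integral>w. fker \<mu> (w - y) * multiplier \<tau> u w \<partial>lborel)"
proof -
  note g = schwartz_rapid[OF schwartz_translation[OF fker_schwartz[OF m], of y]]
  note c = tempered_conv[OF u fker_schwartz[OF t] g]
  show "integrable lborel (\<lambda>w. fker \<mu> (w - y) * multiplier \<tau> u w)"
    using c(1) by (simp add: multiplier_eq[OF u t \<beta>])
  have eq: "fker (\<lambda>\<xi>. \<mu> \<xi> * \<tau> \<xi>) (x - y) = (\<integral>w. fker \<mu> (w - y) * fker \<tau> (x - w) \<partial>lborel)" for x
  proof -
    have [measurable]: "fker \<mu> \<in> borel_measurable borel" "fker \<tau> \<in> borel_measurable borel"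
      using m t by (auto intro!: borel_measurable_continuous_onI smooth_imp_continuous smooth_fker)
    have "fker (\<lambda>\<xi>. \<mu> \<xi> * \<tau> \<xi>) (x - y) = (\<integral>w. fker \<mu> (x - y - w) * fker \<tau> w \<partial>lborel)"
      by (rule fker_mult[OF m t])
    also have "\<dots> = (\<integral>w. fker \<mu> (w - y) * fker \<tau> (x - w) \<partial>lborel)"
      by (subst lborel_integral_affine(1)[of _ "-1" x]) (simp_all add: algebra_simps)
    finally show ?thesis .
  qed
  show "multiplier (\<lambda>\<xi>. \<mu> \<xi> * \<tau> \<xi>) u y = (\<integral>w. fker \<mu> (w - y) * multiplier \<tau> u w \<partial>lborel)"
    unfolding multiplier_eq[OF u test_mult(1)[OF m test_functionsD(1)[OF t]] \<beta>] eq c(2) multiplier_eq[OF u t \<beta>] ..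
qed

end

subsection \<open>Powers of extended nonnegative reals\<close>

lemma ennreal_powr_ennreal: "0 \<le> x \<Longrightarrow> ennreal_powr (ennreal x) a = ennreal (x powr a)"
  by (simp add: ennreal_powr_def)

lemma ennreal_powr_top [simp]: "ennreal_powr \<infinity> a = \<infinity>" "ennreal_powr top a = top"
  by (simp_all add: ennreal_powr_def)

lemma ennreal_powr_zero [simp]: "ennreal_powr 0 a = 0"
  by (simp add: ennreal_powr_def)

lemma ennreal_powr_mono: "x \<le> y \<Longrightarrow> 0 \<le> a \<Longrightarrow> ennreal_powr x a \<le> ennreal_powr y a"
  by (cases x; cases y) (auto simp: ennreal_powr_ennreal powr_mono2 top_unique)

lemma ennreal_powr_mult: "0 < a \<Longrightarrow> ennreal_powr (x * y) a = ennreal_powr x a * ennreal_powr y a"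
  by (cases x; cases y)
     (auto simp: ennreal_powr_ennreal ennreal_mult[symmetric] powr_mult ennreal_top_mult ennreal_mult_top)

lemma ennreal_powr_powr: "ennreal_powr (ennreal_powr x a) b = ennreal_powr x (a * b)"
  by (cases x) (auto simp: ennreal_powr_ennreal powr_powr)

lemma ennreal_powr_1: "ennreal_powr x 1 = x"
  by (cases x) (auto simp: ennreal_powr_ennreal)

lemma ennreal_powr_inverse: "0 < a \<Longrightarrow> ennreal_powr (ennreal_powr x a) (1 / a) = x"
  "0 < a \<Longrightarrow> ennreal_powr (ennreal_powr x (1 / a)) a = x"
  by (simp_all add: ennreal_powr_powr ennreal_powr_1)

lemma ennreal_powr_le_iff: "0 < a \<Longrightarrow> ennreal_powr x a \<le> y \<longleftrightarrow> x \<le> ennreal_powr y (1 / a)"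
  using ennreal_powr_mono[of "ennreal_powr x a" y "1 / a"] ennreal_powr_mono[of x "ennreal_powr y (1 / a)" a]
  by (auto simp: ennreal_powr_inverse)

text \<open>After division by \<open>x + y\<close> both summands lie in the unit interval, where
  \<open>t \<le> t powr p\<close>.\<close>

lemma powr_add_le:
  fixes x y :: real
  assumes "0 \<le> x" "0 \<le> y" "0 < p" "p \<le> 1"
  shows "(x + y) powr p \<le> x powr p + y powr p"
proof (cases "x + y = 0")
  case True
  then show ?thesis using assms by simp
next
  case False
  then have s: "0 < x + y" using assms by linarith
  have *: "t \<le> t powr p" if "0 \<le> t" "t \<le> 1" for t :: real
    using powr_mono'[of p 1 t] that assms by (cases "t = 0") auto
  have "1 = x / (x + y) + y / (x + y)" using s by (simp add: add_divide_distrib[symmetric])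
  also have "\<dots> \<le> (x / (x + y)) powr p + (y / (x + y)) powr p"
    using s assms by (intro add_mono *) (auto simp: field_simps)
  also have "\<dots> = (x powr p + y powr p) / (x + y) powr p"
    using s assms by (simp add: powr_divide add_divide_distrib)
  finally show ?thesis using s by (simp add: field_simps)
qed

lemma ennreal_powr_add_le:
  assumes "0 < p" "p \<le> 1"
  shows "ennreal_powr (x + y) p \<le> ennreal_powr x p + ennreal_powr y p"
  using assms
  by (cases x; cases y) (auto simp: ennreal_powr_ennreal powr_add_le simp flip: ennreal_plus)

lemma ennreal_powr_measurable [measurable]:
  assumes [measurable]: "f \<in> borel_measurable M"
  shows "(\<lambda>x. ennreal_powr (f x) a) \<in> borel_measurable M"
  unfolding ennreal_powr_def by measurable

lemma suminf_ennreal_least: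
  fixes f :: "nat \<Rightarrow> ennreal"
  assumes "\<And>n. (\<Sum>i<n. f i) \<le> B"
  shows "(\<Sum>i. f i) \<le> B"
  unfolding suminf_eq_SUP using assms by (rule SUP_least)

lemma ennreal_powr_suminf_le:
  fixes f :: "nat \<Rightarrow> ennreal"
  assumes "0 < p" "\<And>n. ennreal_powr (\<Sum>i<n. f i) p \<le> B"
  shows "ennreal_powr (\<Sum>i. f i) p \<le> B"
  using assms by (simp add: ennreal_powr_le_iff suminf_ennreal_least)

subsection \<open>The weight functions\<close>

definition wt :: "real \<Rightarrow> real \<Rightarrow> real" where
  "wt M t = (1 + t) powr (- M)"

lemma wt_pos: "0 \<le> t \<Longrightarrow> 0 < wt M t"
  by (simp add: wt_def)

lemma wt_le_1: "0 \<le> t \<Longrightarrow> 0 \<le> M \<Longrightarrow> wt M t \<le> 1"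
  using powr_mono[of "-M" 0 "1 + t"] by (simp add: wt_def)

lemma wt_0 [simp]: "wt M 0 = 1"
  by (simp add: wt_def)

lemma wt_antimono: "0 \<le> t \<Longrightarrow> t \<le> s \<Longrightarrow> 0 \<le> M \<Longrightarrow> wt M s \<le> wt M t"
  unfolding wt_def by (rule powr_mono2') auto

lemma wt_antimono_exponent: "0 \<le> t \<Longrightarrow> M \<le> N \<Longrightarrow> wt N t \<le> wt M t"
  unfolding wt_def by (rule powr_mono) auto

lemma wt_powr: "0 \<le> t \<Longrightarrow> wt M t powr p = wt (M * p) t"
  by (simp add: wt_def powr_powr)

lemma wt_add: "0 \<le> t \<Longrightarrow> wt (M + N) t = wt M t * wt N t"
  by (simp add: wt_def powr_add[symmetric])

text \<open>Peetre's inequality for real exponents, from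
  \<open>1 + t \<le> (1 + s) * (1 + u)\<close>.\<close>

lemma wt_triangle:
  assumes "0 \<le> s" "0 \<le> u" "0 \<le> t" "t \<le> s + u" "0 \<le> M"
  shows "wt M s * wt M u \<le> wt M t"
proof -
  have "1 + t \<le> 1 + s + u + s * u" using assms mult_nonneg_nonneg[of s u] by linarith
  then have "1 + t \<le> (1 + s) * (1 + u)" by (simp add: algebra_simps)
  then have "((1 + s) * (1 + u)) powr (- M) \<le> (1 + t) powr (- M)"
    using assms by (intro powr_mono2') auto
  then show ?thesis using assms by (simp add: wt_def powr_mult)
qed

text \<open>Serves to move the base point of a weight within a cell, whose diameter in units of the
  scale is at most \<open>CARD('n)\<close>.\<close>

lemma wt_quasi:
  assumes "0 \<le> s" "0 \<le> t" "t \<le> s + c" "0 \<le> c" "0 \<le> M"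
  shows "wt M s \<le> (1 + c) powr M * wt M t"
proof -
  have "wt M s * wt M c \<le> wt M t" using assms by (intro wt_triangle) auto
  then have "wt M s * wt M c * (1 + c) powr M \<le> wt M t * (1 + c) powr M" by (rule mult_right_mono) simp
  moreover have "wt M c * (1 + c) powr M = 1" using assms by (simp add: wt_def powr_add[symmetric])
  moreover from this have "wt M s * wt M c * (1 + c) powr M = wt M s" by (simp add: mult.assoc)
  ultimately show ?thesis by (simp only: mult.commute)
qed

lemma wt_numeral_nat: "0 \<le> t \<Longrightarrow> wt (real N) t = 1 / (1 + t) ^ N"
  by (simp add: wt_def powr_minus powr_realpow divide_inverse)

lemma wt_measurable [measurable]: "f \<in> borel_measurable M' \<Longrightarrow> (\<lambda>x. wt M (f x)) \<in> borel_measurable M'"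
  unfolding wt_def by measurable

lemma nn_integral_lborel_affine:
  fixes f :: "'a::euclidean_space \<Rightarrow> ennreal"
  assumes [measurable]: "f \<in> borel_measurable borel" and "c \<noteq> 0"
  shows "(\<integral>\<^sup>+x. f x \<partial>lborel) = ennreal (\<bar>c\<bar> ^ DIM('a)) * (\<integral>\<^sup>+x. f (t + c *\<^sub>R x) \<partial>lborel)"
  by (subst lborel_affine[OF assms(2), of t])
     (simp add: nn_integral_density nn_integral_distr nn_integral_cmult)

subsection \<open>Dyadic cells\<close>

text \<open>Dyadic cubes of level \<open>j\<close> are the fibres of this map, so membership in a
  common cube becomes an equation, and nestedness a statement about floors.\<close>

definition cell :: "int \<Rightarrow> real^'n \<Rightarrow> int^'n" where
  "cell j x = (\<chi> k. \<lfloor>2 powi j * x $ k\<rfloor>)"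

lemma powi_2_pos: "0 < (2::real) powi j"
  by simp

lemma dyadic_cube_eq: "dyadic_cube j m = {x. cell j x = m}"
proof -
  have "2 powi (- j) * of_int a \<le> t \<and> t < 2 powi (- j) * (of_int a + 1) \<longleftrightarrow> \<lfloor>2 powi j * t\<rfloor> = a" for a and t :: real
    unfolding floor_eq_iff using powi_2_pos[of j]
    by (auto simp: power_int_minus field_simps)
  then show ?thesis by (auto simp: dyadic_cube_def cell_def vec_eq_iff)
qed

lemma cell_measurable [measurable]: "cell j \<in> borel \<rightarrow>\<^sub>M count_space UNIV"
proof -
  have "cell j -` {m} \<inter> space borel \<in> sets borel" for m :: "int^'n"
  proof -
    have "cell j -` {m} = (\<Inter>k\<in>UNIV. {x::real^'n. \<lfloor>2 powi j * x $ k\<rfloor> = m $ k})"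
      by (auto simp: cell_def vec_eq_iff)
    also have "\<dots> \<in> sets borel"
      by (intro sets.countable_INT'' countable_finite) (auto intro!: borel_measurable_vimage simp: vimage_def Collect_conj_eq)
    finally show ?thesis by simp
  qed
  then show ?thesis
    by (intro measurable_count_space_eq_countable[THEN iffD2]) auto
qed

lemma cell_function_measurable: "(\<lambda>x. f (cell j x)) \<in> borel \<rightarrow>\<^sub>M N" if "\<And>m. f m \<in> space N"
  using that by (intro measurable_compose[OF cell_measurable]) auto

lemma cell_dist:
  fixes x y :: "real^'n"
  assumes "cell j x = cell j y"
  shows "2 powi j * norm (x - y) \<le> real CARD('n)"
proof -
  have "\<bar>2 powi j * (x $ k - y $ k)\<bar> \<le> 1" for k
  proof -
    have f: "\<lfloor>2 powi j * x $ k\<rfloor> = \<lfloor>2 powi j * y $ k\<rfloor>" using assms by (simp add: cell_def vec_eq_iff)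
    show ?thesis using floor_correct[of "2 powi j * x $ k"] floor_correct[of "2 powi j * y $ k"]
      unfolding f right_diff_distrib by linarith
  qed
  then have "(\<Sum>k\<in>UNIV. \<bar>2 powi j * (x $ k - y $ k)\<bar>) \<le> (\<Sum>k\<in>(UNIV::'n set). 1)" by (intro sum_mono)
  moreover have "2 powi j * norm (x - y) \<le> (\<Sum>k\<in>UNIV. \<bar>2 powi j * (x $ k - y $ k)\<bar>)"
    using mult_left_mono[OF norm_le_l1_cart[of "x - y"], of "2 powi j"] powi_2_pos[of j]
    by (simp add: sum_distrib_left abs_mult)
  ultimately show ?thesis by simp
qed

lemma cell_refine:
  assumes "cell j x = cell j y" "i \<le> j"
  shows "cell i x = cell i y"
proof -
  \<comment> \<open>The coarse index is an integer quotient of the fine one and hence determined by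
    it.\<close>
  have "\<lfloor>2 powi i * t\<rfloor> = \<lfloor>2 powi j * t\<rfloor> div 2 ^ nat (j - i)" for t :: real
  proof -
    have "(2::real) powi j = 2 powi i * 2 powi (j - i)" by (subst power_int_add[symmetric]) auto
    moreover have "(2::real) powi (j - i) = 2 ^ nat (j - i)" using assms(2) by (simp add: power_int_def)
    ultimately have "2 powi i * t = (2 powi j * t) / real_of_int (2 ^ nat (j - i))" by simp
    then show ?thesis by (simp only: floor_divide_real_eq_div zero_le_power zero_le_numeral)
  qed
  then show ?thesis using assms(1) by (simp add: cell_def vec_eq_iff)
qed

lemma sets_dyadic_cube [measurable]: "dyadic_cube j m \<in> sets borel"
proof -
  have "cell j -` {m} \<inter> space borel \<in> sets borel" by (rule measurable_sets[OF cell_measurable]) auto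
  then show ?thesis by (simp add: vimage_def dyadic_cube_eq)
qed

text \<open>The half-open cube lies between an open and a closed box of the same volume.\<close>

lemma emeasure_dyadic_cube:
  fixes m :: "int^'n"
  shows "emeasure lborel (dyadic_cube j m) = ennreal ((2 powi (- j)) ^ CARD('n))"
proof -
  define a b :: "real^'n" where "a = (\<chi> k. 2 powi (- j) * of_int (m $ k))" and "b = (\<chi> k. 2 powi (- j) * (of_int (m $ k) + 1))"
  have d: "(b - a) \<bullet> e = 2 powi (- j)" if e: "e \<in> Basis" for e
  proof -
    obtain k where "e = axis k 1" using e by (auto simp: Basis_vec_def)
    then show ?thesis by (simp add: a_def b_def inner_axis algebra_simps)
  qed
  then have le: "a \<bullet> e \<le> b \<bullet> e" if "e \<in> Basis" for e
    using that powi_2_pos[of "-j"] by (metis diff_ge_0_iff_ge inner_diff_left less_imp_le)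
  have p: "(\<Prod>e\<in>Basis. (b - a) \<bullet> e) = (2 powi (- j)) ^ CARD('n)" using d by simp
  have "emeasure lborel (dyadic_cube j m) \<le> emeasure lborel (cbox a b)"
    by (rule emeasure_mono) (auto simp: dyadic_cube_def mem_box_cart a_def b_def le_less)
  moreover have "emeasure lborel (box a b) \<le> emeasure lborel (dyadic_cube j m)"
    by (rule emeasure_mono) (auto simp: dyadic_cube_def mem_box_cart a_def b_def le_less)
  moreover have "emeasure lborel (cbox a b) = ennreal ((2 powi (- j)) ^ CARD('n))"
    "emeasure lborel (box a b) = ennreal ((2 powi (- j)) ^ CARD('n))"
    using le p by (simp_all add: emeasure_lborel_cbox_eq emeasure_lborel_box_eq)
  ultimately show ?thesis by (metis antisym)
qed

lemma side_length_dyadic_cube: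
  fixes m :: "int^'n"
  shows "side_length (dyadic_cube j m) = 2 powi (- j)"
proof -
  have "measure lebesgue (dyadic_cube j m) = (2 powi (- j)) ^ CARD('n)"
  proof -
    have "measure lebesgue (dyadic_cube j m) = measure lborel (dyadic_cube j m)"
      by (rule measure_completion) (simp add: sets_dyadic_cube)
    also have "\<dots> = (2 powi (- j)) ^ CARD('n)"
      unfolding measure_def emeasure_dyadic_cube by (rule enn2real_ennreal) simp
    finally show ?thesis .
  qed
  moreover have "0 < (2::real) powi (- j)" by (rule powi_2_pos)
  moreover from this have "((2::real) powi (- j)) ^ CARD('n) = (2 powi (- j)) powr (real CARD('n))"
    by (rule powr_realpow[symmetric])
  ultimately show ?thesis by (simp add: side_length_def powr_powr)
qed

lemma nn_integral_wt:
  "(\<integral>\<^sup>+y. ennreal (wt (2 * CARD('n)) (norm (y::real^'n))) \<partial>lborel) < \<infinity>"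
proof -
  have "integrable lborel (\<lambda>x::real^'n. wt (2 * CARD('n)) (norm x))"
  proof -
    have "(\<lambda>x::real^'n. wt (2 * CARD('n)) (norm x)) = (\<lambda>x. 1 / (1 + norm x) ^ (2 * CARD('n)))"
      using wt_numeral_nat[OF norm_ge_zero, of "2 * CARD('n)"] by auto
    then show ?thesis using integrable_inverse_power_norm[of "2 * CARD('n)", where 'n = 'n] by simp
  qed
  then show ?thesis by (simp add: integrable_iff_bounded wt_def)
qed

subsection \<open>Sums of step functions\<close>

lemma powr_superadditive:
  fixes x y :: real
  assumes "0 \<le> x" "0 \<le> y" "1 \<le> q"
  shows "x powr q + y powr q \<le> (x + y) powr q"
proof -
  have "(x powr q + y powr q) powr (1 / q) \<le> (x powr q) powr (1 / q) + (y powr q) powr (1 / q)"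
    using assms by (intro powr_add_le) auto
  also have "\<dots> = x + y" using assms by (simp add: powr_powr)
  finally have "((x powr q + y powr q) powr (1 / q)) powr q \<le> (x + y) powr q"
    using assms by (intro powr_mono2) auto
  then show ?thesis using assms by (simp add: powr_powr)
qed

text \<open>Convexity of the power: a step of given length adds more when it starts further to the
  right.\<close>

lemma powr_increment_mono:
  fixes s d s' d' q :: real
  assumes "1 \<le> q" "0 \<le> s" "s \<le> s'" "0 \<le> d" "d \<le> d'"
  shows "(s + d) powr q - s powr q \<le> (s' + d') powr q - s' powr q"
proof -
  have "(s + d) powr q - s powr q \<le> (s' + d) powr q - s' powr q"
  \<comment> \<open>The convexity used below is that on the open half-line, so \<open>s = 0\<close>
    is left to superadditivity; a vanishing total length is excluded from the denominator of
    \<open>t\<close>.\<close>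
  proof (cases "s = 0 \<or> s' - s + d = 0")
    case True
    then consider "s = 0" | "s' = s" "d = 0" using assms by linarith
    then show ?thesis using assms powr_superadditive[of s' d q] by cases auto
  next
    case False
    let ?f = "\<lambda>x::real. x powr q"
    \<comment> \<open>\<open>s + d\<close> and \<open>s'\<close> are convex combinations of
      \<open>s\<close> and \<open>s' + d\<close> with interchanged coefficients; adding the two
      convexity inequalities gives the claim.\<close>
    define t where "t = d / (s' - s + d)"
    have pos: "0 < s" "0 < s' - s + d" using False assms by auto
    have t: "0 \<le> t" "t \<le> 1" using pos assms by (auto simp: t_def field_simps)
    have td: "t * (s' - s + d) = d" using pos by (simp add: t_def)
    have e1: "(1 - t) * s + t * (s' + d) = s + d" using td by (simp add: algebra_simps)
    have e2: "(1 - (1 - t)) * s + (1 - t) * (s' + d) = s'" using td by (simp add: algebra_simps)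
    have c: "convex_on {0<..} ?f" by (rule powr_convex[OF assms(1)])
    have "?f ((1 - t) *\<^sub>R s + t *\<^sub>R (s' + d)) \<le> (1 - t) * ?f s + t * ?f (s' + d)"
      using t pos assms by (intro convex_onD[OF c]) auto
    moreover have "?f ((1 - (1 - t)) *\<^sub>R s + (1 - t) *\<^sub>R (s' + d)) \<le> (1 - (1 - t)) * ?f s + (1 - t) * ?f (s' + d)"
      using t pos assms by (intro convex_onD[OF c]) auto
    ultimately show ?thesis unfolding real_scaleR_def e1 e2 by (simp add: algebra_simps)
  qed
  also have "\<dots> \<le> (s' + d') powr q - s' powr q" using assms by (intro diff_right_mono powr_mono2) auto
  finally show ?thesis .
qed

definition pdiff :: "real \<Rightarrow> (nat \<Rightarrow> 'a \<Rightarrow> real) \<Rightarrow> nat \<Rightarrow> 'a \<Rightarrow> real" where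
  "pdiff p A j y = (\<Sum>i<Suc j. A i y) powr p - (\<Sum>i<j. A i y) powr p"

lemma pdiff_nonneg:
  assumes "\<And>j. 0 \<le> A j y" "0 \<le> p"
  shows "0 \<le> pdiff p A j y"
  using assms by (auto simp: pdiff_def intro!: powr_mono2 sum_nonneg)

lemma pdiff_sum: "0 < p \<Longrightarrow> (\<Sum>j<n. pdiff p A j y) = (\<Sum>i<n. A i y) powr p"
  unfolding pdiff_def using sum_lessThan_telescope[of "\<lambda>j. (\<Sum>i<j. A i y) powr p" n]
  by (simp del: sum.lessThan_Suc)

text \<open>The telescoping argument: with \<open>S\<^sub>j = A\<^sub>0 + \<dots> + A\<^sub>j\<close> and \<open>D\<^sub>j = S\<^sub>j\<^sup>p - S\<^sub>j\<^sub>-\<^sub>1\<^sup>p\<close>, the increments of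
  \<open>V \<mapsto> V\<^bsup>1/p\<^esup>\<close> grow with both the base point and the step, which replaces the vector-valued
  maximal inequality.\<close>

lemma weighted_increment_le:
  fixes A w :: "nat \<Rightarrow> 'a \<Rightarrow> real" and E :: "nat \<Rightarrow> real"
  assumes p: "0 < p" "p \<le> 1" and A: "\<And>j y. 0 \<le> A j y" and w: "\<And>j y. 0 \<le> w j y"
    and dec: "\<And>j y. w (Suc j) y \<le> w j y"
    and E: "\<And>j y. w j y powr p * pdiff p A j y \<le> E j"
  shows "w j y * A j y \<le> (\<Sum>i<Suc j. E i) powr (1 / p) - (\<Sum>i<j. E i) powr (1 / p)"
proof -
  have dec': "w j y \<le> w i y" if "i \<le> j" for i j
    using lift_Suc_antimono_le[of "\<lambda>j. w j y", OF dec that] .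
  let ?S = "\<lambda>j. \<Sum>i<j. A i y"
  have S: "0 \<le> ?S j" for j using A by (simp add: sum_nonneg)
  let ?w = "w j y powr p"
  have E0: "0 \<le> E i" for i
    using E[of i y] pdiff_nonneg[of A y p i] A p by (meson mult_nonneg_nonneg order_trans powr_ge_zero less_imp_le)
  have r: "w j y * ?S i = (?w * (?S i) powr p) powr (1 / p)" for i
    using w[of j y] S[of i] p by (simp add: powr_mult powr_powr)
  have "w j y * A j y = w j y * ?S (Suc j) - w j y * ?S j" by (simp add: algebra_simps)
  also have "\<dots> = (?w * (?S j) powr p + ?w * pdiff p A j y) powr (1 / p) - (?w * (?S j) powr p) powr (1 / p)"
    unfolding r by (simp add: pdiff_def algebra_simps)
  also have "\<dots> \<le> ((\<Sum>i<j. E i) + E j) powr (1 / p) - (\<Sum>i<j. E i) powr (1 / p)"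
  proof (rule powr_increment_mono)
    show "1 \<le> 1 / p" using p by simp
    show "0 \<le> ?w * (?S j) powr p" by simp
    show "0 \<le> ?w * pdiff p A j y" using pdiff_nonneg[of A y p j] A p by simp
    show "?w * pdiff p A j y \<le> E j" by (rule E)
    have "?w * (?S j) powr p = (\<Sum>i<j. ?w * pdiff p A i y)"
      unfolding pdiff_sum[OF p(1), symmetric] sum_distrib_left ..
    also have "\<dots> \<le> (\<Sum>i<j. E i)"
    proof (rule sum_mono)
      fix i assume "i \<in> {..<j}"
      then have "?w * pdiff p A i y \<le> w i y powr p * pdiff p A i y"
        using w dec'[of i j] p pdiff_nonneg[of A y p i] A by (intro mult_right_mono powr_mono2) auto
      also have "\<dots> \<le> E i" by (rule E)
      finally show "?w * pdiff p A i y \<le> E i" .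
    qed
    finally show "?w * (?S j) powr p \<le> (\<Sum>i<j. E i)" .
  qed
  finally show ?thesis by simp
qed

text \<open>The bound of \<open>weighted_increment_le\<close> does not depend on \<open>y\<close>,
  so it passes to the suprema, and its right-hand sides telescope in \<open>j\<close>.\<close>

lemma weighted_sup_sum_powr_le:
  fixes A w :: "nat \<Rightarrow> 'a \<Rightarrow> real" and E :: "nat \<Rightarrow> ennreal"
  assumes p: "0 < p" "p \<le> 1" and A: "\<And>j y. 0 \<le> A j y" and w: "\<And>j y. 0 \<le> w j y"
    and dec: "\<And>j y. w (Suc j) y \<le> w j y"
    and E: "\<And>j y. ennreal (w j y powr p * pdiff p A j y) \<le> E j"
  shows "ennreal_powr (\<Sum>j. SUP y. ennreal (w j y * A j y)) p \<le> (\<Sum>j. E j)"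
\<comment> \<open>Telescoping involves subtraction; if the sum is finite, all \<open>E j\<close> are
  finite and can be treated as reals.\<close>
proof (cases "(\<Sum>j. E j) = \<infinity>")
  case True
  then show ?thesis by simp
next
  case False
  have "E j \<noteq> \<infinity>" for j
    using False sum_le_suminf[of E "{j}"] by (auto simp: top_unique)
  then have e: "0 \<le> enn2real (E j)" "E j = ennreal (enn2real (E j))" for j
    by (auto simp: less_top)
  define e where "e j = enn2real (E j)" for j
  note e = e[folded e_def]
  let ?b = "\<lambda>j. (\<Sum>i<Suc j. e i) powr (1 / p) - (\<Sum>i<j. e i) powr (1 / p)"
  have b: "w j y * A j y \<le> ?b j" for j y
  proof (rule weighted_increment_le[where p = p and A = A and w = w, OF p A w dec])
    show "w j y powr p * pdiff p A j y \<le> e j" for j y using E[of j y] e(1)[of j] unfolding e(2)[of j] by simp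
  qed
  have b0: "0 \<le> ?b j" for j using e p by (auto intro!: powr_mono2 sum_nonneg)
  show ?thesis
  proof (rule ennreal_powr_suminf_le[OF p(1)])
    fix n
    have "(\<Sum>j<n. SUP y. ennreal (w j y * A j y)) \<le> (\<Sum>j<n. ennreal (?b j))"
      by (intro sum_mono SUP_least ennreal_leI b)
    also have "\<dots> = ennreal ((\<Sum>i<n. e i) powr (1 / p))"
      using b0 p sum_lessThan_telescope[of "\<lambda>j. (\<Sum>i<j. e i) powr (1 / p)" n]
      by (simp del: sum.lessThan_Suc)
    finally have "ennreal_powr (\<Sum>j<n. SUP y. ennreal (w j y * A j y)) p \<le> ennreal_powr (ennreal ((\<Sum>i<n. e i) powr (1 / p))) p"
      using p by (intro ennreal_powr_mono) auto
    also have "\<dots> = ennreal (\<Sum>i<n. e i)" using p e by (simp add: ennreal_powr_ennreal powr_powr sum_nonneg)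
    also have "\<dots> = (\<Sum>i<n. E i)" unfolding e(2) using e(1) by simp
    also have "\<dots> \<le> (\<Sum>j. E j)" by (rule sum_le_suminf) auto
    finally show "ennreal_powr (\<Sum>j<n. SUP y. ennreal (w j y * A j y)) p \<le> (\<Sum>j. E j)" .
  qed
qed

subsection \<open>Integrals against the weights\<close>

abbreviation cw :: "('n::finite) itself \<Rightarrow> ennreal" where
  "cw _ \<equiv> (\<integral>\<^sup>+y. ennreal (wt (2 * CARD('n)) (norm (y::real^'n))) \<partial>lborel)"

lemma nn_integral_wt_scaled:
  fixes x :: "real^'n"
  assumes "0 < l"
  shows "ennreal (l ^ CARD('n)) * (\<integral>\<^sup>+y. ennreal (wt (2 * CARD('n)) (l * norm (x - y))) \<partial>lborel) = cw TYPE('n)"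
  using nn_integral_lborel_affine[of "\<lambda>y::real^'n. ennreal (wt (2 * CARD('n)) (norm y))" "-l" "l *\<^sub>R x"] assms
  by (simp add: scaleR_diff_right[symmetric])

text \<open>As \<open>D\<close> is constant on the cell of \<open>y\<close>, its value equals its
  mean there, and \<open>(2 powi j) ^ CARD('n)\<close> is the reciprocal volume of the cell;
  \<open>wt_quasi\<close> compares the weights at different points of the cell.\<close>

lemma cell_sup_le_integral:
  fixes D :: "real^'n \<Rightarrow> real"
  assumes D: "\<And>y. 0 \<le> D y" "\<And>y z. cell j y = cell j z \<Longrightarrow> D y = D z" and a: "0 \<le> a"
  shows "ennreal (wt a (2 powi j * norm (x - y)) * D y) \<le>
    ennreal ((1 + real CARD('n)) powr a * (2 powi j) ^ CARD('n)) * (\<integral>\<^sup>+z. ennreal (wt a (2 powi j * norm (x - z)) * D z) \<partial>lborel)"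
proof -
  let ?Q = "dyadic_cube j (cell j y)" and ?c = "(1 + real CARD('n)) powr a"
  let ?v = "wt a (2 powi j * norm (x - y)) * D y"
  have c: "0 < ?c" by (simp add: powr_gt_zero add_nonneg_pos)
  have le: "?v / ?c \<le> wt a (2 powi j * norm (x - z)) * D z" if "z \<in> ?Q" for z
  proof -
    have cz: "cell j z = cell j y" using that by (simp add: dyadic_cube_eq)
    have "wt a (2 powi j * norm (x - y)) \<le> ?c * wt a (2 powi j * norm (x - z))"
    proof (rule wt_quasi[OF _ _ _ _ a])
      have "norm (x - z) \<le> norm (x - y) + norm (y - z)"
        using norm_triangle_ineq[of "x - y" "y - z"] by simp
      then have "2 powi j * norm (x - z) \<le> 2 powi j * norm (x - y) + 2 powi j * norm (y - z)"
        using mult_left_mono[of _ _ "2 powi j :: real"] powi_2_pos[of j] by (simp add: distrib_left[symmetric])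
      then show "2 powi j * norm (x - z) \<le> 2 powi j * norm (x - y) + real CARD('n)"
        using cell_dist[OF cz[symmetric]] by linarith
    qed auto
    then have "?v \<le> (?c * wt a (2 powi j * norm (x - z))) * D z"
      unfolding D(2)[OF cz] by (rule mult_right_mono) (rule D)
    then show ?thesis using c by (simp add: field_simps)
  qed
  have v0: "0 \<le> ?v" using D(1) wt_pos[of "2 powi j * norm (x - y)" a] by (simp add: less_imp_le)
  have "ennreal (?v / ?c) * emeasure lborel ?Q = (\<integral>\<^sup>+z. ennreal (?v / ?c) * indicator ?Q z \<partial>lborel)"
    by (simp add: nn_integral_cmult_indicator)
  also have "\<dots> \<le> (\<integral>\<^sup>+z. ennreal (wt a (2 powi j * norm (x - z)) * D z) \<partial>lborel)"
    by (intro nn_integral_mono) (auto simp: indicator_def intro!: ennreal_leI le)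
  finally have "ennreal (?c * (2 powi j) ^ CARD('n)) * (ennreal (?v / ?c) * emeasure lborel ?Q) \<le>
      ennreal (?c * (2 powi j) ^ CARD('n)) * (\<integral>\<^sup>+z. ennreal (wt a (2 powi j * norm (x - z)) * D z) \<partial>lborel)"
    by (rule mult_left_mono) simp
  moreover have "ennreal (?c * (2 powi j) ^ CARD('n)) * (ennreal (?v / ?c) * emeasure lborel ?Q) = ennreal ?v"
  proof -
    have "?c * (2 powi j) ^ CARD('n) * (?v / ?c * (2 powi (- j)) ^ CARD('n)) = ?v * (2 powi j * 2 powi (- j)) ^ CARD('n)"
      using c by (simp add: power_mult_distrib field_simps)
    also have "\<dots> = ?v" by (simp add: power_int_minus)
    finally have "?c * (2 powi j) ^ CARD('n) * (?v / ?c * (2 powi (- j)) ^ CARD('n)) = ?v" .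
    then show ?thesis unfolding emeasure_dyadic_cube using v0 c
      by (simp add: ennreal_mult[symmetric] del: times_divide_eq_left)
  qed
  ultimately show ?thesis by simp
qed

text \<open>A weight at scale \<open>2\<^sup>-\<^sup>L\<close> is essentially constant on cells of level \<open>L\<close>, so that its integral
  against \<open>f\<close> only sees the averages of \<open>f\<close> over these cells.\<close>

lemma weighted_integral_le:
  fixes f :: "real^'n \<Rightarrow> ennreal" and L :: int
  assumes [measurable]: "f \<in> borel_measurable borel"
    and K: "\<And>m. (\<integral>\<^sup>+y. f y * indicator (dyadic_cube L m) y \<partial>lborel) \<le> K * emeasure lborel (dyadic_cube L m :: (real^'n) set)"
  shows "(\<integral>\<^sup>+y. ennreal (wt (2 * CARD('n)) (2 powi L * norm (x - y))) * f y \<partial>lborel) \<le>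
    ennreal ((1 + real CARD('n)) powr (2 * CARD('n)) * (2 powi (- L)) ^ CARD('n)) * cw TYPE('n) * K"
proof -
  let ?a = "real (2 * CARD('n))" and ?c = "(1 + real CARD('n)) powr (2 * CARD('n))"
  let ?\<omega> = "\<lambda>y. ennreal (wt ?a (2 powi L * norm (x - y)))"
  \<comment> \<open>Indicator of pairs in a common cell of level \<open>L\<close>. Its joint
    measurability, needed for exchanging integrals, holds because this set is a countable union of
    products of cubes.\<close>
  let ?q = "\<lambda>(y::real^'n) (z::real^'n). indicator {p. cell L (fst p) = cell L (snd p)} (y, z) :: ennreal"
  let ?v = "ennreal ((2 powi L) ^ CARD('n))"
  have [measurable]: "(\<lambda>p. ?q (fst p) (snd p)) \<in> borel_measurable (lborel \<Otimes>\<^sub>M lborel)"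
  proof -
    have "{p :: (real^'n) \<times> (real^'n). cell L (fst p) = cell L (snd p)} = (\<Union>m. dyadic_cube L m \<times> dyadic_cube L m)"
      by (auto simp: dyadic_cube_eq)
    moreover have "(\<Union>m::int^'n. dyadic_cube L m \<times> dyadic_cube L m) \<in> sets ((borel :: (real^'n) measure) \<Otimes>\<^sub>M (borel :: (real^'n) measure))"
      by (intro sets.countable_UN'' pair_measureI sets_dyadic_cube) auto
    moreover have "sets (borel \<Otimes>\<^sub>M borel) = sets ((lborel :: (real^'n) measure) \<Otimes>\<^sub>M (lborel :: (real^'n) measure))"
      by (rule sets_pair_measure_cong) simp_all
    ultimately have "{p :: (real^'n) \<times> (real^'n). cell L (fst p) = cell L (snd p)} \<in> sets ((lborel :: (real^'n) measure) \<Otimes>\<^sub>M (lborel :: (real^'n) measure))"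
      by (simp only:)
    then show ?thesis by simp
  qed
  have w0: "0 \<le> wt ?a (2 powi L * norm (x - z))" for z
    using wt_pos[of "2 powi L * norm (x - z)"] by (simp add: less_imp_le)
  have qw: "?q y z * ?\<omega> z = ennreal (wt ?a (2 powi L * norm (x - z)) * indicator (dyadic_cube L (cell L y)) z)" for y z
    using w0[of z] by (auto simp: indicator_def dyadic_cube_eq)
  \<comment> \<open>The weight at \<open>y\<close> is dominated by its mean over the cell of
    \<open>y\<close>, up to a constant; after the exchange of integrals \<open>f\<close> is
    integrated over the cell of \<open>z\<close> instead, where \<open>K\<close> applies.\<close>
  have \<omega>: "?\<omega> y \<le> ennreal ?c * ?v * (\<integral>\<^sup>+z. ?q y z * ?\<omega> z \<partial>lborel)" for y
  proof -
    let ?D = "\<lambda>z. indicator (dyadic_cube L (cell L y)) z :: real"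
    have "ennreal (wt ?a (2 powi L * norm (x - y)) * ?D y) \<le>
        ennreal (?c * (2 powi L) ^ CARD('n)) * (\<integral>\<^sup>+z. ennreal (wt ?a (2 powi L * norm (x - z)) * ?D z) \<partial>lborel)"
      by (rule cell_sup_le_integral) (auto simp: indicator_def dyadic_cube_eq)
    then show ?thesis unfolding qw by (simp add: dyadic_cube_eq ennreal_mult)
  qed
  have "(\<integral>\<^sup>+y. ?\<omega> y * f y \<partial>lborel) \<le> (\<integral>\<^sup>+y. (ennreal ?c * ?v * (\<integral>\<^sup>+z. ?q y z * ?\<omega> z \<partial>lborel)) * f y \<partial>lborel)"
    by (intro nn_integral_mono mult_right_mono \<omega>) simp
  also have "\<dots> = (\<integral>\<^sup>+y. (ennreal ?c * ?v) * (\<integral>\<^sup>+z. ?q y z * ?\<omega> z * f y \<partial>lborel) \<partial>lborel)"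
  proof (intro nn_integral_cong)
    fix y :: "real^'n"
    have "?q y = indicator (dyadic_cube L (cell L y))" by (auto simp: fun_eq_iff indicator_def dyadic_cube_eq)
    then have [measurable]: "?q y \<in> borel_measurable lborel" by simp
    have "(\<integral>\<^sup>+z. ?q y z * ?\<omega> z * f y \<partial>lborel) = (\<integral>\<^sup>+z. ?q y z * ?\<omega> z \<partial>lborel) * f y"
      by (rule nn_integral_multc) measurable
    then show "(ennreal ?c * ?v * (\<integral>\<^sup>+z. ?q y z * ?\<omega> z \<partial>lborel)) * f y =
        (ennreal ?c * ?v) * (\<integral>\<^sup>+z. ?q y z * ?\<omega> z * f y \<partial>lborel)" by (simp only: mult.assoc)
  qed
  also have "\<dots> = (ennreal ?c * ?v) * (\<integral>\<^sup>+y. (\<integral>\<^sup>+z. ?q y z * ?\<omega> z * f y \<partial>lborel) \<partial>lborel)"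
    by (intro nn_integral_cmult) measurable
  also have "(\<integral>\<^sup>+y. (\<integral>\<^sup>+z. ?q y z * ?\<omega> z * f y \<partial>lborel) \<partial>lborel) = (\<integral>\<^sup>+z. (\<integral>\<^sup>+y. ?q y z * ?\<omega> z * f y \<partial>lborel) \<partial>lborel)"
    by (rule lborel_pair.Fubini') measurable
  also have "\<dots> \<le> (\<integral>\<^sup>+z. ?\<omega> z * (K * ennreal ((2 powi (- L)) ^ CARD('n))) \<partial>lborel)"
  proof (rule nn_integral_mono)
    fix z :: "real^'n"
    have "(\<integral>\<^sup>+y. ?q y z * ?\<omega> z * f y \<partial>lborel) = (\<integral>\<^sup>+y. ?\<omega> z * (f y * indicator (dyadic_cube L (cell L z)) y) \<partial>lborel)"
      by (intro nn_integral_cong) (auto simp: indicator_def dyadic_cube_eq)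
    also have "\<dots> = ?\<omega> z * (\<integral>\<^sup>+y. f y * indicator (dyadic_cube L (cell L z)) y \<partial>lborel)"
      by (rule nn_integral_cmult) measurable
    also have "\<dots> \<le> ?\<omega> z * (K * ennreal ((2 powi (- L)) ^ CARD('n)))"
      using K[of "cell L z"] unfolding emeasure_dyadic_cube by (intro mult_left_mono) auto
    finally show "(\<integral>\<^sup>+y. ?q y z * ?\<omega> z * f y \<partial>lborel) \<le> ?\<omega> z * (K * ennreal ((2 powi (- L)) ^ CARD('n)))" .
  qed
  also have "\<dots> = (\<integral>\<^sup>+z. ?\<omega> z \<partial>lborel) * (K * ennreal ((2 powi (- L)) ^ CARD('n)))"
    by (rule nn_integral_multc) measurable
  finally have "(\<integral>\<^sup>+y. ?\<omega> y * f y \<partial>lborel) \<le> ennreal ?c * ?v * ((\<integral>\<^sup>+z. ?\<omega> z \<partial>lborel) * (K * ennreal ((2 powi (- L)) ^ CARD('n))))"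
    by (simp add: mult_left_mono)
  also have "\<dots> = ennreal ?c * ennreal ((2 powi (- L)) ^ CARD('n)) * (?v * (\<integral>\<^sup>+z. ?\<omega> z \<partial>lborel)) * K"
    by (simp add: mult_ac)
  also have "?v * (\<integral>\<^sup>+z. ?\<omega> z \<partial>lborel) = cw TYPE('n)"
    using nn_integral_wt_scaled[of "2 powi L" x] by simp
  finally show ?thesis by (simp add: ennreal_mult)
qed

subsection \<open>The Morrey quasi-norm of sums of step functions\<close>

lemma ennreal_scale_le_iff:
  assumes "0 < a" "0 < v"
  shows "ennreal a * (X / ennreal v) \<le> Y \<longleftrightarrow> X \<le> Y * ennreal (1 / a) * ennreal v"
proof (cases X)
  case (real x)
  show ?thesis
  proof (cases Y)
    case (real y)
    then show ?thesis using \<open>X = ennreal x\<close> \<open>0 \<le> x\<close> assms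
      by (simp add: divide_ennreal ennreal_mult[symmetric] field_simps del: ennreal_mult)
  next
    case top
    then show ?thesis using assms by (simp add: ennreal_top_mult)
  qed
next
  case top
  then show ?thesis using assms
    by (cases Y) (auto simp: ennreal_top_divide ennreal_mult_top ennreal_top_mult ennreal_mult[symmetric] top_unique)
qed

lemma emeasure_lebesgue_dyadic_cube:
  fixes m :: "int^'n"
  shows "emeasure lebesgue (dyadic_cube L m) = ennreal ((2 powi (- L)) ^ CARD('n))"
  using emeasure_dyadic_cube[of L m] by (simp add: sets_dyadic_cube)

text \<open>Taking powers and multiplying out turns the supremum into one integral inequality per
  cube, free of roots and quotients; the estimates of Morrey quasi-norms go through this
  form.\<close>

lemma morrey_norm_le_iff:
  fixes F :: "real^'n \<Rightarrow> ennreal"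
  assumes q: "0 < q" and \<phi>: "\<And>t. 0 < t \<Longrightarrow> 0 < \<phi> t"
  shows "morrey_norm \<phi> q F \<le> N \<longleftrightarrow> (\<forall>L m.
    (\<integral>\<^sup>+y. ennreal_powr (F y) q * indicator (dyadic_cube L m) y \<partial>lborel) \<le>
    ennreal_powr N q * ennreal (\<phi> (2 powi (- L)) powr (- q)) * ennreal ((2 powi (- L)) ^ CARD('n)))"
proof -
  have "ennreal (\<phi> (side_length Q)) * ennreal_powr ((\<integral>\<^sup>+y\<in>Q. ennreal_powr (F y) q \<partial>lebesgue) / emeasure lebesgue Q) (1 / q) \<le> N \<longleftrightarrow>
    (\<integral>\<^sup>+y. ennreal_powr (F y) q * indicator Q y \<partial>lborel) \<le>
    ennreal_powr N q * ennreal (\<phi> (2 powi (- L)) powr (- q)) * ennreal ((2 powi (- L)) ^ CARD('n))"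
    if Q: "Q = dyadic_cube L m" for Q L and m :: "int^'n"
  proof -
    have f: "0 < \<phi> (2 powi (- L))" by (rule \<phi>) simp
    let ?X = "(\<integral>\<^sup>+y. ennreal_powr (F y) q * indicator Q y \<partial>lborel)"
    let ?V = "ennreal ((2 powi (- L)) ^ CARD('n))"
    have "ennreal (\<phi> (side_length Q)) * ennreal_powr ((\<integral>\<^sup>+y\<in>Q. ennreal_powr (F y) q \<partial>lebesgue) / emeasure lebesgue Q) (1 / q)
      = ennreal_powr (ennreal (\<phi> (2 powi (- L)) powr q) * (?X / ?V)) (1 / q)"
      unfolding Q side_length_dyadic_cube emeasure_lebesgue_dyadic_cube nn_integral_completion
      using q f by (simp add: ennreal_powr_mult ennreal_powr_ennreal powr_powr)
    also have "\<dots> \<le> N \<longleftrightarrow> ennreal (\<phi> (2 powi (- L)) powr q) * (?X / ?V) \<le> ennreal_powr N q"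
      using q by (subst ennreal_powr_le_iff) auto
    also have "\<dots> \<longleftrightarrow> ?X \<le> ennreal_powr N q * ennreal (1 / \<phi> (2 powi (- L)) powr q) * ?V"
      using f by (intro ennreal_scale_le_iff) auto
    finally show ?thesis by (simp add: powr_minus divide_inverse)
  qed
  then show ?thesis unfolding morrey_norm_def SUP_le_iff dyadic_cubes_def by blast
qed

lemma suminf_split_ennreal:
  fixes f g h :: "nat \<Rightarrow> ennreal"
  assumes "\<And>j. f j \<le> g j + h j"
  shows "(\<Sum>j. f j) \<le> (\<Sum>j. g j) + (\<Sum>j. h j)"
  using suminf_le[of f "\<lambda>j. g j + h j"] assms by (simp add: suminf_add)

text \<open>The telescoping argument leads to single-scale integrals of \<open>pdiff p A j\<close>.
  On the test cube the exponent \<open>4 * CARD('n)\<close> is halved: one half, integrated in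
  \<open>x\<close>, cancels the reciprocal cell volume; the other half, weakened to the scale of the
  cube, no longer depends on \<open>j\<close>, and the differences sum up to at most the power of
  the full sum. A measurable majorant \<open>G\<close> is produced so that its integral can later be
  split additively.\<close>

lemma fine_levels_estimate:
  fixes A :: "nat \<Rightarrow> real^'n \<Rightarrow> real" and L :: int
  assumes p: "0 < p" "p \<le> 1" and A: "\<And>j y. 0 \<le> A j y" "\<And>j. A j \<in> borel_measurable borel"
    and cell: "\<And>j y z. cell (int j) y = cell (int j) z \<Longrightarrow> A j y = A j z"
    and L: "\<And>j y. int j < L \<Longrightarrow> A j y = 0"
    and K: "\<And>m. (\<integral>\<^sup>+y. ennreal_powr (\<Sum>j. ennreal (A j y)) p * indicator (dyadic_cube L m) y \<partial>lborel)
      \<le> K * emeasure lborel (dyadic_cube L m :: (real^'n) set)"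
  shows "\<exists>G\<in>borel_measurable borel.
    (\<forall>x. ennreal_powr (\<Sum>j. SUP y. ennreal (wt (4 * CARD('n) / p) (2 powi j * norm (x - y)) * A j y)) p \<le> G x) \<and>
    (\<integral>\<^sup>+x. G x * indicator (dyadic_cube L m) x \<partial>lborel)
    \<le> ennreal ((1 + real CARD('n)) powr (8 * CARD('n))) * cw TYPE('n) * cw TYPE('n) * K * ennreal ((2 powi (- L)) ^ CARD('n))"
proof -
  let ?n = "real CARD('n)"
  let ?D = "pdiff p A" and ?Q = "dyadic_cube L m :: (real^'n) set"
  let ?c4 = "(1 + ?n) powr (4 * ?n)" and ?c2 = "(1 + ?n) powr (2 * ?n)"
  let ?v = "\<lambda>j::nat. ennreal ((2 powi int j) ^ CARD('n))"
  let ?w4 = "\<lambda>j x z. wt (4 * ?n) (2 powi int j * norm (x - z))"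
  let ?w2 = "\<lambda>j x z. wt (2 * ?n) (2 powi int j * norm (x - z))"
  note [measurable] = A(2)
  have D0: "0 \<le> ?D j y" for j y using A p by (intro pdiff_nonneg) auto
  have Dm[measurable]: "?D j \<in> borel_measurable borel" for j unfolding pdiff_def by measurable
  have Dc: "?D j y = ?D j z" if "cell (int j) y = cell (int j) z" for j y z
  proof -
    have "A i y = A i z" if "i \<le> j" for i
      by (rule cell, rule cell_refine[OF \<open>cell (int j) y = cell (int j) z\<close>]) (use that in simp)
    then show ?thesis unfolding pdiff_def by (auto intro!: arg_cong2[where f = "(-)"] arg_cong2[where f = "(powr)"] sum.cong)
  qed
  have DL: "?D j y = 0" if "int j < L" for j y
    using L that p by (simp add: pdiff_def)
  \<comment> \<open>The bound from \<open>cell_sup_le_integral\<close> at level \<open>j\<close>; it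
    applies because \<open>pdiff p A j\<close> involves only levels up to \<open>j\<close>, all
    constant on cells of level \<open>j\<close>.\<close>
  define E where "E j x = ennreal ?c4 * ?v j * (\<integral>\<^sup>+z. ennreal (?w4 j x z * ?D j z) \<partial>lborel)" for j x
  have [measurable]: "E j \<in> borel_measurable borel" for j unfolding E_def by measurable
  have pw: "ennreal_powr (\<Sum>j. SUP y. ennreal (wt (4 * CARD('n) / p) (2 powi j * norm (x - y)) * A j y)) p \<le> (\<Sum>j. E j x)" for x
  proof (rule weighted_sup_sum_powr_le[OF p A(1)])
    show "0 \<le> wt (4 * CARD('n) / p) (2 powi int j * norm (x - y))" for j y
      using wt_pos[of "2 powi int j * norm (x - y)"] by (simp add: less_imp_le)
    show "wt (4 * CARD('n) / p) (2 powi int (Suc j) * norm (x - y)) \<le> wt (4 * CARD('n) / p) (2 powi int j * norm (x - y))" for j y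
      using p by (intro wt_antimono mult_right_mono) (auto simp: power_int_of_nat simp del: of_nat_Suc)
    show "ennreal (wt (4 * CARD('n) / p) (2 powi int j * norm (x - y)) powr p * ?D j y) \<le> E j x" for j y
    proof -
      have "ennreal (?w4 j x y * ?D j y) \<le> E j x"
      proof -
        have "ennreal (?w4 j x y * ?D j y) \<le> ennreal (?c4 * (2 powi int j) ^ CARD('n)) * (\<integral>\<^sup>+z. ennreal (?w4 j x z * ?D j z) \<partial>lborel)"
          by (rule cell_sup_le_integral[OF D0 Dc]) auto
        then show ?thesis unfolding E_def by (simp add: ennreal_mult)
      qed
      then show ?thesis using p by (simp add: wt_powr)
    qed
  qed
  \<comment> \<open>The lower corner stands for all points of \<open>?Q\<close>, so that the
    remaining weight does not depend on \<open>x\<close>.\<close>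
  define x0 :: "real^'n" where "x0 = (\<chi> k. 2 powi (- L) * of_int (m $ k))"
  have x0: "cell L x0 = m"
    by (simp add: cell_def x0_def vec_eq_iff power_int_minus mult.assoc[symmetric])
  let ?\<omega> = "\<lambda>z. wt (2 * ?n) (2 powi L * norm (x0 - z))"
  have w0: "0 \<le> wt a (2 powi j * norm (x - z))" for a j and x z :: "real^'n"
    using wt_pos[of "2 powi j * norm (x - z)"] by (simp add: less_imp_le)
  have wle: "?w4 j x z * ?D j z \<le> ?c2 * (?\<omega> z * ?D j z) * ?w2 j x z" if x: "x \<in> ?Q" for j x z
  proof (cases "int j < L")
    case True
    then show ?thesis using DL by simp
  next
    case False
    have "?w4 j x z = ?w2 j x z * ?w2 j x z"
      using wt_add[of "2 powi int j * norm (x - z)" "2 * ?n" "2 * ?n"] by simp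
    \<comment> \<open>Levels with \<open>j < L\<close> contribute nothing, so here the scale may be
      coarsened from \<open>j\<close> to \<open>L\<close>.\<close>
    also have "\<dots> \<le> ?w2 j x z * wt (2 * ?n) (2 powi L * norm (x - z))"
      using False by (intro mult_left_mono wt_antimono mult_right_mono w0 power_int_increasing) auto
    also have "\<dots> \<le> ?w2 j x z * (?c2 * ?\<omega> z)"
    proof (intro mult_left_mono wt_quasi w0)
      have "norm (x0 - z) \<le> norm (x - z) + norm (x - x0)"
        using norm_triangle_ineq4[of "x - z" "x - x0"] by simp
      then have "2 powi L * norm (x0 - z) \<le> 2 powi L * norm (x - z) + 2 powi L * norm (x - x0)"
        using mult_left_mono[of _ _ "2 powi L :: real"] by (simp add: distrib_left[symmetric])
      moreover have "2 powi L * norm (x - x0) \<le> ?n"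
        using x x0 by (intro cell_dist) (simp add: dyadic_cube_eq)
      ultimately show "2 powi L * norm (x0 - z) \<le> 2 powi L * norm (x - z) + ?n" by linarith
    qed auto
    finally have "?w4 j x z * ?D j z \<le> (?w2 j x z * (?c2 * ?\<omega> z)) * ?D j z"
      by (rule mult_right_mono) (rule D0)
    then show ?thesis by (simp add: mult_ac)
  qed
  have EQ: "(\<integral>\<^sup>+x. E j x * indicator ?Q x \<partial>lborel) \<le> ennreal ?c4 * ennreal ?c2 * cw TYPE('n) * (\<integral>\<^sup>+z. ennreal (?\<omega> z * ?D j z) \<partial>lborel)" for j
  proof -
    have "(\<integral>\<^sup>+x. E j x * indicator ?Q x \<partial>lborel) =
      (\<integral>\<^sup>+x. (ennreal ?c4 * ?v j) * (\<integral>\<^sup>+z. ennreal (?w4 j x z * ?D j z) * indicator ?Q x \<partial>lborel) \<partial>lborel)"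
      unfolding E_def
      by (intro nn_integral_cong) (simp add: mult.assoc nn_integral_multc)
    also have e0: "\<dots> = (ennreal ?c4 * ?v j) * (\<integral>\<^sup>+x. (\<integral>\<^sup>+z. ennreal (?w4 j x z * ?D j z) * indicator ?Q x \<partial>lborel) \<partial>lborel)"
      by (intro nn_integral_cmult) measurable
    finally have e1: "(\<integral>\<^sup>+x. E j x * indicator ?Q x \<partial>lborel) =
      (ennreal ?c4 * ?v j) * (\<integral>\<^sup>+x. (\<integral>\<^sup>+z. ennreal (?w4 j x z * ?D j z) * indicator ?Q x \<partial>lborel) \<partial>lborel)" .
    have e2: "(\<integral>\<^sup>+x. (\<integral>\<^sup>+z. ennreal (?w4 j x z * ?D j z) * indicator ?Q x \<partial>lborel) \<partial>lborel) =
       (\<integral>\<^sup>+z. (\<integral>\<^sup>+x. ennreal (?w4 j x z * ?D j z) * indicator ?Q x \<partial>lborel) \<partial>lborel)"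
      by (rule lborel_pair.Fubini') measurable
    have e3: "(\<integral>\<^sup>+z. (\<integral>\<^sup>+x. ennreal (?w4 j x z * ?D j z) * indicator ?Q x \<partial>lborel) \<partial>lborel)
      \<le> (\<integral>\<^sup>+z. (\<integral>\<^sup>+x. ennreal (?c2 * (?\<omega> z * ?D j z)) * ennreal (?w2 j x z) \<partial>lborel) \<partial>lborel)"
    proof (intro nn_integral_mono)
      fix z x :: "real^'n"
      have "ennreal (?c2 * (?\<omega> z * ?D j z)) * ennreal (?w2 j x z) = ennreal (?c2 * (?\<omega> z * ?D j z) * ?w2 j x z)"
        by (intro ennreal_mult[symmetric] mult_nonneg_nonneg w0 D0) simp
      then show "ennreal (?w4 j x z * ?D j z) * indicator ?Q x \<le> ennreal (?c2 * (?\<omega> z * ?D j z)) * ennreal (?w2 j x z)"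
        using ennreal_leI[OF wle[of x j z]] by (cases "x \<in> ?Q") simp_all
    qed
    have e4: "(\<integral>\<^sup>+z. (\<integral>\<^sup>+x. ennreal (?c2 * (?\<omega> z * ?D j z)) * ennreal (?w2 j x z) \<partial>lborel) \<partial>lborel)
      = (\<integral>\<^sup>+z. ennreal (?c2 * (?\<omega> z * ?D j z)) * (\<integral>\<^sup>+x. ennreal (?w2 j x z) \<partial>lborel) \<partial>lborel)"
      by (intro nn_integral_cong nn_integral_cmult) measurable
    have "(\<integral>\<^sup>+x. E j x * indicator ?Q x \<partial>lborel) \<le>
        (ennreal ?c4 * ?v j) * (\<integral>\<^sup>+z. ennreal (?c2 * (?\<omega> z * ?D j z)) * (\<integral>\<^sup>+x. ennreal (?w2 j x z) \<partial>lborel) \<partial>lborel)"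
      unfolding e1 e2 e4[symmetric] by (rule mult_left_mono[OF e3]) simp
    also have "\<dots> = ennreal ?c4 * (\<integral>\<^sup>+z. ?v j * (ennreal (?c2 * (?\<omega> z * ?D j z)) * (\<integral>\<^sup>+x. ennreal (?w2 j x z) \<partial>lborel)) \<partial>lborel)"
      unfolding mult.assoc by (intro arg_cong2[where f = "(*)"] refl nn_integral_cmult[symmetric]) measurable
    also have "\<dots> = ennreal ?c4 * (\<integral>\<^sup>+z. (ennreal ?c2 * cw TYPE('n)) * ennreal (?\<omega> z * ?D j z) \<partial>lborel)"
    proof -
      have "?v j * (\<integral>\<^sup>+x. ennreal (?w2 j x z) \<partial>lborel) = cw TYPE('n)" for z :: "real^'n"
        using nn_integral_wt_scaled[of "2 powi int j" z] by (simp add: norm_minus_commute)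
      then have "?v j * (ennreal (?c2 * (?\<omega> z * ?D j z)) * (\<integral>\<^sup>+x. ennreal (?w2 j x z) \<partial>lborel)) =
          (ennreal ?c2 * cw TYPE('n)) * ennreal (?\<omega> z * ?D j z)" for z :: "real^'n"
      proof -
        have "ennreal (?c2 * (?\<omega> z * ?D j z)) = ennreal ?c2 * ennreal (?\<omega> z * ?D j z)"
          by (intro ennreal_mult mult_nonneg_nonneg w0 D0) simp
        then have "?v j * (ennreal (?c2 * (?\<omega> z * ?D j z)) * (\<integral>\<^sup>+x. ennreal (?w2 j x z) \<partial>lborel)) =
          ennreal ?c2 * ennreal (?\<omega> z * ?D j z) * (?v j * (\<integral>\<^sup>+x. ennreal (?w2 j x z) \<partial>lborel))"
          by (simp only: mult_ac)
        then show ?thesis unfolding \<open>\<And>z. ?v j * (\<integral>\<^sup>+x. ennreal (?w2 j x z) \<partial>lborel) = cw TYPE('n)\<close> by (simp only: mult_ac)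
      qed
      then show ?thesis by simp
    qed
    also have "\<dots> = ennreal ?c4 * ennreal ?c2 * cw TYPE('n) * (\<integral>\<^sup>+z. ennreal (?\<omega> z * ?D j z) \<partial>lborel)"
      by (subst nn_integral_cmult) (measurable, simp add: mult.assoc)
    finally show ?thesis .
  qed
  let ?S = "\<lambda>y. ennreal_powr (\<Sum>j. ennreal (A j y)) p"
  have DS: "(\<Sum>j. ennreal (?D j z)) \<le> ?S z" for z
  proof (rule suminf_ennreal_least)
    fix k
    have "(\<Sum>j<k. ennreal (?D j z)) = ennreal_powr (ennreal (\<Sum>j<k. A j z)) p"
      using D0 A(1) p by (simp add: pdiff_sum ennreal_powr_ennreal sum_nonneg)
    also have "\<dots> = ennreal_powr (\<Sum>j<k. ennreal (A j z)) p" using A(1) by simp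
    also have "\<dots> \<le> ?S z" using p by (intro ennreal_powr_mono sum_le_suminf) auto
    finally show "(\<Sum>j<k. ennreal (?D j z)) \<le> ?S z" .
  qed
  have "(\<integral>\<^sup>+x. (\<Sum>j. E j x) * indicator ?Q x \<partial>lborel) \<le> (\<integral>\<^sup>+x. (\<Sum>j. E j x * indicator ?Q x) \<partial>lborel)"
    by (intro nn_integral_mono) (auto simp: indicator_def)
  also have "\<dots> = (\<Sum>j. \<integral>\<^sup>+x. E j x * indicator ?Q x \<partial>lborel)"
    by (rule nn_integral_suminf) measurable
  also have "\<dots> \<le> (\<Sum>j. ennreal ?c4 * ennreal ?c2 * cw TYPE('n) * (\<integral>\<^sup>+z. ennreal (?\<omega> z * ?D j z) \<partial>lborel))"
    by (intro suminf_le EQ) auto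
  also have "\<dots> = ennreal ?c4 * ennreal ?c2 * cw TYPE('n) * (\<integral>\<^sup>+z. (\<Sum>j. ennreal (?\<omega> z * ?D j z)) \<partial>lborel)"
  proof -
    have "(\<lambda>z. ennreal (?\<omega> z * ?D j z)) \<in> borel_measurable lborel" for j by measurable
    then show ?thesis by (simp only: nn_integral_suminf ennreal_suminf_cmult)
  qed
  also have "(\<integral>\<^sup>+z. (\<Sum>j. ennreal (?\<omega> z * ?D j z)) \<partial>lborel) \<le> (\<integral>\<^sup>+z. ennreal (?\<omega> z) * ?S z \<partial>lborel)"
  proof (intro nn_integral_mono)
    fix z
    have "(\<Sum>j. ennreal (?\<omega> z * ?D j z)) = ennreal (?\<omega> z) * (\<Sum>j. ennreal (?D j z))"
      unfolding ennreal_mult[OF w0 D0] by (rule ennreal_suminf_cmult)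
    then show "(\<Sum>j. ennreal (?\<omega> z * ?D j z)) \<le> ennreal (?\<omega> z) * ?S z"
      using mult_left_mono[OF DS, of "ennreal (?\<omega> z)" z] by simp
  qed
  also have "(\<integral>\<^sup>+z. ennreal (?\<omega> z) * ?S z \<partial>lborel) \<le> ennreal (?c2 * (2 powi (- L)) ^ CARD('n)) * cw TYPE('n) * K"
    using weighted_integral_le[of ?S L K x0] K by simp
  finally have "(\<integral>\<^sup>+x. (\<Sum>j. E j x) * indicator ?Q x \<partial>lborel)
    \<le> ennreal ?c4 * ennreal ?c2 * cw TYPE('n) * (ennreal (?c2 * (2 powi (- L)) ^ CARD('n)) * cw TYPE('n) * K)"
    by (simp add: mult_left_mono)
  also have "\<dots> = ennreal (?c4 * ?c2 * ?c2) * cw TYPE('n) * cw TYPE('n) * K * ennreal ((2 powi (- L)) ^ CARD('n))"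
    by (simp add: ennreal_mult mult_ac)
  \<comment> \<open>One constant from passing to integrals, one from moving the base point to
    \<open>x0\<close>, one from \<open>weighted_integral_le\<close>.\<close>
  also have "?c4 * ?c2 * ?c2 = (1 + ?n) powr (8 * CARD('n))"
    by (simp add: powr_add[symmetric])
  finally show ?thesis using pw by (intro bexI[of _ "\<lambda>x. \<Sum>j. E j x"]) auto
qed

text \<open>The two summands account for levels finer and coarser than the test cube; the root
  undoes the power \<open>q\<close> in which both are estimated.\<close>

definition morrey_step_const :: "('n::finite) itself \<Rightarrow> real \<Rightarrow> real \<Rightarrow> real \<Rightarrow> ennreal" where
  "morrey_step_const T p q C0 = ennreal_powr (ennreal ((1 + real CARD('n)) powr (8 * CARD('n))) * cw T * cw T
     + ennreal (C0 powr p)) (1 / q)"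

lemma morrey_step_const_finite: "morrey_step_const TYPE('n::finite) p q C0 < \<infinity>"
proof -
  have "ennreal ((1 + real CARD('n)) powr (8 * CARD('n))) * cw TYPE('n) * cw TYPE('n) + ennreal (C0 powr p) < \<infinity>"
    using nn_integral_wt[where 'n = 'n] by (simp add: ennreal_mult_less_top)
  then show ?thesis unfolding morrey_step_const_def ennreal_powr_def by auto
qed

text \<open>On a test cube of level \<open>L\<close> the series is cut at \<open>L\<close>: finer
  levels go to \<open>fine_levels_estimate\<close>, a coarser one is bounded pointwise through its
  own cell. \<open>I\<close> lists the levels present and \<open>H\<close> sums their contributions;
  the set is everything in the Triebel-Lizorkin case and a short window in the Besov case.\<close>

lemma morrey_step:
  fixes A :: "nat \<Rightarrow> real^'n \<Rightarrow> real"
  assumes p: "0 < p" "p \<le> 1" and q: "0 < q" and \<phi>: "\<And>t. 0 < t \<Longrightarrow> 0 < \<phi> t" and C0: "0 \<le> C0"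
    and A: "\<And>j y. 0 \<le> A j y" "\<And>j. A j \<in> borel_measurable borel"
    and cell: "\<And>j y z. cell (int j) y = cell (int j) z \<Longrightarrow> A j y = A j z"
    and I: "\<And>j y. j \<notin> I \<Longrightarrow> A j y = 0"
    and H: "\<And>L. (\<Sum>j. if j \<in> I \<and> int j < L then ennreal (\<phi> (2 powi (- int j)) powr (- (q / p))) else 0)
      \<le> ennreal (C0 * \<phi> (2 powi (- L)) powr (- (q / p)))"
  shows "morrey_norm \<phi> q (\<lambda>x. ennreal_powr (\<Sum>j. SUP y. ennreal (wt (4 * CARD('n) / p) (2 powi j * norm (x - y)) * A j y)) (p / q))
    \<le> morrey_step_const TYPE('n) p q C0 * morrey_norm \<phi> q (\<lambda>x. ennreal_powr (\<Sum>j. ennreal (A j x)) (p / q))"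
proof -
  let ?N = "morrey_norm \<phi> q (\<lambda>x. ennreal_powr (\<Sum>j. ennreal (A j x)) (p / q))"
  let ?Nq = "ennreal_powr ?N q"
  let ?w = "\<lambda>j x y. wt (4 * CARD('n) / p) (2 powi int j * norm (x - y))"
  let ?S = "\<lambda>y. \<Sum>j. ennreal (A j y)"
  let ?Cf = "ennreal ((1 + real CARD('n)) powr (8 * CARD('n))) * cw TYPE('n) * cw TYPE('n)"
  note [measurable] = A(2)
  have pq: "ennreal_powr (ennreal_powr X (p / q)) q = ennreal_powr X p" for X
    using q by (simp add: ennreal_powr_powr)
  have N: "(\<integral>\<^sup>+y. ennreal_powr (?S y) p * indicator (dyadic_cube L m) y \<partial>lborel) \<le>
      ?Nq * ennreal (\<phi> (2 powi (- L)) powr (- q)) * ennreal ((2 powi (- L)) ^ CARD('n))" for L m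
    using morrey_norm_le_iff[where \<phi> = \<phi> and q = q and F = "\<lambda>x. ennreal_powr (?S x) (p / q)" and N = ?N, OF q \<phi>] unfolding pq by auto
  \<comment> \<open>\<open>A j\<close> is constant on its own cell and lies below the full sum, so
    the Morrey inequality on that cell bounds its value.\<close>
  have c4: "ennreal_powr (ennreal (A j y)) p \<le> ?Nq * ennreal (\<phi> (2 powi (- int j)) powr (- q))" for j y
  proof -
    let ?P = "dyadic_cube (int j) (cell (int j) y) :: (real^'n) set" and ?V = "(2 powi (- int j) :: real) ^ CARD('n)"
    have V: "0 < ?V" by simp
    have "ennreal_powr (ennreal (A j y)) p * ennreal ?V = (\<integral>\<^sup>+z. ennreal_powr (ennreal (A j y)) p * indicator ?P z \<partial>lborel)"
      by (simp add: nn_integral_cmult_indicator emeasure_dyadic_cube)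
    also have "\<dots> \<le> (\<integral>\<^sup>+z. ennreal_powr (?S z) p * indicator ?P z \<partial>lborel)"
    proof (intro nn_integral_mono)
      fix z
      show "ennreal_powr (ennreal (A j y)) p * indicator ?P z \<le> ennreal_powr (?S z) p * indicator ?P z"
      proof (cases "z \<in> ?P")
        case True
        then have "A j y = A j z" by (intro cell) (simp add: dyadic_cube_eq)
        then have "ennreal (A j y) \<le> ?S z" using sum_le_suminf[of "\<lambda>j. ennreal (A j z)" "{j}"] by simp
        then show ?thesis using p by (intro mult_right_mono ennreal_powr_mono) auto
      qed simp
    qed
    also have "\<dots> \<le> ?Nq * ennreal (\<phi> (2 powi (- int j)) powr (- q)) * ennreal ?V" by (rule N)
    finally show ?thesis
      using V ennreal_mult_le_mult_iff[of "ennreal ?V" "ennreal_powr (ennreal (A j y)) p" "?Nq * ennreal (\<phi> (2 powi (- int j)) powr (- q))"]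
      by (simp add: mult.commute)
  qed
  have main: "(\<integral>\<^sup>+x. ennreal_powr (\<Sum>j. SUP y. ennreal (?w j x y * A j y)) p * indicator (dyadic_cube L m) x \<partial>lborel)
    \<le> (?Cf + ennreal (C0 powr p)) * ?Nq * ennreal (\<phi> (2 powi (- L)) powr (- q)) * ennreal ((2 powi (- L)) ^ CARD('n))" for L m
  proof -
    let ?K = "?Nq * ennreal (\<phi> (2 powi (- L)) powr (- q))" and ?V = "ennreal ((2 powi (- L)) ^ CARD('n))"
    let ?Q = "dyadic_cube L m :: (real^'n) set"
    define A1 where "A1 j y = (if int j < L then 0 else A j y)" for j y
    have A1: "0 \<le> A1 j y" "A1 j \<in> borel_measurable borel" "A1 j y \<le> A j y" for j y
      using A unfolding A1_def[abs_def] by auto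
    let ?B1 = "\<lambda>x. \<Sum>j. SUP y. ennreal (?w j x y * A1 j y)"
    \<comment> \<open>Total contribution of the coarse levels: the bounds \<open>c4\<close>, with
      weights replaced by one, summed by \<open>H\<close>.\<close>
    let ?b = "ennreal_powr ?Nq (1 / p) * ennreal (C0 * \<phi> (2 powi (- L)) powr (- (q / p)))"
    have "\<exists>G\<in>borel_measurable borel. (\<forall>x. ennreal_powr (?B1 x) p \<le> G x) \<and>
      (\<integral>\<^sup>+x. G x * indicator ?Q x \<partial>lborel) \<le> ?Cf * ?K * ?V"
    proof (rule fine_levels_estimate[OF p A1(1,2)])
      show "A1 j y = A1 j z" if "cell (int j) y = cell (int j) z" for j y z
        using cell[OF that] by (simp add: A1_def)
      show "A1 j y = 0" if "int j < L" for j y using that by (simp add: A1_def)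
      fix m' :: "int^'n"
      have "(\<integral>\<^sup>+y. ennreal_powr (\<Sum>j. ennreal (A1 j y)) p * indicator (dyadic_cube L m') y \<partial>lborel)
        \<le> (\<integral>\<^sup>+y. ennreal_powr (?S y) p * indicator (dyadic_cube L m') y \<partial>lborel)"
        using p A1(3) by (intro nn_integral_mono mult_right_mono ennreal_powr_mono suminf_le ennreal_leI) auto
      also have "\<dots> \<le> ?K * ?V" by (rule N)
      finally show "(\<integral>\<^sup>+y. ennreal_powr (\<Sum>j. ennreal (A1 j y)) p * indicator (dyadic_cube L m') y \<partial>lborel)
        \<le> ?K * emeasure lborel (dyadic_cube L m' :: (real^'n) set)"
        by (simp add: emeasure_dyadic_cube)
    qed
    then obtain G where [measurable]: "G \<in> borel_measurable borel"
      and G: "\<And>x. ennreal_powr (?B1 x) p \<le> G x" "(\<integral>\<^sup>+x. G x * indicator ?Q x \<partial>lborel) \<le> ?Cf * ?K * ?V"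
      by blast
    have coarse: "(\<Sum>j. SUP y. ennreal (?w j x y * A j y)) \<le> ?B1 x + ?b" for x
    proof -
      let ?g = "\<lambda>j. if j \<in> I \<and> int j < L then ennreal (\<phi> (2 powi (- int j)) powr (- (q / p))) else 0"
      have "(\<Sum>j. SUP y. ennreal (?w j x y * A j y)) \<le> ?B1 x + (\<Sum>j. ennreal_powr ?Nq (1 / p) * ?g j)"
      proof (rule suminf_split_ennreal)
        fix j
        show "(SUP y. ennreal (?w j x y * A j y)) \<le> (SUP y. ennreal (?w j x y * A1 j y)) + ennreal_powr ?Nq (1 / p) * ?g j"
        proof (cases "int j < L")
          case True
          have "ennreal (?w j x y * A j y) \<le> ennreal_powr ?Nq (1 / p) * ?g j" for y
          proof (cases "j \<in> I")
            case False
            then show ?thesis using I by simp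
          next
            case jI: True
            have "?w j x y * A j y \<le> 1 * A j y"
              using p by (intro mult_right_mono wt_le_1 A) auto
            then have "ennreal (?w j x y * A j y) \<le> ennreal_powr (ennreal_powr (ennreal (A j y)) p) (1 / p)"
              using p by (simp add: ennreal_powr_inverse ennreal_leI)
            also have "\<dots> \<le> ennreal_powr (?Nq * ennreal (\<phi> (2 powi (- int j)) powr (- q))) (1 / p)"
              using p by (intro ennreal_powr_mono c4) auto
            also have "\<dots> = ennreal_powr ?Nq (1 / p) * ?g j"
              using p True jI by (simp add: ennreal_powr_mult ennreal_powr_ennreal powr_powr)
            finally show ?thesis .
          qed
          then show ?thesis by (intro order_trans[OF SUP_least add_increasing]) auto
        next
          case False
          then show ?thesis by (simp add: A1_def)
        qed
      qed
      also have "(\<Sum>j. ennreal_powr ?Nq (1 / p) * ?g j) = ennreal_powr ?Nq (1 / p) * (\<Sum>j. ?g j)"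
        by (rule ennreal_suminf_cmult)
      also have "\<dots> \<le> ?b" by (intro mult_left_mono H) simp
      finally show ?thesis by (simp add: add_left_mono)
    qed
    have b: "ennreal_powr ?b p = ennreal (C0 powr p) * ?K"
      using p C0 by (simp add: ennreal_powr_mult ennreal_powr_inverse ennreal_powr_ennreal powr_mult powr_powr ennreal_mult mult_ac)
    have "(\<integral>\<^sup>+x. ennreal_powr (\<Sum>j. SUP y. ennreal (?w j x y * A j y)) p * indicator ?Q x \<partial>lborel) \<le>
      (\<integral>\<^sup>+x. G x * indicator ?Q x + ennreal_powr ?b p * indicator ?Q x \<partial>lborel)"
    proof (intro nn_integral_mono)
      fix x
      have "ennreal_powr (\<Sum>j. SUP y. ennreal (?w j x y * A j y)) p \<le> ennreal_powr (?B1 x + ?b) p"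
        using p by (intro ennreal_powr_mono coarse) auto
      also have "\<dots> \<le> ennreal_powr (?B1 x) p + ennreal_powr ?b p" by (rule ennreal_powr_add_le[OF p])
      also have "\<dots> \<le> G x + ennreal_powr ?b p" by (intro add_right_mono G)
      finally show "ennreal_powr (\<Sum>j. SUP y. ennreal (?w j x y * A j y)) p * indicator ?Q x \<le>
        G x * indicator ?Q x + ennreal_powr ?b p * indicator ?Q x"
        by (auto simp: indicator_def)
    qed
    also have "\<dots> = (\<integral>\<^sup>+x. G x * indicator ?Q x \<partial>lborel) + (\<integral>\<^sup>+x. ennreal_powr ?b p * indicator ?Q x \<partial>lborel)"
      by (intro nn_integral_add) measurable
    also have "\<dots> \<le> ?Cf * ?K * ?V + ennreal (C0 powr p) * ?K * ?V"
      unfolding b by (intro add_mono G) (simp add: nn_integral_cmult_indicator emeasure_dyadic_cube)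
    also have "\<dots> = (?Cf + ennreal (C0 powr p)) * ?K * ?V" by (simp only: distrib_right)
    finally show ?thesis by (simp only: mult.assoc)
  qed
  show ?thesis
  proof (rule morrey_norm_le_iff[where \<phi> = \<phi> and q = q, OF q \<phi>, THEN iffD2], assumption, intro allI)
    fix L m
    have "ennreal_powr (morrey_step_const TYPE('n) p q C0 * ?N) q = (?Cf + ennreal (C0 powr p)) * ?Nq"
      using q by (simp add: morrey_step_const_def ennreal_powr_mult ennreal_powr_inverse)
    then show "(\<integral>\<^sup>+x. ennreal_powr (ennreal_powr (\<Sum>j. SUP y. ennreal (?w j x y * A j y)) (p / q)) q * indicator (dyadic_cube L m) x \<partial>lborel)
      \<le> ennreal_powr (morrey_step_const TYPE('n) p q C0 * ?N) q * ennreal (\<phi> (2 powi (- L)) powr (- q)) * ennreal ((2 powi (- L)) ^ CARD('n))"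
      unfolding pq using main by simp
  qed
qed

subsection \<open>Peetre maximal functions\<close>

text \<open>Within distance one of \<open>u\<close> the weights change by at most
  \<open>2 ^ N\<close>, where \<open>N\<close> is an integer above the real exponent
  \<open>a\<close>.\<close>

lemma schwartz_lipschitz_decay:
  fixes k :: "real^'n \<Rightarrow> complex"
  assumes k: "k \<in> schwartz"
  shows "\<exists>C\<ge>0. \<forall>u v. norm (u - v) \<le> 1 \<longrightarrow> norm (k u - k v) \<le> C * norm (u - v) * wt a (norm u)"
proof -
  obtain N where N: "a \<le> real N" using real_arch_simple by blast
  have "\<forall>j. \<exists>B. \<forall>x. (1 + norm x) ^ N * norm (partial_deriv j k x) \<le> B"
    using schwartz_bound[OF k, of N "[_]"] by (metis iter_partial.simps)
  then obtain B where "\<And>j x. (1 + norm x) ^ N * norm (partial_deriv j k x) \<le> B j" by metis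
  from finite_bound[of "\<lambda>j x. (1 + norm x) ^ N * norm (partial_deriv j k x)", OF this]
  obtain B where B: "\<And>j x. (1 + norm x) ^ N * norm (partial_deriv j k x) \<le> B" by blast
  have B0: "0 \<le> B" using order_trans[OF _ B[of 0 undefined]] by simp
  have pos: "0 < (1 + norm x) ^ N" for x :: "real^'n" by (intro zero_less_power add_pos_nonneg) auto
  have "norm (k u - k v) \<le> (real CARD('n) * B * 2 ^ N) * norm (u - v) * wt a (norm u)" if uv: "norm (u - v) \<le> 1" for u v
  proof -
    have "norm (k u - k v) \<le> real CARD('n) * (B * 2 ^ N / (1 + norm u) ^ N) * norm (u - v)"
    proof (rule smooth_lipschitz_convex[where S = "cball u 1"])
      show "norm (partial_deriv j k \<xi>) \<le> B * 2 ^ N / (1 + norm u) ^ N" if \<xi>: "\<xi> \<in> cball u 1" for j \<xi>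
      proof -
        have "(1 + norm u) ^ N \<le> (1 + norm \<xi>) ^ N * (1 + norm (u - \<xi>)) ^ N" by (rule weight_peetre)
        also have "\<dots> \<le> (1 + norm \<xi>) ^ N * 2 ^ N"
          using \<xi> by (intro mult_left_mono power_mono) (auto simp: dist_norm)
        finally have "(1 + norm u) ^ N * norm (partial_deriv j k \<xi>) \<le> ((1 + norm \<xi>) ^ N * 2 ^ N) * norm (partial_deriv j k \<xi>)"
          by (rule mult_right_mono) simp
        also have "\<dots> = 2 ^ N * ((1 + norm \<xi>) ^ N * norm (partial_deriv j k \<xi>))" by simp
        also have "\<dots> \<le> 2 ^ N * B" by (intro mult_left_mono B) simp
        finally show ?thesis using pos[of u] by (simp add: field_simps)
      qed
    qed (use schwartz_smooth[OF k] uv in \<open>auto simp: dist_norm\<close>)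
    also have "\<dots> = (real CARD('n) * B * 2 ^ N) * norm (u - v) * wt (real N) (norm u)"
      by (simp add: wt_numeral_nat)
    also have "\<dots> \<le> (real CARD('n) * B * 2 ^ N) * norm (u - v) * wt a (norm u)"
      using B0 N by (intro mult_left_mono wt_antimono_exponent) auto
    finally show ?thesis .
  qed
  then show ?thesis using B0 by (intro exI[of _ "real CARD('n) * B * 2 ^ N"]) auto
qed

lemma schwartz_decay_wt:
  fixes k :: "real^'n \<Rightarrow> complex"
  assumes k: "k \<in> schwartz"
  shows "\<exists>C\<ge>0. \<forall>u. norm (k u) \<le> C * wt a (norm u)"
proof -
  obtain N where N: "a \<le> real N" using real_arch_simple by blast
  obtain B where B: "0 \<le> B" "\<And>x. norm (iter_partial [] k x) \<le> B / (1 + norm x) ^ N"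
    using schwartz_decay[OF k] by blast
  have "norm (k u) \<le> B * wt a (norm u)" for u
  proof -
    have "norm (k u) \<le> B * wt (real N) (norm u)" using B(2)[of u] by (simp add: wt_numeral_nat)
    also have "\<dots> \<le> B * wt a (norm u)" using B N by (intro mult_left_mono wt_antimono_exponent) auto
    finally show ?thesis .
  qed
  then show ?thesis using B(1) by blast
qed

definition cwr :: "('n::finite) itself \<Rightarrow> real" where
  "cwr T = enn2real (cw T)"

lemma integral_wt_scaled:
  fixes x :: "real^'n"
  assumes "0 < l"
  shows "integrable lborel (\<lambda>y. wt (2 * CARD('n)) (l * norm (x - y)))"
    and "l ^ CARD('n) * (\<integral>y. wt (2 * CARD('n)) (l * norm (x - y)) \<partial>lborel) = cwr TYPE('n)"
proof -
  let ?w = "\<lambda>y. wt (2 * CARD('n)) (l * norm (x - y))"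
  have w0: "0 \<le> ?w y" for y using wt_pos[of "l * norm (x - y)"] assms by (simp add: less_imp_le)
  have e: "ennreal (l ^ CARD('n)) * (\<integral>\<^sup>+y. ennreal (?w y) \<partial>lborel) = cw TYPE('n)"
    by (rule nn_integral_wt_scaled[OF assms])
  have "(\<integral>\<^sup>+y. ennreal (?w y) \<partial>lborel) < \<infinity>"
    using e nn_integral_wt[where 'n = 'n] assms
    by (metis ennreal_mult_top ennreal_eq_0_iff infinity_ennreal_def less_top not_less power_eq_0_iff zero_less_power zero_le_power less_imp_le)
  then show i: "integrable lborel ?w" using w0 by (intro integrableI_nonneg) auto
  have "(\<integral>\<^sup>+y. ennreal (?w y) \<partial>lborel) = ennreal (\<integral>y. ?w y \<partial>lborel)"
    using w0 i by (intro nn_integral_eq_integral) auto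
  then have "cw TYPE('n) = ennreal (l ^ CARD('n) * (\<integral>y. ?w y \<partial>lborel))"
    using e assms w0 by (simp add: ennreal_mult integral_nonneg_AE)
  then show "l ^ CARD('n) * (\<integral>y. ?w y \<partial>lborel) = cwr TYPE('n)"
    using assms w0 by (simp add: cwr_def integral_nonneg_AE)
qed

lemma cwr_nonneg: "0 \<le> cwr T"
  by (simp add: cwr_def)

text \<open>The weight of \<open>x - y\<close> times that of \<open>y - w\<close> is at most that of
  \<open>x - w\<close>, which the bound on \<open>g\<close> absorbs. This consumes the exponent
  \<open>M\<close> of the kernel; the surplus \<open>2 * CARD('n)\<close> makes the rest integrable,
  and the factor \<open>l ^ CARD('n)\<close> cancels.\<close>

lemma weighted_convolution_bound:
  fixes \<kappa> g :: "real^'n \<Rightarrow> complex" and C M :: real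
  assumes l: "0 < l" and C: "0 \<le> C" and M: "0 \<le> M" and G: "0 \<le> G"
    and int: "integrable lborel (\<lambda>w. \<kappa> w * g w)"
    and \<kappa>: "\<And>w. norm (\<kappa> w) \<le> C * l ^ CARD('n) * wt (M + 2 * CARD('n)) (l * norm (y - w))"
    and g: "\<And>w. norm (g w) * wt M (l * norm (x - w)) \<le> G"
  shows "norm (\<integral>w. \<kappa> w * g w \<partial>lborel) * wt M (l * norm (x - y)) \<le> C * cwr TYPE('n) * G"
proof -
  let ?W = "wt M (l * norm (x - y))"
  have wp: "0 < wt a (l * norm z)" for a and z :: "real^'n" using l by (intro wt_pos) auto
  have bound: "norm (?W *\<^sub>R (\<kappa> w * g w)) \<le> C * l ^ CARD('n) * G * wt (2 * CARD('n)) (l * norm (y - w))" for w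
  proof -
    have "l * norm (x - w) \<le> l * norm (x - y) + l * norm (y - w)"
      using norm_triangle_ineq[of "x - y" "y - w"] l by (simp add: distrib_left[symmetric])
    then have tri: "?W * wt M (l * norm (y - w)) \<le> wt M (l * norm (x - w))"
      using l M by (intro wt_triangle) auto
    have "norm (?W *\<^sub>R (\<kappa> w * g w)) = ?W * norm (\<kappa> w) * norm (g w)"
      using wp[of M "x - y"] by (simp add: norm_mult)
    also have "\<dots> \<le> ?W * (C * l ^ CARD('n) * wt (M + 2 * CARD('n)) (l * norm (y - w))) * norm (g w)"
      using wp[of M "x - y"] by (intro mult_left_mono mult_right_mono \<kappa>) auto
    also have "\<dots> = C * l ^ CARD('n) * wt (2 * CARD('n)) (l * norm (y - w)) * (norm (g w) * (?W * wt M (l * norm (y - w))))"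
      using l by (simp add: wt_add)
    also have "\<dots> \<le> C * l ^ CARD('n) * wt (2 * CARD('n)) (l * norm (y - w)) * (norm (g w) * wt M (l * norm (x - w)))"
      using C l wp by (intro mult_left_mono tri mult_nonneg_nonneg) (auto intro: less_imp_le)
    also have "\<dots> \<le> C * l ^ CARD('n) * wt (2 * CARD('n)) (l * norm (y - w)) * G"
      using C l wp by (intro mult_left_mono g mult_nonneg_nonneg) (auto intro: less_imp_le)
    finally show ?thesis by (simp add: mult_ac)
  qed
  have "norm (\<integral>w. \<kappa> w * g w \<partial>lborel) * ?W = norm (\<integral>w. ?W *\<^sub>R (\<kappa> w * g w) \<partial>lborel)"
    using wp[of M "x - y"] by simp
  also have "\<dots> \<le> (\<integral>w. C * l ^ CARD('n) * G * wt (2 * CARD('n)) (l * norm (y - w)) \<partial>lborel)"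
    by (intro Bochner_Integration.integral_norm_bound_integral bound integrable_scaleR_right int
        integrable_mult_right integral_wt_scaled l)
  also have "\<dots> = C * G * (l ^ CARD('n) * (\<integral>w. wt (2 * CARD('n)) (l * norm (y - w)) \<partial>lborel))" by simp
  also have "\<dots> = C * cwr TYPE('n) * G" unfolding integral_wt_scaled(2)[OF l] by simp
  finally show ?thesis .
qed

section \<open>Infima over dyadic cells\<close>

definition cinf :: "int \<Rightarrow> (real^'n \<Rightarrow> complex) \<Rightarrow> real^'n \<Rightarrow> real" where
  "cinf l g y = (INF z\<in>dyadic_cube l (cell l y). norm (g z))"

lemma self_in_dyadic_cube: "y \<in> dyadic_cube l (cell l y)"
  by (simp add: dyadic_cube_eq)

lemma cinf_lower: "cell l z = cell l y \<Longrightarrow> cinf l g y \<le> norm (g z)"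
  unfolding cinf_def by (intro cINF_lower bdd_belowI[of _ 0]) (auto simp: dyadic_cube_eq)

lemma cinf_greatest: "(\<And>z. cell l z = cell l y \<Longrightarrow> c \<le> norm (g z)) \<Longrightarrow> c \<le> cinf l g y"
  unfolding cinf_def using self_in_dyadic_cube[of y l] by (intro cINF_greatest) (auto simp: dyadic_cube_eq)

lemma cinf_nonneg: "0 \<le> cinf l g y"
  by (rule cinf_greatest) simp

lemma cinf_cong: "cell l y = cell l z \<Longrightarrow> cinf l g y = cinf l g z"
  by (simp add: cinf_def)

lemma cinf_measurable [measurable]: "cinf l g \<in> borel_measurable borel"
proof -
  have "cinf l g = (\<lambda>y. (\<lambda>m. INF z\<in>dyadic_cube l m. norm (g z)) (cell l y))"
    by (simp add: cinf_def fun_eq_iff)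
  also have "\<dots> \<in> borel_measurable borel" by (rule cell_function_measurable) simp
  finally show ?thesis .
qed

text \<open>The oscillation of a band-limited function over a sufficiently small cell is absorbed by half
  of its Peetre maximal function; no power trick is needed for exponents below one.\<close>

lemma peetre_absorb:
  fixes g K :: "real^'n \<Rightarrow> complex" and C M :: real
  assumes l: "0 < l" "2 powi int k = l" and M: "0 \<le> M" and C: "0 \<le> C"
    and K: "\<And>u v. norm (u - v) \<le> 1 \<Longrightarrow> norm (K u - K v) \<le> C * norm (u - v) * wt (M + 2 * CARD('n)) (norm u)"
    and int: "\<And>x. integrable lborel (\<lambda>w. of_real (l ^ CARD('n)) * K (l *\<^sub>R (w - x)) * g w)"
    and rep: "\<And>x. g x = (\<integral>w. of_real (l ^ CARD('n)) * K (l *\<^sub>R (w - x)) * g w \<partial>lborel)"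
    and a: "real CARD('n) \<le> 2 ^ a" "real CARD('n) * (C * cwr TYPE('n)) * 2 \<le> 2 ^ a"
    and bdd: "\<And>w. norm (g w) * wt M (l * norm (x - w)) \<le> G0"
    and B: "\<And>y. cinf (int (k + a)) g y * wt M (l * norm (x - y)) \<le> B"
  shows "norm (g w) * wt M (l * norm (x - w)) \<le> 2 * B"
proof -
  let ?f = "\<lambda>w. norm (g w) * wt M (l * norm (x - w))"
  have wp: "0 < wt a (l * norm z)" for a and z :: "real^'n" using l by (intro wt_pos) auto
  define G where "G = (SUP w. ?f w)"
  have bd: "bdd_above (range ?f)" using bdd by (auto simp: bdd_above_def)
  have G: "?f w \<le> G" for w unfolding G_def by (rule cSUP_upper[OF _ bd]) simp
  have G0: "0 \<le> G" using order_trans[OF _ G[of undefined]] wp by (simp add: less_imp_le)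
  \<comment> \<open>On a cell of level \<open>k + a\<close> the difference of the two kernels
    carries a factor of order \<open>1 / 2 ^ a\<close>, and \<open>a\<close> is large enough to
    leave at most half of \<open>G\<close>.\<close>
  have osc: "norm (g y - g z) * wt M (l * norm (x - y)) \<le> G / 2" if yz: "cell (int (k + a)) y = cell (int (k + a)) z" for y z
  proof -
    have "2 powi int (k + a) = l * 2 ^ a" using l(2) unfolding power_int_of_nat by (simp add: power_add)
    then have d: "l * norm (y - z) * 2 ^ a \<le> real CARD('n)" using cell_dist[OF yz] by (simp add: mult_ac)
    have "l * norm (y - z) * 2 ^ a \<le> 1 * 2 ^ a" using d a(1) by linarith
    then have d1: "l * norm (y - z) \<le> 1" by (rule mult_right_le_imp_le) simp
    let ?k = "\<lambda>w. of_real (l ^ CARD('n)) * K (l *\<^sub>R (w - y)) - of_real (l ^ CARD('n)) * K (l *\<^sub>R (w - z))"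
    have "norm (\<integral>w. ?k w * g w \<partial>lborel) * wt M (l * norm (x - y)) \<le> (C * (l * norm (y - z))) * cwr TYPE('n) * G"
    proof (rule weighted_convolution_bound[OF l(1) _ M G0 _ _ G])
      show "0 \<le> C * (l * norm (y - z))" using C l by simp
      show "integrable lborel (\<lambda>w. ?k w * g w)"
        unfolding left_diff_distrib by (intro Bochner_Integration.integrable_diff int)
      fix w
      have "l *\<^sub>R (w - y) - l *\<^sub>R (w - z) = l *\<^sub>R (z - y)" by (simp add: scaleR_diff_right)
      then have n: "norm (l *\<^sub>R (w - y) - l *\<^sub>R (w - z)) = l * norm (y - z)" using l by (simp add: norm_minus_commute)
      have "norm (?k w) = l ^ CARD('n) * norm (K (l *\<^sub>R (w - y)) - K (l *\<^sub>R (w - z)))"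
        unfolding right_diff_distrib[symmetric] norm_mult norm_of_real using l by simp
      also have "\<dots> \<le> l ^ CARD('n) * (C * (l * norm (y - z)) * wt (M + 2 * CARD('n)) (norm (l *\<^sub>R (w - y))))"
        using K[of "l *\<^sub>R (w - y)" "l *\<^sub>R (w - z)"] d1 l unfolding n by (intro mult_left_mono) auto
      also have "\<dots> = C * (l * norm (y - z)) * l ^ CARD('n) * wt (M + 2 * CARD('n)) (l * norm (y - w))"
        using l by (simp add: norm_minus_commute)
      finally show "norm (?k w) \<le> C * (l * norm (y - z)) * l ^ CARD('n) * wt (M + 2 * CARD('n)) (l * norm (y - w))" .
    qed
    moreover have "(\<integral>w. ?k w * g w \<partial>lborel) = g y - g z"
      unfolding left_diff_distrib Bochner_Integration.integral_diff[OF int int] rep[symmetric] ..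
    moreover have "(C * (l * norm (y - z))) * cwr TYPE('n) * G \<le> G / 2"
    proof -
      have c: "0 \<le> C * cwr TYPE('n)" using C cwr_nonneg[of "TYPE('n)"] by simp
      have "2 * (C * (l * norm (y - z)) * cwr TYPE('n)) * 2 ^ a = (l * norm (y - z) * 2 ^ a) * (C * cwr TYPE('n)) * 2" by simp
      also have "\<dots> \<le> real CARD('n) * (C * cwr TYPE('n)) * 2" using d c by (intro mult_right_mono) auto
      also have "\<dots> \<le> 1 * 2 ^ a" using a(2) by simp
      finally have "2 * (C * (l * norm (y - z)) * cwr TYPE('n)) \<le> 1" by (rule mult_right_le_imp_le) simp
      from mult_right_mono[OF this G0] show ?thesis by simp
    qed
    ultimately show ?thesis by simp
  qed
  have step: "?f y \<le> B + G / 2" for y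
  proof -
    let ?W = "wt M (l * norm (x - y))"
    have W: "0 < ?W" by (rule wp)
    \<comment> \<open>The oscillation bound has the same right-hand side for all \<open>z\<close> in
      the cell, so it passes to the infimum.\<close>
    have "norm (g y) - G / 2 / ?W \<le> cinf (int (k + a)) g y"
    proof (rule cinf_greatest)
      fix z assume "cell (int (k + a)) z = cell (int (k + a)) y"
      then have "norm (g y - g z) * ?W \<le> G / 2" by (intro osc) simp
      then have "norm (g y - g z) \<le> G / 2 / ?W" using W by (simp add: pos_le_divide_eq)
      then show "norm (g y) - G / 2 / ?W \<le> norm (g z)" using norm_triangle_ineq2[of "g y" "g z"] by linarith
    qed
    from mult_right_mono[OF this less_imp_le[OF W]] have "norm (g y) * ?W - G / 2 \<le> cinf (int (k + a)) g y * ?W"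
      using W by (simp add: left_diff_distrib)
    also have "\<dots> \<le> B" by (rule B)
    finally show ?thesis by simp
  qed
  \<comment> \<open>The supremum over \<open>y\<close> is taken; since \<open>G\<close> is a finite
    real, half of it can be moved to the left.\<close>
  have "G \<le> B + G / 2" unfolding G_def[of ] by (rule cSUP_least) (use step G_def in auto)
  then show ?thesis using G[of w] by simp
qed

text \<open>The threshold \<open>a0\<close> depends on \<open>\<Phi>\<close> and \<open>M\<close>
  alone, since the kernels at all scales are dilates of one. The finiteness required for absorption
  comes from a preliminary application whose weight exponent is the growth order of
  \<open>g\<close>: there the weighted supremum is evidently finite, and the outcome is that
  \<open>g\<close> is bounded.\<close>

lemma peetre_maximal:
  fixes \<Phi> :: "real^'n \<Rightarrow> complex" and M :: real
  assumes \<Phi>: "\<Phi> \<in> test_functions" and M: "0 \<le> M"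
  shows "\<exists>a0. \<forall>a\<ge>a0. \<forall>k g x B.
    (\<forall>x. integrable lborel (\<lambda>w. fker (dilate k \<Phi>) (w - x) * g w) \<and>
      g x = (\<integral>w. fker (dilate k \<Phi>) (w - x) * g w \<partial>lborel)) \<longrightarrow>
    (\<exists>C N. \<forall>y. norm (g y) \<le> C * (1 + norm y) ^ N) \<longrightarrow>
    (\<forall>l. \<exists>C. \<forall>y. cinf l g y \<le> C) \<longrightarrow>
    (\<forall>y. cinf (int (k + a)) g y * wt M (2 ^ k * norm (x - y)) \<le> B) \<longrightarrow>
    (\<forall>w. norm (g w) * wt M (2 ^ k * norm (x - w)) \<le> 2 * B)"
proof -
  let ?a = "\<lambda>C a. real CARD('n) \<le> 2 ^ a \<and> real CARD('n) * (C * cwr TYPE('n)) * 2 \<le> 2 ^ a"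
  have ex: "\<exists>a0. \<forall>a\<ge>a0. ?a C a" for C
  proof -
    have "\<exists>a0. max (real CARD('n)) (real CARD('n) * (C * cwr TYPE('n)) * 2) < 2 ^ a0"
      by (rule real_arch_pow) simp
    then obtain a0 where a0: "max (real CARD('n)) (real CARD('n) * (C * cwr TYPE('n)) * 2) < 2 ^ a0" ..
    have "?a C a" if "a0 \<le> a" for a
    proof -
      have "(2::real) ^ a0 \<le> 2 ^ a" by (rule power_increasing[OF that]) simp
      moreover have "real CARD('n) < 2 ^ a0" "real CARD('n) * (C * cwr TYPE('n)) * 2 < 2 ^ a0"
        using a0 by (simp_all only: max_less_iff_conj)
      ultimately show ?thesis by linarith
    qed
    then show ?thesis by blast
  qed
  obtain C where C: "0 \<le> C" "\<And>u v. norm (u - v) \<le> 1 \<Longrightarrow> norm (fker \<Phi> u - fker \<Phi> v) \<le> C * norm (u - v) * wt (M + 2 * CARD('n)) (norm u)"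
    using schwartz_lipschitz_decay[OF fker_schwartz[OF \<Phi>]] by blast
  obtain a0 where a0: "\<And>a. a0 \<le> a \<Longrightarrow> ?a C a" using ex by blast
  show ?thesis
  proof (intro exI[of _ a0] allI impI)
    fix a k g x B w
    assume a: "a0 \<le> a" and rep: "\<forall>x. integrable lborel (\<lambda>w. fker (dilate k \<Phi>) (w - x) * g w) \<and>
      g x = (\<integral>w. fker (dilate k \<Phi>) (w - x) * g w \<partial>lborel)"
      and gr: "\<exists>C N. \<forall>y. norm (g y) \<le> C * (1 + norm y) ^ N" and ci: "\<forall>l. \<exists>C. \<forall>y. cinf l g y \<le> C"
      and B: "\<forall>y. cinf (int (k + a)) g y * wt M (2 ^ k * norm (x - y)) \<le> B"
    let ?l = "2 ^ k :: real"
    have l: "0 < ?l" "2 powi int k = ?l" "1 \<le> ?l" by (simp_all add: power_int_of_nat)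
    have fk: "fker (dilate k \<Phi>) z = of_real (?l ^ CARD('n)) * fker \<Phi> (?l *\<^sub>R z)" for z
      by (simp add: fker_dilate[OF \<Phi>] power_mult)
    have int: "integrable lborel (\<lambda>w. of_real (?l ^ CARD('n)) * fker \<Phi> (?l *\<^sub>R (w - x)) * g w)"
      and rep': "g x = (\<integral>w. of_real (?l ^ CARD('n)) * fker \<Phi> (?l *\<^sub>R (w - x)) * g w \<partial>lborel)" for x
      using rep unfolding fk by blast+
    have "\<exists>G. \<forall>y. norm (g y) \<le> G"
    proof -
      obtain D N where D: "\<And>y. norm (g y) \<le> D * (1 + norm y) ^ N" using gr by blast
      have D0: "0 \<le> D" using order_trans[OF norm_ge_zero D[of 0]] by simp
      obtain C1 where C1: "0 \<le> C1" "\<And>u v. norm (u - v) \<le> 1 \<Longrightarrow> norm (fker \<Phi> u - fker \<Phi> v) \<le> C1 * norm (u - v) * wt (real N + 2 * CARD('n)) (norm u)"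
        using schwartz_lipschitz_decay[OF fker_schwartz[OF \<Phi>]] by blast
      \<comment> \<open>This threshold depends on the growth order and hence on \<open>g\<close>;
        that is harmless, as the infima are bounded on every level.\<close>
      obtain a1 where a1: "?a C1 a1" using ex by blast
      obtain E where E: "\<And>y. cinf (int (k + a1)) g y \<le> E" using ci by blast
      have "norm (g y) * wt (real N) (?l * norm (y - y)) \<le> 2 * E" for y
      proof (rule peetre_absorb[where K = "fker \<Phi>" and k = k and a = a1 and C = C1, OF l(1,2) _ C1 int rep'])
        show "norm (g w) * wt (real N) (?l * norm (y - w)) \<le> D * (1 + norm y) ^ N" for w
        proof -
          have "(1 + norm w) ^ N \<le> (1 + norm y) ^ N * (1 + norm (w - y)) ^ N" by (rule weight_peetre)
          also have "\<dots> \<le> (1 + norm y) ^ N * (1 + ?l * norm (y - w)) ^ N"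
            using mult_right_mono[OF l(3), of "norm (y - w)"]
            by (intro mult_left_mono power_mono) (auto simp: norm_minus_commute)
          finally have "D * (1 + norm w) ^ N \<le> D * ((1 + norm y) ^ N * (1 + ?l * norm (y - w)) ^ N)"
            by (rule mult_left_mono[OF _ D0])
          then have "norm (g w) \<le> D * (1 + norm y) ^ N * (1 + ?l * norm (y - w)) ^ N" using D[of w] by (simp add: mult.assoc)
          moreover have "0 < (1 + ?l * norm (y - w)) ^ N" by (intro zero_less_power add_pos_nonneg) auto
          ultimately show ?thesis by (simp add: wt_numeral_nat pos_divide_le_eq)
        qed
        show "cinf (int (k + a1)) g z * wt (real N) (?l * norm (y - z)) \<le> E" for z
        proof -
          have "cinf (int (k + a1)) g z * wt (real N) (?l * norm (y - z)) \<le> cinf (int (k + a1)) g z * 1"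
            by (intro mult_left_mono wt_le_1 cinf_nonneg) auto
          then show ?thesis using E[of z] by simp
        qed
      qed (use a1 in auto)
      then show ?thesis by auto
    qed
    then obtain G where G: "\<And>y. norm (g y) \<le> G" by blast
    show "norm (g w) * wt M (?l * norm (x - w)) \<le> 2 * B"
    proof (rule peetre_absorb[where K = "fker \<Phi>" and k = k and a = a and C = C, OF l(1,2) M C int rep'])
      show "norm (g w) * wt M (?l * norm (x - w)) \<le> G" for w
      proof -
        have "norm (g w) * wt M (?l * norm (x - w)) \<le> norm (g w) * 1"
          using M by (intro mult_left_mono wt_le_1) auto
        then show ?thesis using G[of w] by simp
      qed
    qed (use a0[OF a] B in auto)
  qed
qed

subsection \<open>Littlewood-Paley decompositions\<close>

text \<open>Assigning \<open>\<theta>\<close> to index zero merges both parts of a quasi-norm into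
  one series over all natural numbers.\<close>

definition lp_family :: "(real^'n \<Rightarrow> complex) \<Rightarrow> (real^'n \<Rightarrow> complex) \<Rightarrow> nat \<Rightarrow> real^'n \<Rightarrow> complex" where
  "lp_family \<theta> \<tau> k = (if k = 0 then \<theta> else dilate k \<tau>)"

lemma test_dilate: "f \<in> test_functions \<Longrightarrow> dilate k f \<in> test_functions"
  using test_affine_comp[of f "1 / 2 ^ k" 0] by (simp add: dilate_def[abs_def])

lemma test_scale: "f \<in> test_functions \<Longrightarrow> c \<noteq> 0 \<Longrightarrow> (\<lambda>\<xi>. f (c *\<^sub>R \<xi>)) \<in> test_functions"
  using test_affine_comp[of f c 0] by simp

lemma admissibleD:
  assumes "admissible \<theta> \<tau>"
  shows "\<theta> \<in> test_functions" "\<tau> \<in> test_functions" "0 \<notin> supp \<tau>"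
    "x \<in> centered_cube 2 \<Longrightarrow> \<theta> x \<noteq> 0"
    "x \<in> centered_cube 2 \<Longrightarrow> x \<notin> centered_cube 1 \<Longrightarrow> \<tau> x \<noteq> 0"
proof -
  have "\<tau> x \<noteq> 0" if x: "x \<in> centered_cube 2" "x \<notin> centered_cube 1"
  proof -
    from assms x have "0 < Re (\<tau> x)" unfolding admissible_def by blast
    then show ?thesis by auto
  qed
  moreover have "\<theta> x \<noteq> 0" if x: "x \<in> centered_cube 2"
  proof -
    from assms x have "0 < Re (\<theta> x)" unfolding admissible_def by blast
    then show ?thesis by auto
  qed
  ultimately show "\<theta> \<in> test_functions" "\<tau> \<in> test_functions" "0 \<notin> supp \<tau>"
    "x \<in> centered_cube 2 \<Longrightarrow> \<theta> x \<noteq> 0"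
    "x \<in> centered_cube 2 \<Longrightarrow> x \<notin> centered_cube 1 \<Longrightarrow> \<tau> x \<noteq> 0"
    using assms unfolding admissible_def by blast+
qed

lemma test_lp_family: "admissible \<theta> \<tau> \<Longrightarrow> lp_family \<theta> \<tau> k \<in> test_functions"
  by (auto simp: lp_family_def intro: test_dilate admissibleD)

text \<open>A sum of squared moduli cannot cancel. Denominators are built this way because
  admissible functions are prescribed to be positive on certain cubes and may take arbitrary complex
  values elsewhere.\<close>

lemma sum_cnj_nonzero:
  fixes f :: "'i \<Rightarrow> complex"
  assumes "finite I" "i \<in> I" "f i \<noteq> 0"
  shows "(\<Sum>i\<in>I. f i * cnj (f i)) \<noteq> 0"
proof -
  have "(\<Sum>i\<in>I. f i * cnj (f i)) = of_real (\<Sum>i\<in>I. (norm (f i))^2)"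
    by (simp only: of_real_sum complex_norm_square)
  moreover have "0 < (\<Sum>i\<in>I. (norm (f i))^2)"
    using assms by (intro sum_pos2[of I i]) auto
  ultimately show ?thesis by (simp only: of_real_eq_0_iff)
qed

lemma centered_cube_scale: "0 < c \<Longrightarrow> c *\<^sub>R x \<in> centered_cube r \<longleftrightarrow> x \<in> centered_cube (r / c)"
  by (simp add: centered_cube_def field_simps)

lemma centered_cube_mono: "x \<in> centered_cube r \<Longrightarrow> r \<le> s \<Longrightarrow> x \<in> centered_cube s"
  unfolding centered_cube_def by (smt (verit) mem_Collect_eq)

lemma closed_centered_cube: "closed (centered_cube r :: (real^'n) set)"
proof -
  have "(centered_cube r :: (real^'n) set) = cbox (\<chi> k. - r) (\<chi> k. r)"
    by (auto simp: centered_cube_def mem_box_cart)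
  then show ?thesis by (simp only: closed_cbox)
qed

lemma compact_subset_centered_cube:
  fixes K :: "(real^'n) set"
  assumes "compact K"
  obtains R where "0 < R" "K \<subseteq> centered_cube R"
proof -
  obtain R where R: "0 < R" "\<And>x. x \<in> K \<Longrightarrow> norm x \<le> R"
    using compact_imp_bounded[OF assms] by (auto simp: bounded_pos)
  have "x \<in> centered_cube R" if "x \<in> K" for x
    using R(2)[OF that] component_le_norm_cart[of x] unfolding centered_cube_def
    by (auto simp: abs_le_iff) (smt (verit))+
  then show ?thesis using that[of R] R(1) by blast
qed

lemma centered_cube_disjoint_supp:
  fixes \<tau> :: "real^'n \<Rightarrow> complex"
  assumes "0 \<notin> supp \<tau>"
  obtains \<delta> where "0 < \<delta>" "centered_cube \<delta> \<inter> supp \<tau> = {}"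
proof -
  have "open (- supp \<tau>)" by (simp add: supp_def open_Compl)
  then obtain e where e: "0 < e" "ball 0 e \<subseteq> - supp \<tau>" using assms by (auto elim!: openE[of _ 0])
  let ?d = "e / (2 * real CARD('n))"
  have "x \<in> ball 0 e" if x: "x \<in> centered_cube ?d" for x :: "real^'n"
  proof -
    have "norm x \<le> (\<Sum>k\<in>UNIV. \<bar>x $ k\<bar>)" by (rule norm_le_l1_cart)
    also have "\<dots> \<le> (\<Sum>k\<in>(UNIV::'n set). ?d)"
      using x by (intro sum_mono) (simp add: centered_cube_def abs_le_iff minus_le_iff)
    also have "\<dots> < e" using e(1) by simp
    finally show ?thesis by simp
  qed
  then have "centered_cube ?d \<inter> supp \<tau> = {}" using e(2) by blast
  then show ?thesis using that[of ?d] e(1) by simp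
qed

text \<open>For the least \<open>m\<close> with \<open>x\<close> in the cube of radius
  \<open>2 ^ m * r\<close>, division by \<open>2 ^ (m - 1) * r\<close> brings \<open>x\<close> into
  \<open>centered_cube 2 - centered_cube 1\<close>.\<close>

lemma annulus_cover:
  assumes ad: "admissible \<theta> \<tau>" and r: "0 < r" and x: "x \<notin> centered_cube r" "x \<in> centered_cube (2 ^ N * r)"
  shows "\<exists>i<N. \<tau> ((1 / (2 ^ i * r)) *\<^sub>R x) \<noteq> 0"
proof -
  define m where "m = (LEAST m. x \<in> centered_cube (2 ^ m * r))"
  have m: "x \<in> centered_cube (2 ^ m * r)" "m \<le> N"
    unfolding m_def using x(2) by (auto intro: LeastI Least_le)
  have "m \<noteq> 0" using m(1) x(1) by (intro notI) simp
  then obtain i where i: "m = Suc i" by (cases m) auto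
  have ni: "x \<notin> centered_cube (2 ^ i * r)"
    using not_less_Least[of i "\<lambda>m. x \<in> centered_cube (2 ^ m * r)"] i unfolding m_def by simp
  have c: "0 < 1 / (2 ^ i * r)" using r by simp
  have "(1 / (2 ^ i * r)) *\<^sub>R x \<in> centered_cube 2" unfolding centered_cube_scale[OF c] using m(1) i by (simp add: mult.assoc)
  moreover have "(1 / (2 ^ i * r)) *\<^sub>R x \<notin> centered_cube 1" unfolding centered_cube_scale[OF c] using ni by simp
  ultimately have "\<tau> ((1 / (2 ^ i * r)) *\<^sub>R x) \<noteq> 0" by (rule admissibleD(5)[OF ad])
  then show ?thesis using i m(2) by (intro exI[of _ i]) auto
qed

lemma nonneg_pow2_bound: "\<exists>s::nat. (x::real) \<le> 2 ^ s"
proof -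
  obtain s where "x < 2 ^ s" using real_arch_pow[of 2 x] by auto
  then show ?thesis by (intro exI[of _ s]) simp
qed

text \<open>The quotient below equals \<open>1\<close> on \<open>K\<close> because the dilates of \<open>\<tau>\<close> used there vanish on \<open>K\<close>,
  while they keep the denominator away from zero where \<open>\<theta>\<close> may vanish.\<close>

lemma cutoff_exists:
  fixes \<theta> \<tau> :: "real^'n \<Rightarrow> complex" and K :: "(real^'n) set"
  assumes ad: "admissible \<theta> \<tau>" and K: "compact K"
  shows "\<exists>\<Phi>\<in>test_functions. \<forall>\<xi>\<in>K. \<Phi> \<xi> = 1"
proof -
  note D = admissibleD[OF ad]
  obtain R where R: "0 < R" "K \<subseteq> centered_cube R" by (rule compact_subset_centered_cube[OF K])
  obtain \<delta> where \<delta>: "0 < \<delta>" "centered_cube \<delta> \<inter> supp \<tau> = {}" by (rule centered_cube_disjoint_supp[OF D(3)])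
  obtain R' where R': "0 < R'" "supp \<theta> \<subseteq> centered_cube R'"
    by (rule compact_subset_centered_cube[OF test_functionsD(2)[OF D(1)]])
  \<comment> \<open>\<open>R \<le> 2 ^ s\<close> keeps the dilate of \<open>\<theta>\<close> nonzero
    on \<open>K\<close>, and \<open>R / \<delta> \<le> 2 ^ s\<close> makes the dilates of
    \<open>\<tau>\<close> vanish there.\<close>
  obtain s :: nat where s: "max R (R / \<delta>) \<le> 2 ^ s" using nonneg_pow2_bound by blast
  \<comment> \<open>The annuli between the radii \<open>2 ^ s\<close> and
    \<open>2 ^ N * 2 ^ s\<close> then cover the support of the dilated \<open>\<theta>\<close>
    outside the inner cube.\<close>
  obtain N :: nat where N: "R' \<le> 2 ^ N" using nonneg_pow2_bound by blast
  define f where "f i \<xi> = \<tau> ((1 / (2 ^ i * 2 ^ s)) *\<^sub>R \<xi>)" for i :: nat and \<xi>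
  define t where "t \<xi> = \<theta> ((1 / 2 ^ s) *\<^sub>R \<xi>)" for \<xi>
  have f: "f i \<in> test_functions" for i unfolding f_def[abs_def] by (intro test_scale D) simp
  have t: "t \<in> test_functions" unfolding t_def[abs_def] by (intro test_scale D) simp
  let ?A = "\<lambda>\<xi>. t \<xi> * cnj (t \<xi>)"
  let ?B = "\<lambda>\<xi>. \<Sum>i<N. f i \<xi> * cnj (f i \<xi>)"
  have A: "?A \<in> test_functions" using test_functionsD(1)[OF t] by (intro test_mult(1)[OF t]) auto
  have B: "smooth ?B" using test_functionsD(1)[OF f] by (intro smooth_sum smooth_mult smooth_cnj)
  have ne: "?A \<xi> + ?B \<xi> \<noteq> 0" if h: "t \<xi> \<noteq> 0 \<or> (\<exists>i<N. f i \<xi> \<noteq> 0)" for \<xi>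
  proof -
    let ?g = "\<lambda>i. if i = N then t \<xi> else f i \<xi>"
    have "\<exists>i\<le>N. ?g i \<noteq> 0"
    proof (cases "t \<xi> \<noteq> 0")
      case False
      with h obtain i where "i < N" "f i \<xi> \<noteq> 0" by blast
      then show ?thesis by (intro exI[of _ i]) auto
    qed auto
    then obtain i where "i \<le> N" "?g i \<noteq> 0" by blast
    then have "(\<Sum>i\<le>N. ?g i * cnj (?g i)) \<noteq> 0" by (intro sum_cnj_nonzero[of _ i]) auto
    moreover have "(\<Sum>i\<le>N. ?g i * cnj (?g i)) = ?A \<xi> + ?B \<xi>"
      unfolding lessThan_Suc_atMost[symmetric] sum.lessThan_Suc by (simp add: add.commute)
    ultimately show ?thesis by simp
  qed
  have inner: "t \<xi> \<noteq> 0" if "\<xi> \<in> centered_cube (2 ^ s)" for \<xi>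
    unfolding t_def by (rule D(4)) (use that in \<open>auto simp: centered_cube_scale intro: centered_cube_mono\<close>)
  have sA: "supp ?A \<subseteq> centered_cube (2 ^ N * 2 ^ s)"
    unfolding supp_def
  proof (rule closure_minimal[OF _ closed_centered_cube], rule subsetI)
    fix \<xi> assume "\<xi> \<in> {\<xi>. ?A \<xi> \<noteq> 0}"
    then have "(1 / 2 ^ s) *\<^sub>R \<xi> \<in> supp \<theta>" using test_functionsD(5)[OF D(1)] by (auto simp: t_def)
    then have "(1 / 2 ^ s) *\<^sub>R \<xi> \<in> centered_cube (2 ^ N)" using R'(2) N by (blast intro: centered_cube_mono)
    then show "\<xi> \<in> centered_cube (2 ^ N * 2 ^ s)" by (simp add: centered_cube_scale)
  qed
  have nz: "?A \<xi> + ?B \<xi> \<noteq> 0" if "\<xi> \<in> supp ?A" for \<xi>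
  proof (cases "\<xi> \<in> centered_cube (2 ^ s)")
    case True
    then show ?thesis using inner ne by blast
  next
    case False
    have "\<xi> \<in> centered_cube (2 ^ N * 2 ^ s)" using sA that by blast
    from annulus_cover[OF ad _ False this] show ?thesis by (intro ne) (simp add: f_def)
  qed
  have test: "(\<lambda>\<xi>. ?A \<xi> / (?A \<xi> + ?B \<xi>)) \<in> test_functions"
    by (rule test_divide[OF A smooth_add[OF test_functionsD(1)[OF A] B] nz])
  have one: "?A \<xi> / (?A \<xi> + ?B \<xi>) = 1" if "\<xi> \<in> K" for \<xi>
  proof -
    have x: "\<xi> \<in> centered_cube R" using that R by blast
    have "f i \<xi> = 0" for i
    proof -
      have "R \<le> \<delta> * (2 ^ i * 2 ^ s)"
      proof -
        have "R \<le> \<delta> * 2 ^ s" using s \<delta>(1) by (simp add: field_simps)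
        also have "\<dots> \<le> \<delta> * (2 ^ i * 2 ^ s)" using \<delta>(1) by (intro mult_left_mono) auto
        finally show ?thesis .
      qed
      then have "(1 / (2 ^ i * 2 ^ s)) *\<^sub>R \<xi> \<in> centered_cube \<delta>"
        using x by (subst centered_cube_scale) (auto intro: centered_cube_mono)
      then show ?thesis unfolding f_def using \<delta>(2) by (intro test_functionsD(5)[OF D(2)]) blast
    qed
    moreover have "t \<xi> \<noteq> 0" using x s by (intro inner) (auto intro: centered_cube_mono)
    ultimately show ?thesis by simp
  qed
  show ?thesis by (intro bexI[OF _ test] ballI one)
qed

section \<open>Division of symbols\<close>

text \<open>The coefficients are \<open>\<zeta> * cnj f\<^sub>i\<close> divided by the sum of the
  squared moduli, smooth because that sum does not vanish on the support of
  \<open>\<zeta>\<close>.\<close>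

lemma quotient_decomposition:
  fixes \<zeta> :: "real^'n \<Rightarrow> complex" and f :: "'i \<Rightarrow> real^'n \<Rightarrow> complex"
  assumes z: "\<zeta> \<in> test_functions" and I: "finite I" and f: "\<And>i. i \<in> I \<Longrightarrow> f i \<in> test_functions"
    and ne: "\<And>\<xi>. \<xi> \<in> supp \<zeta> \<Longrightarrow> \<exists>i\<in>I. f i \<xi> \<noteq> 0"
  shows "\<exists>\<nu>. (\<forall>i\<in>I. \<nu> i \<in> test_functions) \<and> (\<forall>\<xi>. \<zeta> \<xi> = (\<Sum>i\<in>I. \<nu> i \<xi> * f i \<xi>))"
proof -
  let ?P = "\<lambda>\<xi>. \<Sum>i\<in>I. f i \<xi> * cnj (f i \<xi>)"
  let ?n = "\<lambda>i \<xi>. \<zeta> \<xi> / ?P \<xi> * cnj (f i \<xi>)"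
  have P: "?P \<xi> \<noteq> 0" if h: "\<xi> \<in> supp \<zeta>" for \<xi>
  proof -
    obtain i where "i \<in> I" "f i \<xi> \<noteq> 0" using ne[OF h] by blast
    then show ?thesis using sum_cnj_nonzero[OF I, of i "\<lambda>i. f i \<xi>"] by simp
  qed
  have sP: "smooth ?P" using test_functionsD(1)[OF f] by (intro smooth_sum smooth_mult smooth_cnj)
  have "?n i \<in> test_functions" if "i \<in> I" for i
    using test_functionsD(1)[OF f[OF that]] by (intro test_mult(1) test_divide z sP P smooth_cnj)
  moreover have "\<zeta> \<xi> = (\<Sum>i\<in>I. ?n i \<xi> * f i \<xi>)" for \<xi>
  proof -
    have "(\<Sum>i\<in>I. ?n i \<xi> * f i \<xi>) = \<zeta> \<xi> / ?P \<xi> * ?P \<xi>"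
      unfolding sum_distrib_left by (intro sum.cong) (auto simp: mult_ac)
    also have "\<dots> = \<zeta> \<xi>" using P[of \<xi>] test_functionsD(5)[OF z, of \<xi>] by (cases "\<xi> \<in> supp \<zeta>") auto
    finally show ?thesis ..
  qed
  ultimately show ?thesis by (intro exI[of _ ?n]) blast
qed

text \<open>\<open>\<theta>\<close> covers the inner cube and dilates of \<open>\<tau>\<close> cover
  the annuli outside. Every larger \<open>K\<close> is allowed so that finitely many symbols can
  share one.\<close>

lemma low_frequency_decomposition:
  fixes \<theta> \<tau> \<zeta> :: "real^'n \<Rightarrow> complex"
  assumes ad: "admissible \<theta> \<tau>" and z: "\<zeta> \<in> test_functions"
  shows "\<exists>K0. \<forall>K\<ge>K0. \<exists>\<mu>. (\<forall>k\<le>K. \<mu> k \<in> test_functions) \<and> (\<forall>\<xi>. \<zeta> \<xi> = (\<Sum>k\<le>K. \<mu> k \<xi> * lp_family \<theta> \<tau> k \<xi>))"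
proof -
  obtain R where R: "0 < R" "supp \<zeta> \<subseteq> centered_cube R"
    by (rule compact_subset_centered_cube[OF test_functionsD(2)[OF z]])
  obtain K0 :: nat where K0: "R \<le> 2 ^ K0" using nonneg_pow2_bound by blast
  show ?thesis
  proof (intro exI[of _ K0] allI impI)
    fix K assume K: "K0 \<le> K"
    have "\<exists>k\<in>{..K}. lp_family \<theta> \<tau> k \<xi> \<noteq> 0" if "\<xi> \<in> supp \<zeta>" for \<xi>
    proof (cases "\<xi> \<in> centered_cube 2")
      case True
      then show ?thesis using admissibleD(4)[OF ad] by (intro bexI[of _ 0]) (auto simp: lp_family_def)
    next
      case False
      have "(2::real) ^ K0 \<le> 2 ^ K" by (rule power_increasing[OF K]) simp
      moreover have "(0::real) \<le> 2 ^ K" by simp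
      ultimately have "R \<le> 2 ^ K * 2" using K0 by linarith
      then have "\<xi> \<in> centered_cube (2 ^ K * 2)" using R(2) that by (blast intro: centered_cube_mono)
      from annulus_cover[OF ad _ False this] obtain i where i: "i < K" "\<tau> ((1 / (2 ^ i * 2)) *\<^sub>R \<xi>) \<noteq> 0" by auto
      then show ?thesis by (intro bexI[of _ "Suc i"]) (auto simp: lp_family_def dilate_def mult.commute)
    qed
    from quotient_decomposition[OF z _ test_lp_family[OF ad] this]
    obtain \<nu> where "\<forall>i\<in>{..K}. \<nu> i \<in> test_functions" "\<forall>\<xi>. \<zeta> \<xi> = (\<Sum>i\<in>{..K}. \<nu> i \<xi> * lp_family \<theta> \<tau> i \<xi>)" by blast
    then show "\<exists>\<mu>. (\<forall>k\<le>K. \<mu> k \<in> test_functions) \<and> (\<forall>\<xi>. \<zeta> \<xi> = (\<Sum>k\<le>K. \<mu> k \<xi> * lp_family \<theta> \<tau> k \<xi>))" by auto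
  qed
qed

text \<open>A compact support away from zero lies in \<open>2 * a\<close> dyadic annuli between the
  radii \<open>1 / 2 ^ a\<close> and \<open>2 ^ a\<close>, which dilates of \<open>\<tau>\<close>
  cover.\<close>

lemma high_frequency_decomposition:
  fixes \<theta> \<tau> \<zeta> :: "real^'n \<Rightarrow> complex"
  assumes ad: "admissible \<theta> \<tau>" and z: "\<zeta> \<in> test_functions" "0 \<notin> supp \<zeta>"
  shows "\<exists>a \<nu>. (\<forall>i<2*a. \<nu> i \<in> test_functions) \<and> (\<forall>\<xi>. \<zeta> \<xi> = (\<Sum>i<2*a. \<nu> i \<xi> * \<tau> ((2 ^ a / 2 ^ i) *\<^sub>R \<xi>)))"
proof -
  obtain R where R: "0 < R" "supp \<zeta> \<subseteq> centered_cube R"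
    by (rule compact_subset_centered_cube[OF test_functionsD(2)[OF z(1)]])
  obtain \<delta> where \<delta>: "0 < \<delta>" "centered_cube \<delta> \<inter> supp \<zeta> = {}" by (rule centered_cube_disjoint_supp[OF z(2)])
  obtain a :: nat where a: "max R (1 / \<delta>) \<le> 2 ^ a" using nonneg_pow2_bound by blast
  have "\<exists>i\<in>{..<2*a}. \<tau> ((2 ^ a / 2 ^ i) *\<^sub>R \<xi>) \<noteq> 0" if "\<xi> \<in> supp \<zeta>" for \<xi>
  proof -
    have "1 / 2 ^ a \<le> \<delta>" using a \<delta>(1) by (simp add: field_simps)
    then have n: "\<xi> \<notin> centered_cube (1 / 2 ^ a)" using \<delta>(2) that by (blast intro: centered_cube_mono)
    have "(2::real) ^ (2 * a) * (1 / 2 ^ a) = 2 ^ a" by (simp add: mult_2 power_add)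
    then have "\<xi> \<in> centered_cube (2 ^ (2 * a) * (1 / 2 ^ a))" using R(2) a that by (auto intro: centered_cube_mono)
    from annulus_cover[OF ad _ n this] show ?thesis by (auto simp: field_simps)
  qed
  from quotient_decomposition[where f = "\<lambda>i \<xi>. \<tau> ((2 ^ a / 2 ^ i) *\<^sub>R \<xi>)", OF z(1) finite_lessThan _ this]
    test_scale[OF admissibleD(2)[OF ad]] show ?thesis by (intro exI[of _ a]) auto
qed

text \<open>For \<open>j > a\<close> the symbols are dilates of \<open>\<tau>'\<close>, so one
  decomposition serves them all after rescaling; the finitely many \<open>j \<le> a\<close> are
  treated one by one. Finiteness of \<open>F\<close> makes the later kernel bounds uniform in
  \<open>j\<close>.\<close>

lemma lp_decomposition:
  fixes \<theta> \<tau> \<theta>' \<tau>' :: "real^'n \<Rightarrow> complex"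
  assumes ad: "admissible \<theta> \<tau>" and ad': "admissible \<theta>' \<tau>'"
  shows "\<exists>b F. finite F \<and> F \<subseteq> test_functions \<and> (\<forall>j. \<exists>\<nu>. (\<forall>k. \<nu> k \<in> F) \<and>
    (\<forall>\<xi>. lp_family \<theta>' \<tau>' j \<xi> = (\<Sum>k\<in>{j - b..j + b}. dilate j (\<nu> k) \<xi> * lp_family \<theta> \<tau> k \<xi>)))"
proof -
  obtain a \<nu> where \<nu>: "\<And>i. i < 2*a \<Longrightarrow> \<nu> i \<in> test_functions"
    "\<And>\<xi>. \<tau>' \<xi> = (\<Sum>i<2*a. \<nu> i \<xi> * \<tau> ((2 ^ a / 2 ^ i) *\<^sub>R \<xi>))"
    using high_frequency_decomposition[OF ad admissibleD(2,3)[OF ad']] by blast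
  have "\<forall>j. \<exists>K0. \<forall>K\<ge>K0. \<exists>\<mu>. (\<forall>k\<le>K. \<mu> k \<in> test_functions) \<and>
      (\<forall>\<xi>. lp_family \<theta>' \<tau>' j \<xi> = (\<Sum>k\<le>K. \<mu> k \<xi> * lp_family \<theta> \<tau> k \<xi>))"
    using low_frequency_decomposition[OF ad test_lp_family[OF ad']] by blast
  from choice[OF this] obtain K0 where K0: "\<And>j K. K0 j \<le> K \<Longrightarrow> \<exists>\<mu>. (\<forall>k\<le>K. \<mu> k \<in> test_functions) \<and>
      (\<forall>\<xi>. lp_family \<theta>' \<tau>' j \<xi> = (\<Sum>k\<le>K. \<mu> k \<xi> * lp_family \<theta> \<tau> k \<xi>))" by blast
  \<comment> \<open>One window size for both cases: at least \<open>a\<close> for the rescaled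
    decomposition, and at least the thresholds of the exceptional \<open>j\<close>.\<close>
  define K where "K = Max (insert a (K0 ` {..a}))"
  have "K0 j \<le> K" if "j \<le> a" for j unfolding K_def using that by (intro Max_ge) auto
  then have "\<forall>j\<in>{..a}. \<exists>\<mu>. (\<forall>k\<le>K. \<mu> k \<in> test_functions) \<and>
      (\<forall>\<xi>. lp_family \<theta>' \<tau>' j \<xi> = (\<Sum>k\<le>K. \<mu> k \<xi> * lp_family \<theta> \<tau> k \<xi>))" using K0 by blast
  from bchoice[OF this] obtain \<mu> where \<mu>: "\<And>j k. j \<le> a \<Longrightarrow> k \<le> K \<Longrightarrow> \<mu> j k \<in> test_functions"
    "\<And>j \<xi>. j \<le> a \<Longrightarrow> lp_family \<theta>' \<tau>' j \<xi> = (\<Sum>k\<le>K. \<mu> j k \<xi> * lp_family \<theta> \<tau> k \<xi>)" by auto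
  \<comment> \<open>Undoes in advance the dilation by \<open>j\<close> that is applied to the
    coefficients.\<close>
  define \<mu>' where "\<mu>' p \<xi> = \<mu> (fst p) (snd p) (2 ^ fst p *\<^sub>R \<xi>)" for p \<xi>
  let ?F = "insert (\<lambda>_. 0) (\<nu> ` {..<2*a} \<union> \<mu>' ` ({..a} \<times> {..K}))"
  have aK: "a \<le> K" unfolding K_def by simp
  show ?thesis
  proof (intro exI[of _ K] exI[of _ ?F] conjI allI)
    show "finite ?F" by simp
    have "\<mu>' p \<in> test_functions" if "p \<in> {..a} \<times> {..K}" for p
      unfolding \<mu>'_def[abs_def] using that by (intro test_scale \<mu>(1)) auto
    then show "?F \<subseteq> test_functions" using \<nu>(1) test_zero by auto
    fix j
    show "\<exists>\<nu>. (\<forall>k. \<nu> k \<in> ?F) \<and>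
      (\<forall>\<xi>. lp_family \<theta>' \<tau>' j \<xi> = (\<Sum>k\<in>{j - K..j + K}. dilate j (\<nu> k) \<xi> * lp_family \<theta> \<tau> k \<xi>))"
    proof (cases "j \<le> a")
      case True
      let ?n = "\<lambda>k. if k \<le> K then \<mu>' (j, k) else (\<lambda>_. 0)"
      have "lp_family \<theta>' \<tau>' j \<xi> = (\<Sum>k\<in>{j - K..j + K}. dilate j (?n k) \<xi> * lp_family \<theta> \<tau> k \<xi>)" for \<xi>
      proof -
        have "(\<Sum>k\<in>{j - K..j + K}. dilate j (?n k) \<xi> * lp_family \<theta> \<tau> k \<xi>) = (\<Sum>k\<le>K. \<mu> j k \<xi> * lp_family \<theta> \<tau> k \<xi>)"
          using True aK by (intro sum.mono_neutral_cong_right) (auto simp: dilate_def \<mu>'_def)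
        then show ?thesis using \<mu>(2)[OF True] by simp
      qed
      then show ?thesis using True by (intro exI[of _ ?n]) auto
    next
      case False
      \<comment> \<open>Term \<open>i\<close> of the decomposition of \<open>\<tau>'\<close> belongs
        to level \<open>k = j + i - a\<close>. Since \<open>j > a\<close>, these levels are
        positive, so \<open>lp_family\<close> is a dilate of \<open>\<tau>\<close> there.\<close>
      let ?n = "\<lambda>k. if j \<le> k + a \<and> k + a - j < 2 * a then \<nu> (k + a - j) else (\<lambda>_. 0)"
      have "lp_family \<theta>' \<tau>' j \<xi> = (\<Sum>k\<in>{j - K..j + K}. dilate j (?n k) \<xi> * lp_family \<theta> \<tau> k \<xi>)" for \<xi>
      proof -
        have "(\<Sum>k\<in>{j - K..j + K}. dilate j (?n k) \<xi> * lp_family \<theta> \<tau> k \<xi>) =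
            (\<Sum>k\<in>{j - a..<j + a}. dilate j (?n k) \<xi> * lp_family \<theta> \<tau> k \<xi>)"
          using False aK by (intro sum.mono_neutral_right) (auto simp: dilate_def)
        also have "\<dots> = (\<Sum>i<2*a. \<nu> i ((1 / 2 ^ j) *\<^sub>R \<xi>) * \<tau> ((2 ^ a / 2 ^ i) *\<^sub>R ((1 / 2 ^ j) *\<^sub>R \<xi>)))"
        proof (rule sum.reindex_bij_witness[of _ "\<lambda>i. j + i - a" "\<lambda>k. k + a - j"])
          fix k assume k: "k \<in> {j - a..<j + a}"
          then have "k + a - j + j = a + k" using False by auto
          then have "(2::real) ^ (k + a - j) * 2 ^ j = 2 ^ a * 2 ^ k" unfolding power_add[symmetric] by simp
          then have "(2::real) ^ a / 2 ^ (k + a - j) * (1 / 2 ^ j) = 1 / 2 ^ k" by (simp add: field_simps)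
          then show "\<nu> (k + a - j) ((1 / 2 ^ j) *\<^sub>R \<xi>) * \<tau> ((2 ^ a / 2 ^ (k + a - j)) *\<^sub>R ((1 / 2 ^ j) *\<^sub>R \<xi>)) =
              dilate j (?n k) \<xi> * lp_family \<theta> \<tau> k \<xi>"
            using k False by (auto simp: dilate_def lp_family_def)
        qed (use False in auto)
        also have "\<dots> = lp_family \<theta>' \<tau>' j \<xi>"
          using False \<nu>(2)[of "(1 / 2 ^ j) *\<^sub>R \<xi>"] by (simp add: lp_family_def dilate_def)
        finally show ?thesis ..
      qed
      then show ?thesis by (intro exI[of _ ?n]) auto
    qed
  qed
qed

subsection \<open>Pointwise estimates\<close>

lemma wt_dilate:
  assumes "1 \<le> c" "0 \<le> t" "0 \<le> M"
  shows "wt M t \<le> c powr M * wt M (c * t)"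
proof -
  have "1 + c * t \<le> c * (1 + t)" using assms by (simp add: distrib_left)
  then have "(c * (1 + t)) powr (- M) \<le> (1 + c * t) powr (- M)"
    using assms by (intro powr_mono2') (auto intro: add_pos_nonneg)
  then have "c powr M * (c powr (- M) * wt M t) \<le> c powr M * wt M (c * t)"
    using assms by (simp add: wt_def powr_mult mult_left_mono)
  moreover have "c powr M * c powr (- M) = 1" using assms by (simp add: powr_add[symmetric])
  ultimately show ?thesis by (simp add: mult.assoc[symmetric])
qed

text \<open>The cutoffs are one on the supports of \<open>\<theta>\<close> and
  \<open>\<tau>\<close>, so multiplication by the dilated cutoff changes nothing; this expresses
  band limitation as a reproducing formula.\<close>

lemma lp_reproducing:
  fixes \<theta> \<tau> :: "real^'n \<Rightarrow> complex"
  assumes ad: "admissible \<theta> \<tau>" and u: "tempered_distribution u"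
    and \<Phi>: "\<Phi>1 \<in> test_functions" "\<And>\<xi>. \<xi> \<in> supp \<theta> \<Longrightarrow> \<Phi>1 \<xi> = 1"
      "\<Phi>2 \<in> test_functions" "\<And>\<xi>. \<xi> \<in> supp \<tau> \<Longrightarrow> \<Phi>2 \<xi> = 1"
    and g: "g = multiplier (lp_family \<theta> \<tau> k) u" and P: "P = (if k = 0 then \<Phi>1 else \<Phi>2)"
  shows "integrable lborel (\<lambda>w. fker (dilate k P) (w - x) * g w)"
    and "g x = (\<integral>w. fker (dilate k P) (w - x) * g w \<partial>lborel)"
proof -
  note D = admissibleD[OF ad]
  have b: "\<theta> \<in> test_functions" "\<theta> 0 \<noteq> 0" using D(1) D(4)[of 0] by (auto simp: centered_cube_def)
  have Pt: "dilate k P \<in> test_functions" unfolding P using \<Phi> by (intro test_dilate) auto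
  have eq: "(\<lambda>\<xi>. dilate k P \<xi> * lp_family \<theta> \<tau> k \<xi>) = lp_family \<theta> \<tau> k"
  proof
    fix \<xi>
    show "dilate k P \<xi> * lp_family \<theta> \<tau> k \<xi> = lp_family \<theta> \<tau> k \<xi>"
    proof (cases "k = 0")
      case True
      then show ?thesis using \<Phi>(2)[of \<xi>] test_functionsD(5)[OF D(1), of \<xi>]
        by (cases "\<xi> \<in> supp \<theta>") (auto simp: lp_family_def P dilate_def)
    next
      case False
      let ?x = "(1 / 2 ^ k) *\<^sub>R \<xi>"
      show ?thesis using False \<Phi>(4)[of ?x] test_functionsD(5)[OF D(2), of ?x]
        by (cases "?x \<in> supp \<tau>") (auto simp: lp_family_def P dilate_def)
    qed
  qed
  note m = multiplier_mult[OF b u Pt test_lp_family[OF ad, of k], of x]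
  show "integrable lborel (\<lambda>w. fker (dilate k P) (w - x) * g w)" unfolding g by (rule m(1))
  show "g x = (\<integral>w. fker (dilate k P) (w - x) * g w \<partial>lborel)" using m(2) unfolding eq g .
qed

text \<open>The decomposition of symbols writes the piece on the left as a sum of convolutions of
  neighbouring pieces with rapidly decaying kernels, and \<open>peetre_maximal\<close> controls
  these pieces by weighted infima. The bounds \<open>G k\<close> stay abstract; they later become
  roots of suprema once these are known to be finite.\<close>

lemma pointwise_estimate:
  fixes \<theta> \<tau> \<theta>' \<tau>' :: "real^'n \<Rightarrow> complex" and M :: real
  assumes ad: "admissible \<theta> \<tau>" and ad': "admissible \<theta>' \<tau>'" and M: "0 \<le> M"
  shows "\<exists>a b C. 0 < C \<and> (\<forall>u j x G. tempered_distribution u \<longrightarrow>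
    (\<forall>k l. \<exists>D. \<forall>y. cinf l (multiplier (lp_family \<theta> \<tau> k) u) y \<le> D) \<longrightarrow>
    (\<forall>k\<in>{j - b..j + b}. \<forall>y. cinf (int (k + a)) (multiplier (lp_family \<theta> \<tau> k) u) y * wt M (2 ^ (k + a) * norm (x - y)) \<le> G k) \<longrightarrow>
    norm (multiplier (lp_family \<theta>' \<tau>' j) u x) \<le> C * (\<Sum>k\<in>{j - b..j + b}. G k))"
proof -
  note D = admissibleD[OF ad]
  have \<beta>: "\<theta> \<in> test_functions" "\<theta> 0 \<noteq> 0" using D(1) D(4)[of 0] by (auto simp: centered_cube_def)
  obtain \<Phi>1 where \<Phi>1: "\<Phi>1 \<in> test_functions" "\<And>\<xi>. \<xi> \<in> supp \<theta> \<Longrightarrow> \<Phi>1 \<xi> = 1"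
    using cutoff_exists[OF ad test_functionsD(2)[OF D(1)]] by blast
  obtain \<Phi>2 where \<Phi>2: "\<Phi>2 \<in> test_functions" "\<And>\<xi>. \<xi> \<in> supp \<tau> \<Longrightarrow> \<Phi>2 \<xi> = 1"
    using cutoff_exists[OF ad test_functionsD(2)[OF D(2)]] by blast
  let ?peetre = "\<lambda>\<Phi> a. \<forall>k g x B.
    (\<forall>x. integrable lborel (\<lambda>w. fker (dilate k \<Phi>) (w - x) * g w) \<and>
      g x = (\<integral>w. fker (dilate k \<Phi>) (w - x) * g w \<partial>lborel)) \<longrightarrow>
    (\<exists>C N. \<forall>y. norm (g y) \<le> C * (1 + norm y) ^ N) \<longrightarrow>
    (\<forall>l. \<exists>C. \<forall>y. cinf l g y \<le> C) \<longrightarrow>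
    (\<forall>y. cinf (int (k + a)) g y * wt M (2 ^ k * norm (x - y)) \<le> B) \<longrightarrow>
    (\<forall>w. norm (g w) * wt M (2 ^ k * norm (x - w)) \<le> 2 * B)"
  obtain a1 where a1: "\<forall>a\<ge>a1. ?peetre \<Phi>1 a" using peetre_maximal[OF \<Phi>1(1) M] ..
  obtain a2 where a2: "\<forall>a\<ge>a2. ?peetre \<Phi>2 a" using peetre_maximal[OF \<Phi>2(1) M] ..
  define a where "a = max a1 a2"
  have pa: "?peetre (if k = 0 then \<Phi>1 else \<Phi>2) a" for k :: nat
  proof (cases "k = 0")
    case True
    have "?peetre \<Phi>1 a" by (rule mp[OF spec[OF a1, of a]]) (simp add: a_def)
    then show ?thesis unfolding True by (simp only: simp_thms if_True)
  next
    case False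
    have "?peetre \<Phi>2 a" by (rule mp[OF spec[OF a2, of a]]) (simp add: a_def)
    then show ?thesis using False by (simp only: simp_thms if_False)
  qed
  obtain b F where F: "finite F" "F \<subseteq> test_functions" "\<forall>j. \<exists>\<nu>. (\<forall>k. \<nu> k \<in> F) \<and>
    (\<forall>\<xi>. lp_family \<theta>' \<tau>' j \<xi> = (\<Sum>k\<in>{j - b..j + b}. dilate j (\<nu> k) \<xi> * lp_family \<theta> \<tau> k \<xi>))"
    using lp_decomposition[OF ad ad'] by (elim exE conjE)
  have "\<forall>f\<in>F. \<exists>C\<ge>0. \<forall>z. norm (fker f z) \<le> C * wt (M + 2 * CARD('n)) (norm z)"
    using schwartz_decay_wt[OF fker_schwartz] F(2) by blast
  from bchoice[OF this] obtain c where c: "\<And>f. f \<in> F \<Longrightarrow> 0 \<le> c f"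
    "\<And>f z. f \<in> F \<Longrightarrow> norm (fker f z) \<le> c f * wt (M + 2 * CARD('n)) (norm z)" by blast
  define C1 where "C1 = sum c F"
  have C1: "0 \<le> C1" unfolding C1_def using c(1) by (rule sum_nonneg)
  have kb: "norm (fker f z) \<le> C1 * wt (M + 2 * CARD('n)) (norm z)" if "f \<in> F" for f z
  proof -
    have "norm (fker f z) \<le> c f * wt (M + 2 * CARD('n)) (norm z)" by (rule c(2)[OF that])
    also have "\<dots> \<le> C1 * wt (M + 2 * CARD('n)) (norm z)"
      unfolding C1_def using c(1) F(1) that wt_pos[OF norm_ge_zero, of "M + 2 * CARD('n)" z]
      by (intro mult_right_mono member_le_sum) auto
    finally show ?thesis .
  qed
  \<comment> \<open>The factor 2 comes from absorption, the powers of \<open>2 ^ a\<close> and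
    \<open>2 ^ b\<close> from passing between the scales of \<open>k + a\<close>, \<open>k\<close>
    and \<open>j\<close> in the weights.\<close>
  define B where "B = (2 ^ b) powr M * (2 * (2 ^ a) powr M)"
  have B: "0 \<le> B" by (simp add: B_def)
  let ?C = "C1 * cwr TYPE('n) * B + 1"
  have C: "0 \<le> C1 * cwr TYPE('n) * B" using C1 B cwr_nonneg[of "TYPE('n)"] by simp
  show ?thesis
  proof (rule exI[of _ a], rule exI[of _ b], rule exI[of _ ?C], intro conjI allI impI)
    show "0 < ?C" using C by simp
    fix u j x G
    let ?g = "\<lambda>k. multiplier (lp_family \<theta> \<tau> k) u"
    assume u: "tempered_distribution u" and ci: "\<forall>k l. \<exists>D. \<forall>y. cinf l (?g k) y \<le> D"
      and G: "\<forall>k\<in>{j - b..j + b}. \<forall>y. cinf (int (k + a)) (?g k) y * wt M (2 ^ (k + a) * norm (x - y)) \<le> G k"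
    have G0: "0 \<le> G k" if "k \<in> {j - b..j + b}" for k
    proof -
      have "0 \<le> cinf (int (k + a)) (?g k) x * wt M (2 ^ (k + a) * norm (x - x))"
        by (simp add: cinf_nonneg)
      then show ?thesis using G that by (meson order_trans)
    qed
    have mg: "norm (?g k w) * wt M (2 ^ j * norm (x - w)) \<le> B * G k" if k: "k \<in> {j - b..j + b}" for k w
    proof -
      let ?P = "if k = 0 then \<Phi>1 else \<Phi>2"
      have rep: "\<forall>x. integrable lborel (\<lambda>w. fker (dilate k ?P) (w - x) * ?g k w) \<and>
          ?g k x = (\<integral>w. fker (dilate k ?P) (w - x) * ?g k w \<partial>lborel)"
        using lp_reproducing[OF ad u \<Phi>1 \<Phi>2 refl refl, of k] by blast
      have gr: "\<exists>C N. \<forall>y. norm (?g k y) \<le> C * (1 + norm y) ^ N"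
        using multiplier_growth[OF \<beta> u test_lp_family[OF ad, of k]] by blast
      have "cinf (int (k + a)) (?g k) y * wt M (2 ^ k * norm (x - y)) \<le> (2 ^ a) powr M * G k" for y
      proof -
        have "wt M (2 ^ k * norm (x - y)) \<le> (2 ^ a) powr M * wt M (2 ^ a * (2 ^ k * norm (x - y)))"
          by (rule wt_dilate) (use M in auto)
        then have "cinf (int (k + a)) (?g k) y * wt M (2 ^ k * norm (x - y)) \<le>
            cinf (int (k + a)) (?g k) y * ((2 ^ a) powr M * wt M (2 ^ a * (2 ^ k * norm (x - y))))"
          by (rule mult_left_mono) (rule cinf_nonneg)
        also have "\<dots> = (2 ^ a) powr M * (cinf (int (k + a)) (?g k) y * wt M (2 ^ (k + a) * norm (x - y)))"
          by (simp add: power_add mult_ac)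
        also have "\<dots> \<le> (2 ^ a) powr M * G k" using G k by (intro mult_left_mono) auto
        finally show ?thesis .
      qed
      then have pk: "norm (?g k w) * wt M (2 ^ k * norm (x - w)) \<le> 2 * ((2 ^ a) powr M * G k)"
        using pa[of k, rule_format, of k "?g k" x "(2 ^ a) powr M * G k" w] rep gr ci by blast
      have "(2::real) ^ k \<le> 2 ^ b * 2 ^ j"
        unfolding power_add[symmetric] using k by (intro power_increasing) auto
      then have "wt M (2 ^ b * (2 ^ j * norm (x - w))) \<le> wt M (2 ^ k * norm (x - w))"
        using M unfolding mult.assoc[symmetric] by (intro wt_antimono mult_right_mono) auto
      moreover have "wt M (2 ^ j * norm (x - w)) \<le> (2 ^ b) powr M * wt M (2 ^ b * (2 ^ j * norm (x - w)))"
        by (rule wt_dilate) (use M in auto)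
      ultimately have "wt M (2 ^ j * norm (x - w)) \<le> (2 ^ b) powr M * wt M (2 ^ k * norm (x - w))"
        by (meson mult_left_mono order_trans powr_ge_zero)
      then have "norm (?g k w) * wt M (2 ^ j * norm (x - w)) \<le> norm (?g k w) * ((2 ^ b) powr M * wt M (2 ^ k * norm (x - w)))"
        by (rule mult_left_mono) simp
      also have "\<dots> = (2 ^ b) powr M * (norm (?g k w) * wt M (2 ^ k * norm (x - w)))" by (simp add: mult_ac)
      also have "\<dots> \<le> (2 ^ b) powr M * (2 * ((2 ^ a) powr M * G k))" by (intro mult_left_mono pk) simp
      finally show ?thesis by (simp add: B_def mult_ac)
    qed
    obtain \<nu> where \<nu>: "\<And>k. \<nu> k \<in> F" "\<And>\<xi>. lp_family \<theta>' \<tau>' j \<xi> = (\<Sum>k\<in>{j - b..j + b}. dilate j (\<nu> k) \<xi> * lp_family \<theta> \<tau> k \<xi>)"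
      using F(3)[rule_format, of j] by blast
    have \<nu>t: "\<nu> k \<in> test_functions" for k using \<nu>(1) F(2) by blast
    have each: "norm (multiplier (\<lambda>\<xi>. dilate j (\<nu> k) \<xi> * lp_family \<theta> \<tau> k \<xi>) u x) \<le> C1 * cwr TYPE('n) * (B * G k)"
      if k: "k \<in> {j - b..j + b}" for k
    proof -
      note m = multiplier_mult[OF \<beta> u test_dilate[OF \<nu>t[of k], of j] test_lp_family[OF ad, of k], of x]
      \<comment> \<open>The weighted convolution bound is evaluated at its base point, where the
        weight equals one.\<close>
      have "norm (\<integral>w. fker (dilate j (\<nu> k)) (w - x) * ?g k w \<partial>lborel) * wt M (2 ^ j * norm (x - x)) \<le> C1 * cwr TYPE('n) * (B * G k)"
      proof (rule weighted_convolution_bound[OF _ C1 M _ m(1) _ mg[OF k]])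
        show "0 \<le> B * G k" using B G0[OF k] by simp
        fix w
        have "norm (fker (dilate j (\<nu> k)) (w - x)) = (2 ^ j) ^ CARD('n) * norm (fker (\<nu> k) (2 ^ j *\<^sub>R (w - x)))"
          by (simp add: fker_dilate[OF \<nu>t] norm_mult norm_power power_mult)
        also have "\<dots> \<le> (2 ^ j) ^ CARD('n) * (C1 * wt (M + 2 * CARD('n)) (norm (2 ^ j *\<^sub>R (w - x))))"
          by (intro mult_left_mono kb \<nu>) simp
        finally show "norm (fker (dilate j (\<nu> k)) (w - x)) \<le> C1 * (2 ^ j) ^ CARD('n) * wt (M + 2 * CARD('n)) (2 ^ j * norm (x - w))"
          by (simp add: norm_minus_commute mult_ac)
      qed simp
      then show ?thesis unfolding m(2) by simp
    qed
    have "multiplier (lp_family \<theta>' \<tau>' j) u x = multiplier (\<lambda>\<xi>. \<Sum>k\<in>{j - b..j + b}. dilate j (\<nu> k) \<xi> * lp_family \<theta> \<tau> k \<xi>) u x"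
      using \<nu>(2) by (intro arg_cong[where f = "\<lambda>z. multiplier z u x"]) auto
    also have "\<dots> = (\<Sum>k\<in>{j - b..j + b}. multiplier (\<lambda>\<xi>. dilate j (\<nu> k) \<xi> * lp_family \<theta> \<tau> k \<xi>) u x)"
      by (intro multiplier_sum[OF \<beta> u] test_mult(1) test_dilate \<nu>t test_functionsD(1) test_lp_family ad)
    also have "norm \<dots> \<le> (\<Sum>k\<in>{j - b..j + b}. C1 * cwr TYPE('n) * (B * G k))"
      by (intro sum_norm_le each)
    also have "\<dots> = C1 * cwr TYPE('n) * B * (\<Sum>k\<in>{j - b..j + b}. G k)" by (simp add: sum_distrib_left mult.assoc)
    also have "\<dots> \<le> ?C * (\<Sum>k\<in>{j - b..j + b}. G k)"
      using G0 by (intro mult_right_mono sum_nonneg) auto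
    finally show "norm (multiplier (lp_family \<theta>' \<tau>' j) u x) \<le> ?C * (\<Sum>k\<in>{j - b..j + b}. G k)" .
  qed
qed

text \<open>The sum is at most \<open>card W\<close> times its maximum, which covers exponents below
  and above one at once.\<close>

lemma ennreal_powr_sum_le_card:
  fixes f :: "'i \<Rightarrow> ennreal"
  assumes "finite W" "0 < t"
  shows "ennreal_powr (\<Sum>k\<in>W. f k) t \<le> ennreal (real (card W) powr t) * (\<Sum>k\<in>W. ennreal_powr (f k) t)"
proof (cases "W = {}")
  case False
  define m where "m = Max (f ` W)"
  have "m \<in> f ` W" unfolding m_def using False assms by (intro Max_in) auto
  then obtain k where k: "k \<in> W" "m = f k" by auto
  have "(\<Sum>k\<in>W. f k) \<le> (\<Sum>k\<in>W. m)" unfolding m_def using assms by (intro sum_mono Max_ge) auto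
  also have "\<dots> = ennreal (real (card W)) * m" by (simp add: ennreal_of_nat_eq_real_of_nat)
  finally have "ennreal_powr (\<Sum>k\<in>W. f k) t \<le> ennreal_powr (ennreal (real (card W)) * m) t"
    using assms by (intro ennreal_powr_mono) auto
  also have "\<dots> = ennreal (real (card W) powr t) * ennreal_powr m t"
    using assms by (simp add: ennreal_powr_mult ennreal_powr_ennreal)
  also have "\<dots> \<le> ennreal (real (card W) powr t) * (\<Sum>k\<in>W. ennreal_powr (f k) t)"
    unfolding k(2) using assms k(1) by (intro mult_left_mono member_le_sum) auto
  finally show ?thesis .
qed simp

lemma ennreal_powr_enn2real_root:
  assumes "x < top" "0 < \<rho>"
  shows "ennreal_powr (ennreal (enn2real x powr (1 / \<rho>))) \<rho> = x"
  using assms by (simp add: ennreal_powr_ennreal powr_powr)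

lemma card_window: "card {j - b..j + b} \<le> 2 * b + (1::nat)"
  by auto

text \<open>The power \<open>\<rho>\<close> is left free because the Triebel-Lizorkin case uses
  \<open>r\<close> and the Besov case \<open>q\<close>. An infinite supremum makes the estimate
  trivial; otherwise its root is the \<open>G k\<close> of
  \<open>pointwise_estimate\<close>.\<close>

lemma pointwise_sup_estimate:
  fixes \<theta> \<tau> \<theta>' \<tau>' :: "real^'n \<Rightarrow> complex" and M :: real
  assumes ad: "admissible \<theta> \<tau>" and ad': "admissible \<theta>' \<tau>'" and M: "0 \<le> M"
  shows "\<exists>a b C. 0 < C \<and> (\<forall>u j x \<rho>. tempered_distribution u \<longrightarrow>
    (\<forall>k l. \<exists>D. \<forall>y. cinf l (multiplier (lp_family \<theta> \<tau> k) u) y \<le> D) \<longrightarrow> 0 < \<rho> \<longrightarrow>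
    ennreal_powr (ennreal (norm (multiplier (lp_family \<theta>' \<tau>' j) u x))) \<rho> \<le>
    ennreal (C powr \<rho>) * (\<Sum>k\<in>{j - b..j + b}. SUP y. ennreal (wt (M * \<rho>) (2 powi int (k + a) * norm (x - y)) *
        cinf (int (k + a)) (multiplier (lp_family \<theta> \<tau> k) u) y powr \<rho>)))"
proof -
  obtain a b C where C: "0 < C" "\<And>u j x G. tempered_distribution u \<Longrightarrow>
    (\<forall>k l. \<exists>D. \<forall>y. cinf l (multiplier (lp_family \<theta> \<tau> k) u) y \<le> D) \<Longrightarrow>
    (\<forall>k\<in>{j - b..j + b}. \<forall>y. cinf (int (k + a)) (multiplier (lp_family \<theta> \<tau> k) u) y * wt M (2 ^ (k + a) * norm (x - y)) \<le> G k) \<Longrightarrow>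
    norm (multiplier (lp_family \<theta>' \<tau>' j) u x) \<le> C * (\<Sum>k\<in>{j - b..j + b}. G k)"
    using pointwise_estimate[OF ad ad' M] by (elim exE conjE) blast
  let ?N = "real (2 * b + 1)"
  show ?thesis
  proof (rule exI[of _ a], rule exI[of _ b], rule exI[of _ "C * ?N"], intro conjI allI impI)
    show "0 < C * ?N" using C(1) by simp
    fix u j x and \<rho> :: real
    let ?g = "\<lambda>k. multiplier (lp_family \<theta> \<tau> k) u" and ?W = "{j - b..j + b}"
    let ?X = "\<lambda>k. SUP y. ennreal (wt (M * \<rho>) (2 powi int (k + a) * norm (x - y)) * cinf (int (k + a)) (?g k) y powr \<rho>)"
    assume u: "tempered_distribution u" and ci: "\<forall>k l. \<exists>D. \<forall>y. cinf l (?g k) y \<le> D" and \<rho>: "0 < \<rho>"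
    show "ennreal_powr (ennreal (norm (multiplier (lp_family \<theta>' \<tau>' j) u x))) \<rho> \<le> ennreal ((C * ?N) powr \<rho>) * (\<Sum>k\<in>?W. ?X k)"
    proof (cases "\<exists>k\<in>?W. ?X k = \<infinity>")
      case True
      then obtain k where k: "k \<in> ?W" "?X k = \<infinity>" by blast
      have "?X k \<le> (\<Sum>k\<in>?W. ?X k)" using k(1) by (intro member_le_sum) auto
      then have inf: "(\<Sum>k\<in>?W. ?X k) = \<infinity>" unfolding k(2) infinity_ennreal_def by (rule top_le)
      show ?thesis unfolding inf using C(1) by (simp add: ennreal_mult_top)
    next
      case False
      define G where "G k = enn2real (?X k) powr (1 / \<rho>)" for k
      have XG: "?X k = ennreal_powr (ennreal (G k)) \<rho>" if "k \<in> ?W" for k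
      proof -
        have "?X k \<noteq> top" using False that unfolding infinity_ennreal_def by blast
        then have "?X k < top" by (rule less_top[THEN iffD1])
        then show ?thesis unfolding G_def by (rule ennreal_powr_enn2real_root[OF _ \<rho>, symmetric])
      qed
      have "cinf (int (k + a)) (?g k) y * wt M (2 ^ (k + a) * norm (x - y)) \<le> G k" if k: "k \<in> ?W" for k y
      proof -
        let ?c = "cinf (int (k + a)) (?g k) y" and ?w = "wt M (2 ^ (k + a) * norm (x - y))"
        have w0: "0 \<le> ?w" using wt_pos[of "2 ^ (k + a) * norm (x - y)" M] by simp
        have "ennreal_powr (ennreal (?c * ?w)) \<rho> = ennreal (wt (M * \<rho>) (2 powi int (k + a) * norm (x - y)) * ?c powr \<rho>)"
          unfolding power_int_of_nat using w0 cinf_nonneg[of "int (k + a)" "?g k" y]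
          by (simp add: ennreal_powr_ennreal powr_mult wt_powr[symmetric] mult.commute)
        also have "\<dots> \<le> ?X k" by (rule SUP_upper) simp
        finally have "ennreal_powr (ennreal (?c * ?w)) \<rho> \<le> ennreal_powr (ennreal (G k)) \<rho>" unfolding XG[OF k] .
        then have "ennreal (?c * ?w) \<le> ennreal (G k)" using \<rho> by (simp add: ennreal_powr_le_iff ennreal_powr_inverse)
        then show ?thesis by (simp add: G_def)
      qed
      then have "norm (multiplier (lp_family \<theta>' \<tau>' j) u x) \<le> C * (\<Sum>k\<in>?W. G k)"
        by (intro C(2)[OF u ci]) blast
      then have "ennreal (norm (multiplier (lp_family \<theta>' \<tau>' j) u x)) \<le> ennreal C * (\<Sum>k\<in>?W. ennreal (G k))"
        using C(1) by (simp add: G_def ennreal_mult[symmetric] sum_nonneg ennreal_leI)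
      then have "ennreal_powr (ennreal (norm (multiplier (lp_family \<theta>' \<tau>' j) u x))) \<rho> \<le> ennreal_powr (ennreal C * (\<Sum>k\<in>?W. ennreal (G k))) \<rho>"
        using \<rho> by (intro ennreal_powr_mono) auto
      also have "\<dots> = ennreal (C powr \<rho>) * ennreal_powr (\<Sum>k\<in>?W. ennreal (G k)) \<rho>"
        using \<rho> C(1) by (simp add: ennreal_powr_mult ennreal_powr_ennreal)
      also have "\<dots> \<le> ennreal (C powr \<rho>) * (ennreal (real (card ?W) powr \<rho>) * (\<Sum>k\<in>?W. ennreal_powr (ennreal (G k)) \<rho>))"
        by (intro mult_left_mono ennreal_powr_sum_le_card \<rho>) auto
      also have "(\<Sum>k\<in>?W. ennreal_powr (ennreal (G k)) \<rho>) = (\<Sum>k\<in>?W. ?X k)"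
        by (intro sum.cong refl XG[symmetric])
      also have "ennreal (C powr \<rho>) * (ennreal (real (card ?W) powr \<rho>) * (\<Sum>k\<in>?W. ?X k)) \<le>
          ennreal (C powr \<rho>) * (ennreal (?N powr \<rho>) * (\<Sum>k\<in>?W. ?X k))"
        using card_window[of j b] \<rho>
        by (intro mult_left_mono mult_right_mono ennreal_leI powr_mono2) (auto simp del: card_atLeastAtMost)
      also have "\<dots> = ennreal ((C * ?N) powr \<rho>) * (\<Sum>k\<in>?W. ?X k)"
        using C(1) by (simp add: powr_mult ennreal_mult mult.assoc)
      finally show ?thesis .
    qed
  qed
qed

subsection \<open>Series of extended reals\<close>

lemma suminf_shift_le:
  fixes f :: "nat \<Rightarrow> ennreal"
  shows "(\<Sum>k. f (k + a)) \<le> (\<Sum>i. f i)"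
proof (rule suminf_ennreal_least)
  fix n
  have "(\<Sum>k<n. f (k + a)) = (\<Sum>i\<in>{0 + a..<n + a}. f i)"
    unfolding sum.shift_bounds_nat_ivl lessThan_atLeast0 ..
  also have "\<dots> \<le> (\<Sum>i. f i)" by (rule sum_le_suminf) auto
  finally show "(\<Sum>k<n. f (k + a)) \<le> (\<Sum>i. f i)" .
qed

lemma suminf_le_shift:
  fixes f :: "nat \<Rightarrow> ennreal"
  assumes "\<And>i. i < a \<Longrightarrow> f i = 0"
  shows "(\<Sum>i. f i) \<le> (\<Sum>k. f (k + a))"
proof (rule suminf_ennreal_least)
  fix n
  have "(\<Sum>i<n. f i) \<le> (\<Sum>i<n + a. f i)" by (intro sum_mono2) auto
  also have "\<dots> = (\<Sum>i\<in>{0 + a..<n + a}. f i)" using assms by (intro sum.mono_neutral_right) auto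
  also have "\<dots> = (\<Sum>k<n. f (k + a))" unfolding sum.shift_bounds_nat_ivl lessThan_atLeast0 ..
  also have "\<dots> \<le> (\<Sum>k. f (k + a))" by (rule sum_le_suminf) auto
  finally show "(\<Sum>i<n. f i) \<le> (\<Sum>k. f (k + a))" .
qed

lemma suminf_head:
  fixes f :: "nat \<Rightarrow> ennreal"
  shows "(\<Sum>i. f i) \<le> f 0 + (\<Sum>i. f (Suc i))"
proof (rule suminf_ennreal_least)
  fix n
  have "(\<Sum>i<n. f i) \<le> (\<Sum>i<Suc n. f i)" by simp
  also have "\<dots> = f 0 + (\<Sum>i<n. f (Suc i))" by (rule sum.lessThan_Suc_shift)
  also have "\<dots> \<le> f 0 + (\<Sum>i. f (Suc i))" by (intro add_left_mono sum_le_suminf) auto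
  finally show "(\<Sum>i<n. f i) \<le> f 0 + (\<Sum>i. f (Suc i))" .
qed

text \<open>Each \<open>k\<close> lies in the windows of at most \<open>2 * b + 1\<close> indices
  \<open>j\<close>; working with partial sums keeps the exchange of summations finite.\<close>

lemma suminf_window_le:
  fixes a :: "nat \<Rightarrow> ennreal"
  shows "(\<Sum>j. \<Sum>k\<in>{j - b..j + b}. a k) \<le> ennreal (real (2 * b + 1)) * (\<Sum>k. a k)"
proof (rule suminf_ennreal_least)
  fix n
  let ?R = "\<lambda>j k. j - b \<le> k \<and> k \<le> j + b"
  have "(\<Sum>j<n. \<Sum>k\<in>{j - b..j + b}. a k) = (\<Sum>j\<in>{..<n}. \<Sum>k\<in>{k. k \<in> {..n + b} \<and> ?R j k}. a k)"
    by (intro sum.cong) auto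
  also have "\<dots> = (\<Sum>k\<in>{..n + b}. \<Sum>j\<in>{j. j \<in> {..<n} \<and> ?R j k}. a k)"
    by (rule sum.swap_restrict) auto
  also have "\<dots> \<le> (\<Sum>k\<in>{..n + b}. ennreal (real (2 * b + 1)) * a k)"
  proof (rule sum_mono)
    fix k
    have "card {j. j \<in> {..<n} \<and> ?R j k} \<le> card {k - b..k + b}" by (intro card_mono) auto
    also have "\<dots> \<le> 2 * b + 1" by (rule card_window)
    finally have "of_nat (card {j. j \<in> {..<n} \<and> ?R j k}) \<le> (of_nat (2 * b + 1) :: ennreal)" by (rule of_nat_mono)
    then show "(\<Sum>j\<in>{j. j \<in> {..<n} \<and> ?R j k}. a k) \<le> ennreal (real (2 * b + 1)) * a k"
      unfolding sum_constant ennreal_of_nat_eq_real_of_nat by (rule mult_right_mono) simp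
  qed
  also have "\<dots> = ennreal (real (2 * b + 1)) * (\<Sum>k\<in>{..n + b}. a k)" by (rule sum_distrib_left[symmetric])
  also have "\<dots> \<le> ennreal (real (2 * b + 1)) * (\<Sum>k. a k)" by (intro mult_left_mono sum_le_suminf) auto
  finally show "(\<Sum>j<n. \<Sum>k\<in>{j - b..j + b}. a k) \<le> ennreal (real (2 * b + 1)) * (\<Sum>k. a k)" .
qed

subsection \<open>Elementary properties of the Morrey quasi-norm\<close>

context
  fixes q :: real and \<phi> :: "real \<Rightarrow> real"
  assumes q: "0 < q" and \<phi>: "\<And>t. 0 < t \<Longrightarrow> 0 < \<phi> t"
begin

lemma morrey_norm_integral:
  "(\<integral>\<^sup>+y. ennreal_powr (F y) q * indicator (dyadic_cube L m) y \<partial>lborel) \<le>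
    ennreal_powr (morrey_norm \<phi> q F) q * ennreal (\<phi> (2 powi (- L)) powr (- q)) * ennreal ((2 powi (- L)) ^ CARD('n))"
  for F :: "real^'n \<Rightarrow> ennreal"
  by (rule morrey_norm_le_iff[where \<phi> = \<phi> and q = q and N = "morrey_norm \<phi> q F", OF q \<phi>, THEN iffD1, OF _ order_refl, rule_format])

lemma morrey_norm_leI:
  fixes F :: "real^'n \<Rightarrow> ennreal"
  assumes "\<And>L m. (\<integral>\<^sup>+y. ennreal_powr (F y) q * indicator (dyadic_cube L m) y \<partial>lborel) \<le>
    ennreal_powr N q * ennreal (\<phi> (2 powi (- L)) powr (- q)) * ennreal ((2 powi (- L)) ^ CARD('n))"
  shows "morrey_norm \<phi> q F \<le> N"
  by (rule morrey_norm_le_iff[where \<phi> = \<phi> and q = q, OF q \<phi>, THEN iffD2]) (use assms in auto)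

lemma morrey_norm_mono:
  assumes "\<And>x. F x \<le> G x"
  shows "morrey_norm \<phi> q F \<le> morrey_norm \<phi> q G"
proof (rule morrey_norm_leI)
  fix L m
  have "(\<integral>\<^sup>+y. ennreal_powr (F y) q * indicator (dyadic_cube L m) y \<partial>lborel) \<le>
      (\<integral>\<^sup>+y. ennreal_powr (G y) q * indicator (dyadic_cube L m) y \<partial>lborel)"
    using q assms by (intro nn_integral_mono mult_right_mono ennreal_powr_mono) auto
  also note morrey_norm_integral
  finally show "(\<integral>\<^sup>+y. ennreal_powr (F y) q * indicator (dyadic_cube L m) y \<partial>lborel) \<le>
    ennreal_powr (morrey_norm \<phi> q G) q * ennreal (\<phi> (2 powi (- L)) powr (- q)) * ennreal ((2 powi (- L)) ^ CARD('a))" .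
qed

lemma morrey_norm_cmult:
  fixes F :: "real^'n \<Rightarrow> ennreal"
  assumes [measurable]: "F \<in> borel_measurable borel"
  shows "morrey_norm \<phi> q (\<lambda>x. c * F x) \<le> c * morrey_norm \<phi> q F"
proof (rule morrey_norm_leI)
  fix L and m :: "int^'n"
  have "(\<integral>\<^sup>+y. ennreal_powr (c * F y) q * indicator (dyadic_cube L m) y \<partial>lborel) =
      ennreal_powr c q * (\<integral>\<^sup>+y. ennreal_powr (F y) q * indicator (dyadic_cube L m) y \<partial>lborel)"
    unfolding ennreal_powr_mult[OF q] mult.assoc by (rule nn_integral_cmult) measurable
  also have "\<dots> \<le> ennreal_powr c q * (ennreal_powr (morrey_norm \<phi> q F) q * ennreal (\<phi> (2 powi (- L)) powr (- q)) * ennreal ((2 powi (- L)) ^ CARD('n)))"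
    by (intro mult_left_mono morrey_norm_integral) simp
  finally show "(\<integral>\<^sup>+y. ennreal_powr (c * F y) q * indicator (dyadic_cube L m) y \<partial>lborel) \<le>
    ennreal_powr (c * morrey_norm \<phi> q F) q * ennreal (\<phi> (2 powi (- L)) powr (- q)) * ennreal ((2 powi (- L)) ^ CARD('n))"
    unfolding ennreal_powr_mult[OF q] by (simp only: mult.assoc)
qed

text \<open>Integrals of \<open>q\<close>-th powers are additive, so this combination is available
  for every positive \<open>q\<close>, also for \<open>q < 1\<close>, where the triangle inequality
  fails.\<close>

lemma morrey_norm_sum:
  fixes F :: "'i \<Rightarrow> real^'n \<Rightarrow> ennreal"
  assumes W: "finite W" and [measurable]: "\<And>k. F k \<in> borel_measurable borel"
  shows "morrey_norm \<phi> q (\<lambda>x. ennreal_powr (\<Sum>k\<in>W. ennreal_powr (F k x) q) (1 / q))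
    \<le> ennreal_powr (\<Sum>k\<in>W. ennreal_powr (morrey_norm \<phi> q (F k)) q) (1 / q)"
proof (rule morrey_norm_leI)
  fix L and m :: "int^'n"
  have "(\<integral>\<^sup>+y. ennreal_powr (ennreal_powr (\<Sum>k\<in>W. ennreal_powr (F k y) q) (1 / q)) q * indicator (dyadic_cube L m) y \<partial>lborel)
    = (\<integral>\<^sup>+y. (\<Sum>k\<in>W. ennreal_powr (F k y) q * indicator (dyadic_cube L m) y) \<partial>lborel)"
    unfolding ennreal_powr_inverse(2)[OF q] sum_distrib_right ..
  also have "\<dots> = (\<Sum>k\<in>W. \<integral>\<^sup>+y. ennreal_powr (F k y) q * indicator (dyadic_cube L m) y \<partial>lborel)"
    by (rule nn_integral_sum) measurable
  also have "\<dots> \<le> (\<Sum>k\<in>W. ennreal_powr (morrey_norm \<phi> q (F k)) q * ennreal (\<phi> (2 powi (- L)) powr (- q)) * ennreal ((2 powi (- L)) ^ CARD('n)))"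
    by (intro sum_mono morrey_norm_integral)
  finally show "(\<integral>\<^sup>+y. ennreal_powr (ennreal_powr (\<Sum>k\<in>W. ennreal_powr (F k y) q) (1 / q)) q * indicator (dyadic_cube L m) y \<partial>lborel)
    \<le> ennreal_powr (ennreal_powr (\<Sum>k\<in>W. ennreal_powr (morrey_norm \<phi> q (F k)) q) (1 / q)) q * ennreal (\<phi> (2 powi (- L)) powr (- q)) * ennreal ((2 powi (- L)) ^ CARD('n))"
    unfolding ennreal_powr_inverse(2)[OF q] sum_distrib_right .
qed

text \<open>The Morrey inequality on a single cell bounds the infimum there, and its right-hand side
  depends on the level only.\<close>

lemma cinf_bounded:
  fixes g :: "real^'n \<Rightarrow> complex"
  assumes "morrey_norm \<phi> q (\<lambda>x. ennreal (norm (g x))) < \<infinity>"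
  shows "\<exists>D. \<forall>y. cinf l g y \<le> D"
proof -
  let ?N = "ennreal_powr (morrey_norm \<phi> q (\<lambda>x. ennreal (norm (g x)))) q * ennreal (\<phi> (2 powi (- l)) powr (- q))"
  let ?V = "(2 powi (- l) :: real) ^ CARD('n)"
  have N: "?N < top"
    using assms by (auto simp: ennreal_mult_less_top ennreal_powr_def)
  have "cinf l g y \<le> enn2real ?N powr (1 / q)" for y
  proof -
    let ?P = "dyadic_cube l (cell l y)"
    let ?c = "ennreal_powr (ennreal (cinf l g y)) q"
    have "?c * ennreal ?V = (\<integral>\<^sup>+z. ?c * indicator ?P z \<partial>lborel)"
      by (simp add: nn_integral_cmult_indicator emeasure_dyadic_cube)
    also have "\<dots> \<le> (\<integral>\<^sup>+z. ennreal_powr (ennreal (norm (g z))) q * indicator ?P z \<partial>lborel)"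
    proof (intro nn_integral_mono)
      fix z
      show "?c * indicator ?P z \<le> ennreal_powr (ennreal (norm (g z))) q * indicator ?P z"
      proof (cases "z \<in> ?P")
        case True
        then have "cinf l g y \<le> norm (g z)" by (intro cinf_lower) (simp add: dyadic_cube_eq)
        then show ?thesis using q by (intro mult_right_mono ennreal_powr_mono ennreal_leI) auto
      qed simp
    qed
    also have "\<dots> \<le> ?N * ennreal ?V" by (rule morrey_norm_integral)
    finally have "?c \<le> ?N"
      using ennreal_mult_le_mult_iff[of "ennreal ?V" ?c ?N] by (simp add: mult.commute)
    then have "ennreal (cinf l g y) \<le> ennreal_powr ?N (1 / q)" using q by (simp add: ennreal_powr_le_iff)
    also have "?N = ennreal (enn2real ?N)" by (rule ennreal_enn2real[OF N, symmetric])
    also have "ennreal_powr \<dots> (1 / q) = ennreal (enn2real ?N powr (1 / q))" by (rule ennreal_powr_ennreal) simp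
    finally show ?thesis by simp
  qed
  then show ?thesis by blast
qed

end

subsection \<open>The core estimates\<close>

lemma powr_window_le:
  fixes j k b :: nat and r s :: real
  assumes k: "k \<in> {j - b..j + b}" and r: "0 \<le> r"
  shows "ennreal (2 powr (real j * s * r)) \<le> ennreal (2 powr (real b * \<bar>s\<bar> * r)) * ennreal (2 powr (real k * s * r))"
proof -
  have "(real j - real k) * s \<le> \<bar>real j - real k\<bar> * \<bar>s\<bar>" by (simp add: abs_mult[symmetric])
  also have "\<dots> \<le> real b * \<bar>s\<bar>" using k by (intro mult_right_mono) auto
  finally have "(real j - real k) * s * r \<le> real b * \<bar>s\<bar> * r" using r by (intro mult_right_mono) auto
  then have "2 powr (real j * s * r) \<le> 2 powr (b * \<bar>s\<bar> * r) * 2 powr (real k * s * r)"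
    unfolding powr_add[symmetric] by (intro powr_mono) (auto simp: algebra_simps)
  then show ?thesis by (simp add: ennreal_mult[symmetric] ennreal_leI)
qed

text \<open>\<open>morrey_step\<close> is applied with \<open>p = q / r\<close> to
  \<open>r\<close>-th powers of infima. The infimum of piece \<open>k\<close> lives on cells of
  level \<open>k + a\<close>, hence the index shift by \<open>a\<close>.\<close>

lemma triebel_lizorkin_core:
  fixes \<theta> \<tau> \<theta>' \<tau>' :: "real^'n \<Rightarrow> complex" and q r s C0 :: real and \<phi> :: "real \<Rightarrow> real"
  assumes ad: "admissible \<theta> \<tau>" and ad': "admissible \<theta>' \<tau>'" and q: "0 < q" "q \<le> r"
    and \<phi>0: "\<forall>t>0. 0 < \<phi> t" and C0: "0 \<le> C0"
    and H: "\<And>L. (\<Sum>j. if int j < L then ennreal (\<phi> (2 powi (- int j)) powr (- r)) else 0)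
      \<le> ennreal (C0 * \<phi> (2 powi (- L)) powr (- r))"
  shows "\<exists>C<\<infinity>. \<forall>u. tempered_distribution u \<longrightarrow>
    (\<forall>k l. \<exists>D. \<forall>y. cinf l (multiplier (lp_family \<theta> \<tau> k) u) y \<le> D) \<longrightarrow>
    morrey_norm \<phi> q (\<lambda>x. ennreal_powr (\<Sum>j. ennreal (2 powr (real j * s * r)) *
      ennreal_powr (ennreal (norm (multiplier (lp_family \<theta>' \<tau>' j) u x))) r) (1 / r)) \<le>
    C * morrey_norm \<phi> q (\<lambda>x. ennreal_powr (\<Sum>j. ennreal (2 powr (real j * s * r)) *
      ennreal_powr (ennreal (norm (multiplier (lp_family \<theta> \<tau> j) u x))) r) (1 / r))"
proof -
  have \<phi>: "\<And>t. 0 < t \<Longrightarrow> 0 < \<phi> t" using \<phi>0 by blast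
  note D = admissibleD[OF ad]
  have \<beta>: "\<theta> \<in> test_functions" "\<theta> 0 \<noteq> 0" using D(1) D(4)[of 0] by (auto simp: centered_cube_def)
  have r: "0 < r" using q by simp
  define p where "p = q / r"
  have p: "0 < p" "p \<le> 1" "p / q = 1 / r" "q / p = r" using q r by (auto simp: p_def)
  \<comment> \<open>Chosen so that \<open>M * r\<close> is the exponent
    \<open>4 * CARD('n) / p\<close> of \<open>morrey_step\<close>.\<close>
  define M where "M = 4 * CARD('n) / q"
  have M: "0 \<le> M" "M * r = 4 * CARD('n) / p" using q r by (auto simp: M_def p_def)
  obtain a b Cp where Cp: "0 < Cp" "\<forall>u j x \<rho>. tempered_distribution u \<longrightarrow>
    (\<forall>k l. \<exists>D. \<forall>y. cinf l (multiplier (lp_family \<theta> \<tau> k) u) y \<le> D) \<longrightarrow> 0 < \<rho> \<longrightarrow>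
    ennreal_powr (ennreal (norm (multiplier (lp_family \<theta>' \<tau>' j) u x))) \<rho> \<le>
    ennreal (Cp powr \<rho>) * (\<Sum>k\<in>{j - b..j + b}. SUP y. ennreal (wt (M * \<rho>) (2 powi int (k + a) * norm (x - y)) *
        cinf (int (k + a)) (multiplier (lp_family \<theta> \<tau> k) u) y powr \<rho>))"
    using pointwise_sup_estimate[OF ad ad' M(1)] by (elim exE conjE)
  \<comment> \<open>The pointwise constant, the change of the smoothness factor within a window, and
    the overlap of the windows.\<close>
  define K where "K = Cp powr r * 2 powr (b * \<bar>s\<bar> * r) * real (2 * b + 1)"
  have K: "0 < K" using Cp(1) by (simp add: K_def)
  let ?C = "morrey_step_const TYPE('n) p q C0 * ennreal (K powr (1 / r))"
  show ?thesis
  proof (rule exI[of _ ?C], intro conjI allI impI)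
    show "?C < \<infinity>" using morrey_step_const_finite[of p q C0, where 'n = 'n] by (simp add: ennreal_mult_less_top)
    fix u
    let ?g = "\<lambda>k. multiplier (lp_family \<theta> \<tau> k) u" and ?h = "\<lambda>j. multiplier (lp_family \<theta>' \<tau>' j) u"
    let ?e = "\<lambda>k. 2 powr (real k * s * r)"
    assume u: "tempered_distribution u" and ci: "\<forall>k l. \<exists>D. \<forall>y. cinf l (?g k) y \<le> D"
    \<comment> \<open>Levels below \<open>a\<close> carry nothing; \<open>K\<close> is built in so
      that the weighted suprema of \<open>A\<close> bound the series over \<open>j\<close>
      directly.\<close>
    define A where "A i y = (if i < a then 0 else K * ?e (i - a) * cinf (int i) (?g (i - a)) y powr r)" for i y
    let ?X = "\<lambda>x k. SUP y. ennreal (wt (M * r) (2 powi int (k + a) * norm (x - y)) * cinf (int (k + a)) (?g k) y powr r)"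
    let ?B = "\<lambda>x. \<Sum>i. SUP y. ennreal (wt (4 * CARD('n) / p) (2 powi int i * norm (x - y)) * A i y)"
    let ?G = "\<lambda>x. \<Sum>j. ennreal (?e j) * ennreal_powr (ennreal (norm (?g j x))) r"
    have gm [measurable]: "?g k \<in> borel_measurable borel" for k
      by (intro borel_measurable_continuous_onI multiplier_continuous[OF \<beta> u] test_lp_family[OF ad])
    have Am: "A i \<in> borel_measurable borel" for i unfolding A_def[abs_def] by measurable
    have pw: "(\<Sum>j. ennreal (?e j) * ennreal_powr (ennreal (norm (?h j x))) r) \<le> ?B x" for x
    proof -
      have "(\<Sum>j. ennreal (?e j) * ennreal_powr (ennreal (norm (?h j x))) r) \<le>
        (\<Sum>j. ennreal (Cp powr r * 2 powr (b * \<bar>s\<bar> * r)) * (\<Sum>k\<in>{j - b..j + b}. ennreal (?e k) * ?X x k))"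
      proof (intro suminf_le)
        fix j
        have "ennreal (?e j) * ennreal_powr (ennreal (norm (?h j x))) r \<le>
            ennreal (?e j) * (ennreal (Cp powr r) * (\<Sum>k\<in>{j - b..j + b}. ?X x k))"
          using Cp(2) u ci r by (intro mult_left_mono) auto
        also have "\<dots> = ennreal (Cp powr r) * (\<Sum>k\<in>{j - b..j + b}. ennreal (?e j) * ?X x k)"
          by (simp only: sum_distrib_left mult.left_commute)
        also have "\<dots> \<le> ennreal (Cp powr r) * (\<Sum>k\<in>{j - b..j + b}. ennreal (2 powr (b * \<bar>s\<bar> * r)) * (ennreal (?e k) * ?X x k))"
        proof (intro mult_left_mono sum_mono)
          fix k assume "k \<in> {j - b..j + b}"
          then have "ennreal (?e j) \<le> ennreal (2 powr (b * \<bar>s\<bar> * r)) * ennreal (?e k)"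
            using r by (intro powr_window_le) auto
          then show "ennreal (?e j) * ?X x k \<le> ennreal (2 powr (b * \<bar>s\<bar> * r)) * (ennreal (?e k) * ?X x k)"
            unfolding mult.assoc[symmetric] by (rule mult_right_mono) simp
        qed simp
        also have "\<dots> = ennreal (Cp powr r * 2 powr (b * \<bar>s\<bar> * r)) * (\<Sum>k\<in>{j - b..j + b}. ennreal (?e k) * ?X x k)"
          by (simp only: sum_distrib_left[symmetric] ennreal_mult[OF powr_ge_zero powr_ge_zero] mult.assoc)
        finally show "ennreal (?e j) * ennreal_powr (ennreal (norm (?h j x))) r \<le>
          ennreal (Cp powr r * 2 powr (b * \<bar>s\<bar> * r)) * (\<Sum>k\<in>{j - b..j + b}. ennreal (?e k) * ?X x k)" .
      qed auto
      also have "\<dots> = ennreal (Cp powr r * 2 powr (b * \<bar>s\<bar> * r)) * (\<Sum>j. \<Sum>k\<in>{j - b..j + b}. ennreal (?e k) * ?X x k)"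
        by (rule ennreal_suminf_cmult)
      also have "\<dots> \<le> ennreal (Cp powr r * 2 powr (b * \<bar>s\<bar> * r)) * (ennreal (real (2 * b + 1)) * (\<Sum>k. ennreal (?e k) * ?X x k))"
        by (intro mult_left_mono suminf_window_le) simp
      also have "\<dots> = ennreal K * (\<Sum>k. ennreal (?e k) * ?X x k)"
      proof -
        have "ennreal K = ennreal (Cp powr r * 2 powr (b * \<bar>s\<bar> * r)) * ennreal (real (2 * b + 1))"
          unfolding K_def by (rule ennreal_mult) auto
        then show ?thesis by (simp only: mult.assoc)
      qed
      also have "\<dots> = (\<Sum>k. ennreal K * (ennreal (?e k) * ?X x k))" by (rule ennreal_suminf_cmult[symmetric])
      also have "\<dots> = (\<Sum>k. SUP y. ennreal (wt (4 * CARD('n) / p) (2 powi int (k + a) * norm (x - y)) * A (k + a) y))"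
      proof (rule suminf_cong)
        fix k
        have "ennreal K * (ennreal (?e k) * ?X x k) = ennreal (K * ?e k) * ?X x k"
          using K by (simp add: ennreal_mult mult.assoc)
        also have "\<dots> = (SUP y. ennreal (K * ?e k) * ennreal (wt (M * r) (2 powi int (k + a) * norm (x - y)) * cinf (int (k + a)) (?g k) y powr r))"
          by (rule SUP_mult_left_ennreal)
        also have "\<dots> = (SUP y. ennreal (wt (4 * CARD('n) / p) (2 powi int (k + a) * norm (x - y)) * A (k + a) y))"
          unfolding M(2)
        proof (rule SUP_cong[OF refl])
          fix y
          have "0 \<le> wt (4 * CARD('n) / p) (2 powi int (k + a) * norm (x - y))"
            by (rule less_imp_le, rule wt_pos) simp
          then show "ennreal (K * ?e k) * ennreal (wt (4 * CARD('n) / p) (2 powi int (k + a) * norm (x - y)) * cinf (int (k + a)) (?g k) y powr r)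
            = ennreal (wt (4 * CARD('n) / p) (2 powi int (k + a) * norm (x - y)) * A (k + a) y)"
            using K by (subst ennreal_mult[symmetric]) (auto simp: A_def mult_ac)
        qed
        finally show "ennreal K * (ennreal (?e k) * ?X x k) = (SUP y. ennreal (wt (4 * CARD('n) / p) (2 powi int (k + a) * norm (x - y)) * A (k + a) y))" .
      qed
      also have "\<dots> \<le> ?B x"
        by (rule suminf_shift_le[of "\<lambda>i. SUP y. ennreal (wt (4 * CARD('n) / p) (2 powi int i * norm (x - y)) * A i y)" a])
      finally show ?thesis .
    qed
    have Ag: "(\<Sum>i. ennreal (A i x)) \<le> ennreal K * ?G x" for x
    proof -
      have "(\<Sum>i. ennreal (A i x)) \<le> (\<Sum>k. ennreal (A (k + a) x))" by (rule suminf_le_shift) (simp add: A_def)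
      also have "\<dots> \<le> (\<Sum>k. ennreal K * (ennreal (?e k) * ennreal_powr (ennreal (norm (?g k x))) r))"
      proof (intro suminf_le)
        fix k
        have "A (k + a) x \<le> K * (?e k * norm (?g k x) powr r)"
          unfolding A_def using K r by (auto simp: mult.assoc intro!: mult_left_mono powr_mono2 cinf_nonneg cinf_lower)
        then have "ennreal (A (k + a) x) \<le> ennreal (K * (?e k * norm (?g k x) powr r))" by (rule ennreal_leI)
        also have "\<dots> = ennreal K * (ennreal (?e k) * ennreal_powr (ennreal (norm (?g k x))) r)"
          using K by (simp add: ennreal_mult ennreal_powr_ennreal)
        finally show "ennreal (A (k + a) x) \<le> ennreal K * (ennreal (?e k) * ennreal_powr (ennreal (norm (?g k x))) r)" .
      qed auto
      also have "\<dots> = ennreal K * ?G x" by (rule ennreal_suminf_cmult)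
      finally show ?thesis .
    qed
    have "morrey_norm \<phi> q (\<lambda>x. ennreal_powr (\<Sum>j. ennreal (?e j) * ennreal_powr (ennreal (norm (?h j x))) r) (1 / r)) \<le>
        morrey_norm \<phi> q (\<lambda>x. ennreal_powr (?B x) (p / q))"
      unfolding p(3) using r by (intro morrey_norm_mono[where \<phi> = \<phi>, OF q(1) \<phi>] ennreal_powr_mono pw) auto
    also have "\<dots> \<le> morrey_step_const TYPE('n) p q C0 * morrey_norm \<phi> q (\<lambda>x. ennreal_powr (\<Sum>i. ennreal (A i x)) (p / q))"
    proof (rule morrey_step[where I = UNIV, OF p(1,2) q(1) \<phi> C0 _ Am])
      show "0 \<le> A j y" for j y using K by (simp add: A_def)
      show "A j y = A j z" if "cell (int j) y = cell (int j) z" for j y z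
        using cinf_cong[OF that] by (simp add: A_def)
      show "(\<Sum>j. if j \<in> UNIV \<and> int j < L then ennreal (\<phi> (2 powi (- int j)) powr (- (q / p))) else 0)
        \<le> ennreal (C0 * \<phi> (2 powi (- L)) powr (- (q / p)))" for L
        unfolding p(4) using H[of L] by simp
    qed auto
    also have "\<dots> \<le> morrey_step_const TYPE('n) p q C0 * (ennreal (K powr (1 / r)) * morrey_norm \<phi> q (\<lambda>x. ennreal_powr (?G x) (1 / r)))"
    proof (rule mult_left_mono)
      have "morrey_norm \<phi> q (\<lambda>x. ennreal_powr (\<Sum>i. ennreal (A i x)) (p / q)) \<le>
          morrey_norm \<phi> q (\<lambda>x. ennreal (K powr (1 / r)) * ennreal_powr (?G x) (1 / r))"
      proof (rule morrey_norm_mono[where \<phi> = \<phi>, OF q(1) \<phi>])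
        fix x
        have "ennreal_powr (\<Sum>i. ennreal (A i x)) (p / q) \<le> ennreal_powr (ennreal K * ?G x) (1 / r)"
          unfolding p(3) using r by (intro ennreal_powr_mono Ag) auto
        also have "\<dots> = ennreal (K powr (1 / r)) * ennreal_powr (?G x) (1 / r)"
          using r K by (simp add: ennreal_powr_mult ennreal_powr_ennreal)
        finally show "ennreal_powr (\<Sum>i. ennreal (A i x)) (p / q) \<le> ennreal (K powr (1 / r)) * ennreal_powr (?G x) (1 / r)" .
      qed
      also have "\<dots> \<le> ennreal (K powr (1 / r)) * morrey_norm \<phi> q (\<lambda>x. ennreal_powr (?G x) (1 / r))"
        by (intro morrey_norm_cmult[where \<phi> = \<phi>, OF q(1) \<phi>]) (auto intro!: ennreal_powr_measurable)
      finally show "morrey_norm \<phi> q (\<lambda>x. ennreal_powr (\<Sum>i. ennreal (A i x)) (p / q)) \<le>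
        ennreal (K powr (1 / r)) * morrey_norm \<phi> q (\<lambda>x. ennreal_powr (?G x) (1 / r))" .
    qed simp
    finally show "morrey_norm \<phi> q (\<lambda>x. ennreal_powr (\<Sum>j. ennreal (?e j) * ennreal_powr (ennreal (norm (?h j x))) r) (1 / r)) \<le>
        ?C * morrey_norm \<phi> q (\<lambda>x. ennreal_powr (?G x) (1 / r))" by (simp only: mult.assoc)
  qed
qed

text \<open>A single piece is treated, so the power is \<open>q\<close> and
  \<open>morrey_step\<close> is used with \<open>p = 1\<close>. The number of levels present, at
  most \<open>2 * b + 1\<close>, is independent of \<open>j\<close>, and so is the constant.\<close>

lemma besov_core:
  fixes \<theta> \<tau> \<theta>' \<tau>' :: "real^'n \<Rightarrow> complex" and q :: real and \<phi> :: "real \<Rightarrow> real"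
  assumes ad: "admissible \<theta> \<tau>" and ad': "admissible \<theta>' \<tau>'" and q: "0 < q"
    and \<phi>0: "\<forall>t>0. 0 < \<phi> t" and mono: "mono_on {0<..} \<phi>"
  shows "\<exists>b C. C < \<infinity> \<and> (\<forall>u j. tempered_distribution u \<longrightarrow>
    (\<forall>k l. \<exists>D. \<forall>y. cinf l (multiplier (lp_family \<theta> \<tau> k) u) y \<le> D) \<longrightarrow>
    morrey_norm \<phi> q (\<lambda>x. ennreal (norm (multiplier (lp_family \<theta>' \<tau>' j) u x))) \<le>
    C * ennreal_powr (\<Sum>k\<in>{j - b..j + b}. ennreal_powr (morrey_norm \<phi> q (\<lambda>x. ennreal (norm (multiplier (lp_family \<theta> \<tau> k) u x)))) q) (1 / q))"
proof -
  have \<phi>: "\<And>t. 0 < t \<Longrightarrow> 0 < \<phi> t" using \<phi>0 by blast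
  note D = admissibleD[OF ad]
  have \<beta>: "\<theta> \<in> test_functions" "\<theta> 0 \<noteq> 0" using D(1) D(4)[of 0] by (auto simp: centered_cube_def)
  define M where "M = 4 * CARD('n) / q"
  have M: "0 \<le> M" "M * q = 4 * CARD('n) / 1" using q by (auto simp: M_def)
  obtain a b Cp where Cp: "0 < Cp" "\<forall>u j x \<rho>. tempered_distribution u \<longrightarrow>
    (\<forall>k l. \<exists>D. \<forall>y. cinf l (multiplier (lp_family \<theta> \<tau> k) u) y \<le> D) \<longrightarrow> 0 < \<rho> \<longrightarrow>
    ennreal_powr (ennreal (norm (multiplier (lp_family \<theta>' \<tau>' j) u x))) \<rho> \<le>
    ennreal (Cp powr \<rho>) * (\<Sum>k\<in>{j - b..j + b}. SUP y. ennreal (wt (M * \<rho>) (2 powi int (k + a) * norm (x - y)) *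
        cinf (int (k + a)) (multiplier (lp_family \<theta> \<tau> k) u) y powr \<rho>))"
    using pointwise_sup_estimate[OF ad ad' M(1)] by (elim exE conjE)
  define K where "K = Cp powr q"
  have K: "0 < K" using Cp(1) by (simp add: K_def)
  let ?S = "morrey_step_const TYPE('n) 1 q (real (2 * b + 1))"
  let ?C = "?S * ennreal (K powr (1 / q))"
  show ?thesis
  proof (rule exI[of _ b], rule exI[of _ ?C], intro conjI allI impI)
    show "?C < \<infinity>" using morrey_step_const_finite[of 1 q "real (2 * b + 1)", where 'n = 'n] by (simp add: ennreal_mult_less_top)
    fix u j
    let ?g = "\<lambda>k. multiplier (lp_family \<theta> \<tau> k) u" and ?h = "multiplier (lp_family \<theta>' \<tau>' j) u"
    let ?W = "{j - b..j + b}"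
    assume u: "tempered_distribution u" and ci: "\<forall>k l. \<exists>D. \<forall>y. cinf l (?g k) y \<le> D"
    define I where "I = (\<lambda>k. k + a) ` ?W"
    have I: "i \<in> I \<longleftrightarrow> a \<le> i \<and> i - a \<in> ?W" for i
      unfolding I_def by (auto simp: image_iff intro!: bexI[of _ "i - a"])
    have finI: "finite I" "card I \<le> 2 * b + 1"
      unfolding I_def using card_image_le[of ?W "\<lambda>k. k + a"] card_window[of j b] by auto
    define A where "A i y = (if i \<in> I then K * cinf (int i) (?g (i - a)) y powr q else 0)" for i y
    let ?X = "\<lambda>x k. SUP y. ennreal (wt (M * q) (2 powi int (k + a) * norm (x - y)) * cinf (int (k + a)) (?g k) y powr q)"
    let ?f = "\<lambda>x i. SUP y. ennreal (wt (4 * CARD('n) / 1) (2 powi int i * norm (x - y)) * A i y)"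
    let ?G = "\<lambda>x. \<Sum>k\<in>?W. ennreal_powr (ennreal (norm (?g k x))) q"
    have gm [measurable]: "?g k \<in> borel_measurable borel" for k
      by (intro borel_measurable_continuous_onI multiplier_continuous[OF \<beta> u] test_lp_family[OF ad])
    have Am: "A i \<in> borel_measurable borel" for i unfolding A_def[abs_def] by measurable
    have pw: "ennreal_powr (ennreal (norm (?h x))) q \<le> (\<Sum>i. ?f x i)" for x
    proof -
      have "ennreal_powr (ennreal (norm (?h x))) q \<le> ennreal K * (\<Sum>k\<in>?W. ?X x k)"
        unfolding K_def using Cp(2) u ci q by auto
      also have "\<dots> = (\<Sum>k\<in>?W. ?f x (k + a))"
        unfolding sum_distrib_left
      proof (rule sum.cong[OF refl])
        fix k assume k: "k \<in> ?W"
        have "ennreal K * ?X x k = (SUP y. ennreal K * ennreal (wt (M * q) (2 powi int (k + a) * norm (x - y)) * cinf (int (k + a)) (?g k) y powr q))"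
          by (rule SUP_mult_left_ennreal)
        also have "\<dots> = ?f x (k + a)"
          unfolding M(2)
        proof (rule SUP_cong[OF refl])
          fix y
          have "0 \<le> wt (4 * CARD('n) / 1) (2 powi int (k + a) * norm (x - y))"
            by (rule less_imp_le, rule wt_pos) simp
          then show "ennreal K * ennreal (wt (4 * CARD('n) / 1) (2 powi int (k + a) * norm (x - y)) * cinf (int (k + a)) (?g k) y powr q)
            = ennreal (wt (4 * CARD('n) / 1) (2 powi int (k + a) * norm (x - y)) * A (k + a) y)"
            using K k I[of "k + a"] by (subst ennreal_mult[symmetric]) (auto simp: A_def mult_ac)
        qed
        finally show "ennreal K * ?X x k = ?f x (k + a)" .
      qed
      also have "\<dots> \<le> (\<Sum>k. ?f x (k + a))" by (rule sum_le_suminf) auto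
      also have "\<dots> \<le> (\<Sum>i. ?f x i)" by (rule suminf_shift_le[of "?f x" a])
      finally show ?thesis .
    qed
    have Ag: "(\<Sum>i. ennreal (A i x)) \<le> ennreal K * ?G x" for x
    proof (rule suminf_ennreal_least)
      fix n
      have "(\<Sum>i<n. ennreal (A i x)) \<le> (\<Sum>i\<in>{..<n} \<union> I. ennreal (A i x))" using finI by (intro sum_mono2) auto
      also have "\<dots> = (\<Sum>i\<in>I. ennreal (A i x))" using finI by (intro sum.mono_neutral_right) (auto simp: A_def)
      also have "\<dots> = (\<Sum>k\<in>?W. ennreal (A (k + a) x))"
        unfolding I_def by (subst sum.reindex) (auto simp: inj_on_def)
      also have "\<dots> \<le> (\<Sum>k\<in>?W. ennreal K * ennreal_powr (ennreal (norm (?g k x))) q)"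
      proof (rule sum_mono)
        fix k assume "k \<in> ?W"
        then have "A (k + a) x \<le> K * norm (?g k x) powr q"
          unfolding A_def using K q I[of "k + a"] by (auto intro!: mult_left_mono powr_mono2 cinf_nonneg cinf_lower)
        then have "ennreal (A (k + a) x) \<le> ennreal (K * norm (?g k x) powr q)" by (rule ennreal_leI)
        then show "ennreal (A (k + a) x) \<le> ennreal K * ennreal_powr (ennreal (norm (?g k x))) q"
          using K by (simp add: ennreal_mult ennreal_powr_ennreal)
      qed
      also have "\<dots> = ennreal K * ?G x" by (rule sum_distrib_left[symmetric])
      finally show "(\<Sum>i<n. ennreal (A i x)) \<le> ennreal K * ?G x" .
    qed
    have "morrey_norm \<phi> q (\<lambda>x. ennreal (norm (?h x))) \<le> morrey_norm \<phi> q (\<lambda>x. ennreal_powr (\<Sum>i. ?f x i) (1 / q))"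
      using q pw by (intro morrey_norm_mono[where \<phi> = \<phi>, OF q \<phi>]) (auto simp: ennreal_powr_le_iff)
    also have "\<dots> \<le> ?S * morrey_norm \<phi> q (\<lambda>x. ennreal_powr (\<Sum>i. ennreal (A i x)) (1 / q))"
    proof (rule morrey_step[where I = I and p = 1, OF _ _ q \<phi> _ _ Am])
      show "0 \<le> A j y" for j y using K by (simp add: A_def)
      show "A j y = A j z" if "cell (int j) y = cell (int j) z" for j y z
        using cinf_cong[OF that] by (simp add: A_def)
      show "A j y = 0" if "j \<notin> I" for j y using that by (simp add: A_def)
      fix L :: int
      let ?t = "\<lambda>i. if i \<in> I \<and> int i < L then ennreal (\<phi> (2 powi (- int i)) powr (- (q / 1))) else 0"
      let ?c = "ennreal (\<phi> (2 powi (- L)) powr (- (q / 1)))"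
      show "(\<Sum>i. ?t i) \<le> ennreal (real (2 * b + 1) * \<phi> (2 powi (- L)) powr (- (q / 1)))"
      proof (rule suminf_ennreal_least)
        fix n
        have "(\<Sum>i<n. ?t i) \<le> (\<Sum>i\<in>{..<n} \<union> I. ?t i)" using finI by (intro sum_mono2) auto
        also have "\<dots> = (\<Sum>i\<in>I. ?t i)" using finI by (intro sum.mono_neutral_right) auto
        also have "\<dots> \<le> (\<Sum>i\<in>I. ?c)"
        proof (rule sum_mono)
          fix i
          show "?t i \<le> ?c"
          proof (cases "int i < L")
            case True
            then have "(2::real) powi (- L) \<le> 2 powi (- int i)" by (intro power_int_increasing) auto
            then have "\<phi> (2 powi (- L)) \<le> \<phi> (2 powi (- int i))" by (intro mono_onD[OF mono]) auto
            then have "\<phi> (2 powi (- int i)) powr (- (q / 1)) \<le> \<phi> (2 powi (- L)) powr (- (q / 1))"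
              using q \<phi>[of "2 powi (- L)"] by (intro powr_mono2') auto
            then show ?thesis by (auto intro: ennreal_leI)
          qed simp
        qed
        also have "\<dots> = of_nat (card I) * ?c" by simp
        also have "\<dots> \<le> of_nat (2 * b + 1) * ?c" by (intro mult_right_mono of_nat_mono finI) simp
        also have "\<dots> = ennreal (real (2 * b + 1) * \<phi> (2 powi (- L)) powr (- (q / 1)))"
          unfolding ennreal_of_nat_eq_real_of_nat by (rule ennreal_mult[symmetric]) auto
        finally show "(\<Sum>i<n. ?t i) \<le> ennreal (real (2 * b + 1) * \<phi> (2 powi (- L)) powr (- (q / 1)))" .
      qed
    qed auto
    also have "\<dots> \<le> ?S * (ennreal (K powr (1 / q)) * morrey_norm \<phi> q (\<lambda>x. ennreal_powr (?G x) (1 / q)))"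
    proof (rule mult_left_mono)
      have "morrey_norm \<phi> q (\<lambda>x. ennreal_powr (\<Sum>i. ennreal (A i x)) (1 / q)) \<le>
          morrey_norm \<phi> q (\<lambda>x. ennreal (K powr (1 / q)) * ennreal_powr (?G x) (1 / q))"
      proof (rule morrey_norm_mono[where \<phi> = \<phi>, OF q \<phi>])
        fix x
        have "ennreal_powr (\<Sum>i. ennreal (A i x)) (1 / q) \<le> ennreal_powr (ennreal K * ?G x) (1 / q)"
          using q by (intro ennreal_powr_mono Ag) auto
        also have "\<dots> = ennreal (K powr (1 / q)) * ennreal_powr (?G x) (1 / q)"
          using q K by (simp add: ennreal_powr_mult ennreal_powr_ennreal)
        finally show "ennreal_powr (\<Sum>i. ennreal (A i x)) (1 / q) \<le> ennreal (K powr (1 / q)) * ennreal_powr (?G x) (1 / q)" .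
      qed
      also have "\<dots> \<le> ennreal (K powr (1 / q)) * morrey_norm \<phi> q (\<lambda>x. ennreal_powr (?G x) (1 / q))"
        by (intro morrey_norm_cmult[where \<phi> = \<phi>, OF q \<phi>]) (auto intro!: ennreal_powr_measurable)
      finally show "morrey_norm \<phi> q (\<lambda>x. ennreal_powr (\<Sum>i. ennreal (A i x)) (1 / q)) \<le>
        ennreal (K powr (1 / q)) * morrey_norm \<phi> q (\<lambda>x. ennreal_powr (?G x) (1 / q))" .
    qed simp
    also have "\<dots> = ?C * morrey_norm \<phi> q (\<lambda>x. ennreal_powr (?G x) (1 / q))" by (simp only: mult.assoc)
    also have "\<dots> \<le> ?C * ennreal_powr (\<Sum>k\<in>?W. ennreal_powr (morrey_norm \<phi> q (\<lambda>x. ennreal (norm (?g k x)))) q) (1 / q)"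
      by (intro mult_left_mono morrey_norm_sum[where \<phi> = \<phi>, OF q \<phi>]) auto
    finally show "morrey_norm \<phi> q (\<lambda>x. ennreal (norm (?h x))) \<le>
      ?C * ennreal_powr (\<Sum>k\<in>?W. ennreal_powr (morrey_norm \<phi> q (\<lambda>x. ennreal (norm (?g k x)))) q) (1 / q)" .
  qed
qed

subsection \<open>Comparison of the quasi-norms\<close>

text \<open>With \<open>t\<close> the side length at level \<open>j\<close> and
  \<open>\<rho>\<close> that at level \<open>L\<close>, the growth condition bounds term
  \<open>j\<close> by \<open>x ^ (L - j)\<close> times the value at \<open>L\<close>, up to the
  factor \<open>C powr r\<close>.\<close>

lemma weight_tail_sum:
  fixes \<phi> :: "real \<Rightarrow> real"
  assumes r: "0 < r" and \<phi>: "\<And>t. 0 < t \<Longrightarrow> 0 < \<phi> t" and \<epsilon>: "0 < \<epsilon>" and C: "0 < C"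
    and H: "\<And>t \<rho>. 0 < \<rho> \<Longrightarrow> \<rho> \<le> t \<Longrightarrow> t powr \<epsilon> / \<phi> t \<le> C * (\<rho> powr \<epsilon> / \<phi> \<rho>)"
  shows "\<exists>C0\<ge>0. \<forall>L. (\<Sum>j. if int j < L then ennreal (\<phi> (2 powi (- int j)) powr (- r)) else 0)
    \<le> ennreal (C0 * \<phi> (2 powi (- L)) powr (- r))"
proof -
  define x :: real where "x = 2 powr (- (\<epsilon> * r))"
  have x: "0 < x" "x < 1" using \<epsilon> r powr_less_mono[of "- (\<epsilon> * r)" 0 "2::real"] by (auto simp: x_def)
  have 1: "\<phi> (2 powi (- int j)) powr (- r) \<le> C powr r * x ^ nat (L - int j) * \<phi> (2 powi (- L)) powr (- r)"
    if j: "int j < L" for j L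
  proof -
    define t \<rho> :: real where "t = 2 powi (- int j)" and "\<rho> = 2 powi (- L)"
    have t: "t = 2 powr (- real j)" "\<rho> = 2 powr (- real_of_int L)"
      unfolding t_def \<rho>_def using powr_real_of_int'[of "2::real" "- int j"] powr_real_of_int'[of "2::real" "- L"] by simp_all
    have pos: "0 < t" "0 < \<rho>" "\<rho> \<le> t" unfolding t using j by (auto intro!: powr_mono)
    note p = \<phi>[OF pos(1)] \<phi>[OF pos(2)]
    have e: "\<rho> powr \<epsilon> / t powr \<epsilon> = 2 powr (- (\<epsilon> * (L - j)))"
      unfolding t powr_powr powr_diff[symmetric] by (simp add: algebra_simps)
    have "t powr \<epsilon> / \<phi> t \<le> C * (\<rho> powr \<epsilon> / \<phi> \<rho>)" using H[OF pos(2,3)] .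
    then have "1 / \<phi> t \<le> C * (\<rho> powr \<epsilon> / t powr \<epsilon>) * (1 / \<phi> \<rho>)"
      using p pos by (simp add: field_simps)
    then have "(1 / \<phi> t) powr r \<le> (C * (\<rho> powr \<epsilon> / t powr \<epsilon>) * (1 / \<phi> \<rho>)) powr r"
      using p r by (intro powr_mono2) auto
    also have "\<dots> = C powr r * (\<rho> powr \<epsilon> / t powr \<epsilon>) powr r * (1 / \<phi> \<rho>) powr r"
      using C p by (simp only: powr_mult)
    also have "(\<rho> powr \<epsilon> / t powr \<epsilon>) powr r = x powr real (nat (L - int j))"
      unfolding e x_def powr_powr using j by (simp add: algebra_simps)
    also have "\<dots> = x ^ nat (L - int j)" using x by (intro powr_realpow)
    finally show ?thesis
      unfolding t_def[symmetric] \<rho>_def[symmetric] using p by (simp add: powr_divide powr_minus_divide)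
  qed
  have "(\<Sum>j. if int j < L then ennreal (\<phi> (2 powi (- int j)) powr (- r)) else 0)
      \<le> ennreal (C powr r / (1 - x) * \<phi> (2 powi (- L)) powr (- r))" for L
  proof (rule suminf_ennreal_least)
    fix n
    define J where "J = {j. j < n \<and> int j < L}"
    have J: "finite J" by (simp add: J_def)
    have "(\<Sum>j<n. if int j < L then ennreal (\<phi> (2 powi (- int j)) powr (- r)) else 0)
        = (\<Sum>j\<in>J. ennreal (\<phi> (2 powi (- int j)) powr (- r)))"
      unfolding J_def by (subst sum.inter_filter[symmetric]) (auto intro: sum.cong)
    also have "\<dots> = ennreal (\<Sum>j\<in>J. \<phi> (2 powi (- int j)) powr (- r))" by (rule sum_ennreal) simp
    also have "\<dots> \<le> ennreal (C powr r / (1 - x) * \<phi> (2 powi (- L)) powr (- r))"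
    proof (rule ennreal_leI)
      have "(\<Sum>j\<in>J. \<phi> (2 powi (- int j)) powr (- r)) \<le>
          (\<Sum>j\<in>J. C powr r * x ^ nat (L - int j) * \<phi> (2 powi (- L)) powr (- r))"
        by (rule sum_mono, rule 1) (simp add: J_def)
      also have "\<dots> = C powr r * (\<Sum>j\<in>J. x ^ nat (L - int j)) * \<phi> (2 powi (- L)) powr (- r)"
        by (simp only: sum_distrib_left sum_distrib_right)
      also have "(\<Sum>j\<in>J. x ^ nat (L - int j)) = (\<Sum>i\<in>(\<lambda>j. nat (L - int j)) ` J. x ^ i)"
        by (subst sum.reindex) (auto simp: inj_on_def J_def)
      also have "\<dots> \<le> (\<Sum>i. x ^ i)" using x J by (intro sum_le_suminf summable_geometric) auto
      also have "\<dots> = 1 / (1 - x)" using x by (intro suminf_geometric) auto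
      finally show "(\<Sum>j\<in>J. \<phi> (2 powi (- int j)) powr (- r)) \<le> C powr r / (1 - x) * \<phi> (2 powi (- L)) powr (- r)"
        by (simp add: mult_left_mono mult_right_mono)
    qed
    finally show "(\<Sum>j<n. if int j < L then ennreal (\<phi> (2 powi (- int j)) powr (- r)) else 0)
      \<le> ennreal (C powr r / (1 - x) * \<phi> (2 powi (- L)) powr (- r))" .
  qed
  then show ?thesis using x by (intro exI[of _ "C powr r / (1 - x)"]) auto
qed

text \<open>A finite right-hand side bounds the Morrey quasi-norm of each piece, hence the infima
  that \<open>besov_core\<close> asks for. What remains is a sum over windows of fixed
  length.\<close>

lemma besov_morrey_norm_le:
  fixes \<theta> \<tau> \<theta>' \<tau>' :: "real^'n \<Rightarrow> complex" and q r s :: real and \<phi> :: "real \<Rightarrow> real"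
  assumes ad: "admissible \<theta> \<tau>" and ad': "admissible \<theta>' \<tau>'" and q: "0 < q" "q \<le> r"
    and \<phi>0: "\<forall>t>0. 0 < \<phi> t" and mono: "mono_on {0<..} \<phi>"
  shows "\<exists>C<\<infinity>. \<forall>u. tempered_distribution u \<longrightarrow>
    besov_morrey_norm \<phi> q r s \<theta>' \<tau>' u \<le> C * besov_morrey_norm \<phi> q r s \<theta> \<tau> u"
proof -
  have \<phi>: "\<And>t. 0 < t \<Longrightarrow> 0 < \<phi> t" using \<phi>0 by blast
  have r: "0 < r" using q by simp
  obtain b Cb where Cb: "Cb < \<infinity>" "\<forall>u j. tempered_distribution u \<longrightarrow>
    (\<forall>k l. \<exists>D. \<forall>y. cinf l (multiplier (lp_family \<theta> \<tau> k) u) y \<le> D) \<longrightarrow>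
    morrey_norm \<phi> q (\<lambda>x. ennreal (norm (multiplier (lp_family \<theta>' \<tau>' j) u x))) \<le>
    Cb * ennreal_powr (\<Sum>k\<in>{j - b..j + b}. ennreal_powr (morrey_norm \<phi> q (\<lambda>x. ennreal (norm (multiplier (lp_family \<theta> \<tau> k) u x)))) q) (1 / q)"
    using besov_core[where \<phi> = \<phi>, OF ad ad' q(1) \<phi>0 mono] by (elim exE conjE)
  \<comment> \<open>The core constant to the power \<open>r\<close>, the cost of raising a window
    sum to the power \<open>r / q\<close>, and the change of the smoothness factor within a
    window.\<close>
  define K where "K = ennreal_powr Cb r * ennreal (real (2 * b + 1) powr (r / q)) * ennreal (2 powr (b * \<bar>s\<bar> * r))"
  define K' where "K' = K * ennreal (real (2 * b + 1)) * 2"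
  \<comment> \<open>The summand one keeps \<open>C\<close> away from zero, so that \<open>C\<close>
    times an infinite quasi-norm is infinite.\<close>
  define C where "C = 1 + 2 * ennreal_powr K' (1 / r)"
  have "K' < \<infinity>"
    using Cb(1) by (simp add: K'_def K_def ennreal_mult_less_top ennreal_powr_def)
  then have C: "C < \<infinity>" "C \<noteq> 0" by (auto simp: C_def ennreal_mult_less_top ennreal_powr_def)
  have "besov_morrey_norm \<phi> q r s \<theta>' \<tau>' u \<le> C * besov_morrey_norm \<phi> q r s \<theta> \<tau> u"
    if u: "tempered_distribution u" for u
  proof (cases "besov_morrey_norm \<phi> q r s \<theta> \<tau> u = \<infinity>")
    case True
    then show ?thesis using C(2) by (simp add: ennreal_mult_top)
  next
    case False
    define N where "N k = morrey_norm \<phi> q (\<lambda>x. ennreal (norm (multiplier (lp_family \<theta> \<tau> k) u x)))" for k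
    define N' where "N' k = morrey_norm \<phi> q (\<lambda>x. ennreal (norm (multiplier (lp_family \<theta>' \<tau>' k) u x)))" for k
    define Z where "Z = besov_morrey_norm \<phi> q r s \<theta> \<tau> u"
    let ?e = "\<lambda>k. ennreal (2 powr (real k * s * r))"
    let ?W = "\<lambda>j. {j - b..j + b}"
    let ?F = "\<Sum>k. ?e k * ennreal_powr (N k) r"
    let ?F' = "\<Sum>k. ?e k * ennreal_powr (N' k) r"
    have Z: "Z = N 0 + ennreal_powr (\<Sum>i. ?e (Suc i) * ennreal_powr (N (Suc i)) r) (1 / r)"
      unfolding Z_def N_def besov_morrey_norm_def lp_family_def by simp
    have Z': "besov_morrey_norm \<phi> q r s \<theta>' \<tau>' u = N' 0 + ennreal_powr (\<Sum>i. ?e (Suc i) * ennreal_powr (N' (Suc i)) r) (1 / r)"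
      unfolding N'_def besov_morrey_norm_def lp_family_def by simp
    have "?F \<le> ?e 0 * ennreal_powr (N 0) r + (\<Sum>i. ?e (Suc i) * ennreal_powr (N (Suc i)) r)"
      by (rule suminf_head)
    also have "\<dots> \<le> ennreal_powr Z r + ennreal_powr Z r"
    proof (rule add_mono)
      show "?e 0 * ennreal_powr (N 0) r \<le> ennreal_powr Z r" using r by (auto simp: Z intro!: ennreal_powr_mono)
      have "ennreal_powr (\<Sum>i. ?e (Suc i) * ennreal_powr (N (Suc i)) r) (1 / r) \<le> Z" unfolding Z by simp
      then show "(\<Sum>i. ?e (Suc i) * ennreal_powr (N (Suc i)) r) \<le> ennreal_powr Z r"
        using r ennreal_powr_le_iff[of "1 / r"] by simp
    qed
    finally have F: "?F \<le> 2 * ennreal_powr Z r" by (simp add: mult_2)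
    have "2 * ennreal_powr Z r < top" using False by (auto simp: Z_def ennreal_powr_def ennreal_mult_less_top less_top)
    with F have Ffin: "?F < top" by (rule le_less_trans)
    have "N k < \<infinity>" for k
    proof -
      have "?e k * ennreal_powr (N k) r \<le> ?F" using sum_le_suminf[of "\<lambda>k. ?e k * ennreal_powr (N k) r" "{k}"] by simp
      then have "?e k * ennreal_powr (N k) r < top" using Ffin by (rule le_less_trans)
      then have "ennreal_powr (N k) r < top" by (auto simp: ennreal_mult_less_top)
      then show ?thesis by (auto simp: ennreal_powr_def less_top split: if_splits)
    qed
    then have ci: "\<forall>k l. \<exists>D. \<forall>y. cinf l (multiplier (lp_family \<theta> \<tau> k) u) y \<le> D"
      unfolding N_def by (intro allI cinf_bounded[where \<phi> = \<phi>, OF q(1) \<phi>])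
    have le: "?e j * ennreal_powr (N' j) r \<le> K * (\<Sum>k\<in>?W j. ?e k * ennreal_powr (N k) r)" for j
    proof -
      have "N' j \<le> Cb * ennreal_powr (\<Sum>k\<in>?W j. ennreal_powr (N k) q) (1 / q)"
        unfolding N_def N'_def using Cb(2) u ci by blast
      then have "ennreal_powr (N' j) r \<le> ennreal_powr (Cb * ennreal_powr (\<Sum>k\<in>?W j. ennreal_powr (N k) q) (1 / q)) r"
        using r by (intro ennreal_powr_mono) auto
      also have "\<dots> = ennreal_powr Cb r * ennreal_powr (\<Sum>k\<in>?W j. ennreal_powr (N k) q) (r / q)"
        using r by (simp add: ennreal_powr_mult ennreal_powr_powr)
      also have "\<dots> \<le> ennreal_powr Cb r * (ennreal (real (card (?W j)) powr (r / q)) * (\<Sum>k\<in>?W j. ennreal_powr (ennreal_powr (N k) q) (r / q)))"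
        using q r by (intro mult_left_mono ennreal_powr_sum_le_card) auto
      also have "\<dots> \<le> ennreal_powr Cb r * (ennreal (real (2 * b + 1) powr (r / q)) * (\<Sum>k\<in>?W j. ennreal_powr (N k) r))"
      proof (intro mult_left_mono mult_mono ennreal_leI powr_mono2)
        show "real (card (?W j)) \<le> real (2 * b + 1)" by (rule of_nat_mono) (rule card_window)
        show "(\<Sum>k\<in>?W j. ennreal_powr (ennreal_powr (N k) q) (r / q)) \<le> (\<Sum>k\<in>?W j. ennreal_powr (N k) r)"
          using q by (simp add: ennreal_powr_powr)
      qed (use q r in auto)
      finally have "?e j * ennreal_powr (N' j) r \<le> ?e j * (ennreal_powr Cb r * (ennreal (real (2 * b + 1) powr (r / q)) * (\<Sum>k\<in>?W j. ennreal_powr (N k) r)))"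
        by (rule mult_left_mono) simp
      also have "\<dots> = ennreal_powr Cb r * ennreal (real (2 * b + 1) powr (r / q)) * (\<Sum>k\<in>?W j. ?e j * ennreal_powr (N k) r)"
        unfolding sum_distrib_left[symmetric] by (simp only: mult_ac)
      also have "\<dots> \<le> ennreal_powr Cb r * ennreal (real (2 * b + 1) powr (r / q)) * (\<Sum>k\<in>?W j. ennreal (2 powr (b * \<bar>s\<bar> * r)) * ?e k * ennreal_powr (N k) r)"
        using r by (intro mult_left_mono sum_mono mult_right_mono powr_window_le) auto
      also have "\<dots> = K * (\<Sum>k\<in>?W j. ?e k * ennreal_powr (N k) r)"
        unfolding K_def by (simp only: sum_distrib_left[symmetric] mult.assoc)
      finally show ?thesis .
    qed
    have "?F' \<le> (\<Sum>j. K * (\<Sum>k\<in>?W j. ?e k * ennreal_powr (N k) r))"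
      by (intro suminf_le le) auto
    also have "\<dots> = K * (\<Sum>j. \<Sum>k\<in>?W j. ?e k * ennreal_powr (N k) r)" by (rule ennreal_suminf_cmult)
    also have "\<dots> \<le> K * (ennreal (real (2 * b + 1)) * ?F)" by (intro mult_left_mono suminf_window_le) simp
    also have "\<dots> \<le> K * (ennreal (real (2 * b + 1)) * (2 * ennreal_powr Z r))"
      by (intro mult_left_mono F) auto
    also have "\<dots> = K' * ennreal_powr Z r" by (simp only: K'_def mult.assoc)
    finally have F': "?F' \<le> K' * ennreal_powr Z r" .
    have "ennreal_powr ?F' (1 / r) \<le> ennreal_powr (K' * ennreal_powr Z r) (1 / r)"
      using r by (intro ennreal_powr_mono F') auto
    also have "\<dots> = ennreal_powr K' (1 / r) * Z" using r by (simp add: ennreal_powr_mult ennreal_powr_inverse)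
    finally have F'r: "ennreal_powr ?F' (1 / r) \<le> ennreal_powr K' (1 / r) * Z" .
    have "ennreal_powr (N' 0) r \<le> ?F'"
      using sum_le_suminf[of "\<lambda>k. ?e k * ennreal_powr (N' k) r" "{0}"] by simp
    then have "N' 0 \<le> ennreal_powr ?F' (1 / r)" using r by (simp add: ennreal_powr_le_iff)
    moreover have "(\<Sum>i. ?e (Suc i) * ennreal_powr (N' (Suc i)) r) \<le> ?F'"
      using suminf_shift_le[of "\<lambda>k. ?e k * ennreal_powr (N' k) r" 1] by simp
    then have "ennreal_powr (\<Sum>i. ?e (Suc i) * ennreal_powr (N' (Suc i)) r) (1 / r) \<le> ennreal_powr ?F' (1 / r)"
      using r by (intro ennreal_powr_mono) auto
    ultimately have "besov_morrey_norm \<phi> q r s \<theta>' \<tau>' u \<le> ennreal_powr ?F' (1 / r) + ennreal_powr ?F' (1 / r)"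
      unfolding Z' by (rule add_mono)
    also have "\<dots> = 2 * ennreal_powr ?F' (1 / r)" by (rule mult_2[symmetric])
    also have "\<dots> \<le> 2 * (ennreal_powr K' (1 / r) * Z)" by (intro mult_left_mono F'r) simp
    also have "\<dots> = 2 * ennreal_powr K' (1 / r) * Z" by (simp only: mult.assoc)
    also have "\<dots> \<le> C * Z" unfolding C_def by (intro mult_right_mono) auto
    finally show ?thesis unfolding Z_def .
  qed
  then show ?thesis using C(1) by auto
qed

text \<open>Finiteness of the right-hand side again gives bounded infima. Index zero is merged with
  the square-function sum under the integral, by subadditivity of the power
  \<open>q / r\<close>.\<close>

lemma triebel_lizorkin_morrey_norm_le:
  fixes \<theta> \<tau> \<theta>' \<tau>' :: "real^'n \<Rightarrow> complex" and q r s \<epsilon> C\<epsilon> :: real and \<phi> :: "real \<Rightarrow> real"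
  assumes ad: "admissible \<theta> \<tau>" and ad': "admissible \<theta>' \<tau>'" and q: "0 < q" "q \<le> r"
    and \<phi>0: "\<forall>t>0. 0 < \<phi> t" and \<epsilon>: "0 < \<epsilon>" "0 < C\<epsilon>"
    and H: "\<And>t \<rho>. 0 < \<rho> \<Longrightarrow> \<rho> \<le> t \<Longrightarrow> t powr \<epsilon> / \<phi> t \<le> C\<epsilon> * (\<rho> powr \<epsilon> / \<phi> \<rho>)"
  shows "\<exists>C<\<infinity>. \<forall>u. tempered_distribution u \<longrightarrow>
    triebel_lizorkin_morrey_norm \<phi> q r s \<theta>' \<tau>' u \<le> C * triebel_lizorkin_morrey_norm \<phi> q r s \<theta> \<tau> u"
proof -
  have \<phi>: "\<And>t. 0 < t \<Longrightarrow> 0 < \<phi> t" using \<phi>0 by blast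
  have r: "0 < r" using q by simp
  obtain C0 where C0: "0 \<le> C0" "\<And>L. (\<Sum>j. if int j < L then ennreal (\<phi> (2 powi (- int j)) powr (- r)) else 0)
      \<le> ennreal (C0 * \<phi> (2 powi (- L)) powr (- r))"
    using weight_tail_sum[where \<phi> = \<phi>, OF r \<phi> \<epsilon> H] by blast
  obtain Cb where Cb: "Cb < \<infinity>" "\<forall>u. tempered_distribution u \<longrightarrow>
    (\<forall>k l. \<exists>D. \<forall>y. cinf l (multiplier (lp_family \<theta> \<tau> k) u) y \<le> D) \<longrightarrow>
    morrey_norm \<phi> q (\<lambda>x. ennreal_powr (\<Sum>j. ennreal (2 powr (real j * s * r)) *
      ennreal_powr (ennreal (norm (multiplier (lp_family \<theta>' \<tau>' j) u x))) r) (1 / r)) \<le>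
    Cb * morrey_norm \<phi> q (\<lambda>x. ennreal_powr (\<Sum>j. ennreal (2 powr (real j * s * r)) *
      ennreal_powr (ennreal (norm (multiplier (lp_family \<theta> \<tau> j) u x))) r) (1 / r))"
    using triebel_lizorkin_core[where \<phi> = \<phi> and s = s, OF ad ad' q \<phi>0 C0] by (elim exE conjE)
  define C where "C = 1 + 2 * (Cb * ennreal_powr 2 (1 / q))"
  have C: "C < \<infinity>" "C \<noteq> 0" using Cb(1) by (auto simp: C_def ennreal_mult_less_top ennreal_powr_def)
  note D = admissibleD[OF ad]
  have \<beta>: "\<theta> \<in> test_functions" "\<theta> 0 \<noteq> 0" using D(1) D(4)[of 0] by (auto simp: centered_cube_def)
  note mono = morrey_norm_mono[where \<phi> = \<phi>, OF q(1) \<phi>]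
  have "triebel_lizorkin_morrey_norm \<phi> q r s \<theta>' \<tau>' u \<le> C * triebel_lizorkin_morrey_norm \<phi> q r s \<theta> \<tau> u"
    if u: "tempered_distribution u" for u
  proof (cases "triebel_lizorkin_morrey_norm \<phi> q r s \<theta> \<tau> u = \<infinity>")
    case True
    then show ?thesis using C(2) by (simp add: ennreal_mult_top)
  next
    case False
    define N where "N k x = ennreal (norm (multiplier (lp_family \<theta> \<tau> k) u x))" for k x
    define N' where "N' k x = ennreal (norm (multiplier (lp_family \<theta>' \<tau>' k) u x))" for k x
    define Z where "Z = triebel_lizorkin_morrey_norm \<phi> q r s \<theta> \<tau> u"
    let ?e = "\<lambda>k. ennreal (2 powr (real k * s * r))"
    let ?S = "\<lambda>x. \<Sum>i. ?e (Suc i) * ennreal_powr (N (Suc i) x) r"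
    let ?S' = "\<lambda>x. \<Sum>i. ?e (Suc i) * ennreal_powr (N' (Suc i) x) r"
    let ?F = "\<lambda>x. \<Sum>k. ?e k * ennreal_powr (N k x) r"
    let ?F' = "\<lambda>x. \<Sum>k. ?e k * ennreal_powr (N' k x) r"
    \<comment> \<open>The two parts of the quasi-norm as a family for
      \<open>morrey_norm_sum\<close>; merging them costs the factor
      \<open>2 powr (1 / q)\<close>.\<close>
    define G where "G i x = (if i = 0 then N 0 x else ennreal_powr (?S x) (1 / r))" for i :: nat and x
    have Nm [measurable]: "N k \<in> borel_measurable borel" for k
    proof -
      have [measurable]: "multiplier (lp_family \<theta> \<tau> k) u \<in> borel_measurable borel"
        by (intro borel_measurable_continuous_onI multiplier_continuous[OF \<beta> u] test_lp_family[OF ad])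
      show ?thesis unfolding N_def[abs_def] by measurable
    qed
    have Gm: "G i \<in> borel_measurable borel" for i unfolding G_def[abs_def] by measurable
    have Z: "Z = morrey_norm \<phi> q (N 0) + morrey_norm \<phi> q (\<lambda>x. ennreal_powr (?S x) (1 / r))"
      unfolding Z_def N_def triebel_lizorkin_morrey_norm_def lp_family_def by simp
    have Z': "triebel_lizorkin_morrey_norm \<phi> q r s \<theta>' \<tau>' u = morrey_norm \<phi> q (N' 0) + morrey_norm \<phi> q (\<lambda>x. ennreal_powr (?S' x) (1 / r))"
      unfolding N'_def triebel_lizorkin_morrey_norm_def lp_family_def by simp
    have GZ: "morrey_norm \<phi> q (G i) \<le> Z" for i
      unfolding Z by (cases "i = 0") (simp_all add: G_def[abs_def] del: of_nat_Suc)
    have "morrey_norm \<phi> q (\<lambda>x. ennreal_powr (?F x) (1 / r)) \<le>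
        morrey_norm \<phi> q (\<lambda>x. ennreal_powr (\<Sum>i\<in>{0, 1}. ennreal_powr (G i x) q) (1 / q))"
    proof (rule mono)
      fix x
      have "ennreal_powr (ennreal_powr (?F x) (1 / r)) q = ennreal_powr (?F x) (q / r)"
        by (simp add: ennreal_powr_powr)
      also have "\<dots> \<le> ennreal_powr (ennreal_powr (N 0 x) r + ?S x) (q / r)"
        using q r suminf_head[of "\<lambda>k. ?e k * ennreal_powr (N k x) r"] by (intro ennreal_powr_mono) auto
      also have "\<dots> \<le> ennreal_powr (ennreal_powr (N 0 x) r) (q / r) + ennreal_powr (?S x) (q / r)"
        using q r by (intro ennreal_powr_add_le) auto
      also have "\<dots> = (\<Sum>i\<in>{0, 1}. ennreal_powr (G i x) q)"
        using r by (simp add: G_def ennreal_powr_powr)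
      finally show "ennreal_powr (?F x) (1 / r) \<le> ennreal_powr (\<Sum>i\<in>{0, 1}. ennreal_powr (G i x) q) (1 / q)"
        using q by (simp only: ennreal_powr_le_iff)
    qed
    also have "\<dots> \<le> ennreal_powr (\<Sum>i\<in>{0, 1}. ennreal_powr (morrey_norm \<phi> q (G i)) q) (1 / q)"
      by (rule morrey_norm_sum[where \<phi> = \<phi>, OF q(1) \<phi>]) (auto intro: Gm)
    also have "\<dots> \<le> ennreal_powr (\<Sum>i\<in>{0, 1::nat}. ennreal_powr Z q) (1 / q)"
      using q by (intro ennreal_powr_mono sum_mono GZ) auto
    also have "(\<Sum>i\<in>{0, 1::nat}. ennreal_powr Z q) = 2 * ennreal_powr Z q" by (simp add: mult_2)
    also have "ennreal_powr \<dots> (1 / q) = ennreal_powr 2 (1 / q) * Z"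
      using q by (simp add: ennreal_powr_mult ennreal_powr_inverse)
    finally have F: "morrey_norm \<phi> q (\<lambda>x. ennreal_powr (?F x) (1 / r)) \<le> ennreal_powr 2 (1 / q) * Z" .
    have "ennreal_powr 2 (1 / q) * Z < top"
      using False by (auto simp: Z_def ennreal_powr_def ennreal_mult_less_top less_top)
    with F have Ffin: "morrey_norm \<phi> q (\<lambda>x. ennreal_powr (?F x) (1 / r)) < top" by (rule le_less_trans)
    have "morrey_norm \<phi> q (N k) < \<infinity>" for k
    proof -
      \<comment> \<open>Each piece is at most this multiple of the root of the full sum and inherits
        its finiteness.\<close>
      let ?c = "2 powr (- (real k * s))"
      have le: "N k x \<le> ennreal ?c * ennreal_powr (?F x) (1 / r)" for x
      proof -
        have "?e k * ennreal_powr (N k x) r \<le> ?F x"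
          using sum_le_suminf[of "\<lambda>k. ?e k * ennreal_powr (N k x) r" "{k}"] by simp
        then have "ennreal_powr (?e k * ennreal_powr (N k x) r) (1 / r) \<le> ennreal_powr (?F x) (1 / r)"
          using r by (intro ennreal_powr_mono) auto
        moreover have "ennreal_powr (?e k * ennreal_powr (N k x) r) (1 / r) = ennreal (2 powr (real k * s)) * N k x"
          using r by (simp add: ennreal_powr_mult ennreal_powr_inverse ennreal_powr_ennreal powr_powr)
        ultimately have "ennreal ?c * (ennreal (2 powr (real k * s)) * N k x) \<le> ennreal ?c * ennreal_powr (?F x) (1 / r)"
          by (intro mult_left_mono) auto
        moreover have "ennreal ?c * ennreal (2 powr (real k * s)) = 1"
          by (simp add: ennreal_mult[symmetric] powr_add[symmetric])
        ultimately show ?thesis by (simp add: mult.assoc[symmetric])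
      qed
      have "morrey_norm \<phi> q (N k) \<le> morrey_norm \<phi> q (\<lambda>x. ennreal ?c * ennreal_powr (?F x) (1 / r))"
        by (rule mono, assumption, rule le)
      also have "\<dots> \<le> ennreal ?c * morrey_norm \<phi> q (\<lambda>x. ennreal_powr (?F x) (1 / r))"
        by (rule morrey_norm_cmult[where \<phi> = \<phi>, OF q(1) \<phi>]) auto
      also have "\<dots> < \<infinity>" using Ffin by (simp add: ennreal_mult_less_top)
      finally show ?thesis .
    qed
    then have ci: "\<forall>k l. \<exists>D. \<forall>y. cinf l (multiplier (lp_family \<theta> \<tau> k) u) y \<le> D"
      unfolding N_def by (intro allI cinf_bounded[where \<phi> = \<phi>, OF q(1) \<phi>])
    have F': "morrey_norm \<phi> q (\<lambda>x. ennreal_powr (?F' x) (1 / r)) \<le> Cb * morrey_norm \<phi> q (\<lambda>x. ennreal_powr (?F x) (1 / r))"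
      using Cb(2) u ci unfolding N_def N'_def by blast
    have "morrey_norm \<phi> q (N' 0) \<le> morrey_norm \<phi> q (\<lambda>x. ennreal_powr (?F' x) (1 / r))"
    proof (rule mono)
      fix x
      have "ennreal_powr (N' 0 x) r \<le> ?F' x"
        using sum_le_suminf[of "\<lambda>k. ?e k * ennreal_powr (N' k x) r" "{0}"] by simp
      then show "N' 0 x \<le> ennreal_powr (?F' x) (1 / r)" using r by (simp add: ennreal_powr_le_iff)
    qed
    moreover have "morrey_norm \<phi> q (\<lambda>x. ennreal_powr (?S' x) (1 / r)) \<le> morrey_norm \<phi> q (\<lambda>x. ennreal_powr (?F' x) (1 / r))"
    proof (rule mono)
      fix x
      have "?S' x \<le> ?F' x" using suminf_shift_le[of "\<lambda>k. ?e k * ennreal_powr (N' k x) r" 1] by simp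
      then show "ennreal_powr (?S' x) (1 / r) \<le> ennreal_powr (?F' x) (1 / r)" using r by (intro ennreal_powr_mono) auto
    qed
    ultimately have "triebel_lizorkin_morrey_norm \<phi> q r s \<theta>' \<tau>' u \<le>
        morrey_norm \<phi> q (\<lambda>x. ennreal_powr (?F' x) (1 / r)) + morrey_norm \<phi> q (\<lambda>x. ennreal_powr (?F' x) (1 / r))"
      unfolding Z' by (rule add_mono)
    also have "\<dots> = 2 * morrey_norm \<phi> q (\<lambda>x. ennreal_powr (?F' x) (1 / r))" by (rule mult_2[symmetric])
    also have "\<dots> \<le> 2 * (Cb * (ennreal_powr 2 (1 / q) * Z))"
      by (intro mult_left_mono order_trans[OF F'] F) auto
    also have "\<dots> = 2 * (Cb * ennreal_powr 2 (1 / q)) * Z" by (simp only: mult.assoc)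
    also have "\<dots> \<le> C * Z" unfolding C_def by (intro mult_right_mono) auto
    finally show ?thesis unfolding Z_def .
  qed
  then show ?thesis using C(1) by auto
qed

theorem theorem1p4:
  fixes q r s :: real and \<phi> :: "real \<Rightarrow> real" and A :: scale
    and \<theta> \<tau> \<theta>' \<tau>' :: "real^'n \<Rightarrow> complex"
  assumes "0 < q" and "q \<le> r"
    and "\<phi> \<in> morrey_weights CARD('n) q"
    and "A = Triebel_Lizorkin \<Longrightarrow>
      \<exists>\<epsilon> C. 0 < \<epsilon> \<and> 0 < C \<and>
        (\<forall>t \<rho>. 0 < \<rho> \<and> \<rho> \<le> t \<longrightarrow> t powr \<epsilon> / \<phi> t \<le> C * (\<rho> powr \<epsilon> / \<phi> \<rho>))"
    and "admissible \<theta> \<tau>" and "admissible \<theta>' \<tau>'"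
  shows "\<exists>C'\<ge>1. \<forall>f. tempered_distribution f \<longrightarrow>
    ennreal (1 / C') * scale_norm A \<phi> q r s \<theta>' \<tau>' f \<le> scale_norm A \<phi> q r s \<theta> \<tau> f \<and>
    scale_norm A \<phi> q r s \<theta> \<tau> f \<le> ennreal C' * scale_norm A \<phi> q r s \<theta>' \<tau>' f"
proof -
  have \<phi>: "\<forall>t>0. 0 < \<phi> t" and mono: "mono_on {0<..} \<phi>"
    using assms(3) by (auto simp: morrey_weights_def)
  \<comment> \<open>One direction for arbitrary pairs; exchanging their roles gives the
    other.\<close>
  have one: "\<exists>C<\<infinity>. \<forall>f. tempered_distribution f \<longrightarrow> scale_norm A \<phi> q r s \<theta>2 \<tau>2 f \<le> C * scale_norm A \<phi> q r s \<theta>1 \<tau>1 f"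
    if "admissible \<theta>1 \<tau>1" "admissible \<theta>2 \<tau>2" for \<theta>1 \<tau>1 \<theta>2 \<tau>2 :: "real^'n \<Rightarrow> complex"
  proof (cases A)
    case Besov
    then show ?thesis using besov_morrey_norm_le[where \<phi> = \<phi> and s = s, OF that assms(1,2) \<phi> mono] by simp
  next
    case Triebel_Lizorkin
    then obtain \<epsilon> C where "0 < \<epsilon>" "0 < C" "\<And>t \<rho>. 0 < \<rho> \<Longrightarrow> \<rho> \<le> t \<Longrightarrow> t powr \<epsilon> / \<phi> t \<le> C * (\<rho> powr \<epsilon> / \<phi> \<rho>)"
      using assms(4) by blast
    from triebel_lizorkin_morrey_norm_le[where \<phi> = \<phi> and s = s, OF that assms(1,2) \<phi> this] Triebel_Lizorkin show ?thesis by simp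
  qed
  obtain C1 where C1: "C1 < \<infinity>" "\<And>f. tempered_distribution f \<Longrightarrow> scale_norm A \<phi> q r s \<theta>' \<tau>' f \<le> C1 * scale_norm A \<phi> q r s \<theta> \<tau> f"
    using one[OF assms(5,6)] by blast
  obtain C2 where C2: "C2 < \<infinity>" "\<And>f. tempered_distribution f \<Longrightarrow> scale_norm A \<phi> q r s \<theta> \<tau> f \<le> C2 * scale_norm A \<phi> q r s \<theta>' \<tau>' f"
    using one[OF assms(6,5)] by blast
  define C' where "C' = max 1 (max (enn2real C1) (enn2real C2))"
  have C': "1 \<le> C'" by (simp add: C'_def)
  have le: "C1 \<le> ennreal C'" "C2 \<le> ennreal C'"
    proof -
    have *: "C \<le> ennreal C'" if "C < \<infinity>" "enn2real C \<le> C'" for C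
      using that ennreal_leI[OF that(2)] by simp
    show "C1 \<le> ennreal C'" by (rule *[OF C1(1)]) (simp add: C'_def)
    show "C2 \<le> ennreal C'" by (rule *[OF C2(1)]) (simp add: C'_def)
  qed
  show ?thesis
  proof (rule exI[of _ C'], intro conjI allI impI C')
    fix f :: "(real^'n \<Rightarrow> complex) \<Rightarrow> complex" assume f: "tempered_distribution f"
    have "ennreal (1 / C') * scale_norm A \<phi> q r s \<theta>' \<tau>' f \<le> ennreal (1 / C') * (ennreal C' * scale_norm A \<phi> q r s \<theta> \<tau> f)"
      by (intro mult_left_mono order_trans[OF C1(2)[OF f]] mult_right_mono le) auto
    also have "\<dots> = scale_norm A \<phi> q r s \<theta> \<tau> f"
      using C' by (simp add: mult.assoc[symmetric] ennreal_mult[symmetric])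
    finally show "ennreal (1 / C') * scale_norm A \<phi> q r s \<theta>' \<tau>' f \<le> scale_norm A \<phi> q r s \<theta> \<tau> f" .
    show "scale_norm A \<phi> q r s \<theta> \<tau> f \<le> ennreal C' * scale_norm A \<phi> q r s \<theta>' \<tau>' f"
      by (rule order_trans[OF C2(2)[OF f]]) (intro mult_right_mono le, simp)
  qed
qed

end
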